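(* Let $\Sigma$ be an embedded self-shrinker in $\mathbb R^{n+1}$ with finite index. Then $\Sigma\times\mathbb R\subset\mathbb R^{n+2}$ is a self-shrinker with finite index.
   Context: An embedded hypersurface $\Sigma^n\subset\mathbb R^{n+1}$ is a self-shrinker if $H=\frac{\langle x,\nu\rangle}2$, where $H$ is the mean curvature with respect to the unit normal $\nu$. An embedded self-shrinker $\Sigma^n$ has $\mathrm{index}\ge k$ if there is a $k$-dimensional subspace $W\subset C^\infty(\Sigma)$ such that every nonzero $f\in W$ has compact support and $\int_\Sigma(|\nabla f|^2-|A|^2f^2-\frac12f^2)e^{-|x|^2/4}\,d\mathcal H^n<0$, where $A$ is the second fundamental form. $\Sigma$ has index $k$ if it has $\mathrm{index}\ge k$ but not $\mathrm{index}\ge k+1$; it has finite index if it has index $k$ for some finite $k$. *)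

theory Defs
  imports "HOL-Analysis.Analysis" "HOL-Library.Function_Algebras"
begin

text \<open>
  Conventions. The ambient Euclidean space is a type \<open>'a::euclidean_space\<close> with
  \<open>DIM('a) = n + 1\<close>; then \<open>'a \<times> real\<close>, with its library inner product, is Euclidean space of
  dimension \<open>n + 2\<close>. A hypersurface is a subset of the ambient space; it has no boundary and is
  not assumed closed, complete or connected.
\<close>

section \<open>Functions as a real vector space\<close>

instantiation "fun" :: (type, real_vector) real_vector
begin

definition scaleR_fun :: "real \<Rightarrow> ('a \<Rightarrow> 'b) \<Rightarrow> 'a \<Rightarrow> 'b" where
  "scaleR_fun c f = (\<lambda>x. c *\<^sub>R f x)"

instance
  by standard (auto simp: scaleR_fun_def fun_eq_iff algebra_simps)

end

section \<open>Smooth maps\<close>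

text \<open>\<open>Ck_on k U f\<close> is only meant for open \<open>U\<close>, and for finite-dimensional domains, where
  continuity of all iterated directional derivatives is the usual class \<open>C\<close>-\<open>k\<close>.\<close>

primrec Ck_on :: "nat \<Rightarrow> 'a::real_normed_vector set \<Rightarrow> ('a \<Rightarrow> 'b::real_normed_vector) \<Rightarrow> bool" where
  "Ck_on 0 U f \<longleftrightarrow> continuous_on U f"
| "Ck_on (Suc k) U f \<longleftrightarrow>
     f differentiable_on U \<and> (\<forall>v. Ck_on k U (\<lambda>x. frechet_derivative f (at x) v))"

definition smooth_on :: "'a::real_normed_vector set \<Rightarrow> ('a \<Rightarrow> 'b::real_normed_vector) \<Rightarrow> bool" where
  "smooth_on U f \<longleftrightarrow> open U \<and> (\<forall>k. Ck_on k U f)"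

text \<open>Smoothness on an arbitrary subset: locally the restriction of a smooth map on an open set
  of the ambient space. On an embedded submanifold this is the intrinsic notion.\<close>

definition smooth_along :: "'a::real_normed_vector set \<Rightarrow> ('a \<Rightarrow> 'b::real_normed_vector) \<Rightarrow> bool" where
  "smooth_along S f \<longleftrightarrow>
     (\<forall>p\<in>S. \<exists>U g. p \<in> U \<and> smooth_on U g \<and> (\<forall>x\<in>S \<inter> U. f x = g x))"

section \<open>Embedded hypersurfaces\<close>

text \<open>Slice charts: near each of its points, \<open>S\<close> is carried to a coordinate hyperplane by a
  diffeomorphism between open sets of the ambient space.\<close>

definition embedded_hypersurface :: "'a::euclidean_space set \<Rightarrow> bool" where
  "embedded_hypersurface S \<longleftrightarrow>
     (\<forall>p\<in>S. \<exists>U V. \<exists>\<Phi> \<Psi> :: 'a \<Rightarrow> 'a. \<exists>e\<in>Basis. p \<in> U \<and> smooth_on U \<Phi> \<and> smooth_on V \<Psi> \<and>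
        homeomorphism U V \<Phi> \<Psi> \<and> \<Phi> ` (S \<inter> U) = {y \<in> V. y \<bullet> e = 0})"

definition tangent_space :: "'a::euclidean_space set \<Rightarrow> 'a \<Rightarrow> 'a set" where
  "tangent_space S p =
     {v. \<exists>\<gamma> \<epsilon>. \<epsilon> > 0 \<and> smooth_on {-\<epsilon><..<\<epsilon>} \<gamma> \<and> \<gamma> ` {-\<epsilon><..<\<epsilon>} \<subseteq> S \<and> \<gamma> 0 = p \<and>
           (\<gamma> has_vector_derivative v) (at (0::real))}"

definition tangent_onb :: "'a::euclidean_space set \<Rightarrow> 'a \<Rightarrow> 'a set" where
  "tangent_onb S p =
     (SOME B. pairwise orthogonal B \<and> (\<forall>b\<in>B. norm b = 1) \<and> span B = tangent_space S p)"

text \<open>A derivative within \<open>S\<close> is not unique, but on an embedded hypersurface any two derivatives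
  of a map within \<open>S\<close> agree on tangent vectors, and below \<open>deriv_along\<close> is applied to no others.\<close>

definition deriv_along :: "'a::euclidean_space set \<Rightarrow> ('a \<Rightarrow> 'b::real_normed_vector) \<Rightarrow> 'a \<Rightarrow> 'a \<Rightarrow> 'b" where
  "deriv_along S f p v = frechet_derivative f (at p within S) v"

definition tangential_gradient :: "'a::euclidean_space set \<Rightarrow> ('a \<Rightarrow> real) \<Rightarrow> 'a \<Rightarrow> 'a" where
  "tangential_gradient S f p =
     (THE g. g \<in> tangent_space S p \<and> (\<forall>v\<in>tangent_space S p. g \<bullet> v = deriv_along S f p v))"

section \<open>Curvature and self-shrinkers\<close>

text \<open>A smooth unit normal field defined near \<open>p\<close>. It exists at each point of an embedded
  hypersurface and is unique up to sign near \<open>p\<close>. Replacing \<open>\<nu>\<close> by \<open>-\<nu>\<close> changes the sign of the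
  second fundamental form and of the mean curvature, but affects neither the self-shrinker equation
  nor the squared norm of the second fundamental form.\<close>

definition unit_normal_near :: "'a::euclidean_space set \<Rightarrow> 'a \<Rightarrow> ('a \<Rightarrow> 'a) \<Rightarrow> bool" where
  "unit_normal_near S p \<nu> \<longleftrightarrow>
     (\<exists>U. open U \<and> p \<in> U \<and> smooth_along (S \<inter> U) \<nu> \<and>
        (\<forall>x\<in>S \<inter> U. norm (\<nu> x) = 1 \<and> (\<forall>v\<in>tangent_space S x. \<nu> x \<bullet> v = 0)))"

definition second_fundamental_form ::
    "'a::euclidean_space set \<Rightarrow> ('a \<Rightarrow> 'a) \<Rightarrow> 'a \<Rightarrow> 'a \<Rightarrow> 'a \<Rightarrow> real" where
  "second_fundamental_form S \<nu> p v w = deriv_along S \<nu> p v \<bullet> w"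

text \<open>The sign is such that the mean curvature is the divergence of \<open>\<nu>\<close> along \<open>S\<close>. Thus spheres
  have positive mean curvature with respect to the outward normal, and the sphere of radius
  \<open>sqrt (2 * n)\<close> about the origin is a self-shrinker.\<close>

definition mean_curvature :: "'a::euclidean_space set \<Rightarrow> ('a \<Rightarrow> 'a) \<Rightarrow> 'a \<Rightarrow> real" where
  "mean_curvature S \<nu> p = (\<Sum>b\<in>tangent_onb S p. second_fundamental_form S \<nu> p b b)"

definition norm_A_squared :: "'a::euclidean_space set \<Rightarrow> 'a \<Rightarrow> real" where
  "norm_A_squared S p =
     (\<Sum>b\<in>tangent_onb S p. \<Sum>c\<in>tangent_onb S p.
        (second_fundamental_form S (SOME \<nu>. unit_normal_near S p \<nu>) p b c)\<^sup>2)"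

definition self_shrinker :: "'a::euclidean_space set \<Rightarrow> bool" where
  "self_shrinker S \<longleftrightarrow> embedded_hypersurface S \<and>
     (\<forall>p\<in>S. \<exists>\<nu>. unit_normal_near S p \<nu> \<and> mean_curvature S \<nu> p = (p \<bullet> \<nu> p) / 2)"

section \<open>Hausdorff measure\<close>

text \<open>Normalised so that in dimension \<open>d\<close> a set of diameter \<open>2 * r\<close> contributes the volume of a
  \<open>d\<close>-ball of radius \<open>r\<close>. The empty set is treated separately because of \<open>0 ^ 0 = 1\<close>, and covers
  by unbounded sets are excluded explicitly because their \<open>diameter\<close> is unspecified.\<close>

definition hausdorff_gauge :: "nat \<Rightarrow> 'a::metric_space set \<Rightarrow> ennreal" where
  "hausdorff_gauge d C =
     (if C = {} then 0 else ennreal (unit_ball_vol (real d) * (diameter C / 2) ^ d))"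

definition hausdorff_content :: "nat \<Rightarrow> real \<Rightarrow> 'a::metric_space set \<Rightarrow> ennreal" where
  "hausdorff_content d \<delta> A =
     (INF C\<in>{C :: nat \<Rightarrow> 'a set. A \<subseteq> (\<Union>i. C i) \<and> (\<forall>i. bounded (C i) \<and> diameter (C i) \<le> \<delta>)}.
        \<Sum>i. hausdorff_gauge d (C i))"

definition hausdorff_outer_measure :: "nat \<Rightarrow> 'a::metric_space set \<Rightarrow> ennreal" where
  "hausdorff_outer_measure d A = (SUP \<delta>\<in>{0<..}. hausdorff_content d \<delta> A)"

definition hausdorff_measure :: "nat \<Rightarrow> 'a::metric_space measure" where
  "hausdorff_measure d = measure_of UNIV (sets borel) (hausdorff_outer_measure d)"

section \<open>Index\<close>

text \<open>Functions on \<open>S\<close> are represented by their extensions by zero to the ambient type, so that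
  vanishing on \<open>S\<close>, linear independence and dimension have their meaning for functions on \<open>S\<close>.\<close>

definition smooth_functions :: "'a::euclidean_space set \<Rightarrow> ('a \<Rightarrow> real) set" where
  "smooth_functions S = {f. smooth_along S f \<and> (\<forall>x. x \<notin> S \<longrightarrow> f x = 0)}"

definition compactly_supported_in :: "'a::euclidean_space set \<Rightarrow> ('a \<Rightarrow> real) \<Rightarrow> bool" where
  "compactly_supported_in S f \<longleftrightarrow> compact (S \<inter> closure {x \<in> S. f x \<noteq> 0})"

definition index_form :: "'a::euclidean_space set \<Rightarrow> ('a \<Rightarrow> real) \<Rightarrow> real" where
  "index_form S f =
     (LINT x:S|hausdorff_measure (DIM('a) - 1).
        ((norm (tangential_gradient S f x))\<^sup>2 - norm_A_squared S x * (f x)\<^sup>2 - 1 / 2 * (f x)\<^sup>2)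
          * exp (- (norm x)\<^sup>2 / 4))"

definition index_ge :: "'a::euclidean_space set \<Rightarrow> nat \<Rightarrow> bool" where
  "index_ge S k \<longleftrightarrow>
     (\<exists>W. subspace W \<and> W \<subseteq> smooth_functions S \<and>
        (\<exists>B. independent B \<and> finite B \<and> card B = k \<and> span B = W) \<and>
        (\<forall>f\<in>W. f \<noteq> 0 \<longrightarrow> compactly_supported_in S f \<and> index_form S f < 0))"

definition has_index :: "'a::euclidean_space set \<Rightarrow> nat \<Rightarrow> bool" where
  "has_index S k \<longleftrightarrow> index_ge S k \<and> \<not> index_ge S (k + 1)"

definition finite_index :: "'a::euclidean_space set \<Rightarrow> bool" where
  "finite_index S \<longleftrightarrow> (\<exists>k. has_index S k)"

end

theory Submission
  imports Defs
begin

text \<open>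
  Finite index gives finitely many test functions \<open>w\<^sub>i\<close> with \<open>B(w\<^sub>i, w\<^sub>j) = - \<delta>\<^sub>i\<^sub>j\<close>, maximal in number, and
  then \<open>B(f, f) \<ge> - (\<Sum>i. B(f, w\<^sub>i)\<^sup>2)\<close> for every test function \<open>f\<close>. Each \<open>B(_, w\<^sub>i)\<close> is bounded in the
  weighted \<open>L\<^sup>2\<close> norm. Instead of the divergence theorem, this uses a deformation of
  \<open>\<Sigma>\<close> along a tangential field by maps whose inverses have Lipschitz constant \<open>1 + O(s)\<close>:
  this gives \<open>\<bar>\<integral>\<langle>\<nabla>f, X\<rangle>\<bar> \<le> C \<integral>f\<close> for \<open>f \<ge> 0\<close>, and such a bound self-improves to \<open>L\<^sup>2\<close>. Hence
  \<open>B(f, f) \<ge> - C \<parallel>f - f'\<parallel>\<^sup>2\<close> whenever \<open>B(f', w\<^sub>i) = 0\<close> for all \<open>i\<close>.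

  On \<open>\<Sigma> \<times> \<real>\<close> the surface measure is a constant multiple of the product measure. In one dimension
  there is a map \<open>j\<close> of \<open>\<real>\<close> onto a finite set such that the Gaussian integral of \<open>h'\<^sup>2\<close> dominates \<open>C\<close>
  times that of \<open>(h - h \<circ> j)\<^sup>2\<close>. Applied to \<open>F(x, _)\<close> this shows that the index form is nonnegative
  at every \<open>F\<close> with \<open>B(F(_, t), w\<^sub>i) = 0\<close> for all \<open>i\<close> and all \<open>t\<close> in the range of \<open>j\<close>, which are
  finitely many linear conditions.
\<close>

section \<open>Hausdorff measure\<close>

text \<open>\<open>\<Sigma>\<close> is not assumed closed or complete, so its stability operator
  need not have eigenfunctions, and multiplying eigenfunctions by Hermite polynomials, the usual way
  to count negative directions on \<open>\<Sigma> \<times> \<real>\<close>, is not at hand. Pairings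
  with compactly supported functions at finitely many heights make sense for every test function,
  and they are counted instead. The price is the error \<open>F (x, t) - F (x, j t)\<close>, which
  the one-dimensional inequality controls only without derivatives in \<open>x\<close>. The bound on
  the pairings must therefore be free of gradients although the form contains them; this is why the
  estimate of \<open>\<integral> \<langle>\<nabla>f, X\<rangle>\<close> is the heart of the matter.
  Since area is Hausdorff measure, that estimate is drawn from the only change of variables that
  such a measure offers directly, its behaviour under Lipschitz maps. The same principle compares
  the cylinder with a flat product. The factor between the two measures is left unevaluated because
  only the sign of the form matters.\<close>

definition hausdorff_covers :: "real \<Rightarrow> 'a::metric_space set \<Rightarrow> (nat \<Rightarrow> 'a set) set" where
  "hausdorff_covers \<delta> A = {C. A \<subseteq> (\<Union>i. C i) \<and> (\<forall>i. bounded (C i) \<and> diameter (C i) \<le> \<delta>)}"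

lemma hausdorff_content_alt:
  "hausdorff_content d \<delta> A = (INF C\<in>hausdorff_covers \<delta> A. \<Sum>i. hausdorff_gauge d (C i))"
  unfolding hausdorff_content_def hausdorff_covers_def ..

lemma hausdorff_content_le:
  assumes "C \<in> hausdorff_covers \<delta> A"
  shows "hausdorff_content d \<delta> A \<le> (\<Sum>i. hausdorff_gauge d (C i))"
  unfolding hausdorff_content_alt using assms by (rule INF_lower)

lemma hausdorff_content_greatest:
  assumes "\<And>C. C \<in> hausdorff_covers \<delta> A \<Longrightarrow> x \<le> (\<Sum>i. hausdorff_gauge d (C i))"
  shows "x \<le> hausdorff_content d \<delta> A"
  unfolding hausdorff_content_alt using assms by (rule INF_greatest)

lemma hausdorff_content_mono: "A \<subseteq> B \<Longrightarrow> hausdorff_content d \<delta> A \<le> hausdorff_content d \<delta> B"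
  by (intro hausdorff_content_greatest hausdorff_content_le) (auto simp: hausdorff_covers_def)

lemma hausdorff_content_antimono: "\<delta> \<le> \<delta>' \<Longrightarrow> hausdorff_content d \<delta>' A \<le> hausdorff_content d \<delta> A"
  by (intro hausdorff_content_greatest hausdorff_content_le)
    (auto simp: hausdorff_covers_def intro: order_trans)

lemma hausdorff_gauge_empty [simp]: "hausdorff_gauge d {} = 0"
  by (simp add: hausdorff_gauge_def)

lemma hausdorff_content_empty [simp]: "\<delta> \<ge> 0 \<Longrightarrow> hausdorff_content d \<delta> {} = 0"
  using hausdorff_content_le[of "\<lambda>_. {}" \<delta> "{}" d] by (simp add: hausdorff_covers_def)

lemma hausdorff_content_countably_subadditive:
  fixes A :: "nat \<Rightarrow> 'a::metric_space set"
  shows "hausdorff_content d \<delta> (\<Union>i. A i) \<le> (\<Sum>i. hausdorff_content d \<delta> (A i))"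
proof (rule ennreal_le_epsilon)
  fix \<epsilon> :: real assume eps: "\<epsilon> > 0" and fin: "(\<Sum>i. hausdorff_content d \<delta> (A i)) < top"
  have "\<exists>C\<in>hausdorff_covers \<delta> (A i). (\<Sum>j. hausdorff_gauge d (C j))
      < hausdorff_content d \<delta> (A i) + ennreal (\<epsilon> * (1/2) ^ Suc i)" for i
  proof -
    have "hausdorff_content d \<delta> (A i) < top"
      using fin ennreal_suminf_lessD by blast
    then have "hausdorff_content d \<delta> (A i)
        < hausdorff_content d \<delta> (A i) + ennreal (\<epsilon> * (1/2) ^ Suc i)"
      using eps ennreal_add_left_cancel_less[of "hausdorff_content d \<delta> (A i)" 0] by (simp add: less_top)
    then show ?thesis
      unfolding hausdorff_content_alt by (simp add: INF_less_iff)
  qed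
  then obtain C where C: "\<And>i. C i \<in> hausdorff_covers \<delta> (A i)"
    and C_less: "\<And>i. (\<Sum>j. hausdorff_gauge d (C i j))
      < hausdorff_content d \<delta> (A i) + ennreal (\<epsilon> * (1/2) ^ Suc i)"
    by metis
  define D where "D = (\<lambda>k. case prod_decode k of (i, j) \<Rightarrow> C i j)"
  have "D \<in> hausdorff_covers \<delta> (\<Union>i. A i)"
    unfolding hausdorff_covers_def
  proof (intro CollectI conjI allI subsetI)
    fix x assume "x \<in> (\<Union>i. A i)"
    then obtain i where "x \<in> A i" by auto
    then obtain j where "x \<in> C i j" using C[of i] by (auto simp: hausdorff_covers_def)
    then have "x \<in> D (prod_encode (i, j))" by (simp add: D_def)
    then show "x \<in> (\<Union>k. D k)" by blast
  qed (use C in \<open>auto simp: hausdorff_covers_def D_def split: prod.split\<close>)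
  then have "hausdorff_content d \<delta> (\<Union>i. A i) \<le> (\<Sum>k. hausdorff_gauge d (D k))"
    by (rule hausdorff_content_le)
  also have "\<dots> = (\<Sum>i. \<Sum>j. hausdorff_gauge d (C i j))"
    using suminf_ennreal_2dimen[of "\<lambda>i. \<Sum>j. hausdorff_gauge d (C i j)"
        "\<lambda>(i,j). hausdorff_gauge d (C i j)"]
    by (simp add: D_def comp_def case_prod_beta)
  also have "\<dots> \<le> (\<Sum>i. hausdorff_content d \<delta> (A i) + ennreal (\<epsilon> * (1/2) ^ Suc i))"
    by (intro suminf_le less_imp_le[OF C_less]) auto
  also have "\<dots> = (\<Sum>i. hausdorff_content d \<delta> (A i)) + (\<Sum>i. ennreal (\<epsilon> * (1/2) ^ Suc i))"
    by (simp add: suminf_add)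
  also have "(\<Sum>i. ennreal (\<epsilon> * (1/2) ^ Suc i)) = ennreal \<epsilon>"
    using sums_mult[OF power_half_series, of \<epsilon>] eps
    by (intro suminf_ennreal_eq) auto
  finally show "hausdorff_content d \<delta> (\<Union>i. A i) \<le> (\<Sum>i. hausdorff_content d \<delta> (A i)) + ennreal \<epsilon>" .
qed

lemma hausdorff_content_le_outer_measure:
  "\<delta> > 0 \<Longrightarrow> hausdorff_content d \<delta> A \<le> hausdorff_outer_measure d A"
  unfolding hausdorff_outer_measure_def by (intro SUP_upper) auto

lemma hausdorff_outer_measure_least:
  "(\<And>\<delta>. \<delta> > 0 \<Longrightarrow> hausdorff_content d \<delta> A \<le> x) \<Longrightarrow> hausdorff_outer_measure d A \<le> x"
  unfolding hausdorff_outer_measure_def by (intro SUP_least) auto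

lemma hausdorff_outer_measure_empty [simp]: "hausdorff_outer_measure d {} = 0"
  using hausdorff_outer_measure_least[of d "{}" 0] by simp

lemma hausdorff_outer_measure_mono:
  "A \<subseteq> B \<Longrightarrow> hausdorff_outer_measure d A \<le> hausdorff_outer_measure d B"
  by (rule hausdorff_outer_measure_least)
    (meson hausdorff_content_le_outer_measure hausdorff_content_mono order_trans)

lemma hausdorff_outer_measure_countably_subadditive:
  fixes A :: "nat \<Rightarrow> 'a::metric_space set"
  shows "hausdorff_outer_measure d (\<Union>i. A i) \<le> (\<Sum>i. hausdorff_outer_measure d (A i))"
proof (rule hausdorff_outer_measure_least)
  fix \<delta> :: real assume "\<delta> > 0"
  then have "(\<Sum>i. hausdorff_content d \<delta> (A i)) \<le> (\<Sum>i. hausdorff_outer_measure d (A i))"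
    by (intro suminf_le hausdorff_content_le_outer_measure) auto
  then show "hausdorff_content d \<delta> (\<Union>i. A i) \<le> (\<Sum>i. hausdorff_outer_measure d (A i))"
    using hausdorff_content_countably_subadditive order_trans by blast
qed

section \<open>Separated sets and Caratheodory's criterion\<close>

lemma hausdorff_outer_measure_Un_le:
  "hausdorff_outer_measure d (A \<union> B) \<le> hausdorff_outer_measure d A + hausdorff_outer_measure d B"
proof -
  have "hausdorff_outer_measure d (A \<union> B) = hausdorff_outer_measure d (\<Union>i::nat. if i = 0 then A else if i = 1 then B else {})"
    by (rule arg_cong[where f="hausdorff_outer_measure d"]) (fastforce split: if_splits intro: exI[of _ "0::nat"] exI[of _ "Suc 0"])
  also have "\<dots> \<le> (\<Sum>i::nat. hausdorff_outer_measure d (if i = 0 then A else if i = 1 then B else {}))"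
    by (rule hausdorff_outer_measure_countably_subadditive)
  also have "\<dots> = (\<Sum>i\<in>{0,1::nat}. hausdorff_outer_measure d (if i = 0 then A else if i = 1 then B else {}))"
    by (rule suminf_finite) auto
  finally show ?thesis by simp
qed

text \<open>A covering set of diameter below the gap \<open>\<eta>\<close> cannot meet both sets, so
  every fine enough cover splits into a cover of \<open>A\<close> and a cover of \<open>B\<close>
  that share no nonempty member.\<close>

lemma hausdorff_outer_measure_metric:
  assumes "\<eta> > 0" and sep: "\<And>x y. x \<in> A \<Longrightarrow> y \<in> B \<Longrightarrow> dist x y \<ge> \<eta>"
  shows "hausdorff_outer_measure d A + hausdorff_outer_measure d B \<le> hausdorff_outer_measure d (A \<union> B)"
proof -
  have content: "hausdorff_content d \<delta> A + hausdorff_content d \<delta> B \<le> hausdorff_content d \<delta> (A \<union> B)"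
    if "0 < \<delta>" "\<delta> < \<eta>" for \<delta>
  proof (rule hausdorff_content_greatest)
    fix C assume C: "C \<in> hausdorff_covers \<delta> (A \<union> B)"
    define CA where "CA = (\<lambda>i. if C i \<inter> A = {} then {} else C i)"
    define CB where "CB = (\<lambda>i. if C i \<inter> B = {} then {} else C i)"
    have "CA \<in> hausdorff_covers \<delta> A" "CB \<in> hausdorff_covers \<delta> B"
      using C \<open>0 < \<delta>\<close> by (auto simp: hausdorff_covers_def CA_def CB_def subset_eq) blast+
    then have "hausdorff_content d \<delta> A + hausdorff_content d \<delta> B
        \<le> (\<Sum>i. hausdorff_gauge d (CA i)) + (\<Sum>i. hausdorff_gauge d (CB i))"
      by (intro add_mono hausdorff_content_le)
    also have "\<dots> = (\<Sum>i. hausdorff_gauge d (CA i) + hausdorff_gauge d (CB i))"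
      by (simp add: suminf_add)
    also have "\<dots> \<le> (\<Sum>i. hausdorff_gauge d (C i))"
    proof (intro suminf_le)
      fix i
      have "C i \<inter> A = {} \<or> C i \<inter> B = {}"
      proof (rule ccontr)
        assume "\<not> ?thesis"
        then obtain x y where xy: "x \<in> C i" "x \<in> A" "y \<in> C i" "y \<in> B" by auto
        have "dist x y \<le> diameter (C i)"
          using C xy by (intro diameter_bounded_bound) (auto simp: hausdorff_covers_def)
        also have "\<dots> \<le> \<delta>" using C by (auto simp: hausdorff_covers_def)
        finally show False using sep[of x y] xy \<open>\<delta> < \<eta>\<close> by simp
      qed
      then show "hausdorff_gauge d (CA i) + hausdorff_gauge d (CB i) \<le> hausdorff_gauge d (C i)"
        by (auto simp: CA_def CB_def)
    qed auto
    finally show "hausdorff_content d \<delta> A + hausdorff_content d \<delta> B \<le> (\<Sum>i. hausdorff_gauge d (C i))" .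
  qed
  \<comment> \<open>The two outer measures are suprema over independent scales. Additivity is first
    extended to different \<open>\<delta>\<close> and \<open>\<delta>'\<close> by passing to a
    common scale \<open>\<rho>\<close> below \<open>\<eta>\<close>.\<close>
  have le: "hausdorff_content d \<delta> A + hausdorff_content d \<delta>' B \<le> hausdorff_outer_measure d (A \<union> B)"
    if "\<delta> > 0" "\<delta>' > 0" for \<delta> \<delta>'
  proof -
    define \<rho> where "\<rho> = min (min \<delta> \<delta>') (\<eta> / 2)"
    have \<rho>: "0 < \<rho>" "\<rho> < \<eta>" "\<rho> \<le> \<delta>" "\<rho> \<le> \<delta>'" using that assms(1) by (auto simp: \<rho>_def)
    have "hausdorff_content d \<delta> A + hausdorff_content d \<delta>' B \<le> hausdorff_content d \<rho> A + hausdorff_content d \<rho> B"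
      using \<rho> by (intro add_mono hausdorff_content_antimono) auto
    also have "\<dots> \<le> hausdorff_content d \<rho> (A \<union> B)" using \<rho> content by simp
    also have "\<dots> \<le> hausdorff_outer_measure d (A \<union> B)"
      using \<rho> by (intro hausdorff_content_le_outer_measure)
    finally show ?thesis .
  qed
  have "hausdorff_outer_measure d A + hausdorff_outer_measure d B
      = (SUP \<delta>\<in>{0<..}. hausdorff_content d \<delta> A + hausdorff_outer_measure d B)"
    unfolding hausdorff_outer_measure_def[of d A] by (subst ennreal_SUP_add_left) auto
  also have "\<dots> \<le> hausdorff_outer_measure d (A \<union> B)"
  proof (rule SUP_least)
    fix \<delta> :: real assume "\<delta> \<in> {0<..}"
    have "hausdorff_content d \<delta> A + hausdorff_outer_measure d B
        = (SUP \<delta>'\<in>{0<..}. hausdorff_content d \<delta>' B + hausdorff_content d \<delta> A)"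
      unfolding hausdorff_outer_measure_def by (subst ennreal_SUP_add_left) (auto simp: add.commute)
    also have "\<dots> \<le> hausdorff_outer_measure d (A \<union> B)"
      using le[of \<delta>] \<open>\<delta> \<in> {0<..}\<close> by (intro SUP_least) (simp add: add.commute[of _ "hausdorff_content d \<delta> A"])
    finally show "hausdorff_content d \<delta> A + hausdorff_outer_measure d B \<le> hausdorff_outer_measure d (A \<union> B)" .
  qed
  finally show ?thesis .
qed

text \<open>The parts \<open>P k\<close> of \<open>A - C\<close> at distance at least
  \<open>1 / Suc k\<close> are separated from \<open>C\<close>, so only the loss in passing from
  \<open>P k\<close> to \<open>A - C\<close> has to vanish. It is bounded by a tail sum over the
  shells \<open>R k\<close>. The series over all shells converges because shells whose indices
  differ by two are separated, so the even ones and the odd ones each add up to at most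
  \<open>f A\<close>.\<close>

lemma hausdorff_outer_measure_split_closed:
  fixes A C :: "'a::metric_space set"
  assumes "closed C"
  shows "hausdorff_outer_measure d (A \<inter> C) + hausdorff_outer_measure d (A - C) \<le> hausdorff_outer_measure d A"
proof (cases "C = {} \<or> hausdorff_outer_measure d A = top")
  case True then show ?thesis by auto
next
  \<comment> \<open>\<open>infdist x {} = 0\<close>, so for empty \<open>C\<close> all sets
    \<open>P k\<close> would be empty; this is why that case is split off.\<close>
  case False
  define f :: "'a set \<Rightarrow> ennreal" where "f = hausdorff_outer_measure d"
  define P where "P = (\<lambda>k::nat. {x \<in> A. infdist x C \<ge> 1 / real (Suc k)})"
  define R where "R = (\<lambda>k. P (Suc k) - P k)"
  have fA: "f A < top" using False by (simp add: f_def less_top)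
  have P_sub: "P k \<subseteq> A - C" for k
    by (auto simp: P_def)
  have P_mono: "P k \<subseteq> P (Suc k)" for k
    unfolding P_def by (auto intro: order_trans[rotated] simp: frac_le)
  have sepC: "f (A \<inter> C) + f (P k) \<le> f A" for k
  proof -
    have "f (A \<inter> C) + f (P k) \<le> f (A \<inter> C \<union> P k)"
      unfolding f_def
    proof (rule hausdorff_outer_measure_metric[of "1 / real (Suc k)"])
      fix x y assume "x \<in> A \<inter> C" "y \<in> P k"
      then show "1 / real (Suc k) \<le> dist x y"
        using infdist_le[of x C y] by (auto simp: P_def dist_commute)
    qed simp
    also have "\<dots> \<le> f A" unfolding f_def using P_sub by (intro hausdorff_outer_measure_mono) auto
    finally show ?thesis .
  qed
  have sepR: "f (P k) + f (R (Suc k)) \<le> f (P (Suc (Suc k)))" for k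
  proof -
    have "f (P k) + f (R (Suc k)) \<le> f (P k \<union> R (Suc k))"
      unfolding f_def
    proof (rule hausdorff_outer_measure_metric[of "1 / real (Suc k) - 1 / real (Suc (Suc k))"])
      fix x y assume "x \<in> P k" "y \<in> R (Suc k)"
      then have "infdist x C \<ge> 1 / real (Suc k)" "infdist y C \<le> 1 / real (Suc (Suc k))"
        by (auto simp: P_def R_def)
      then show "1 / real (Suc k) - 1 / real (Suc (Suc k)) \<le> dist x y"
        using infdist_triangle[of x C y] by linarith
    qed (simp add: field_simps add_pos_nonneg)
    also have "\<dots> \<le> f (P (Suc (Suc k)))"
      unfolding f_def using P_mono by (intro hausdorff_outer_measure_mono) (auto simp: R_def)
    finally show ?thesis .
  qed
  \<comment> \<open>\<open>P (Suc m)\<close> accounts for the shells with the parity of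
    \<open>m\<close>, and \<open>P m\<close> for those with the other parity; the two swap places in
    the induction step.\<close>
  have sumR: "(\<Sum>k<Suc m. f (R k)) \<le> f (P (Suc m)) + f (P m)" for m
  proof (induction m)
    case 0
    have "f (R 0) \<le> f (P (Suc 0))"
      unfolding f_def R_def by (intro hausdorff_outer_measure_mono) auto
    then show ?case by (simp add: add_increasing2)
  next
    case (Suc m)
    have "(\<Sum>k<Suc (Suc m). f (R k)) \<le> (f (P (Suc m)) + f (P m)) + f (R (Suc m))"
      using Suc.IH by (simp add: add_mono)
    also have "\<dots> = f (P (Suc m)) + (f (P m) + f (R (Suc m)))" by (simp add: ac_simps)
    also have "\<dots> \<le> f (P (Suc m)) + f (P (Suc (Suc m)))" by (intro add_mono sepR order_refl)
    finally show ?case by (simp add: add.commute)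
  qed
  have fP: "f (P k) \<le> f A" for k
    unfolding f_def P_def by (intro hausdorff_outer_measure_mono) auto
  have "(\<Sum>k<m. f (R k)) \<le> f A + f A" for m
  proof -
    have "(\<Sum>k<m. f (R k)) \<le> (\<Sum>k<Suc m. f (R k))" by simp
    then show ?thesis using sumR[of m] add_mono[OF fP[of "Suc m"] fP[of m]] by (meson order_trans)
  qed
  then have "(\<Sum>k. f (R k)) \<le> f A + f A" by (intro suminf_le_const) auto
  then have fin: "(\<Sum>k. f (R k)) < top" using fA by (simp add: le_less_trans)
  have tail: "f (A - C) \<le> f (P m) + (\<Sum>k. f (R (k + m)))" for m
  proof -
    have "A - C \<subseteq> P m \<union> (\<Union>k. R (k + m))"
    proof
      fix x assume x: "x \<in> A - C"
      have "infdist x C > 0"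
        using x assms False in_closed_iff_infdist_zero[of C x] infdist_nonneg[of x C]
        by (auto simp: less_le)
      then obtain n where n: "1 / real (Suc n) < infdist x C"
        using nat_approx_posE by (metis)
      then have ex: "x \<in> P n" using x by (auto simp: P_def)
      show "x \<in> P m \<union> (\<Union>k. R (k + m))"
      proof (cases "x \<in> P m")
        case False
        define n0 where "n0 = (LEAST n. x \<in> P n)"
        have n0: "x \<in> P n0" unfolding n0_def using ex by (rule LeastI)
        have less: "x \<notin> P k" if "k < n0" for k
          using that not_less_Least unfolding n0_def by blast
        have "m < n0"
        proof (rule ccontr)
          assume "\<not> m < n0"
          then have "P n0 \<subseteq> P m" using lift_Suc_mono_le[of P n0 m] P_mono by simp
          then show False using n0 False by auto
        qed
        then obtain k where k: "n0 = Suc (k + m)"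
          by (metis add.commute add_Suc_right less_iff_Suc_add)
        then have "x \<in> R (k + m)" using n0 less[of "k + m"] by (auto simp: R_def)
        then show ?thesis by auto
      qed auto
    qed
    then have "f (A - C) \<le> f (P m \<union> (\<Union>k. R (k + m)))"
      unfolding f_def by (rule hausdorff_outer_measure_mono)
    also have "\<dots> \<le> f (P m) + f (\<Union>k. R (k + m))"
      unfolding f_def by (rule hausdorff_outer_measure_Un_le)
    also have "f (\<Union>k. R (k + m)) \<le> (\<Sum>k. f (R (k + m)))"
      unfolding f_def by (rule hausdorff_outer_measure_countably_subadditive)
    finally show ?thesis by (simp add: add_mono)
  qed
  have bound: "f (A \<inter> C) + f (A - C) \<le> f A + (\<Sum>k. f (R (k + m)))" for m
  proof -
    have "f (A \<inter> C) + f (A - C) \<le> f (A \<inter> C) + (f (P m) + (\<Sum>k. f (R (k + m))))"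
      by (intro add_mono tail order_refl)
    also have "\<dots> = (f (A \<inter> C) + f (P m)) + (\<Sum>k. f (R (k + m)))" by (simp add: ac_simps)
    also have "\<dots> \<le> f A + (\<Sum>k. f (R (k + m)))" by (intro add_mono sepC order_refl)
    finally show ?thesis .
  qed
  have "(\<lambda>m. \<Sum>k. f (R (k + m))) \<longlonglongrightarrow> 0"
  proof -
    define r where "r = (\<lambda>k. enn2real (f (R k)))"
    have fr: "f (R k) = ennreal (r k)" for k
      using fin ennreal_suminf_lessD[of "\<lambda>k. f (R k)" top k] by (simp add: r_def less_top)
    have r0: "r k \<ge> 0" for k by (simp add: r_def)
    have sr: "summable r"
      by (intro summable_suminf_not_top r0) (use fin in \<open>simp add: fr less_top\<close>)
    have "(\<Sum>k. f (R (k + m))) = ennreal (\<Sum>k. r (k + m))" for m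
      unfolding fr using sr r0 by (intro suminf_ennreal2) (auto simp: summable_iff_shift)
    moreover have "(\<lambda>m. ennreal (\<Sum>k. r (k + m))) \<longlonglongrightarrow> ennreal 0"
      by (intro tendsto_ennrealI suminf_exist_split2 sr)
    ultimately show ?thesis by simp
  qed
  from tendsto_add[OF tendsto_const[of "f A"] this] have "(\<lambda>m. f A + (\<Sum>k. f (R (k + m)))) \<longlonglongrightarrow> f A"
    by simp
  then show ?thesis
    unfolding f_def[symmetric] by (rule Lim_bounded2) (use bound in auto)
qed

text \<open>\<open>measure_of\<close> yields the zero measure unless its argument is a measure on
  the generated \<sigma>-algebra. This lemma is what gives \<open>hausdorff_measure\<close> its
  intended values: closed sets are Caratheodory measurable, hence so are all Borel sets.\<close>

lemma measure_space_hausdorff: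
  "measure_space UNIV (sets borel) (hausdorff_outer_measure d :: 'a::metric_space set \<Rightarrow> ennreal)"
proof -
  let ?H = "hausdorff_outer_measure d :: 'a set \<Rightarrow> ennreal"
  interpret sigma_algebra UNIV "Pow UNIV :: 'a set set" by (rule sigma_algebra_Pow)
  have "outer_measure_space (Pow UNIV) ?H"
    unfolding outer_measure_space_def positive_def increasing_def countably_subadditive_def
    by (auto intro: hausdorff_outer_measure_mono hausdorff_outer_measure_countably_subadditive)
  then have ms: "measure_space UNIV (lambda_system UNIV (Pow UNIV) ?H) ?H"
    by (rule caratheodory_lemma)
  have "C \<in> lambda_system UNIV (Pow UNIV) ?H" if "closed C" for C
    unfolding lambda_system_def
  proof (intro CollectI conjI ballI)
    fix A :: "'a set"
    have "?H A \<le> ?H (A \<inter> C) + ?H (A - C)"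
      using hausdorff_outer_measure_Un_le[of d "A \<inter> C" "A - C"] by (simp add: Un_Diff_Int Int_Diff_Un)
    with hausdorff_outer_measure_split_closed[OF that, of d A]
    show "?H (C \<inter> A) + ?H ((UNIV - C) \<inter> A) = ?H A"
      by (simp add: Int_commute Diff_eq antisym)
  qed simp
  then have "sigma_sets UNIV {C. closed C} \<subseteq> lambda_system UNIV (Pow UNIV) ?H"
    using ms by (intro sigma_algebra.sigma_sets_subset) (auto simp: measure_space_def)
  then have "sets borel \<subseteq> lambda_system UNIV (Pow UNIV) ?H"
    by (simp add: borel_eq_closed)
  then show ?thesis
    by (rule measure_down[OF ms, rotated]) (metis sets.sigma_algebra_axioms space_borel)
qed

lemma space_hausdorff_measure [simp]: "space (hausdorff_measure d) = UNIV"
  by (simp add: hausdorff_measure_def)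

lemma sets_hausdorff_measure [simp, measurable_cong]: "sets (hausdorff_measure d) = sets borel"
  using sets.sigma_sets_eq[of borel] by (simp add: hausdorff_measure_def)

lemma emeasure_hausdorff_measure:
  "A \<in> sets borel \<Longrightarrow> emeasure (hausdorff_measure d) A = hausdorff_outer_measure d A"
  using measure_space_hausdorff[of d] sets.sigma_sets_eq[of borel]
  unfolding hausdorff_measure_def measure_space_def
  by (subst emeasure_measure_of_sigma) (auto simp: sets.sigma_algebra_axioms)

section \<open>Behaviour under Lipschitz maps\<close>

lemma hausdorff_outer_measure_lipschitz_image:
  fixes f :: "'a::metric_space \<Rightarrow> 'b::metric_space"
  assumes L: "L > 0" and f: "\<And>x y. x \<in> A \<Longrightarrow> y \<in> A \<Longrightarrow> dist (f x) (f y) \<le> L * dist x y"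
  shows "hausdorff_outer_measure d (f ` A) \<le> ennreal (L ^ d) * hausdorff_outer_measure d A"
proof (rule hausdorff_outer_measure_least)
  fix \<delta> :: real assume \<delta>: "\<delta> > 0"
  \<comment> \<open>A cover at scale \<open>\<delta> / L\<close> is carried to one at scale
    \<open>\<delta>\<close>. Its members are first cut down to \<open>A\<close>, since
    \<open>f\<close> is Lipschitz only there.\<close>
  have "hausdorff_content d \<delta> (f ` A) / ennreal (L ^ d) \<le> hausdorff_content d (\<delta> / L) A"
  proof (rule hausdorff_content_greatest)
    fix C assume C: "C \<in> hausdorff_covers (\<delta> / L) A"
    have bd: "bounded (C i)" "diameter (C i) \<le> \<delta> / L" for i
      using C by (auto simp: hausdorff_covers_def)
    have diam: "dist y z \<le> L * diameter (C i)" if yz: "y \<in> f ` (C i \<inter> A)" "z \<in> f ` (C i \<inter> A)" for i y z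
    proof -
      obtain u v where uv: "u \<in> C i \<inter> A" "v \<in> C i \<inter> A" "y = f u" "z = f v" using yz by auto
      have "dist y z \<le> L * dist u v" using uv f by auto
      also have "\<dots> \<le> L * diameter (C i)"
        using uv L by (intro mult_left_mono diameter_bounded_bound bd) auto
      finally show ?thesis .
    qed
    have bdf: "bounded (f ` (C i \<inter> A))" for i
      unfolding bounded_two_points using diam by blast
    have diamf: "diameter (f ` (C i \<inter> A)) \<le> L * diameter (C i)" for i
      unfolding diameter_def[of "f ` (C i \<inter> A)"]
      using diam[of _ i] L diameter_ge_0[OF bd(1)[of i]] by (auto intro!: cSUP_least)
    have "L * diameter (C i) \<le> \<delta>" for i
      using bd(2)[of i] L by (simp add: field_simps)
    then have "(\<lambda>i. f ` (C i \<inter> A)) \<in> hausdorff_covers \<delta> (f ` A)"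
      using C bdf diamf by (fastforce simp: hausdorff_covers_def intro: order_trans)
    then have "hausdorff_content d \<delta> (f ` A) \<le> (\<Sum>i. hausdorff_gauge d (f ` (C i \<inter> A)))"
      by (rule hausdorff_content_le)
    also have "\<dots> \<le> (\<Sum>i. ennreal (L ^ d) * hausdorff_gauge d (C i))"
    proof (intro suminf_le)
      fix i
      have "unit_ball_vol (real d) * (diameter (f ` (C i \<inter> A)) / 2) ^ d
          \<le> unit_ball_vol (real d) * (L * diameter (C i) / 2) ^ d"
        using diamf[of i] diameter_ge_0[OF bdf]
        by (intro mult_left_mono power_mono) auto
      also have "\<dots> = L ^ d * (unit_ball_vol (real d) * (diameter (C i) / 2) ^ d)"
        by (simp add: power_mult_distrib power_divide)
      finally show "hausdorff_gauge d (f ` (C i \<inter> A)) \<le> ennreal (L ^ d) * hausdorff_gauge d (C i)"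
        using L diameter_ge_0[OF bd(1)[of i]]
        by (auto simp: hausdorff_gauge_def ennreal_mult[symmetric] intro!: ennreal_leI)
    qed auto
    also have "\<dots> = ennreal (L ^ d) * (\<Sum>i. hausdorff_gauge d (C i))" by simp
    finally show "hausdorff_content d \<delta> (f ` A) / ennreal (L ^ d) \<le> (\<Sum>i. hausdorff_gauge d (C i))"
      using L by (intro divide_le_posI_ennreal) (auto simp: mult.commute)
  qed
  also have "\<dots> \<le> hausdorff_outer_measure d A"
    using L \<delta> by (intro hausdorff_content_le_outer_measure) simp
  finally have "ennreal (L ^ d) * (hausdorff_content d \<delta> (f ` A) / ennreal (L ^ d))
      \<le> ennreal (L ^ d) * hausdorff_outer_measure d A"
    by (rule mult_left_mono) simp
  moreover have "ennreal (L ^ d) * (hausdorff_content d \<delta> (f ` A) / ennreal (L ^ d))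
      = hausdorff_content d \<delta> (f ` A)"
    using L by (simp add: ennreal_times_divide mult.commute[of "ennreal (L ^ d)"] mult_divide_eq_ennreal)
  ultimately show "hausdorff_content d \<delta> (f ` A) \<le> ennreal (L ^ d) * hausdorff_outer_measure d A"
    by simp
qed

lemma hausdorff_outer_measure_isometric_image:
  fixes f :: "'a::metric_space \<Rightarrow> 'b::metric_space"
  assumes f: "\<And>x y. x \<in> A \<Longrightarrow> y \<in> A \<Longrightarrow> dist (f x) (f y) = dist x y"
  shows "hausdorff_outer_measure d (f ` A) = hausdorff_outer_measure d A"
proof (rule antisym)
  show "hausdorff_outer_measure d (f ` A) \<le> hausdorff_outer_measure d A"
    using hausdorff_outer_measure_lipschitz_image[of 1 A f d] f by simp
  have inj: "inj_on f A" using f by (metis dist_eq_0_iff inj_onI)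
  have "hausdorff_outer_measure d (inv_into A f ` f ` A) \<le> hausdorff_outer_measure d (f ` A)"
    using hausdorff_outer_measure_lipschitz_image[of 1 "f ` A" "inv_into A f" d] f
    by (simp, metis f_inv_into_f inv_into_into order_refl)
  then show "hausdorff_outer_measure d A \<le> hausdorff_outer_measure d (f ` A)"
    using inj by (simp add: inv_into_image_cancel)
qed

section \<open>Flat cubes have finite and positive measure\<close>

lemma hausdorff_content_finite_cover:
  assumes I: "finite I" and A: "A \<subseteq> (\<Union>i\<in>I. C i)" and "\<delta> \<ge> 0"
    and C: "\<And>i. i \<in> I \<Longrightarrow> bounded (C i)" "\<And>i. i \<in> I \<Longrightarrow> diameter (C i) \<le> \<delta>"
  shows "hausdorff_content d \<delta> A \<le> (\<Sum>i\<in>I. hausdorff_gauge d (C i))"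
proof -
  obtain h where h: "bij_betw h {0..<card I} I" using ex_bij_betw_nat_finite[OF I] by blast
  define E where "E = (\<lambda>k. if k < card I then C (h k) else {})"
  have hI: "h k \<in> I" if "k < card I" for k using h that by (auto simp: bij_betw_def)
  have "E \<in> hausdorff_covers \<delta> A"
    unfolding hausdorff_covers_def
  proof (intro CollectI conjI subsetI allI)
    fix x assume "x \<in> A"
    then obtain i where i: "i \<in> I" "x \<in> C i" using A by auto
    then obtain k where "k < card I" "i = h k" using h by (force simp: bij_betw_def)
    then show "x \<in> (\<Union>i. E i)" using i by (auto simp: E_def)
  qed (use C hI \<open>\<delta> \<ge> 0\<close> in \<open>auto simp: E_def\<close>)
  then have "hausdorff_content d \<delta> A \<le> (\<Sum>k. hausdorff_gauge d (E k))"
    by (rule hausdorff_content_le)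
  also have "\<dots> = (\<Sum>k\<in>{0..<card I}. hausdorff_gauge d (E k))"
    by (rule suminf_finite) (auto simp: E_def)
  also have "\<dots> = (\<Sum>k\<in>{0..<card I}. hausdorff_gauge d (C (h k)))"
    by (intro sum.cong) (auto simp: E_def)
  also have "\<dots> = (\<Sum>i\<in>I. hausdorff_gauge d (C i))"
    using h by (rule sum.reindex_bij_betw)
  finally show ?thesis .
qed

definition flat_cube :: "'a::euclidean_space set \<Rightarrow> real \<Rightarrow> 'a set" where
  "flat_cube D k = {x. (\<forall>b\<in>D. \<bar>x \<bullet> b\<bar> \<le> k) \<and> (\<forall>b\<in>Basis - D. x \<bullet> b = 0)}"

text \<open>A grid of mesh \<open>1 / N\<close> has about \<open>N ^ d\<close> cells and each has
  gauge about \<open>1 / N ^ d\<close>, so the total gauge stays bounded however fine the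
  grid.\<close>

lemma hausdorff_flat_cube_finite:
  fixes D :: "'a::euclidean_space set"
  assumes D: "D \<subseteq> Basis"
  shows "hausdorff_outer_measure (card D) (flat_cube D (real k)) < top"
proof -
  define d where "d = card D"
  have finD: "finite D" using D finite_Basis finite_subset by blast
  \<comment> \<open>There are \<open>(2 * k * N + 1) ^ d\<close> cells, each of diameter at most
    \<open>d / N\<close> as a sum of \<open>d\<close> coordinate differences, and
    \<open>2 * k * N + 1 \<le> 3 * (k + 1) * N\<close>.\<close>
  define K where "K = unit_ball_vol (real d) * (3 * (real k + 1) * real d / 2) ^ d"
  have "hausdorff_outer_measure d (flat_cube D (real k)) \<le> ennreal K"
  proof (rule hausdorff_outer_measure_least)
    fix \<delta> :: real assume \<delta>: "\<delta> > 0"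
    define N where "N = nat \<lceil>real d / \<delta>\<rceil> + 1"
    have N: "N \<ge> 1" "real d / real N \<le> \<delta>"
    proof -
      have "real d / \<delta> \<le> real N" unfolding N_def by linarith
      then have "real d \<le> \<delta> * real N" using \<delta> by (simp add: pos_divide_le_eq mult.commute)
      moreover have "real N > 0" by (simp add: N_def)
      ultimately show "real d / real N \<le> \<delta>" by (simp add: pos_divide_le_eq)
    qed (simp add: N_def)
    define I where "I = PiE D (\<lambda>_. {- int (k * N) .. int (k * N)})"
    define C where "C = (\<lambda>m. {x \<in> flat_cube D (real k). \<forall>b\<in>D. \<lfloor>real N * (x \<bullet> b)\<rfloor> = m b})"
    have finI: "finite I" unfolding I_def using finD by (intro finite_PiE) auto
    have cardI: "card I = (2 * k * N + 1) ^ d"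
      unfolding I_def by (simp add: card_PiE finD d_def prod_constant nat_add_distrib nat_mult_distrib algebra_simps)
    have cover: "flat_cube D (real k) \<subseteq> (\<Union>m\<in>I. C m)"
    proof
      fix x assume x: "x \<in> flat_cube D (real k)"
      define m where "m = (\<lambda>b\<in>D. \<lfloor>real N * (x \<bullet> b)\<rfloor>)"
      have "m \<in> I" unfolding I_def
      proof (rule PiE_I)
        fix b assume b: "b \<in> D"
        then have "\<bar>x \<bullet> b\<bar> \<le> real k" using x by (auto simp: flat_cube_def)
        then have "\<bar>real N * (x \<bullet> b)\<bar> \<le> real N * real k"
          by (simp add: abs_mult mult_left_mono)
        then have "- real_of_int (int (k * N)) \<le> real N * (x \<bullet> b)" "real N * (x \<bullet> b) \<le> real_of_int (int (k * N))"
          by (auto simp: mult.commute)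
        then show "m b \<in> {- int (k * N) .. int (k * N)}"
          using b by (simp add: m_def le_floor_iff floor_le_iff)
      qed (simp add: m_def)
      moreover have "x \<in> C m" using x by (simp add: C_def m_def)
      ultimately show "x \<in> (\<Union>m\<in>I. C m)" by blast
    qed
    have dist: "dist x y \<le> real d / real N" if xy: "x \<in> C m" "y \<in> C m" for m x y
    proof -
      have "norm (x - y) \<le> (\<Sum>b\<in>Basis. \<bar>(x - y) \<bullet> b\<bar>)" by (rule norm_le_l1)
      also have "\<dots> \<le> (\<Sum>b\<in>Basis. if b \<in> D then 1 / real N else 0)"
      proof (rule sum_mono)
        fix b :: 'a assume b: "b \<in> Basis"
        show "\<bar>(x - y) \<bullet> b\<bar> \<le> (if b \<in> D then 1 / real N else 0)"
        proof (cases "b \<in> D")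
          case True
          then have "\<lfloor>real N * (x \<bullet> b)\<rfloor> = \<lfloor>real N * (y \<bullet> b)\<rfloor>" using xy by (simp add: C_def)
          then have "\<bar>real N * (x \<bullet> b) - real N * (y \<bullet> b)\<bar> \<le> 1" by linarith
          then have "real N * \<bar>(x - y) \<bullet> b\<bar> \<le> 1"
            by (simp add: inner_diff_left right_diff_distrib[symmetric] abs_mult)
          then show ?thesis using True N(1) by (simp add: field_simps)
        next
          case False
          then show ?thesis using xy b by (simp add: C_def flat_cube_def inner_diff_left)
        qed
      qed
      also have "\<dots> = real d / real N"
        using D finD by (simp add: sum.If_cases Int_absorb1 d_def)
      finally show ?thesis by (simp add: dist_norm)
    qed
    have bd: "bounded (C m)" for m unfolding bounded_two_points using dist by blast
    have diam: "diameter (C m) \<le> real d / real N" for m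
      using dist by (intro diameter_le) (auto simp: dist_norm)
    have "hausdorff_content d \<delta> (flat_cube D (real k)) \<le> (\<Sum>m\<in>I. hausdorff_gauge d (C m))"
      using finI cover \<delta> bd diam N(2) by (intro hausdorff_content_finite_cover) (auto intro: order_trans)
    also have "\<dots> \<le> (\<Sum>m\<in>I. ennreal (unit_ball_vol (real d) * (real d / real N / 2) ^ d))"
    proof (rule sum_mono)
      fix m
      have "(diameter (C m) / 2) ^ d \<le> (real d / real N / 2) ^ d"
        using diam[of m] diameter_ge_0[OF bd[of m]] by (intro power_mono divide_right_mono) auto
      then show "hausdorff_gauge d (C m) \<le> ennreal (unit_ball_vol (real d) * (real d / real N / 2) ^ d)"
        by (auto simp: hausdorff_gauge_def intro!: ennreal_leI mult_left_mono)
    qed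
    also have "\<dots> = ennreal (real ((2 * k * N + 1) ^ d) * (unit_ball_vol (real d) * (real d / real N / 2) ^ d))"
      by (simp add: cardI ennreal_of_nat_eq_real_of_nat ennreal_mult[symmetric] del: of_nat_power)
    also have "\<dots> \<le> ennreal K"
    proof (rule ennreal_leI)
      have "real ((2 * k * N + 1) ^ d) * (unit_ball_vol (real d) * (real d / real N / 2) ^ d)
          = unit_ball_vol (real d) * (real (2 * k * N + 1) * (real d / real N / 2)) ^ d"
        unfolding power_mult_distrib[of "real (2 * k * N + 1)"] of_nat_power
        by (rule mult.left_commute)
      also have "\<dots> \<le> K" unfolding K_def
      proof (intro mult_left_mono power_mono)
        have "real (2 * k * N + 1) \<le> 3 * (real k + 1) * real N"
          using N(1) by (simp add: algebra_simps add_increasing)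
        then have "real (2 * k * N + 1) * (real d / real N / 2) \<le> 3 * (real k + 1) * real N * (real d / real N / 2)"
          by (intro mult_right_mono) auto
        also have "\<dots> = 3 * (real k + 1) * real d / 2" using N(1) by simp
        finally show "real (2 * k * N + 1) * (real d / real N / 2) \<le> 3 * (real k + 1) * real d / 2" .
      qed auto
      finally show "real ((2 * k * N + 1) ^ d) * (unit_ball_vol (real d) * (real d / real N / 2) ^ d) \<le> K" .
    qed
    finally show "hausdorff_content d \<delta> (flat_cube D (real k)) \<le> ennreal K" .
  qed
  then show ?thesis unfolding d_def using ennreal_less_top le_less_trans by blast
qed

text \<open>Thickening a cover of the cube in the direction \<open>e\<close> to a cover of a full-dimensional cube
  bounds its gauge from below by Lebesgue measure.\<close>

lemma hausdorff_flat_cube_pos: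
  fixes e :: "'a::euclidean_space"
  assumes e: "e \<in> Basis"
  shows "hausdorff_outer_measure (DIM('a) - 1) (flat_cube (Basis - {e}) 1) > 0"
proof -
  define n where "n = DIM('a) - 1"
  \<comment> \<open>The box over a covering set of diameter \<open>r\<close> has side
    \<open>2\<close> in direction \<open>e\<close> and side \<open>2 * r\<close> in the
    \<open>n\<close> others. Its volume \<open>2 * (2 * r) ^ n\<close> is \<open>K\<close> times the
    gauge \<open>unit_ball_vol n * (r / 2) ^ n\<close>.\<close>
  define K where "K = 2 * 4 ^ n / unit_ball_vol (real n)"
  have K: "K > 0" by (simp add: K_def)
  have card: "card (Basis - {e}) = n" using e by (simp add: n_def)
  have "ennreal (2 ^ DIM('a)) / ennreal K \<le> hausdorff_content n 1 (flat_cube (Basis - {e}) 1)"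
  proof (rule hausdorff_content_greatest)
    fix C assume C: "C \<in> hausdorff_covers 1 (flat_cube (Basis - {e}) 1)"
    have bd: "bounded (C i)" for i using C by (auto simp: hausdorff_covers_def)
    define r where "r = (\<lambda>i. diameter (C i))"
    have r0: "r i \<ge> 0" for i unfolding r_def by (rule diameter_ge_0[OF bd])
    define x where "x = (\<lambda>i. SOME x. x \<in> C i)"
    have x: "x i \<in> C i" if "C i \<noteq> {}" for i using that unfolding x_def by (simp add: some_in_eq)
    define lo where "lo = (\<lambda>i. \<Sum>b\<in>Basis. (if b = e then - 1 else x i \<bullet> b - r i) *\<^sub>R b)"
    define hi where "hi = (\<lambda>i. \<Sum>b\<in>Basis. (if b = e then 1 else x i \<bullet> b + r i) *\<^sub>R b)"
    define E where "E = (\<lambda>i. if C i = {} then {} else cbox (lo i) (hi i))"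
    have lo: "lo i \<bullet> b = (if b = e then - 1 else x i \<bullet> b - r i)"
      and hi: "hi i \<bullet> b = (if b = e then 1 else x i \<bullet> b + r i)" if "b \<in> Basis" for i b
      unfolding lo_def hi_def using that by (simp_all only: inner_sum_left_Basis)
    have Em: "E i \<in> sets lborel" for i by (auto simp: E_def)
    have cover: "cbox (- One) One \<subseteq> (\<Union>i. E i)"
    proof
      fix y :: 'a assume y: "y \<in> cbox (- One) One"
      have yb: "\<bar>y \<bullet> b\<bar> \<le> 1" if "b \<in> Basis" for b
      proof -
        have "(- One) \<bullet> b \<le> y \<bullet> b \<and> y \<bullet> b \<le> One \<bullet> b" using y that unfolding mem_box by blast
        then show ?thesis using that by (simp add: abs_le_iff)
      qed
      define z where "z = y - (y \<bullet> e) *\<^sub>R e"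
      have zb: "z \<bullet> b = (if b = e then 0 else y \<bullet> b)" if "b \<in> Basis" for b
        using that e by (auto simp: z_def inner_diff_left inner_Basis)
      have "z \<in> flat_cube (Basis - {e}) 1"
        using yb by (auto simp: flat_cube_def zb)
      then obtain i where i: "z \<in> C i" using C by (auto simp: hausdorff_covers_def)
      then have xi: "x i \<in> C i" by (intro x) auto
      have zx: "\<bar>z \<bullet> b - x i \<bullet> b\<bar> \<le> r i" if "b \<in> Basis" for b
      proof -
        have "\<bar>z \<bullet> b - x i \<bullet> b\<bar> \<le> norm (z - x i)"
          using Basis_le_norm[OF that, of "z - x i"] by (simp add: inner_diff_left)
        also have "\<dots> \<le> r i" unfolding r_def dist_norm[symmetric]
          using i xi by (intro diameter_bounded_bound bd)
        finally show ?thesis .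
      qed
      have "lo i \<bullet> b \<le> y \<bullet> b \<and> y \<bullet> b \<le> hi i \<bullet> b" if "b \<in> Basis" for b
      proof (cases "b = e")
        case True
        then have "lo i \<bullet> b = - 1" "hi i \<bullet> b = 1" unfolding lo[OF that] hi[OF that] by simp_all
        then show ?thesis using yb[OF that] by linarith
      next
        case False
        then have "lo i \<bullet> b = x i \<bullet> b - r i" "hi i \<bullet> b = x i \<bullet> b + r i" "z \<bullet> b = y \<bullet> b"
          unfolding lo[OF that] hi[OF that] zb[OF that] by simp_all
        then show ?thesis using zx[OF that] by linarith
      qed
      then have "y \<in> cbox (lo i) (hi i)" unfolding mem_box by blast
      then show "y \<in> (\<Union>i. E i)" using i by (auto simp: E_def)
    qed
    have "ennreal (2 ^ DIM('a)) = emeasure lborel (cbox (- One) (One::'a))"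
    proof -
      have "(\<Prod>b\<in>Basis. ((One::'a) - - One) \<bullet> b) = (\<Prod>b\<in>(Basis::'a set). 2::real)"
        by (intro prod.cong) (auto simp: inner_diff_left inner_add_left)
      then show ?thesis by (subst emeasure_lborel_cbox) (auto simp: inner_diff_left)
    qed
    also have "\<dots> \<le> emeasure lborel (\<Union>i. E i)"
      using cover Em by (intro emeasure_mono) auto
    also have "\<dots> \<le> (\<Sum>i. emeasure lborel (E i))"
      using Em by (intro emeasure_subadditive_countably) auto
    also have "\<dots> \<le> (\<Sum>i. ennreal K * hausdorff_gauge n (C i))"
    proof (intro suminf_le)
      fix i
      show "emeasure lborel (E i) \<le> ennreal K * hausdorff_gauge n (C i)"
      proof (cases "C i = {}")
        case False
        have "emeasure lborel (E i) = ennreal (\<Prod>b\<in>Basis. (hi i - lo i) \<bullet> b)"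
        proof -
          have "lo i \<bullet> b \<le> hi i \<bullet> b" if "b \<in> Basis" for b
            unfolding lo[OF that] hi[OF that] using r0[of i] by simp
          then show ?thesis using False by (simp add: E_def emeasure_lborel_cbox)
        qed
        also have "(\<Prod>b\<in>Basis. (hi i - lo i) \<bullet> b) = ((hi i - lo i) \<bullet> e) * (\<Prod>b\<in>Basis - {e}. (hi i - lo i) \<bullet> b)"
          using e by (intro prod.remove) auto
        also have "(\<Prod>b\<in>Basis - {e}. (hi i - lo i) \<bullet> b) = (\<Prod>b\<in>Basis - {e}. 2 * r i)"
        proof (intro prod.cong refl)
          fix b assume b: "b \<in> Basis - {e}"
          then have bB: "b \<in> Basis" by simp
          show "(hi i - lo i) \<bullet> b = 2 * r i"
            unfolding inner_diff_left lo[OF bB] hi[OF bB] using b by simp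
        qed
        also have "\<dots> = (2 * r i) ^ n" by (simp only: prod_constant card)
        also have "(hi i - lo i) \<bullet> e = 2"
          unfolding inner_diff_left lo[OF e] hi[OF e] by simp
        also have "2 * (2 * r i) ^ n = K * (unit_ball_vol (real n) * (r i / 2) ^ n)"
        proof -
          have "(2 * r i) ^ n = 4 ^ n * (r i / 2) ^ n"
            unfolding power_mult_distrib[symmetric] by simp
          then show ?thesis using unit_ball_vol_pos[of "real n"] by (simp add: K_def del: unit_ball_vol_pos)
        qed
        finally show ?thesis
          using False K r0[of i] by (simp add: hausdorff_gauge_def r_def ennreal_mult[symmetric])
      qed (simp add: E_def)
    qed auto
    also have "\<dots> = ennreal K * (\<Sum>i. hausdorff_gauge n (C i))" by simp
    finally show "ennreal (2 ^ DIM('a)) / ennreal K \<le> (\<Sum>i. hausdorff_gauge n (C i))"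
      using K by (intro divide_le_posI_ennreal) (auto simp: mult.commute)
  qed
  also have "\<dots> \<le> hausdorff_outer_measure n (flat_cube (Basis - {e}) 1)"
    by (rule hausdorff_content_le_outer_measure) simp
  finally show ?thesis
    using K unfolding n_def by (auto simp: divide_ennreal intro: less_le_trans[rotated])
qed

section \<open>Translation-invariant measures and the product formula in a hyperplane\<close>

text \<open>The Fubini argument for the uniqueness of Haar measure, on a subgroup \<open>P\<close>.\<close>

lemma translation_invariant_measure_unique:
  fixes M N :: "'a::euclidean_space measure"
  assumes sets: "sets M = sets borel" "sets N = sets borel"
    and sf: "sigma_finite_measure M" "sigma_finite_measure N"
    and ae: "AE x in M. x \<in> P" "AE x in N. x \<in> P"
    and inv: "\<And>v A. v \<in> P \<Longrightarrow> A \<in> sets borel \<Longrightarrow> emeasure M ((\<lambda>x. x + v) -` A) = emeasure M A"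
      "\<And>v A. v \<in> P \<Longrightarrow> A \<in> sets borel \<Longrightarrow> emeasure N ((\<lambda>x. x + v) -` A) = emeasure N A"
    and neg: "\<And>v. v \<in> P \<Longrightarrow> - v \<in> P"
    and A: "A \<in> sets borel" and B: "B \<in> sets borel" "\<And>x. x \<in> B \<Longrightarrow> - x \<in> B"
  shows "emeasure M A * emeasure N B = emeasure N A * emeasure M B"
proof -
  interpret MN: pair_sigma_finite M N using sf by (simp add: pair_sigma_finite_def)
  note [measurable_cong] = sets
  note [measurable] = A B(1)
  have m_shift: "emeasure M A = (\<integral>\<^sup>+ x. indicator A (x + y) \<partial>M)" if "y \<in> P" for y
  proof -
    have "emeasure M A = emeasure M ((\<lambda>x. x + y) -` A)" using inv(1)[OF that A] by simp
    also have "\<dots> = (\<integral>\<^sup>+ x. indicator ((\<lambda>x. x + y) -` A) x \<partial>M)"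
      by (subst nn_integral_indicator) (auto simp: sets intro!: measurable_sets_borel[OF _ A])
    finally show ?thesis by (simp add: indicator_def)
  qed
  have n_shift: "(\<integral>\<^sup>+ y. indicator B y * indicator A (x + y) \<partial>N)
      = (\<integral>\<^sup>+ y. indicator B (y - x) * indicator A y \<partial>N)" if "x \<in> P" for x
  proof -
    have "distr N borel (\<lambda>y. y + x) = N"
    proof (rule measure_eqI)
      fix X assume "X \<in> sets (distr N borel (\<lambda>y. y + x))"
      then have X: "X \<in> sets borel" by simp
      have "space N = UNIV" using sets(2) sets_eq_imp_space_eq by fastforce
      then show "emeasure (distr N borel (\<lambda>y. y + x)) X = emeasure N X"
        using X inv(2)[OF that X] by (subst emeasure_distr) auto
    qed (simp add: sets)
    then have "(\<integral>\<^sup>+ y. indicator B (y - x) * indicator A y \<partial>N)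
        = (\<integral>\<^sup>+ y. indicator B (y - x) * indicator A y \<partial>distr N borel (\<lambda>y. y + x))" by simp
    also have "\<dots> = (\<integral>\<^sup>+ y. indicator B y * indicator A (y + x) \<partial>N)"
      by (subst nn_integral_distr) auto
    finally show ?thesis by (simp add: add.commute)
  qed
  have m_B: "(\<integral>\<^sup>+ x. indicator B (y - x) \<partial>M) = emeasure M B" if "y \<in> P" for y
  proof -
    have eq: "y - x \<in> B \<longleftrightarrow> x + - y \<in> B" for x using B(2)[of "y - x"] B(2)[of "x - y"] by auto
    have "emeasure M B = emeasure M ((\<lambda>x. x + - y) -` B)" using inv(1)[OF neg[OF that] B(1)] by simp
    also have "\<dots> = (\<integral>\<^sup>+ x. indicator ((\<lambda>x. x + - y) -` B) x \<partial>M)"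
      by (subst nn_integral_indicator) (auto simp: sets intro!: measurable_sets_borel[OF _ B(1)])
    finally show ?thesis by (simp add: indicator_def eq)
  qed
  \<comment> \<open>For each \<open>y\<close> in \<open>B\<close>, \<open>M A\<close> is replaced by
    the measure of a translate of \<open>A\<close>. The integrals are interchanged, invariance of
    \<open>N\<close> moves the translation from \<open>A\<close> to \<open>B\<close>, and the
    integrals are interchanged back; symmetry of \<open>B\<close> then turns the inner integral into
    \<open>M B\<close>.\<close>
  have "emeasure M A * emeasure N B = (\<integral>\<^sup>+ y. emeasure M A * indicator B y \<partial>N)"
    by (simp add: nn_integral_cmult sets)
  also have "\<dots> = (\<integral>\<^sup>+ y. \<integral>\<^sup>+ x. indicator B y * indicator A (x + y) \<partial>M \<partial>N)"
    using ae(2) by (intro nn_integral_cong_AE, elim AE_mp, intro AE_I2 impI)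
      (subst m_shift, auto simp: nn_integral_cmult mult.commute)
  also have "\<dots> = (\<integral>\<^sup>+ x. \<integral>\<^sup>+ y. indicator B y * indicator A (x + y) \<partial>N \<partial>M)"
    by (rule MN.Fubini') simp
  also have "\<dots> = (\<integral>\<^sup>+ x. \<integral>\<^sup>+ y. indicator B (y - x) * indicator A y \<partial>N \<partial>M)"
    using ae(1) by (intro nn_integral_cong_AE, elim AE_mp, intro AE_I2 impI) (rule n_shift)
  also have "\<dots> = (\<integral>\<^sup>+ y. \<integral>\<^sup>+ x. indicator B (y - x) * indicator A y \<partial>M \<partial>N)"
    by (rule MN.Fubini'[symmetric]) simp
  also have "\<dots> = (\<integral>\<^sup>+ y. emeasure M B * indicator A y \<partial>N)"
    using ae(2) by (intro nn_integral_cong_AE, elim AE_mp, intro AE_I2 impI)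
      (simp add: nn_integral_multc m_B)
  also have "\<dots> = emeasure N A * emeasure M B"
    using A by (simp add: nn_integral_cmult sets mult.commute[of _ "emeasure M B"])
  finally show ?thesis .
qed

text \<open>Kept on the ambient type: the measure is carried by the hyperplane and invariant under
  translations by its vectors, which form the subgroup \<open>P\<close> of the uniqueness
  lemma.\<close>

definition flat_measure :: "'a::euclidean_space \<Rightarrow> 'a measure" where
  "flat_measure e = density (hausdorff_measure (DIM('a) - 1)) (indicator {x. x \<bullet> e = 0})"

lemma sets_flat_measure [simp, measurable_cong]: "sets (flat_measure e) = sets borel"
  by (simp add: flat_measure_def)

lemma space_flat_measure [simp]: "space (flat_measure e) = UNIV"
  by (simp add: flat_measure_def)

lemma emeasure_flat_measure:
  fixes e :: "'a::euclidean_space"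
  assumes "A \<in> sets borel"
  shows "emeasure (flat_measure e) A = hausdorff_outer_measure (DIM('a) - 1) ({x. x \<bullet> e = 0} \<inter> A)"
  unfolding flat_measure_def using assms
  by (subst emeasure_restricted) (auto simp: emeasure_hausdorff_measure)

lemma AE_flat_measure: "AE x in flat_measure e. x \<in> {x. x \<bullet> e = 0}"
  unfolding flat_measure_def by (subst AE_density) (auto simp: indicator_def)

lemma flat_measure_translate:
  fixes e :: "'a::euclidean_space"
  assumes v: "v \<in> {x. x \<bullet> e = 0}" and A: "A \<in> sets borel"
  shows "emeasure (flat_measure e) ((\<lambda>x. x + v) -` A) = emeasure (flat_measure e) A"
proof -
  have "{x. x \<bullet> e = 0} \<inter> A = (\<lambda>x. x + v) ` ({x. x \<bullet> e = 0} \<inter> (\<lambda>x. x + v) -` A)"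
  proof (intro equalityI subsetI)
    fix x assume "x \<in> {x. x \<bullet> e = 0} \<inter> A"
    then show "x \<in> (\<lambda>x. x + v) ` ({x. x \<bullet> e = 0} \<inter> (\<lambda>x. x + v) -` A)"
      using v by (intro image_eqI[of _ _ "x - v"]) (auto simp: inner_diff_left)
  qed (use v in \<open>auto simp: inner_add_left\<close>)
  then have "hausdorff_outer_measure (DIM('a) - 1) ({x. x \<bullet> e = 0} \<inter> A)
      = hausdorff_outer_measure (DIM('a) - 1) ({x. x \<bullet> e = 0} \<inter> (\<lambda>x. x + v) -` A)"
    by (simp add: hausdorff_outer_measure_isometric_image dist_norm)
  moreover have "(\<lambda>x. x + v) -` A \<in> sets borel" by (rule measurable_sets_borel[OF _ A]) simp
  ultimately show ?thesis using A by (simp add: emeasure_flat_measure)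
qed

lemma flat_slab_borel: "{x::'a::euclidean_space. \<forall>b\<in>D. \<bar>x \<bullet> b\<bar> \<le> k} \<in> sets borel"
proof -
  have "{x::'a. \<forall>b\<in>D. \<bar>x \<bullet> b\<bar> \<le> k} = (\<Inter>b\<in>D. {x. \<bar>x \<bullet> b\<bar> \<le> k})" by auto
  moreover have "closed (\<Inter>b\<in>D. {x::'a. \<bar>x \<bullet> b\<bar> \<le> k})"
    by (intro closed_INT ballI closed_Collect_le continuous_intros)
  ultimately show ?thesis by (simp add: borel_closed)
qed

lemma emeasure_flat_measure_slab:
  fixes e :: "'a::euclidean_space"
  assumes e: "e \<in> Basis"
  shows "emeasure (flat_measure e) {x. \<forall>b\<in>Basis - {e}. \<bar>x \<bullet> b\<bar> \<le> k}
    = hausdorff_outer_measure (DIM('a) - 1) (flat_cube (Basis - {e}) k)"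
proof -
  have "{x. x \<bullet> e = 0} \<inter> {x. \<forall>b\<in>Basis - {e}. \<bar>x \<bullet> b\<bar> \<le> k} = flat_cube (Basis - {e}) k"
    using e by (auto simp: flat_cube_def)
  then show ?thesis by (simp add: emeasure_flat_measure flat_slab_borel)
qed

lemma flat_measure_slab_finite:
  fixes e :: "'a::euclidean_space"
  assumes e: "e \<in> Basis"
  shows "emeasure (flat_measure e) {x. \<forall>b\<in>Basis - {e}. \<bar>x \<bullet> b\<bar> \<le> real k} < top"
  using hausdorff_flat_cube_finite[of "Basis - {e}" k] e
  by (simp add: emeasure_flat_measure_slab)

lemma sigma_finite_flat_measure:
  fixes e :: "'a::euclidean_space"
  assumes e: "e \<in> Basis"
  shows "sigma_finite_measure (flat_measure e)"
proof
  let ?S = "\<lambda>k::nat. {x::'a. \<forall>b\<in>Basis - {e}. \<bar>x \<bullet> b\<bar> \<le> real k}"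
  have "\<exists>k. x \<in> ?S k" for x
  proof -
    obtain k :: nat where "norm x \<le> real k" using real_arch_simple by blast
    then show ?thesis by (auto intro!: exI[of _ k] order_trans[OF Basis_le_norm])
  qed
  then have "(\<Union>k. ?S k) = UNIV" by blast
  then show "\<exists>A. countable A \<and> A \<subseteq> sets (flat_measure e) \<and> \<Union> A = space (flat_measure e)
      \<and> (\<forall>a\<in>A. emeasure (flat_measure e) a \<noteq> \<infinity>)"
    using flat_measure_slab_finite[OF e] flat_slab_borel
    by (intro exI[of _ "range ?S"]) (auto simp: flat_measure_def less_top)
qed

text \<open>The product of the flat measure with length, and the Hausdorff measure of one dimension
  more, both live on the hyperplane orthogonal to \<open>(e, 0)\<close> and are invariant under its
  translations. They are therefore proportional, with a factor that is the same for all
  \<open>A\<close> and \<open>B\<close>.\<close>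

proposition hausdorff_flat_product:
  fixes e :: "'a::euclidean_space"
  assumes e: "e \<in> Basis"
  obtains c :: real where "c \<ge> 0"
    "\<And>A B. A \<in> sets borel \<Longrightarrow> B \<in> sets borel \<Longrightarrow> A \<subseteq> {x. x \<bullet> e = 0} \<Longrightarrow>
      hausdorff_outer_measure (DIM('a)) (A \<times> (B :: real set))
        = ennreal c * hausdorff_outer_measure (DIM('a) - 1) A * emeasure lborel B"
proof -
  define e' :: "'a \<times> real" where "e' = (e, 0)"
  have e': "e' \<in> Basis" using e by (simp add: e'_def Basis_prod_def)
  define M where "M = flat_measure e \<Otimes>\<^sub>M (lborel :: real measure)"
  define N where "N = flat_measure e'"
  interpret fe: sigma_finite_measure "flat_measure e" using e by (rule sigma_finite_flat_measure)
  interpret pair_sigma_finite "flat_measure e" "lborel :: real measure" ..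
  have setsM: "sets M = sets borel"
    unfolding M_def borel_prod[symmetric] by (intro sets_pair_measure_cong) auto
  have sfM: "sigma_finite_measure M" unfolding M_def by (rule sigma_finite_measure_axioms)
  have emM: "emeasure M (A \<times> B) = emeasure (flat_measure e) A * emeasure lborel B"
    if "A \<in> sets borel" "B \<in> sets borel" for A B
    unfolding M_def using that by (intro lborel.emeasure_pair_measure_Times) auto
  let ?P = "{z::'a \<times> real. z \<bullet> e' = 0}"
  have P: "z \<in> ?P \<longleftrightarrow> fst z \<bullet> e = 0" for z by (cases z) (simp add: e'_def)
  have aeM: "AE z in M. z \<in> ?P"
  proof (rule AE_I')
    have "(- {x. x \<bullet> e = 0}) \<times> (UNIV::real set) \<in> sets M" unfolding setsM borel_prod[symmetric]
      by (intro pair_measureI) auto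
    moreover have "emeasure M ((- {x. x \<bullet> e = 0}) \<times> (UNIV::real set)) = 0"
      by (subst emM) (auto simp: emeasure_flat_measure)
    ultimately show "(- {x. x \<bullet> e = 0}) \<times> (UNIV::real set) \<in> null_sets M" by auto
    show "{z \<in> space M. \<not> z \<in> ?P} \<subseteq> (- {x. x \<bullet> e = 0}) \<times> (UNIV::real set)"
      unfolding P by auto
  qed
  have invM: "emeasure M ((\<lambda>x. x + v) -` A) = emeasure M A" if v: "v \<in> ?P" and A: "A \<in> sets borel" for v A
  proof -
    obtain w s where vw: "v = (w, s)" by (cases v)
    have w: "w \<in> {x. x \<bullet> e = 0}" using v P[of v] by (simp add: vw)
    have d1: "distr (flat_measure e) borel (\<lambda>x. x + w) = flat_measure e"
      by (rule measure_eqI) (auto simp: emeasure_distr flat_measure_translate[OF w])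
    have d2: "distr lborel borel (\<lambda>x. x + s) = (lborel :: real measure)"
    proof -
      have "(\<lambda>x. x + s) = (+) s" by (simp add: fun_eq_iff add.commute)
      then show ?thesis using lborel_distr_plus[of s] by simp
    qed
    have "M = distr (flat_measure e) borel (\<lambda>x. x + w) \<Otimes>\<^sub>M distr lborel borel (\<lambda>x. x + s)"
      by (simp add: d1 d2 M_def)
    also have "\<dots> = distr M (borel \<Otimes>\<^sub>M borel) (\<lambda>(x, y). (x + w, y + s))"
      unfolding M_def by (intro pair_measure_distr) (auto simp: d2 sigma_finite_lborel)
    finally have eq: "M = distr M (borel \<Otimes>\<^sub>M borel) (\<lambda>(x, y). (x + w, y + s))" .
    have f: "(\<lambda>(x, y). (x + w, y + s)) = (\<lambda>z. z + v)" by (auto simp: vw)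
    have "emeasure M A = emeasure (distr M borel (\<lambda>z. z + v)) A"
      using eq unfolding f borel_prod by simp
    also have "\<dots> = emeasure M ((\<lambda>z. z + v) -` A \<inter> space M)"
      using A by (intro emeasure_distr) (auto simp: measurable_cong_sets[OF setsM refl])
    also have "space M = UNIV" using setsM sets_eq_imp_space_eq by fastforce
    finally show ?thesis by simp
  qed
  \<comment> \<open>The reference set \<open>?B\<close> is symmetric and has positive finite
    \<open>M\<close>-measure; \<open>c\<close> is the ratio of the two measures on it.\<close>
  let ?S = "{x. \<forall>b\<in>Basis - {e}. \<bar>x \<bullet> b\<bar> \<le> 1} :: 'a set"
  let ?B = "?S \<times> {-1..1::real}"
  have S: "?S \<in> sets borel" by (rule flat_slab_borel)
  have B: "?B \<in> sets borel" unfolding borel_prod[symmetric] using S by (intro pair_measureI) auto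
  have MB: "emeasure M ?B = hausdorff_outer_measure (DIM('a) - 1) (flat_cube (Basis - {e}) 1) * 2"
    using S by (simp add: emM emeasure_flat_measure_slab e)
  have MB_pos: "emeasure M ?B > 0"
    unfolding MB using hausdorff_flat_cube_pos[OF e] by (simp add: ennreal_zero_less_mult_iff)
  have MB_fin: "emeasure M ?B < top"
    using flat_measure_slab_finite[OF e, of 1] e
    by (auto simp: MB emeasure_flat_measure_slab ennreal_mult_less_top)
  have "Basis - {e'} = insert (0, 1) ((\<lambda>u. (u, 0)) ` (Basis - {e}))"
    by (auto simp: e'_def Basis_prod_def)
  then have "?B = {x. \<forall>b\<in>Basis - {e'}. \<bar>x \<bullet> b\<bar> \<le> 1}"
    by (auto simp: abs_le_iff)
  then have NB_fin: "emeasure N ?B < top"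
    using flat_measure_slab_finite[OF e', of 1] by (simp add: N_def)
  define c where "c = enn2real (emeasure N ?B / emeasure M ?B)"
  have c: "ennreal c = emeasure N ?B / emeasure M ?B"
    unfolding c_def
    by (rule ennreal_enn2real) (use NB_fin MB_pos in \<open>auto simp: less_top[symmetric] ennreal_divide_eq_top_iff\<close>)
  have aeN: "AE z in N. z \<in> ?P" unfolding N_def by (rule AE_flat_measure)
  have main: "hausdorff_outer_measure (DIM('a)) (A \<times> B)
        = ennreal c * hausdorff_outer_measure (DIM('a) - 1) A * emeasure lborel B"
    if A: "A \<in> sets borel" and B': "B \<in> sets borel" and AP: "A \<subseteq> {x. x \<bullet> e = 0}" for A and B :: "real set"
  proof -
    have AB: "A \<times> B \<in> sets borel" unfolding borel_prod[symmetric] using A B' by (intro pair_measureI)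
    have "emeasure M (A \<times> B) * emeasure N ?B = emeasure N (A \<times> B) * emeasure M ?B"
      using AB B
      by (intro translation_invariant_measure_unique[of M N ?P] setsM sfM invM aeM aeN)
        (auto simp: N_def sigma_finite_flat_measure e' flat_measure_translate)
    then have "emeasure N (A \<times> B) = emeasure M (A \<times> B) * emeasure N ?B / emeasure M ?B"
      using MB_pos MB_fin by (simp add: mult_divide_eq_ennreal)
    also have "\<dots> = ennreal c * emeasure M (A \<times> B)"
      by (simp add: c ennreal_times_divide mult.commute)
    also have "emeasure M (A \<times> B) = hausdorff_outer_measure (DIM('a) - 1) A * emeasure lborel B"
      using AP by (simp add: emM A B' emeasure_flat_measure Int_absorb1)
    also have "emeasure N (A \<times> B) = hausdorff_outer_measure (DIM('a)) (A \<times> B)"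
    proof -
      have "?P \<inter> A \<times> B = A \<times> B" using AP by (auto simp: e'_def)
      then show ?thesis by (simp add: N_def emeasure_flat_measure AB)
    qed
    finally show ?thesis by (simp add: mult.assoc)
  qed
  show thesis by (rule that[of c]) (use main in \<open>auto simp: c_def\<close>)
qed

section \<open>Calculus of smooth maps\<close>

lemma frechet_derivative_eqI: "(f has_derivative f') (at x) \<Longrightarrow> frechet_derivative f (at x) = f'"
  by (rule frechet_derivative_at[symmetric])

lemma frechet_derivative_cong_open:
  assumes "open U" "x \<in> U" "\<And>y. y \<in> U \<Longrightarrow> f y = g y"
  shows "frechet_derivative f (at x) = frechet_derivative g (at x)"
proof -
  have "(f has_derivative D) (at x) \<longleftrightarrow> (g has_derivative D) (at x)" for D
    by (rule iffI; erule has_derivative_transform_within_open[OF _ assms(1,2)]) (simp_all add: assms(3))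
  then show ?thesis by (simp add: frechet_derivative_def)
qed

lemma differentiable_on_openD:
  "open U \<Longrightarrow> f differentiable_on U \<Longrightarrow> x \<in> U \<Longrightarrow> (f has_derivative frechet_derivative f (at x)) (at x)"
  by (metis differentiable_on_eq_differentiable_at frechet_derivative_works)

lemma Ck_on_cong:
  assumes U: "open U"
  shows "(\<And>x. x \<in> U \<Longrightarrow> f x = g x) \<Longrightarrow> Ck_on k U f \<Longrightarrow> Ck_on k U g"
proof (induction k arbitrary: f g)
  case 0
  then show ?case by (metis Ck_on.simps(1) continuous_on_cong)
next
  case (Suc k)
  have "g differentiable_on U"
    using Suc.prems unfolding differentiable_on_def
    by (metis Ck_on.simps(2) differentiable_on_def differentiable_transform_within zero_less_one)
  moreover have "Ck_on k U (\<lambda>x. frechet_derivative g (at x) v)" for v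
  proof (rule Suc.IH)
    show "frechet_derivative f (at x) v = frechet_derivative g (at x) v" if "x \<in> U" for x
      using frechet_derivative_cong_open[OF U that, of f g] Suc.prems(1) by simp
  qed (use Suc.prems(2) in simp)
  ultimately show ?case by simp
qed

lemma Ck_on_continuous: "Ck_on k U f \<Longrightarrow> continuous_on U f"
  by (cases k) (auto intro: differentiable_imp_continuous_on)

lemma Ck_on_Suc_D: "Ck_on (Suc k) U f \<Longrightarrow> Ck_on k U f"
proof (induction k arbitrary: f)
  case 0
  then show ?case using Ck_on_continuous[of "Suc 0"] by simp
next
  case (Suc k)
  then show ?case by simp
qed

lemma Ck_on_subset: "V \<subseteq> U \<Longrightarrow> Ck_on k U f \<Longrightarrow> Ck_on k V f"
  by (induction k arbitrary: f) (auto intro: continuous_on_subset differentiable_on_subset)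

lemma Ck_on_const: "Ck_on k U (\<lambda>_. c)"
  by (induction k arbitrary: c) auto

text \<open>\<open>Ck_on\<close> speaks of \<open>frechet_derivative\<close>, which is a choice.
  With this rule the closure properties follow from explicit derivative formulas.\<close>

lemma Ck_on_SucI:
  assumes U: "open U" and f: "\<And>x. x \<in> U \<Longrightarrow> (f has_derivative f' x) (at x)"
    and f': "\<And>v. Ck_on k U (\<lambda>x. f' x v)"
  shows "Ck_on (Suc k) U f"
proof -
  have "f differentiable_on U"
    using U f by (auto simp: differentiable_on_eq_differentiable_at differentiable_def)
  moreover have "Ck_on k U (\<lambda>x. frechet_derivative f (at x) v)" for v
    by (rule Ck_on_cong[OF U _ f'[of v]]) (simp add: frechet_derivative_eqI[OF f])
  ultimately show ?thesis by simp
qed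

lemma Ck_on_SucD:
  assumes "open U" "Ck_on (Suc k) U f"
  shows "\<And>x. x \<in> U \<Longrightarrow> (f has_derivative frechet_derivative f (at x)) (at x)"
    and "\<And>v. Ck_on k U (\<lambda>x. frechet_derivative f (at x) v)"
  using assms differentiable_on_openD by auto

lemma Ck_on_linear:
  assumes L: "bounded_linear L" and U: "open U"
  shows "Ck_on k U f \<Longrightarrow> Ck_on k U (\<lambda>x. L (f x))"
proof (induction k arbitrary: f)
  case 0
  then show ?case using bounded_linear.continuous_on[OF L] by auto
next
  case (Suc k)
  show ?case
    by (rule Ck_on_SucI[OF U, where f'="\<lambda>x v. L (frechet_derivative f (at x) v)"])
      (auto intro: Suc.IH Ck_on_SucD[OF U Suc.prems] bounded_linear.has_derivative[OF L]
        simp del: Ck_on.simps)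
qed

lemma Ck_on_add:
  assumes U: "open U"
  shows "Ck_on k U f \<Longrightarrow> Ck_on k U g \<Longrightarrow> Ck_on k U (\<lambda>x. f x + g x)"
proof (induction k arbitrary: f g)
  case (Suc k)
  show ?case
    by (rule Ck_on_SucI[OF U, where f'="\<lambda>x v. frechet_derivative f (at x) v + frechet_derivative g (at x) v"])
      (auto intro: has_derivative_add Suc.IH Ck_on_SucD[OF U Suc.prems(1)] Ck_on_SucD[OF U Suc.prems(2)])
qed (auto intro: continuous_intros)

lemma Ck_on_sum:
  assumes U: "open U" and "finite I" and "\<And>i. i \<in> I \<Longrightarrow> Ck_on k U (f i)"
  shows "Ck_on k U (\<lambda>x. \<Sum>i\<in>I. f i x)"
  using assms(2,3) by (induction I rule: finite_induct) (auto intro: Ck_on_const Ck_on_add[OF U])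

lemma Ck_on_bilinear:
  assumes B: "bounded_bilinear B" and U: "open U"
  shows "Ck_on k U f \<Longrightarrow> Ck_on k U g \<Longrightarrow> Ck_on k U (\<lambda>x. B (f x) (g x))"
proof (induction k arbitrary: f g)
  case 0
  then show ?case using bounded_bilinear.continuous_on[OF B] by auto
next
  case (Suc k)
  note f = Ck_on_SucD[OF U Suc.prems(1)] and g = Ck_on_SucD[OF U Suc.prems(2)]
  show ?case
    by (rule Ck_on_SucI[OF U, where f'="\<lambda>x v. B (f x) (frechet_derivative g (at x) v) + B (frechet_derivative f (at x) v) (g x)"])
      (intro bounded_bilinear.FDERIV[OF B] f(1) g(1) Ck_on_add[OF U] Suc.IH f(2) g(2)
        Suc.prems[THEN Ck_on_Suc_D]; assumption)+
qed

lemma Ck_on_id: "open U \<Longrightarrow> Ck_on k U (\<lambda>x. x)"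
proof (cases k)
  case (Suc l)
  moreover assume "open U"
  then have "Ck_on (Suc l) U (\<lambda>x. x)"
    by (rule Ck_on_SucI[where f'="\<lambda>x v. v"]) (rule has_derivative_ident Ck_on_const)+
  ultimately show ?thesis by simp
qed simp

lemma has_derivative_basis_sum:
  assumes "(g has_derivative g') F"
  shows "g' (w :: 'b::euclidean_space) = (\<Sum>b\<in>Basis. (w \<bullet> b) *\<^sub>R g' b)"
proof -
  have "linear g'" using assms has_derivative_linear by blast
  then have "g' (\<Sum>b\<in>Basis. (w \<bullet> b) *\<^sub>R b) = (\<Sum>b\<in>Basis. (w \<bullet> b) *\<^sub>R g' b)"
    by (simp add: linear_sum linear_scale)
  then show ?thesis by (simp add: euclidean_representation)
qed

text \<open>The chain rule differentiates \<open>g\<close> in the direction \<open>Df(x) v\<close>,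
  which moves with \<open>x\<close>, whereas \<open>Ck_on\<close> controls derivatives in fixed
  directions only. Expanding the moving direction in \<open>Basis\<close> reduces one to the other;
  hence the middle space is Euclidean.\<close>

lemma Ck_on_compose:
  fixes f :: "'a::real_normed_vector \<Rightarrow> 'b::euclidean_space"
  assumes U: "open U" and V: "open V" and fUV: "f ` U \<subseteq> V"
  shows "Ck_on k U f \<Longrightarrow> Ck_on k V g \<Longrightarrow> Ck_on k U (\<lambda>x. g (f x))"
proof (induction k arbitrary: g)
  case 0
  then show ?case using continuous_on_compose2[OF _ _ fUV] by auto
next
  case (Suc k)
  note f = Ck_on_SucD[OF U Suc.prems(1)] and g = Ck_on_SucD[OF V Suc.prems(2)]
  show ?case
  proof (rule Ck_on_SucI[OF U, where f'="\<lambda>x v. \<Sum>b\<in>Basis.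
        (frechet_derivative f (at x) v \<bullet> b) *\<^sub>R frechet_derivative g (at (f x)) b"])
    fix x assume x: "x \<in> U"
    then have fx: "f x \<in> V" using fUV by auto
    have "((\<lambda>x. g (f x)) has_derivative (\<lambda>v. frechet_derivative g (at (f x)) (frechet_derivative f (at x) v))) (at x)"
      by (rule has_derivative_compose[OF f(1)[OF x] g(1)[OF fx]])
    then show "((\<lambda>x. g (f x)) has_derivative (\<lambda>v. \<Sum>b\<in>Basis.
        (frechet_derivative f (at x) v \<bullet> b) *\<^sub>R frechet_derivative g (at (f x)) b)) (at x)"
      by (subst (asm) has_derivative_basis_sum[OF g(1)[OF fx]])
  next
    fix v
    show "Ck_on k U (\<lambda>x. \<Sum>b\<in>Basis. (frechet_derivative f (at x) v \<bullet> b) *\<^sub>R frechet_derivative g (at (f x)) b)"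
      using Suc.prems(1)[THEN Ck_on_Suc_D] f(2) g(2)
      by (intro Ck_on_sum[OF U] Ck_on_bilinear[OF bounded_bilinear_scaleR U]
          Ck_on_linear[OF bounded_linear_inner_left U] Suc.IH) auto
  qed
qed

lemma smooth_on_open: "smooth_on U f \<Longrightarrow> open U"
  and smooth_on_const: "open U \<Longrightarrow> smooth_on U (\<lambda>_. c)"
  and smooth_on_id: "open U \<Longrightarrow> smooth_on U (\<lambda>x. x)"
  and smooth_on_subset: "smooth_on U f \<Longrightarrow> open V \<Longrightarrow> V \<subseteq> U \<Longrightarrow> smooth_on V f"
  and smooth_on_linear: "bounded_linear L \<Longrightarrow> smooth_on U f \<Longrightarrow> smooth_on U (\<lambda>x. L (f x))"
  and smooth_on_add: "smooth_on U f \<Longrightarrow> smooth_on U g \<Longrightarrow> smooth_on U (\<lambda>x. f x + g x)"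
  and smooth_on_bilinear: "bounded_bilinear B \<Longrightarrow> smooth_on U f' \<Longrightarrow> smooth_on U g' \<Longrightarrow> smooth_on U (\<lambda>x. B (f' x) (g' x))"
  and smooth_on_derivative: "smooth_on U f \<Longrightarrow> smooth_on U (\<lambda>x. frechet_derivative f (at x) v)"
  and smooth_on_cong: "smooth_on U f \<Longrightarrow> (\<And>x. x \<in> U \<Longrightarrow> f x = g x) \<Longrightarrow> smooth_on U g"
  and smooth_on_continuous: "smooth_on U f \<Longrightarrow> continuous_on U f"
  unfolding smooth_on_def
  by (blast intro: Ck_on_const Ck_on_id Ck_on_subset Ck_on_linear Ck_on_add
      Ck_on_bilinear Ck_on_continuous Ck_on_cong Ck_on_SucD(2))+

lemma smooth_on_sum:
  "open U \<Longrightarrow> finite I \<Longrightarrow> (\<And>i. i \<in> I \<Longrightarrow> smooth_on U (f i)) \<Longrightarrow> smooth_on U (\<lambda>x. \<Sum>i\<in>I. f i x)"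
  by (auto simp: smooth_on_def intro: Ck_on_sum)

lemma smooth_on_compose:
  fixes f :: "'a::real_normed_vector \<Rightarrow> 'b::euclidean_space"
  shows "smooth_on U f \<Longrightarrow> smooth_on V g \<Longrightarrow> f ` U \<subseteq> V \<Longrightarrow> smooth_on U (\<lambda>x. g (f x))"
  by (auto simp: smooth_on_def intro: Ck_on_compose[of U V])

lemma smooth_on_Pair: 
  assumes "smooth_on U f" "smooth_on U g" shows "smooth_on U (\<lambda>x. (f x, g x))"
proof -
  have "smooth_on U (\<lambda>x. (f x, 0) + (0, g x))"
    by (intro smooth_on_add smooth_on_linear[OF _ assms(1)] smooth_on_linear[OF _ assms(2)]
        bounded_linear_Pair bounded_linear_ident bounded_linear_zero)
  then show ?thesis by simp
qed

lemma smooth_on_exp: "smooth_on UNIV (exp :: real \<Rightarrow> real)"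
proof -
  \<comment> \<open>The coefficient \<open>c\<close> makes the induction close: the derivative in
    direction \<open>v\<close> is again of this form, with coefficient \<open>v * c\<close>.\<close>
  have "Ck_on k UNIV (\<lambda>x::real. c * exp x)" for k c
  proof (induction k arbitrary: c)
    case (Suc k)
    show ?case
    proof (rule Ck_on_SucI[where f'="\<lambda>x v. (v * c) * exp x"])
      show "((\<lambda>x. c * exp x) has_derivative (\<lambda>v. v * c * exp x)) (at x)" for x :: real
        by (auto intro!: derivative_eq_intros)
    qed (use Suc in auto)
  qed (simp add: continuous_on_mult continuous_on_const continuous_on_exp continuous_on_id)
  from this[of _ 1] show ?thesis by (simp add: smooth_on_def)
qed

section \<open>Local Lipschitz estimates for smooth maps and their derivatives\<close>

lemma smooth_on_has_derivative:
  "smooth_on U f \<Longrightarrow> x \<in> U \<Longrightarrow> (f has_derivative frechet_derivative f (at x)) (at x)"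
  using Ck_on_SucD(1)[of U 0 f x] by (simp add: smooth_on_def)

text \<open>Turns estimates of derivatives along the finitely many basis directions, where
  continuity is available direction by direction, into estimates uniform in the direction.\<close>

lemma norm_linear_le_basis:
  fixes w :: "'b::euclidean_space"
  assumes "linear A" and "\<And>b. b \<in> Basis \<Longrightarrow> norm (A b) \<le> c"
  shows "norm (A w) \<le> real DIM('b) * c * norm w"
proof -
  have "A w = (\<Sum>b\<in>Basis. (w \<bullet> b) *\<^sub>R A b)"
    using assms(1) by (metis (mono_tags, lifting) euclidean_representation linear_scale linear_sum sum.cong)
  also have "norm \<dots> \<le> (\<Sum>b\<in>(Basis::'b set). norm w * c)"
  proof (rule sum_norm_le)
    fix b :: 'b assume b: "b \<in> Basis"
    have "\<bar>w \<bullet> b\<bar> * norm (A b) \<le> norm w * c"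
      using Basis_le_norm[OF b, of w] assms(2)[OF b] by (intro mult_mono) auto
    then show "norm ((w \<bullet> b) *\<^sub>R A b) \<le> norm w * c" by simp
  qed
  finally show ?thesis by (simp add: mult_ac)
qed

lemma smooth_on_deriv_close:
  fixes g :: "'b::euclidean_space \<Rightarrow> 'c::real_normed_vector"
  assumes g: "smooth_on U g" and p: "p \<in> U" and eps: "\<epsilon> > 0"
  shows "\<exists>r>0. ball p r \<subseteq> U \<and>
    (\<forall>x\<in>ball p r. \<forall>v. norm (frechet_derivative g (at x) v - frechet_derivative g (at p) v) \<le> \<epsilon> * norm v)"
proof -
  have U: "open U" using g smooth_on_open by blast
  define \<eta> where "\<eta> = \<epsilon> / real DIM('b)"
  have eta: "\<eta> > 0" using eps by (simp add: \<eta>_def)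
  have "\<forall>\<^sub>F x in nhds p. norm (frechet_derivative g (at x) b - frechet_derivative g (at p) b) < \<eta>" for b
  proof -
    have "continuous_on U (\<lambda>x. frechet_derivative g (at x) b)"
      using g smooth_on_derivative smooth_on_continuous by blast
    then have "isCont (\<lambda>x. frechet_derivative g (at x) b) p"
      using U p continuous_on_eq_continuous_at by blast
    then have "\<forall>\<^sub>F x in nhds p. dist (frechet_derivative g (at x) b) (frechet_derivative g (at p) b) < \<eta>"
      using eta unfolding continuous_at_eps_delta eventually_nhds_metric by (simp add: dist_commute)
    then show ?thesis by (simp add: dist_norm)
  qed
  then have "\<forall>\<^sub>F x in nhds p. \<forall>b\<in>(Basis::'b set). norm (frechet_derivative g (at x) b - frechet_derivative g (at p) b) < \<eta>"
    by (intro eventually_ball_finite) auto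
  moreover have "\<forall>\<^sub>F x in nhds p. x \<in> U" using U p eventually_nhds by blast
  ultimately have "\<forall>\<^sub>F x in nhds p. x \<in> U \<and> (\<forall>b\<in>(Basis::'b set). norm (frechet_derivative g (at x) b - frechet_derivative g (at p) b) < \<eta>)"
    by (auto intro: eventually_conj)
  then obtain r where r: "r > 0" and rU: "\<And>x. x \<in> ball p r \<Longrightarrow> x \<in> U"
    and rb: "\<And>x b. x \<in> ball p r \<Longrightarrow> b \<in> (Basis::'b set) \<Longrightarrow> norm (frechet_derivative g (at x) b - frechet_derivative g (at p) b) < \<eta>"
    unfolding eventually_nhds_metric by (auto simp: dist_commute)
  have "norm (frechet_derivative g (at x) v - frechet_derivative g (at p) v) \<le> \<epsilon> * norm v" if x: "x \<in> ball p r" for x v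
  proof -
    have "linear (\<lambda>v. frechet_derivative g (at x) v - frechet_derivative g (at p) v)"
      using smooth_on_has_derivative[OF g rU[OF x]] smooth_on_has_derivative[OF g p]
      by (intro linear_compose_sub has_derivative_linear)
    from norm_linear_le_basis[OF this, of \<eta> v] rb[OF x] show ?thesis
      by (simp add: \<eta>_def less_imp_le)
  qed
  then show ?thesis using r rU by blast
qed

lemma smooth_on_local_lipschitz:
  fixes g :: "'b::euclidean_space \<Rightarrow> 'c::real_normed_vector"
  assumes g: "smooth_on U g" and p: "p \<in> U"
  shows "\<exists>r>0. \<exists>L\<ge>0. ball p r \<subseteq> U \<and>
    (\<forall>x\<in>ball p r. \<forall>v. norm (frechet_derivative g (at x) v) \<le> L * norm v) \<and>
    (\<forall>x\<in>ball p r. \<forall>y\<in>ball p r. norm (g x - g y) \<le> L * norm (x - y))"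
proof -
  obtain r where r: "r > 0" "ball p r \<subseteq> U"
    and close: "\<And>x v. x \<in> ball p r \<Longrightarrow> norm (frechet_derivative g (at x) v - frechet_derivative g (at p) v) \<le> 1 * norm v"
    using smooth_on_deriv_close[OF g p, of 1] by auto
  define L where "L = onorm (frechet_derivative g (at p)) + 1"
  have bl: "bounded_linear (frechet_derivative g (at p))"
    using smooth_on_has_derivative[OF g p] has_derivative_bounded_linear by blast
  have L0: "L \<ge> 0" using onorm_pos_le[OF bl] by (simp add: L_def)
  have D: "norm (frechet_derivative g (at x) v) \<le> L * norm v" if "x \<in> ball p r" for x v
  proof -
    have "norm (frechet_derivative g (at x) v) \<le> norm (frechet_derivative g (at x) v - frechet_derivative g (at p) v) + norm (frechet_derivative g (at p) v)"
      by (metis diff_add_cancel norm_triangle_ineq)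
    also have "\<dots> \<le> 1 * norm v + onorm (frechet_derivative g (at p)) * norm v"
      by (intro add_mono close that onorm[OF bl])
    finally show ?thesis by (simp add: L_def algebra_simps)
  qed
  have "norm (g x - g y) \<le> L * norm (x - y)" if "x \<in> ball p r" "y \<in> ball p r" for x y
  proof (rule differentiable_bound[of "ball p r" g "\<lambda>x. frechet_derivative g (at x)"])
    show "(g has_derivative frechet_derivative g (at z)) (at z within ball p r)" if "z \<in> ball p r" for z
      using smooth_on_has_derivative[OF g, of z] that r(2) has_derivative_at_withinI by blast
    show "onorm (frechet_derivative g (at z)) \<le> L" if "z \<in> ball p r" for z
      using D[OF that] L0 by (intro onorm_bound) auto
  qed (use that in auto)
  then show ?thesis using r L0 D by blast
qed

lemma smooth_on_deriv_local_lipschitz: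
  fixes g :: "'b::euclidean_space \<Rightarrow> 'c::real_normed_vector"
  assumes g: "smooth_on U g" and p: "p \<in> U"
  shows "\<exists>r>0. \<exists>L\<ge>0. ball p r \<subseteq> U \<and> (\<forall>x\<in>ball p r. \<forall>y\<in>ball p r. \<forall>v.
    norm (frechet_derivative g (at x) v - frechet_derivative g (at y) v) \<le> L * norm (x - y) * norm v)"
proof -
  have "\<exists>r>0. \<exists>L\<ge>0. ball p r \<subseteq> U \<and> (\<forall>x\<in>ball p r. \<forall>y\<in>ball p r.
      norm (frechet_derivative g (at x) b - frechet_derivative g (at y) b) \<le> L * norm (x - y))" for b
    using smooth_on_local_lipschitz[OF smooth_on_derivative[OF g, of b] p] by meson
  then obtain r L where r: "\<And>b. r b > 0" and L: "\<And>b. L b \<ge> 0" and rU: "\<And>b. ball p (r b) \<subseteq> U"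
    and lip: "\<And>b x y. x \<in> ball p (r b) \<Longrightarrow> y \<in> ball p (r b) \<Longrightarrow>
      norm (frechet_derivative g (at x) b - frechet_derivative g (at y) b) \<le> L b * norm (x - y)"
    by metis
  define R where "R = Min (r ` (Basis :: 'b set))"
  define M where "M = Max (L ` (Basis :: 'b set))"
  have R: "R > 0" unfolding R_def using r by (subst Min_gr_iff) auto
  have Rr: "ball p R \<subseteq> ball p (r b)" if "b \<in> Basis" for b
    unfolding R_def using that by (intro subset_ball Min_le) auto
  have LM: "L b \<le> M" if "b \<in> Basis" for b
    unfolding M_def using that by (intro Max_ge) auto
  have RU: "ball p R \<subseteq> U" using Rr[OF SOME_Basis] rU by blast
  have M: "M \<ge> 0" using LM[OF SOME_Basis] L order_trans by blast
  have "norm (frechet_derivative g (at x) v - frechet_derivative g (at y) v) \<le> real DIM('b) * M * norm (x - y) * norm v"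
    if xy: "x \<in> ball p R" "y \<in> ball p R" for x y v
  proof -
    have lin: "linear (\<lambda>v. frechet_derivative g (at x) v - frechet_derivative g (at y) v)"
      using xy RU by (intro linear_compose_sub has_derivative_linear[OF smooth_on_has_derivative[OF g]]) auto
    have "norm (frechet_derivative g (at x) b - frechet_derivative g (at y) b) \<le> M * norm (x - y)" if b: "b \<in> Basis" for b
      using lip[of x b y] Rr[OF b] xy mult_right_mono[OF LM[OF b], of "norm (x - y)"] by fastforce
    from norm_linear_le_basis[OF lin this, of v] show ?thesis by (simp add: mult_ac)
  qed
  then show ?thesis using R RU M
    by (intro exI[of _ R] conjI exI[of _ "real DIM('b) * M"]) auto
qed

section \<open>Smoothness along a subset\<close>

lemma smooth_along_const: "smooth_along S (\<lambda>_. c)"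
  unfolding smooth_along_def using smooth_on_const[of UNIV] by blast

lemma smooth_alongE:
  assumes "smooth_along S f" "p \<in> S"
  obtains U g where "p \<in> U" "open U" "smooth_on U g" "\<And>x. x \<in> S \<Longrightarrow> x \<in> U \<Longrightarrow> f x = g x"
  using assms smooth_on_open unfolding smooth_along_def by (metis IntI)

lemma smooth_alongI:
  assumes "\<And>p. p \<in> S \<Longrightarrow> \<exists>U g. p \<in> U \<and> smooth_on U g \<and> (\<forall>x\<in>S \<inter> U. f x = g x)"
  shows "smooth_along S f"
  using assms by (auto simp: smooth_along_def)

lemma smooth_along_bilinear:
  assumes B: "bounded_bilinear B" and f: "smooth_along S f" and h: "smooth_along S h"
  shows "smooth_along S (\<lambda>x. B (f x) (h x))"
proof (rule smooth_alongI)
  fix p assume p: "p \<in> S"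
  obtain U f' where U: "p \<in> U" "open U" "smooth_on U f'" "\<And>x. x \<in> S \<Longrightarrow> x \<in> U \<Longrightarrow> f x = f' x"
    using smooth_alongE[OF f p] by blast
  obtain V h' where V: "p \<in> V" "open V" "smooth_on V h'" "\<And>x. x \<in> S \<Longrightarrow> x \<in> V \<Longrightarrow> h x = h' x"
    using smooth_alongE[OF h p] by blast
  have "smooth_on (U \<inter> V) (\<lambda>x. B (f' x) (h' x))"
    using U V by (intro smooth_on_bilinear[OF B] smooth_on_subset[OF U(3)] smooth_on_subset[OF V(3)]) auto
  then show "\<exists>U g. p \<in> U \<and> smooth_on U g \<and> (\<forall>x\<in>S \<inter> U. B (f x) (h x) = g x)"
    using U(1,4) V(1,4) by (intro exI[of _ "U \<inter> V"] exI[of _ "\<lambda>x. B (f' x) (h' x)"]) auto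
qed

lemma smooth_along_compose_inner:
  fixes h :: "'b::real_normed_vector \<Rightarrow> 'a::euclidean_space"
  assumes f: "smooth_along S f" and h: "smooth_on UNIV h" and im: "h ` T \<subseteq> S"
  shows "smooth_along T (\<lambda>x. f (h x))"
proof (rule smooth_alongI)
  fix p assume p: "p \<in> T"
  then have hp: "h p \<in> S" using im by auto
  obtain U f' where U: "h p \<in> U" "open U" "smooth_on U f'" "\<And>x. x \<in> S \<Longrightarrow> x \<in> U \<Longrightarrow> f x = f' x"
    using smooth_alongE[OF f hp] by blast
  have op: "open (h -` U)"
    using smooth_on_continuous[OF h] U(2) by (simp add: continuous_on_open_vimage)
  have "smooth_on (h -` U) (\<lambda>x. f' (h x))"
    using op by (intro smooth_on_compose[OF _ U(3)] smooth_on_subset[OF h]) auto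
  then show "\<exists>U g. p \<in> U \<and> smooth_on U g \<and> (\<forall>x\<in>T \<inter> U. f (h x) = g x)"
    using U(1) im by (intro exI[of _ "h -` U"] exI[of _ "\<lambda>x. f' (h x)"]) (auto intro!: U(4))
qed

lemma smooth_along_linear:
  assumes L: "bounded_linear L" and f: "smooth_along S f"
  shows "smooth_along S (\<lambda>x. L (f x))"
proof (rule smooth_alongI)
  fix p assume p: "p \<in> S"
  obtain U f' where U: "p \<in> U" "open U" "smooth_on U f'" "\<And>x. x \<in> S \<Longrightarrow> x \<in> U \<Longrightarrow> f x = f' x"
    using smooth_alongE[OF f p] by blast
  have "smooth_on U (\<lambda>x. L (f' x))" by (rule smooth_on_linear[OF L U(3)])
  then show "\<exists>U g. p \<in> U \<and> smooth_on U g \<and> (\<forall>x\<in>S \<inter> U. L (f x) = g x)"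
    using U(1,4) by (intro exI[of _ U] exI[of _ "\<lambda>x. L (f' x)"]) auto
qed

lemma smooth_along_add:
  assumes f: "smooth_along S f" and h: "smooth_along S h"
  shows "smooth_along S (\<lambda>x. f x + h x)"
proof (rule smooth_alongI)
  fix p assume p: "p \<in> S"
  obtain U f' where U: "p \<in> U" "open U" "smooth_on U f'" "\<And>x. x \<in> S \<Longrightarrow> x \<in> U \<Longrightarrow> f x = f' x"
    using smooth_alongE[OF f p] by blast
  obtain V h' where V: "p \<in> V" "open V" "smooth_on V h'" "\<And>x. x \<in> S \<Longrightarrow> x \<in> V \<Longrightarrow> h x = h' x"
    using smooth_alongE[OF h p] by blast
  have "smooth_on (U \<inter> V) (\<lambda>x. f' x + h' x)"
    using U V by (intro smooth_on_add smooth_on_subset[OF U(3)] smooth_on_subset[OF V(3)]) auto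
  then show "\<exists>U g. p \<in> U \<and> smooth_on U g \<and> (\<forall>x\<in>S \<inter> U. f x + h x = g x)"
    using U(1,4) V(1,4) by (intro exI[of _ "U \<inter> V"] exI[of _ "\<lambda>x. f' x + h' x"]) auto
qed

lemma smooth_along_smooth_on: "smooth_on UNIV h \<Longrightarrow> smooth_along S h"
  by (rule smooth_alongI) auto

lemma smooth_along_continuous:
  assumes "smooth_along S f"
  shows "continuous_on S f"
proof -
  have "continuous (at p within S) f" if p: "p \<in> S" for p
  proof -
    obtain U g where U: "p \<in> U" "open U" "smooth_on U g" "\<And>x. x \<in> S \<Longrightarrow> x \<in> U \<Longrightarrow> f x = g x"
      using smooth_alongE[OF assms p] by blast
    have "continuous_on (S \<inter> U) f"
      using continuous_on_subset[OF smooth_on_continuous[OF U(3)], of "S \<inter> U"] U(4)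
      by (subst continuous_on_cong[OF refl, of _ f g]) auto
    then have "continuous (at p within S \<inter> U) f" using p U by (auto simp: continuous_on_eq_continuous_within)
    moreover have "at p within S \<inter> U = at p within S"
      using at_within_open_subset[of p U] U(1,2) at_within_nhd[of p U "S \<inter> U" S] by auto
    ultimately show ?thesis by simp
  qed
  then show ?thesis by (simp add: continuous_on_eq_continuous_within)
qed

section \<open>Geometry of embedded hypersurfaces\<close>

lemma embedded_hypersurface_chart:
  fixes S :: "'a::euclidean_space set"
  assumes "embedded_hypersurface S" "p \<in> S"
  obtains U V \<Phi> \<Psi> and e :: 'a where "e \<in> Basis" "p \<in> U" "smooth_on U \<Phi>" "smooth_on V \<Psi>"
    "\<And>x. x \<in> U \<Longrightarrow> \<Phi> x \<in> V" "\<And>y. y \<in> V \<Longrightarrow> \<Psi> y \<in> U"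
    "\<And>x. x \<in> U \<Longrightarrow> \<Psi> (\<Phi> x) = x" "\<And>y. y \<in> V \<Longrightarrow> \<Phi> (\<Psi> y) = y"
    "\<And>x. x \<in> U \<Longrightarrow> x \<in> S \<longleftrightarrow> \<Phi> x \<bullet> e = 0"
proof -
  obtain U V \<Phi> \<Psi> and e :: 'a where e: "e \<in> Basis" "p \<in> U" "smooth_on U \<Phi>" "smooth_on V \<Psi>"
    and hom: "homeomorphism U V \<Phi> \<Psi>" and im: "\<Phi> ` (S \<inter> U) = {y \<in> V. y \<bullet> e = 0}"
    using assms unfolding embedded_hypersurface_def by blast
  have 1: "\<Phi> x \<in> V" "\<Psi> (\<Phi> x) = x" if "x \<in> U" for x using hom that by (auto simp: homeomorphism_def)
  have 2: "\<Psi> y \<in> U" "\<Phi> (\<Psi> y) = y" if "y \<in> V" for y using hom that by (auto simp: homeomorphism_def)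
  have 3: "x \<in> S \<longleftrightarrow> \<Phi> x \<bullet> e = 0" if x: "x \<in> U" for x
  proof
    assume "x \<in> S"
    then have "\<Phi> x \<in> \<Phi> ` (S \<inter> U)" using x by auto
    then show "\<Phi> x \<bullet> e = 0" unfolding im by simp
  next
    assume "\<Phi> x \<bullet> e = 0"
    then have "\<Phi> x \<in> \<Phi> ` (S \<inter> U)" unfolding im using 1[OF x] by simp
    then obtain x' where "\<Phi> x = \<Phi> x'" "x' \<in> S" "x' \<in> U" by auto
    then show "x \<in> S" using 1[OF x] 1[of x'] by metis
  qed
  show thesis using that[OF e 1(1) 2(1) 1(2) 2(2) 3] .
qed

lemma inverse_derivative:
  assumes "smooth_on U \<Phi>" "smooth_on V \<Psi>" "x \<in> U" "\<Phi> x \<in> V" "\<And>x. x \<in> U \<Longrightarrow> \<Psi> (\<Phi> x) = x"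
  shows "frechet_derivative \<Psi> (at (\<Phi> x)) (frechet_derivative \<Phi> (at x) v) = v"
proof -
  have "((\<lambda>x. \<Psi> (\<Phi> x)) has_derivative
      (\<lambda>v. frechet_derivative \<Psi> (at (\<Phi> x)) (frechet_derivative \<Phi> (at x) v))) (at x)"
    by (rule has_derivative_compose[OF smooth_on_has_derivative[OF assms(1,3)]
        smooth_on_has_derivative[OF assms(2,4)]])
  moreover have "((\<lambda>x. \<Psi> (\<Phi> x)) has_derivative (\<lambda>v. v)) (at x)"
    by (rule has_derivative_transform_within_open[OF has_derivative_ident smooth_on_open[OF assms(1)] assms(3)])
      (simp add: assms(5))
  ultimately show ?thesis using has_derivative_unique by (metis (no_types, lifting))
qed

lemma smooth_on_affine_curve: "smooth_on UNIV (\<lambda>t::real. a + t *\<^sub>R w)"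
  by (intro smooth_on_add smooth_on_const smooth_on_linear[OF bounded_linear_scaleR_left] smooth_on_id) auto

text \<open>Tangent vectors are velocities of curves in \<open>S\<close>. Differentiating
  \<open>\<Phi> (\<gamma> t) \<bullet> e = 0\<close> gives one inclusion. For the other,
  \<open>\<Psi>\<close> carries the segment through \<open>\<Phi> x\<close> in direction
  \<open>w\<close> to a curve in \<open>S\<close> with velocity \<open>v\<close>.\<close>

lemma tangent_space_chart:
  fixes S :: "'a::euclidean_space set" and \<Phi> \<Psi> :: "'a \<Rightarrow> 'a"
  assumes U: "smooth_on U \<Phi>" and V: "smooth_on V \<Psi>"
    and UV: "\<And>x. x \<in> U \<Longrightarrow> \<Phi> x \<in> V" "\<And>y. y \<in> V \<Longrightarrow> \<Psi> y \<in> U"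
      "\<And>x. x \<in> U \<Longrightarrow> \<Psi> (\<Phi> x) = x" "\<And>y. y \<in> V \<Longrightarrow> \<Phi> (\<Psi> y) = y"
    and SU: "\<And>x. x \<in> U \<Longrightarrow> x \<in> S \<longleftrightarrow> \<Phi> x \<bullet> e = 0"
    and x: "x \<in> S" "x \<in> U"
  shows "tangent_space S x = {v. frechet_derivative \<Phi> (at x) v \<bullet> e = 0}"
proof (intro equalityI subsetI)
  fix v assume "v \<in> tangent_space S x"
  then obtain \<gamma> \<epsilon> where \<gamma>: "\<epsilon> > 0" "smooth_on {-\<epsilon><..<\<epsilon>} \<gamma>" "\<gamma> ` {-\<epsilon><..<\<epsilon>} \<subseteq> S" "\<gamma> 0 = x"
    "(\<gamma> has_vector_derivative v) (at (0::real))"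
    unfolding tangent_space_def by blast
  have op: "open ({-\<epsilon><..<\<epsilon>} \<inter> \<gamma> -` U)"
    using smooth_on_continuous[OF \<gamma>(2)] smooth_on_open[OF U]
    by (intro continuous_open_preimage) auto
  have mem: "0 \<in> {-\<epsilon><..<\<epsilon>} \<inter> \<gamma> -` U" using \<gamma> x by auto
  have zero: "\<Phi> (\<gamma> t) \<bullet> e = 0" if "t \<in> {-\<epsilon><..<\<epsilon>} \<inter> \<gamma> -` U" for t
    using that subsetD[OF \<gamma>(3), of "\<gamma> t"] SU[of "\<gamma> t"] by auto
  have d: "((\<lambda>t. \<Phi> (\<gamma> t) \<bullet> e) has_derivative (\<lambda>t. frechet_derivative \<Phi> (at x) (t *\<^sub>R v) \<bullet> e)) (at 0)"
    using \<gamma>(4,5) smooth_on_has_derivative[OF U x(2)]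
    by (intro has_derivative_inner_left has_derivative_compose[of \<gamma> _ _ _ \<Phi>])
      (auto simp: has_vector_derivative_def)
  have "((\<lambda>t. 0) has_derivative (\<lambda>t. frechet_derivative \<Phi> (at x) (t *\<^sub>R v) \<bullet> e)) (at 0)"
    by (rule has_derivative_transform_within_open[OF d op mem zero])
  then have "(\<lambda>t. frechet_derivative \<Phi> (at x) (t *\<^sub>R v) \<bullet> e) = (\<lambda>t. 0)"
    by (rule has_derivative_unique[OF _ has_derivative_const])
  from fun_cong[OF this, of 1] show "v \<in> {v. frechet_derivative \<Phi> (at x) v \<bullet> e = 0}" by simp
next
  fix v assume v: "v \<in> {v. frechet_derivative \<Phi> (at x) v \<bullet> e = 0}"
  define w where "w = frechet_derivative \<Phi> (at x) v"
  have "open V" using V smooth_on_open by blast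
  then obtain r where r: "r > 0" "ball (\<Phi> x) r \<subseteq> V"
    using UV(1)[OF x(2)] open_contains_ball by blast
  \<comment> \<open>Keeps \<open>\<Phi> x + t *\<^sub>R w\<close> within distance \<open>r\<close>
    of \<open>\<Phi> x\<close>; the \<open>+ 1\<close> covers \<open>w = 0\<close>.\<close>
  define \<epsilon> where "\<epsilon> = r / (norm w + 1)"
  have \<epsilon>: "\<epsilon> > 0" using r by (simp add: \<epsilon>_def add_nonneg_pos)
  have inV: "\<Phi> x + t *\<^sub>R w \<in> V" if "t \<in> {-\<epsilon><..<\<epsilon>}" for t
  proof -
    have "\<bar>t\<bar> * norm w \<le> \<bar>t\<bar> * (norm w + 1)" by (simp add: mult_left_mono)
    also have "\<dots> < \<epsilon> * (norm w + 1)" using that by (intro mult_strict_right_mono) (auto simp: add_nonneg_pos)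
    also have "\<dots> = r" unfolding \<epsilon>_def using norm_ge_zero[of w] by (simp add: add_nonneg_eq_0_iff)
    finally have "\<Phi> x + t *\<^sub>R w \<in> ball (\<Phi> x) r" by (simp add: dist_norm)
    then show ?thesis using r by auto
  qed
  define \<gamma> where "\<gamma> = (\<lambda>t. \<Psi> (\<Phi> x + t *\<^sub>R w))"
  have "smooth_on {-\<epsilon><..<\<epsilon>} \<gamma>" unfolding \<gamma>_def
    using inV by (intro smooth_on_compose[OF _ V] smooth_on_subset[OF smooth_on_affine_curve]) auto
  moreover have "\<gamma> ` {-\<epsilon><..<\<epsilon>} \<subseteq> S"
  proof
    fix y assume "y \<in> \<gamma> ` {-\<epsilon><..<\<epsilon>}"
    then obtain t where t: "t \<in> {-\<epsilon><..<\<epsilon>}" "y = \<gamma> t" by auto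
    have "\<Phi> (\<gamma> t) \<bullet> e = 0"
      using UV(4)[OF inV[OF t(1)]] SU[OF x(2)] x(1) v by (simp add: \<gamma>_def w_def inner_add_left)
    then show "y \<in> S" using SU[of "\<gamma> t"] UV(2)[OF inV[OF t(1)]] t(2) by (simp add: \<gamma>_def)
  qed
  moreover have "\<gamma> 0 = x" using UV(3)[OF x(2)] by (simp add: \<gamma>_def)
  moreover have "(\<gamma> has_vector_derivative v) (at 0)"
  proof -
    have "((\<lambda>t. \<Phi> x + t *\<^sub>R w) has_derivative (\<lambda>t. t *\<^sub>R w)) (at 0)"
      by (auto intro!: derivative_eq_intros)
    moreover have "(\<Psi> has_derivative frechet_derivative \<Psi> (at (\<Phi> x))) (at (\<Phi> x + 0 *\<^sub>R w))"
      using smooth_on_has_derivative[OF V UV(1)[OF x(2)]] by simp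
    ultimately have "(\<gamma> has_derivative (\<lambda>t. frechet_derivative \<Psi> (at (\<Phi> x)) (t *\<^sub>R w))) (at 0)"
      unfolding \<gamma>_def by (rule has_derivative_compose)
    moreover have "frechet_derivative \<Psi> (at (\<Phi> x)) (t *\<^sub>R w) = t *\<^sub>R v" for t
      using inverse_derivative[OF U V x(2) UV(1)[OF x(2)] UV(3), of v]
        has_derivative_linear[OF smooth_on_has_derivative[OF V UV(1)[OF x(2)]]]
      by (simp add: w_def linear_scale)
    ultimately show ?thesis by (simp add: has_vector_derivative_def)
  qed
  ultimately show "v \<in> tangent_space S x" unfolding tangent_space_def using \<epsilon> by blast
qed

text \<open>The tangent space is the orthogonal complement of a single vector \<open>a\<close>, the
  transposed derivative of the chart applied to \<open>e\<close>. It is nonzero because the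
  derivative of \<open>\<Phi>\<close> reaches \<open>e\<close>. A vector orthogonal to this
  hyperplane is a multiple of \<open>a\<close>, so a unit normal determines the whole tangent space
  and not just contains it in its complement.\<close>

lemma tangent_space_unit_normal:
  fixes S :: "'a::euclidean_space set"
  assumes S: "embedded_hypersurface S" "x \<in> S"
    and n: "norm n = 1" "\<And>v. v \<in> tangent_space S x \<Longrightarrow> n \<bullet> v = 0"
  shows "tangent_space S x = {v. n \<bullet> v = 0}"
proof -
  obtain U V \<Phi> \<Psi> and e :: 'a where ch: "e \<in> Basis" "x \<in> U" "smooth_on U \<Phi>" "smooth_on V \<Psi>"
    "\<And>x. x \<in> U \<Longrightarrow> \<Phi> x \<in> V" "\<And>y. y \<in> V \<Longrightarrow> \<Psi> y \<in> U"
    "\<And>x. x \<in> U \<Longrightarrow> \<Psi> (\<Phi> x) = x" "\<And>y. y \<in> V \<Longrightarrow> \<Phi> (\<Psi> y) = y"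
    "\<And>x. x \<in> U \<Longrightarrow> x \<in> S \<longleftrightarrow> \<Phi> x \<bullet> e = 0"
    by (rule embedded_hypersurface_chart[OF S]) (rule that; (assumption | simp))
  define a where "a = (\<Sum>b\<in>Basis. (frechet_derivative \<Phi> (at x) b \<bullet> e) *\<^sub>R b)"
  have a: "frechet_derivative \<Phi> (at x) v \<bullet> e = v \<bullet> a" for v
    unfolding has_derivative_basis_sum[OF smooth_on_has_derivative[OF ch(3,2)], of v] a_def
    by (simp add: inner_sum_left inner_sum_right mult.commute)
  have T: "tangent_space S x = {v. v \<bullet> a = 0}"
    using tangent_space_chart[OF ch(3-9) S(2) ch(2)] by (simp add: a)
  have "frechet_derivative \<Psi> (at (\<Phi> x)) e \<bullet> a = 1"
  proof -
    have "frechet_derivative \<Phi> (at (\<Psi> (\<Phi> x))) (frechet_derivative \<Psi> (at (\<Phi> x)) e) = e"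
      using ch by (intro inverse_derivative[OF ch(4,3)]) auto
    then show ?thesis unfolding a[symmetric] using ch by simp
  qed
  then have "a \<noteq> 0" by auto
  then have aa: "a \<bullet> a > 0" by simp
  define k where "k = (n \<bullet> a) / (a \<bullet> a)"
  have k: "(n - k *\<^sub>R a) \<bullet> a = 0" using aa by (simp add: k_def inner_diff_left)
  then have "n - k *\<^sub>R a \<in> tangent_space S x" by (simp add: T)
  then have "n \<bullet> (n - k *\<^sub>R a) = 0" by (rule n(2))
  then have "(n - k *\<^sub>R a) \<bullet> (n - k *\<^sub>R a) = 0"
    using k by (simp add: inner_diff_left inner_diff_right inner_commute)
  then have nk: "n = k *\<^sub>R a" by simp
  then have "k \<noteq> 0" using n(1) by auto
  then show ?thesis unfolding T nk by (auto simp: inner_commute)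
qed

text \<open>Composition with a curve in \<open>S\<close> of velocity \<open>v\<close> has a unique
  derivative, and this fixes the value at \<open>v\<close> of whichever derivative within
  \<open>S\<close> has been chosen. Any local extension of \<open>f\<close> may thus be used for
  computation.\<close>

lemma deriv_along_eq:
  assumes "(g has_derivative g') (at x)" "open U" "x \<in> U" "x \<in> S"
    and fg: "\<And>y. y \<in> S \<Longrightarrow> y \<in> U \<Longrightarrow> f y = g y"
    and v: "v \<in> tangent_space S x"
  shows "deriv_along S f x v = g' v"
proof -
  obtain \<gamma> \<epsilon> where \<gamma>: "\<epsilon> > 0" "smooth_on {-\<epsilon><..<\<epsilon>} \<gamma>" "\<gamma> ` {-\<epsilon><..<\<epsilon>} \<subseteq> S" "\<gamma> 0 = x"
    "(\<gamma> has_vector_derivative v) (at (0::real))"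
    using v unfolding tangent_space_def by blast
  obtain r where r: "r > 0" "ball x r \<subseteq> U" using assms(2,3) open_contains_ball by blast
  have f': "(f has_derivative g') (at x within S)"
  proof (rule has_derivative_transform_within[OF has_derivative_at_withinI[OF assms(1)] r(1) \<open>x \<in> S\<close>])
    fix y assume y: "y \<in> S" "dist y x < r"
    then have "y \<in> U" using r(2) by (auto simp: dist_commute)
    then show "g y = f y" using fg y by simp
  qed
  have comp: "((\<lambda>t. f (\<gamma> t)) has_derivative (\<lambda>t. D (t *\<^sub>R v))) (at 0)"
    if D: "(f has_derivative D) (at x within S)" for D
  proof -
    have "((\<lambda>t. f (\<gamma> t)) has_derivative (\<lambda>t. D (t *\<^sub>R v))) (at 0 within {-\<epsilon><..<\<epsilon>})"
    proof (rule has_derivative_in_compose[of \<gamma>])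
      show "(\<gamma> has_derivative (\<lambda>t. t *\<^sub>R v)) (at 0 within {-\<epsilon><..<\<epsilon>})"
        using \<gamma>(5) unfolding has_vector_derivative_def by (rule has_derivative_at_withinI)
      show "(f has_derivative D) (at (\<gamma> 0) within \<gamma> ` {-\<epsilon><..<\<epsilon>})"
        unfolding \<gamma>(4) by (rule has_derivative_subset[OF D \<gamma>(3)])
    qed
    then show ?thesis using at_within_open[of 0 "{-\<epsilon><..<\<epsilon>}"] \<gamma>(1) by simp
  qed
  have "(f has_derivative frechet_derivative f (at x within S)) (at x within S)"
    using f' by (intro frechet_derivative_works[THEN iffD1] differentiableI)
  then have "(\<lambda>t. frechet_derivative f (at x within S) (t *\<^sub>R v)) = (\<lambda>t. g' (t *\<^sub>R v))"
    by (rule has_derivative_unique[OF comp comp[OF f']])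
  from fun_cong[OF this, of 1] show ?thesis by (simp add: deriv_along_def)
qed

section \<open>Traces in orthonormal bases\<close>

definition orthonormal :: "'a::euclidean_space set \<Rightarrow> bool" where
  "orthonormal B \<longleftrightarrow> pairwise orthogonal B \<and> (\<forall>b\<in>B. norm b = 1)"

lemma orthonormal_finite: "orthonormal B \<Longrightarrow> finite B"
  unfolding orthonormal_def
  by (rule independent_imp_finite[OF pairwise_orthogonal_independent]) force+

lemma orthonormal_inner: "orthonormal B \<Longrightarrow> b \<in> B \<Longrightarrow> c \<in> B \<Longrightarrow> b \<bullet> c = (if b = c then 1 else 0)"
  unfolding orthonormal_def pairwise_def orthogonal_def by (simp add: norm_eq_1)

lemma orthonormal_expand:
  assumes "orthonormal B" "x \<in> span B"
  shows "x = (\<Sum>b\<in>B. (x \<bullet> b) *\<^sub>R b)"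
  using orthonormal_basis_expand[of B x] assms orthonormal_finite[OF assms(1)]
  by (simp add: orthonormal_def)

text \<open>\<open>tangent_onb\<close> is an arbitrary choice at each point. Expanding one basis in
  the other shows that curvature quantities defined through it may be computed in any orthonormal
  basis of the tangent space.\<close>

lemma orthonormal_trace_eq:
  fixes h :: "'a::euclidean_space \<Rightarrow> 'a \<Rightarrow> real"
  assumes B: "orthonormal B" and C: "orthonormal C" and sp: "span B = span C"
    and lin: "\<And>x. linear (h x)" "\<And>y. linear (\<lambda>x. h x y)"
  shows "(\<Sum>b\<in>B. h b b) = (\<Sum>c\<in>C. h c c)"
proof -
  have expand: "h b b = (\<Sum>c\<in>C. \<Sum>d\<in>C. (b \<bullet> c) * (b \<bullet> d) * h c d)" if b: "b \<in> B" for b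
  proof -
    have bC: "b = (\<Sum>c\<in>C. (b \<bullet> c) *\<^sub>R c)"
      using orthonormal_expand[OF C] b sp span_base by blast
    have 1: "h x b = (\<Sum>d\<in>C. (b \<bullet> d) * h x d)" for x
      by (subst bC) (simp add: linear_sum[OF lin(1)] linear_scale[OF lin(1)])
    have 2: "h b y = (\<Sum>c\<in>C. (b \<bullet> c) * h c y)" for y
      by (subst bC) (simp add: linear_sum[OF lin(2)] linear_scale[OF lin(2)])
    show ?thesis by (subst 2, subst 1) (simp add: sum_distrib_left mult.assoc)
  qed
  have delta: "(\<Sum>b\<in>B. (b \<bullet> c) * (b \<bullet> d)) = (if c = d then 1 else 0)" if cd: "c \<in> C" "d \<in> C" for c d
  proof -
    have "c = (\<Sum>b\<in>B. (c \<bullet> b) *\<^sub>R b)"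
      using orthonormal_expand[OF B] cd sp span_base by blast
    then have "c \<bullet> d = (\<Sum>b\<in>B. (c \<bullet> b) *\<^sub>R b) \<bullet> d" by simp
    also have "\<dots> = (\<Sum>b\<in>B. (b \<bullet> c) * (b \<bullet> d))" by (simp add: inner_sum_left inner_commute[of c])
    finally show ?thesis using orthonormal_inner[OF C cd] by simp
  qed
  have "(\<Sum>b\<in>B. h b b) = (\<Sum>b\<in>B. \<Sum>c\<in>C. \<Sum>d\<in>C. (b \<bullet> c) * (b \<bullet> d) * h c d)"
    by (intro sum.cong expand refl)
  also have "\<dots> = (\<Sum>c\<in>C. \<Sum>b\<in>B. \<Sum>d\<in>C. (b \<bullet> c) * (b \<bullet> d) * h c d)" by (rule sum.swap)
  also have "\<dots> = (\<Sum>c\<in>C. \<Sum>d\<in>C. \<Sum>b\<in>B. (b \<bullet> c) * (b \<bullet> d) * h c d)"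
    by (intro sum.cong refl sum.swap)
  also have "\<dots> = (\<Sum>c\<in>C. \<Sum>d\<in>C. (if c = d then 1 else 0) * h c d)"
    by (intro sum.cong refl) (simp add: sum_distrib_right[symmetric] delta)
  also have "\<dots> = (\<Sum>c\<in>C. h c c)"
  proof (intro sum.cong refl)
    fix c assume c: "c \<in> C"
    have "(\<Sum>d\<in>C. (if c = d then 1 else 0) * h c d) = (\<Sum>d\<in>C. if c = d then h c d else 0)"
      by (intro sum.cong) auto
    then show "(\<Sum>d\<in>C. (if c = d then 1 else 0) * h c d) = h c c"
      using orthonormal_finite[OF C] c by simp
  qed
  finally show ?thesis .
qed

text \<open>With one argument fixed, the sum of squares is the trace of a bilinear form in the
  other, so the basis can be changed in one slot at a time.\<close>

lemma orthonormal_sum_squares_eq: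
  fixes h :: "'a::euclidean_space \<Rightarrow> 'a \<Rightarrow> real"
  assumes B: "orthonormal B" and C: "orthonormal C" and sp: "span B = span C"
    and lin: "\<And>x. linear (h x)" "\<And>y. linear (\<lambda>x. h x y)"
  shows "(\<Sum>b\<in>B. \<Sum>c\<in>B. (h b c)\<^sup>2) = (\<Sum>b\<in>C. \<Sum>c\<in>C. (h b c)\<^sup>2)"
proof -
  have l: "linear (\<lambda>x. h x y * k)" "linear (\<lambda>y. h x y * k)" "linear (\<lambda>x. k * h x y)" "linear (\<lambda>y. k * h x y)" for x y k
    using linear_compose_scale_right[OF lin(1), of k] linear_compose_scale_right[OF lin(2), of k]
    by (simp_all add: mult.commute)
  have 1: "(\<Sum>c\<in>B. (h b c)\<^sup>2) = (\<Sum>c\<in>C. (h b c)\<^sup>2)" for b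
    using orthonormal_trace_eq[OF B C sp, of "\<lambda>x y. h b x * h b y"] l by (simp add: power2_eq_square)
  have 2: "(\<Sum>b\<in>B. (h b c)\<^sup>2) = (\<Sum>b\<in>C. (h b c)\<^sup>2)" for c
    using orthonormal_trace_eq[OF B C sp, of "\<lambda>x y. h x c * h y c"] l by (simp add: power2_eq_square)
  have "(\<Sum>b\<in>B. \<Sum>c\<in>B. (h b c)\<^sup>2) = (\<Sum>b\<in>B. \<Sum>c\<in>C. (h b c)\<^sup>2)" by (simp add: 1)
  also have "\<dots> = (\<Sum>c\<in>C. \<Sum>b\<in>B. (h b c)\<^sup>2)" by (rule sum.swap)
  also have "\<dots> = (\<Sum>c\<in>C. \<Sum>b\<in>C. (h b c)\<^sup>2)" by (simp add: 2)
  also have "\<dots> = (\<Sum>b\<in>C. \<Sum>c\<in>C. (h b c)\<^sup>2)" by (rule sum.swap)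
  finally show ?thesis .
qed

lemma orthonormal_Basis: "orthonormal Basis"
  by (auto simp: orthonormal_def pairwise_def orthogonal_def inner_Basis)

lemma tangent_onb_spec:
  assumes "subspace (tangent_space S x)"
  shows "orthonormal (tangent_onb S x) \<and> span (tangent_onb S x) = tangent_space S x"
proof -
  obtain B where "pairwise orthogonal B" "\<And>x. x \<in> B \<Longrightarrow> norm x = 1" "span B = tangent_space S x"
    using orthonormal_basis_subspace[OF assms] by metis
  then show ?thesis
    using someI[of "\<lambda>B. pairwise orthogonal B \<and> (\<forall>b\<in>B. norm b = 1) \<and> span B = tangent_space S x" B]
    unfolding tangent_onb_def orthonormal_def by blast
qed

section \<open>Local normals, tangential gradients and curvature\<close>

lemma unit_normals_parallel:
  fixes m n :: "'a::euclidean_space"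
  assumes "norm m = 1" "norm n = 1" "\<And>v. n \<bullet> v = 0 \<Longrightarrow> m \<bullet> v = 0"
  shows "m = (m \<bullet> n) *\<^sub>R n"
proof -
  have nn: "n \<bullet> n = 1" using assms by (simp add: norm_eq_1)
  then have "n \<bullet> (m - (m \<bullet> n) *\<^sub>R n) = 0" by (simp add: inner_diff_right inner_commute)
  then have "(m - (m \<bullet> n) *\<^sub>R n) \<bullet> (m - (m \<bullet> n) *\<^sub>R n) = 0"
    using assms(3) by (simp add: inner_diff_left)
  then show ?thesis by simp
qed

text \<open>Existence of local unit normals is put into the locale instead of being derived from the
  charts, since a self-shrinker comes with them. The cylinder becomes a second instance, so
  everything proved here applies to both.\<close>

locale hypersurface =
  fixes S :: "'a::euclidean_space set"
  assumes embedded: "embedded_hypersurface S"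
    and normal: "\<And>p. p \<in> S \<Longrightarrow> \<exists>\<nu>. unit_normal_near S p \<nu>"
begin

lemma normal_extension:
  assumes p: "p \<in> S" and \<nu>: "unit_normal_near S p \<nu>"
  obtains U n where "open U" "p \<in> U" "smooth_on U n" "\<And>x. x \<in> S \<Longrightarrow> x \<in> U \<Longrightarrow> \<nu> x = n x"
    "\<And>x. x \<in> S \<Longrightarrow> x \<in> U \<Longrightarrow> norm (n x) = 1"
    "\<And>x. x \<in> S \<Longrightarrow> x \<in> U \<Longrightarrow> tangent_space S x = {v. n x \<bullet> v = 0}"
proof -
  obtain U where U: "open U" "p \<in> U" "smooth_along (S \<inter> U) \<nu>"
    "\<And>x. x \<in> S \<Longrightarrow> x \<in> U \<Longrightarrow> norm (\<nu> x) = 1"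
    "\<And>x v. x \<in> S \<Longrightarrow> x \<in> U \<Longrightarrow> v \<in> tangent_space S x \<Longrightarrow> \<nu> x \<bullet> v = 0"
    using \<nu> unfolding unit_normal_near_def by blast
  obtain V n where V: "p \<in> V" "open V" "smooth_on V n"
    "\<And>x. x \<in> S \<inter> U \<Longrightarrow> x \<in> V \<Longrightarrow> \<nu> x = n x"
    using smooth_alongE[OF U(3), of p] p U(2) by blast
  show thesis
  proof (rule that[of "U \<inter> V" n])
    show "smooth_on (U \<inter> V) n" using V U by (intro smooth_on_subset[OF V(3)]) auto
    fix x assume x: "x \<in> S" "x \<in> U \<inter> V"
    then have eq: "\<nu> x = n x" using V(4) by simp
    then show "\<nu> x = n x" "norm (n x) = 1" using U(4)[of x] x by simp_all
    then show "tangent_space S x = {v. n x \<bullet> v = 0}"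
      using U(5)[of x] x eq by (intro tangent_space_unit_normal embedded) auto
  qed (use U V in auto)
qed

lemma subspace_tangent_space: "x \<in> S \<Longrightarrow> subspace (tangent_space S x)"
proof -
  assume x: "x \<in> S"
  then obtain \<nu> where "unit_normal_near S x \<nu>" using normal by blast
  then obtain n where "tangent_space S x = {v. n \<bullet> v = 0}"
    using normal_extension[OF x] x by metis
  then show ?thesis by (simp add: subspace_hyperplane)
qed

lemmas tangent_onb = tangent_onb_spec[OF subspace_tangent_space]

text \<open>On \<open>S\<close> near \<open>p\<close> the inner product of the two normals is
  continuous with values \<open>1\<close> and \<open>-1\<close> only, hence locally constant. This
  is what makes the squared norm of the second fundamental form independent of the normal picked by
  \<open>SOME\<close>.\<close>

lemma unit_normal_sign:
  assumes p: "p \<in> S" and \<nu>: "unit_normal_near S p \<nu>" "unit_normal_near S p \<mu>"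
  obtains U s where "open U" "p \<in> U" "s = 1 \<or> s = (-1::real)"
    "\<And>x. x \<in> S \<Longrightarrow> x \<in> U \<Longrightarrow> \<nu> x = s *\<^sub>R \<mu> x"
proof -
  obtain U n where U: "open U" "p \<in> U" "smooth_on U n" "\<And>x. x \<in> S \<Longrightarrow> x \<in> U \<Longrightarrow> \<nu> x = n x"
    "\<And>x. x \<in> S \<Longrightarrow> x \<in> U \<Longrightarrow> norm (n x) = 1"
    "\<And>x. x \<in> S \<Longrightarrow> x \<in> U \<Longrightarrow> tangent_space S x = {v. n x \<bullet> v = 0}"
    by (rule normal_extension[OF p \<nu>(1)]) (rule that; (assumption | simp))
  obtain V m where V: "open V" "p \<in> V" "smooth_on V m" "\<And>x. x \<in> S \<Longrightarrow> x \<in> V \<Longrightarrow> \<mu> x = m x"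
    "\<And>x. x \<in> S \<Longrightarrow> x \<in> V \<Longrightarrow> norm (m x) = 1"
    "\<And>x. x \<in> S \<Longrightarrow> x \<in> V \<Longrightarrow> tangent_space S x = {v. m x \<bullet> v = 0}"
    by (rule normal_extension[OF p \<nu>(2)]) (rule that; (assumption | simp))
  have par: "n x = (n x \<bullet> m x) *\<^sub>R m x" if "x \<in> S" "x \<in> U" "x \<in> V" for x
    using U(5,6)[OF that(1,2)] V(5,6)[OF that(1,3)] by (intro unit_normals_parallel) auto
  have pm1: "n x \<bullet> m x = 1 \<or> n x \<bullet> m x = - 1" if "x \<in> S" "x \<in> U" "x \<in> V" for x
  proof -
    have "\<bar>n x \<bullet> m x\<bar> * norm (m x) = norm (n x)" using par[OF that] by (metis norm_scaleR)
    then show ?thesis using U(5)[OF that(1,2)] V(5)[OF that(1,3)] by (simp add: abs_if split: if_splits)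
  qed
  have "continuous_on (U \<inter> V) (\<lambda>x. n x \<bullet> m x)"
    using smooth_on_continuous[OF U(3)] smooth_on_continuous[OF V(3)]
    by (intro continuous_intros) (auto intro: continuous_on_subset)
  moreover have "open (U \<inter> V)" "p \<in> U \<inter> V" using U V by auto
  ultimately obtain r where r: "r > 0"
    and close: "\<And>x. x \<in> U \<inter> V \<Longrightarrow> dist x p < r \<Longrightarrow> dist (n x \<bullet> m x) (n p \<bullet> m p) < 1"
    unfolding continuous_on_iff by (metis zero_less_one)
  show thesis
  proof (rule that[of "U \<inter> V \<inter> ball p r" "n p \<bullet> m p"])
    show "n p \<bullet> m p = 1 \<or> n p \<bullet> m p = - 1" using pm1 p U V by simp
    fix x assume x: "x \<in> S" "x \<in> U \<inter> V \<inter> ball p r"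
    then have "dist (n x \<bullet> m x) (n p \<bullet> m p) < 1" using close[of x] by (auto simp: dist_commute)
    then have "n x \<bullet> m x = n p \<bullet> m p" using pm1[of x] pm1[of p] x p U V by (auto simp: dist_real_def)
    then show "\<nu> x = (n p \<bullet> m p) *\<^sub>R \<mu> x" using par[of x] x U(4)[of x] V(4)[of x] by auto
  qed (use U V r in auto)
qed

lemma tangential_gradient_unique:
  assumes "x \<in> S" "g \<in> tangent_space S x" "\<And>v. v \<in> tangent_space S x \<Longrightarrow> g \<bullet> v = deriv_along S f x v"
  shows "tangential_gradient S f x = g"
  unfolding tangential_gradient_def
proof (rule the_equality)
  fix h assume h: "h \<in> tangent_space S x \<and> (\<forall>v\<in>tangent_space S x. h \<bullet> v = deriv_along S f x v)"
  have d: "h - g \<in> tangent_space S x"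
    using h assms(2) subspace_tangent_space[OF assms(1)] by (auto intro: subspace_diff)
  then have "(h - g) \<bullet> (h - g) = 0" using h assms(3) by (simp add: inner_diff_left)
  then show "h = g" by simp
qed (use assms in auto)

text \<open>The Euclidean gradient of a local extension minus its normal component. As an expression
  in the extension and the normal it can be seen to vary smoothly, unlike the \<open>THE\<close> of
  the definition.\<close>

lemma tangential_gradient_formula:
  assumes x: "x \<in> S" and n: "norm n = 1" "tangent_space S x = {v. n \<bullet> v = 0}"
    and g: "(g has_derivative g') (at x)" "open U" "x \<in> U" "\<And>y. y \<in> S \<Longrightarrow> y \<in> U \<Longrightarrow> f y = g y"
  shows "tangential_gradient S f x = (\<Sum>b\<in>Basis. g' b *\<^sub>R b) - g' n *\<^sub>R n"
    and "tangential_gradient S f x \<in> tangent_space S x"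
    and "v \<in> tangent_space S x \<Longrightarrow> tangential_gradient S f x \<bullet> v = g' v"
    and "v \<in> tangent_space S x \<Longrightarrow> deriv_along S f x v = g' v"
proof -
  have d: "deriv_along S f x v = g' v" if "v \<in> tangent_space S x" for v
    using deriv_along_eq[OF g(1,2,3) x g(4) that] by simp
  have G: "(\<Sum>b\<in>Basis. g' b *\<^sub>R b) \<bullet> v = g' v" for v
    using has_derivative_basis_sum[OF g(1), of v] by (simp add: inner_sum_left inner_commute[of v] mult.commute)
  have nn: "n \<bullet> n = 1" using n by (simp add: norm_eq_1)
  have in_T: "(\<Sum>b\<in>Basis. g' b *\<^sub>R b) - g' n *\<^sub>R n \<in> tangent_space S x"
    unfolding n(2) using G[of n] nn by (simp add: inner_diff_right inner_commute)
  have inner: "((\<Sum>b\<in>Basis. g' b *\<^sub>R b) - g' n *\<^sub>R n) \<bullet> v = g' v" if "v \<in> tangent_space S x" for v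
    using that unfolding n(2) by (simp add: inner_diff_left G)
  show eq: "tangential_gradient S f x = (\<Sum>b\<in>Basis. g' b *\<^sub>R b) - g' n *\<^sub>R n"
    using in_T inner d by (intro tangential_gradient_unique x) auto
  show "tangential_gradient S f x \<in> tangent_space S x"
    and "v \<in> tangent_space S x \<Longrightarrow> tangential_gradient S f x \<bullet> v = g' v"
    and "v \<in> tangent_space S x \<Longrightarrow> deriv_along S f x v = g' v"
    using in_T inner d eq by auto
qed

lemma local_data:
  assumes x: "x \<in> S" and f: "smooth_along S f"
  obtains U n g where "open U" "x \<in> U" "smooth_on U n" "smooth_on U g"
    "\<And>y. y \<in> S \<Longrightarrow> y \<in> U \<Longrightarrow> f y = g y"
    "\<And>y. y \<in> S \<Longrightarrow> y \<in> U \<Longrightarrow> norm (n y) = 1"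
    "\<And>y. y \<in> S \<Longrightarrow> y \<in> U \<Longrightarrow> tangent_space S y = {v. n y \<bullet> v = 0}"
proof -
  obtain \<nu> where "unit_normal_near S x \<nu>" using normal x by blast
  then obtain U n where U: "open U" "x \<in> U" "smooth_on U n"
    "\<And>y. y \<in> S \<Longrightarrow> y \<in> U \<Longrightarrow> \<nu> y = n y"
    "\<And>y. y \<in> S \<Longrightarrow> y \<in> U \<Longrightarrow> norm (n y) = 1"
    "\<And>y. y \<in> S \<Longrightarrow> y \<in> U \<Longrightarrow> tangent_space S y = {v. n y \<bullet> v = 0}"
    by (rule normal_extension[OF x]) (rule that; (assumption | simp))
  note U = U(1-3,5,6)
  obtain V g where V: "x \<in> V" "open V" "smooth_on V g" "\<And>y. y \<in> S \<Longrightarrow> y \<in> V \<Longrightarrow> f y = g y"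
    using smooth_alongE[OF f x] by blast
  show thesis
    by (rule that[of "U \<inter> V" n g])
      (use U V in \<open>auto intro: smooth_on_subset[OF U(3)] smooth_on_subset[OF V(3)]\<close>)
qed

lemma tangential_gradient_tangent:
  assumes "x \<in> S" "smooth_along S f"
  shows "tangential_gradient S f x \<in> tangent_space S x"
    and "v \<in> tangent_space S x \<Longrightarrow> tangential_gradient S f x \<bullet> v = deriv_along S f x v"
proof -
  obtain U n g where U: "open U" "x \<in> U" "smooth_on U n" "smooth_on U g"
    "\<And>y. y \<in> S \<Longrightarrow> y \<in> U \<Longrightarrow> f y = g y" "\<And>y. y \<in> S \<Longrightarrow> y \<in> U \<Longrightarrow> norm (n y) = 1"
    "\<And>y. y \<in> S \<Longrightarrow> y \<in> U \<Longrightarrow> tangent_space S y = {v. n y \<bullet> v = 0}"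
    by (rule local_data[OF assms]) (rule that; (assumption | simp))
  note tg = tangential_gradient_formula[OF assms(1) U(6,7)[OF assms(1) U(2)] smooth_on_has_derivative[OF U(4,2)] U(1,2,5)]
  show "tangential_gradient S f x \<in> tangent_space S x" by (rule tg(2))
  show "v \<in> tangent_space S x \<Longrightarrow> tangential_gradient S f x \<bullet> v = deriv_along S f x v"
    using tg(3,4) by simp
qed

lemma smooth_along_tangential_gradient:
  assumes f: "smooth_along S f"
  shows "smooth_along S (tangential_gradient S f)"
proof (rule smooth_alongI)
  fix p assume p: "p \<in> S"
  obtain U n g where U: "open U" "p \<in> U" "smooth_on U n" "smooth_on U g"
    "\<And>y. y \<in> S \<Longrightarrow> y \<in> U \<Longrightarrow> f y = g y" "\<And>y. y \<in> S \<Longrightarrow> y \<in> U \<Longrightarrow> norm (n y) = 1"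
    "\<And>y. y \<in> S \<Longrightarrow> y \<in> U \<Longrightarrow> tangent_space S y = {v. n y \<bullet> v = 0}"
    by (rule local_data[OF p f]) (rule that; (assumption | simp))
  define D where "D = (\<lambda>x b. frechet_derivative g (at x) b)"
  define G where "G = (\<lambda>x. (\<Sum>b\<in>Basis. D x b *\<^sub>R b) + (- (\<Sum>b\<in>Basis. (n x \<bullet> b) *\<^sub>R D x b)) *\<^sub>R n x)"
  have D: "smooth_on U (\<lambda>x. D x b)" for b
    unfolding D_def by (rule smooth_on_derivative[OF U(4)])
  have "smooth_on U G"
    unfolding G_def
    by (intro smooth_on_add smooth_on_sum U(1) finite_Basis
        smooth_on_linear[OF bounded_linear_scaleR_left] smooth_on_bilinear[OF bounded_bilinear_scaleR]
        smooth_on_linear[OF bounded_linear_minus[OF bounded_linear_ident]]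
        smooth_on_linear[OF bounded_linear_inner_left] D U(3))
  moreover have "tangential_gradient S f x = G x" if x: "x \<in> S" "x \<in> U" for x
  proof -
    note sd = smooth_on_has_derivative[OF U(4) x(2)]
    have "frechet_derivative g (at x) (n x) = (\<Sum>b\<in>Basis. (n x \<bullet> b) *\<^sub>R D x b)"
      using has_derivative_basis_sum[OF sd, of "n x"] by (simp add: D_def)
    then show ?thesis
      using tangential_gradient_formula(1)[OF x(1) U(6,7)[OF x] sd U(1) x(2) U(5)]
      by (simp add: G_def D_def)
  qed
  ultimately show "\<exists>U g. p \<in> U \<and> smooth_on U g \<and> (\<forall>x\<in>S \<inter> U. tangential_gradient S f x = g x)"
    using U(2) by (intro exI[of _ U] exI[of _ G]) auto
qed

lemma unit_normal_near_extension:
  assumes "open U" "smooth_on U n" "\<And>y. y \<in> S \<Longrightarrow> y \<in> U \<Longrightarrow> norm (n y) = 1"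
    "\<And>y. y \<in> S \<Longrightarrow> y \<in> U \<Longrightarrow> tangent_space S y = {v. n y \<bullet> v = 0}" "x \<in> U"
  shows "unit_normal_near S x n"
  unfolding unit_normal_near_def using assms
  by (intro exI[of _ U]) (auto intro!: smooth_alongI exI[of _ U] exI[of _ n])

lemma mean_curvature_onb:
  assumes x: "x \<in> S" and U: "open U" "x \<in> U" "smooth_on U n" "\<And>y. y \<in> S \<Longrightarrow> y \<in> U \<Longrightarrow> \<nu> y = n y"
    and B: "orthonormal B" "span B = tangent_space S x"
  shows "mean_curvature S \<nu> x = (\<Sum>b\<in>B. frechet_derivative n (at x) b \<bullet> b)"
proof -
  note d = smooth_on_has_derivative[OF U(3,2)]
  have l: "linear (frechet_derivative n (at x))" using d has_derivative_linear by blast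
  have "mean_curvature S \<nu> x = (\<Sum>b\<in>tangent_onb S x. frechet_derivative n (at x) b \<bullet> b)"
    unfolding mean_curvature_def second_fundamental_form_def
  proof (intro sum.cong refl)
    fix b assume "b \<in> tangent_onb S x"
    then have "b \<in> tangent_space S x" using tangent_onb[OF x] span_base by metis
    then show "deriv_along S \<nu> x b \<bullet> b = frechet_derivative n (at x) b \<bullet> b"
      using deriv_along_eq[OF d U(1,2) x U(4)] by simp
  qed
  also have "\<dots> = (\<Sum>b\<in>B. frechet_derivative n (at x) b \<bullet> b)"
    using tangent_onb[OF x] B l
    by (intro orthonormal_trace_eq) (auto intro!: linearI simp: inner_add_left inner_add_right linear_add linear_scale)
  finally show ?thesis .
qed

lemma norm_A_squared_onb:
  assumes x: "x \<in> S" and U: "open U" "x \<in> U" "smooth_on U n" "\<And>y. y \<in> S \<Longrightarrow> y \<in> U \<Longrightarrow> norm (n y) = 1"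
    "\<And>y. y \<in> S \<Longrightarrow> y \<in> U \<Longrightarrow> tangent_space S y = {v. n y \<bullet> v = 0}"
    and B: "orthonormal B" "span B = tangent_space S x"
  shows "norm_A_squared S x = (\<Sum>b\<in>B. \<Sum>c\<in>B. (frechet_derivative n (at x) b \<bullet> c)\<^sup>2)"
proof -
  note d = smooth_on_has_derivative[OF U(3,2)]
  have l: "linear (frechet_derivative n (at x))" using d has_derivative_linear by blast
  define \<nu> where "\<nu> = (SOME \<nu>. unit_normal_near S x \<nu>)"
  have \<nu>: "unit_normal_near S x \<nu>" unfolding \<nu>_def using normal[OF x] by (rule someI_ex)
  have un: "unit_normal_near S x n"
    by (rule unit_normal_near_extension[OF U(1,3) _ _ U(2)]) (use U(4,5) in auto)
  obtain V s where V: "open V" "x \<in> V" "s = 1 \<or> s = (-1::real)" "\<And>y. y \<in> S \<Longrightarrow> y \<in> V \<Longrightarrow> \<nu> y = s *\<^sub>R n y"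
    by (rule unit_normal_sign[OF x \<nu> un]) (rule that; (assumption | simp))
  have sd: "((\<lambda>y. s *\<^sub>R n y) has_derivative (\<lambda>v. s *\<^sub>R frechet_derivative n (at x) v)) (at x)"
    using d by (rule has_derivative_scaleR_right)
  have "norm_A_squared S x = (\<Sum>b\<in>tangent_onb S x. \<Sum>c\<in>tangent_onb S x. (frechet_derivative n (at x) b \<bullet> c)\<^sup>2)"
    unfolding norm_A_squared_def second_fundamental_form_def \<nu>_def[symmetric]
  proof (intro sum.cong refl)
    fix b c assume "b \<in> tangent_onb S x"
    then have "b \<in> tangent_space S x" using tangent_onb[OF x] span_base by metis
    then have "deriv_along S \<nu> x b = s *\<^sub>R frechet_derivative n (at x) b"
      using deriv_along_eq[OF sd V(1,2) x V(4)] by simp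
    then show "(deriv_along S \<nu> x b \<bullet> c)\<^sup>2 = (frechet_derivative n (at x) b \<bullet> c)\<^sup>2"
      using V(3) by auto
  qed
  also have "\<dots> = (\<Sum>b\<in>B. \<Sum>c\<in>B. (frechet_derivative n (at x) b \<bullet> c)\<^sup>2)"
    using tangent_onb[OF x] B l
    by (intro orthonormal_sum_squares_eq) (auto intro!: linearI simp: inner_add_left inner_add_right linear_add linear_scale)
  finally show ?thesis .
qed

text \<open>\<open>tangent_onb S x\<close> has no reason to vary continuously with \<open>x\<close>.
  The sum over it is therefore rewritten as a sum over the fixed \<open>Basis\<close>, whose terms
  are built from a smooth extension of the normal.\<close>

lemma smooth_along_norm_A_squared: "smooth_along S (norm_A_squared S)"
proof (rule smooth_alongI)
  fix p assume p: "p \<in> S"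
  obtain U n and g :: "'a \<Rightarrow> real" where U: "open U" "p \<in> U" "smooth_on U n" "smooth_on U g"
    "\<And>y. y \<in> S \<Longrightarrow> y \<in> U \<Longrightarrow> 0 = g y"
    "\<And>y. y \<in> S \<Longrightarrow> y \<in> U \<Longrightarrow> norm (n y) = 1"
    "\<And>y. y \<in> S \<Longrightarrow> y \<in> U \<Longrightarrow> tangent_space S y = {v. n y \<bullet> v = 0}"
    by (rule local_data[OF p smooth_along_const[of S 0]]) (rule that; (assumption | simp))
  note U = U(1-3,6,7)
  define D where "D = (\<lambda>x b. frechet_derivative n (at x) b)"
  \<comment> \<open>At points of \<open>S\<close> this is the orthogonal projection to the tangent
    space, and \<open>h\<close> is the second fundamental form extended by zero to the normal
    direction. Adjoining \<open>n x\<close> to a tangent basis then adds only zero terms and gives a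
    basis of the whole space.\<close>
  define P where "P = (\<lambda>x b. b + (- (n x \<bullet> b)) *\<^sub>R n x)"
  define h where "h = (\<lambda>x b c. (\<Sum>d\<in>Basis. (P x b \<bullet> d) *\<^sub>R D x d) \<bullet> P x c)"
  define G where "G = (\<lambda>x. \<Sum>b\<in>Basis. \<Sum>c\<in>Basis. h x b c * h x b c)"
  have D: "smooth_on U (\<lambda>x. D x b)" for b
    unfolding D_def by (rule smooth_on_derivative[OF U(3)])
  have P: "smooth_on U (\<lambda>x. P x b)" for b
    unfolding P_def
    by (intro smooth_on_add smooth_on_const U(1) smooth_on_bilinear[OF bounded_bilinear_scaleR] U(3)
        smooth_on_linear[OF bounded_linear_minus[OF bounded_linear_inner_left]])
  have h: "smooth_on U (\<lambda>x. h x b c)" for b c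
    unfolding h_def
    by (intro smooth_on_bilinear[OF bounded_bilinear_inner] smooth_on_sum U(1) finite_Basis
        smooth_on_bilinear[OF bounded_bilinear_scaleR] smooth_on_linear[OF bounded_linear_inner_left] D P)
  have "smooth_on U G"
    unfolding G_def
    by (intro smooth_on_sum U(1) finite_Basis smooth_on_bilinear[OF bounded_bilinear_mult] h)
  moreover have "norm_A_squared S x = G x" if x: "x \<in> S" "x \<in> U" for x
  proof -
    note sd = smooth_on_has_derivative[OF U(3) x(2)]
    have l: "linear (frechet_derivative n (at x))" using sd has_derivative_linear by blast
    define B where "B = tangent_onb S x"
    have B: "orthonormal B" "span B = tangent_space S x" using tangent_onb[OF x(1)] by (auto simp: B_def)
    have T: "tangent_space S x = {v. n x \<bullet> v = 0}" using U(5)[OF x] .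
    have nn: "n x \<bullet> n x = 1" using U(4)[OF x] by (simp add: norm_eq_1)
    have Bn: "n x \<bullet> b = 0" if "b \<in> B" for b using that B(2) T span_base by blast
    have nB: "n x \<notin> B" using Bn nn by force
    have PB: "P x b = b" if "b \<in> B" for b using Bn[OF that] by (simp add: P_def)
    have Pn: "P x (n x) = 0" by (simp add: P_def nn)
    have h_eq: "h x b c = frechet_derivative n (at x) (P x b) \<bullet> P x c" for b c
      using has_derivative_basis_sum[OF sd, of "P x b"] by (simp add: h_def D_def)
    have Plin: "linear (P x)"
      unfolding P_def by (auto intro!: linearI simp: inner_add_right algebra_simps)
    have on: "orthonormal (insert (n x) B)"
      using B(1) Bn U(4)[OF x] unfolding orthonormal_def
      by (auto simp: pairwise_insert orthogonal_def inner_commute)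
    have "v \<in> span (insert (n x) B)" for v
    proof -
      have "v - (n x \<bullet> v) *\<^sub>R n x \<in> span B" unfolding B(2) T by (simp add: inner_diff_right nn)
      then show ?thesis using span_breakdown_eq by blast
    qed
    then have sp: "span (insert (n x) B) = span Basis" by auto
    have "norm_A_squared S x = (\<Sum>b\<in>B. \<Sum>c\<in>B. (frechet_derivative n (at x) b \<bullet> c)\<^sup>2)"
      by (rule norm_A_squared_onb[OF x(1) U(1) x(2) U(3-5) B])
    also have "\<dots> = (\<Sum>b\<in>B. \<Sum>c\<in>B. (h x b c)\<^sup>2)"
      by (intro sum.cong refl) (simp add: h_eq PB)
    also have "\<dots> = (\<Sum>b\<in>insert (n x) B. \<Sum>c\<in>insert (n x) B. (h x b c)\<^sup>2)"
      using orthonormal_finite[OF B(1)] nB l by (simp add: h_eq Pn linear_0)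
    also have "\<dots> = (\<Sum>b\<in>Basis. \<Sum>c\<in>Basis. (h x b c)\<^sup>2)"
      using l Plin on orthonormal_Basis sp
      by (intro orthonormal_sum_squares_eq)
        (auto intro!: linearI simp: h_eq inner_add_left inner_add_right linear_add linear_scale)
    finally show ?thesis by (simp add: G_def power2_eq_square)
  qed
  ultimately show "\<exists>U g. p \<in> U \<and> smooth_on U g \<and> (\<forall>x\<in>S \<inter> U. norm_A_squared S x = g x)"
    using U(2) by (intro exI[of _ U] exI[of _ G]) auto
qed

end

lemma self_shrinker_hypersurface: "self_shrinker S \<Longrightarrow> hypersurface S"
  unfolding self_shrinker_def hypersurface_def by blast

section \<open>The cylinder over a hypersurface\<close>

lemma smooth_on_fst: "smooth_on UNIV (fst :: 'a::euclidean_space \<times> 'b::euclidean_space \<Rightarrow> 'a)"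
  and smooth_on_snd: "smooth_on UNIV (snd :: 'a::euclidean_space \<times> 'b::euclidean_space \<Rightarrow> 'b)"
  using smooth_on_linear[OF bounded_linear_fst smooth_on_id[OF open_UNIV]]
    smooth_on_linear[OF bounded_linear_snd smooth_on_id[OF open_UNIV]] by simp_all

lemma smooth_on_cylinder:
  fixes f :: "'a::euclidean_space \<Rightarrow> 'b::euclidean_space"
  assumes "smooth_on U f"
  shows "smooth_on (U \<times> (UNIV :: real set)) (\<lambda>z. f (fst z))"
  using open_Times[OF smooth_on_open[OF assms] open_UNIV]
  by (intro smooth_on_compose[OF _ assms] smooth_on_subset[OF smooth_on_fst]) auto

lemma embedded_hypersurface_cylinder:
  fixes S :: "'a::euclidean_space set"
  assumes S: "embedded_hypersurface S"
  shows "embedded_hypersurface (S \<times> (UNIV :: real set))"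
  unfolding embedded_hypersurface_def
proof
  fix p assume "p \<in> S \<times> (UNIV :: real set)"
  then have p: "fst p \<in> S" by auto
  obtain U V \<Phi> \<Psi> and e :: 'a where ch: "e \<in> Basis" "fst p \<in> U" "smooth_on U \<Phi>" "smooth_on V \<Psi>"
    "homeomorphism U V \<Phi> \<Psi>" "\<Phi> ` (S \<inter> U) = {y \<in> V. y \<bullet> e = 0}"
    using S p unfolding embedded_hypersurface_def by blast
  define \<Phi>' where "\<Phi>' = (\<lambda>z::'a \<times> real. (\<Phi> (fst z), snd z))"
  define \<Psi>' where "\<Psi>' = (\<lambda>z::'a \<times> real. (\<Psi> (fst z), snd z))"
  have open': "open (U \<times> (UNIV::real set))" "open (V \<times> (UNIV::real set))"
    by (intro open_Times smooth_on_open[OF ch(3)] smooth_on_open[OF ch(4)] open_UNIV)+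
  have sm: "smooth_on (U \<times> UNIV) \<Phi>'" "smooth_on (V \<times> UNIV) \<Psi>'"
    unfolding \<Phi>'_def \<Psi>'_def
    by (intro smooth_on_Pair smooth_on_cylinder ch smooth_on_subset[OF smooth_on_snd] open' subset_UNIV)+
  have im: "\<Phi> ` U = V" "\<Psi> ` V = U" and inv: "\<And>x. x \<in> U \<Longrightarrow> \<Psi> (\<Phi> x) = x" "\<And>y. y \<in> V \<Longrightarrow> \<Phi> (\<Psi> y) = y"
    using ch(5) by (auto simp: homeomorphism_def)
  have im1: "\<Phi>' ` (A \<times> UNIV) = (\<Phi> ` A) \<times> UNIV" for A
  proof (intro equalityI subsetI)
    fix z assume "z \<in> \<Phi> ` A \<times> (UNIV::real set)"
    then obtain x where "x \<in> A" "fst z = \<Phi> x" by auto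
    then show "z \<in> \<Phi>' ` (A \<times> UNIV)"
      by (intro image_eqI[of _ _ "(x, snd z)"]) (auto simp: \<Phi>'_def prod_eq_iff)
  qed (auto simp: \<Phi>'_def)
  have im2: "\<Psi>' ` (A \<times> UNIV) = (\<Psi> ` A) \<times> UNIV" for A
  proof (intro equalityI subsetI)
    fix z assume "z \<in> \<Psi> ` A \<times> (UNIV::real set)"
    then obtain x where "x \<in> A" "fst z = \<Psi> x" by auto
    then show "z \<in> \<Psi>' ` (A \<times> UNIV)"
      by (intro image_eqI[of _ _ "(x, snd z)"]) (auto simp: \<Psi>'_def prod_eq_iff)
  qed (auto simp: \<Psi>'_def)
  have hom: "homeomorphism (U \<times> UNIV) (V \<times> UNIV) \<Phi>' \<Psi>'"
    unfolding homeomorphism_def im1 im2 im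
    using smooth_on_continuous[OF sm(1)] smooth_on_continuous[OF sm(2)] inv
    by (auto simp: \<Phi>'_def \<Psi>'_def)
  have slice: "\<Phi>' ` (S \<times> UNIV \<inter> U \<times> UNIV) = {y \<in> V \<times> UNIV. y \<bullet> (e, 0) = 0}"
    using im1[of "S \<inter> U"] ch(6) by (auto simp: Times_Int_Times)
  have e': "(e, 0::real) \<in> Basis" using ch(1) by (simp add: Basis_prod_def)
  have p': "p \<in> U \<times> UNIV" using ch(2) by (cases p) simp
  have "\<exists>e\<in>Basis. p \<in> U \<times> UNIV \<and> smooth_on (U \<times> UNIV) \<Phi>' \<and> smooth_on (V \<times> UNIV) \<Psi>'
      \<and> homeomorphism (U \<times> UNIV) (V \<times> UNIV) \<Phi>' \<Psi>'
      \<and> \<Phi>' ` (S \<times> UNIV \<inter> U \<times> UNIV) = {y \<in> V \<times> UNIV. y \<bullet> e = 0}"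
    by (rule bexI[OF _ e'], intro conjI p' sm hom slice)
  then show "\<exists>U V. \<exists>\<Phi> \<Psi> :: 'a \<times> real \<Rightarrow> 'a \<times> real. \<exists>e\<in>Basis. p \<in> U \<and> smooth_on U \<Phi> \<and> smooth_on V \<Psi> \<and> homeomorphism U V \<Phi> \<Psi>
      \<and> \<Phi> ` (S \<times> UNIV \<inter> U) = {y \<in> V. y \<bullet> e = 0}"
    by - ((rule exI)+, assumption)
qed

lemma tangent_space_cylinder_fst:
  fixes S :: "'a::euclidean_space set"
  assumes "v \<in> tangent_space (S \<times> (UNIV :: real set)) z"
  shows "fst v \<in> tangent_space S (fst z)"
proof -
  obtain \<gamma> \<epsilon> where \<gamma>: "\<epsilon> > 0" "smooth_on {-\<epsilon><..<\<epsilon>} \<gamma>" "\<gamma> ` {-\<epsilon><..<\<epsilon>} \<subseteq> S \<times> UNIV" "\<gamma> 0 = z"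
    "(\<gamma> has_vector_derivative v) (at (0::real))"
    using assms unfolding tangent_space_def by blast
  have "smooth_on {-\<epsilon><..<\<epsilon>} (\<lambda>t. fst (\<gamma> t))"
    by (rule smooth_on_linear[OF bounded_linear_fst \<gamma>(2)])
  moreover have "(\<lambda>t. fst (\<gamma> t)) ` {-\<epsilon><..<\<epsilon>} \<subseteq> S" using \<gamma>(3) by force
  moreover have "((\<lambda>t. fst (\<gamma> t)) has_vector_derivative fst v) (at 0)"
    using \<gamma>(5) unfolding has_vector_derivative_def by (auto dest: has_derivative_fst)
  ultimately show ?thesis unfolding tangent_space_def using \<gamma>(1,4) by blast
qed

lemma unit_normal_near_cylinder:
  fixes S :: "'a::euclidean_space set"
  assumes "unit_normal_near S x \<nu>"
  shows "unit_normal_near (S \<times> (UNIV :: real set)) (x, t) (\<lambda>z. (\<nu> (fst z), 0))"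
proof -
  obtain U where U: "open U" "x \<in> U" "smooth_along (S \<inter> U) \<nu>"
    "\<And>y. y \<in> S \<inter> U \<Longrightarrow> norm (\<nu> y) = 1"
    "\<And>y v. y \<in> S \<inter> U \<Longrightarrow> v \<in> tangent_space S y \<Longrightarrow> \<nu> y \<bullet> v = 0"
    using assms unfolding unit_normal_near_def by blast
  have "smooth_along (S \<times> UNIV \<inter> U \<times> (UNIV :: real set)) (\<lambda>z. \<nu> (fst z))"
    by (rule smooth_along_compose_inner[OF U(3) smooth_on_fst]) auto
  then have "smooth_along (S \<times> UNIV \<inter> U \<times> (UNIV :: real set)) (\<lambda>z. (\<nu> (fst z), 0::real))"
    by (rule smooth_along_linear[rotated]) (intro bounded_linear_Pair bounded_linear_ident bounded_linear_zero)
  moreover have "open (U \<times> (UNIV :: real set))" using U(1) by (intro open_Times) auto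
  moreover have "(\<nu> (fst z), 0::real) \<bullet> v = 0"
    if "z \<in> S \<times> UNIV \<inter> U \<times> UNIV" "v \<in> tangent_space (S \<times> (UNIV :: real set)) z" for z v
    using U(5)[of "fst z" "fst v"] that tangent_space_cylinder_fst[OF that(2)] by (auto simp: inner_prod_def)
  ultimately show ?thesis
    unfolding unit_normal_near_def using U(2,4)
    by (intro exI[of _ "U \<times> UNIV"]) (auto simp: norm_Pair)
qed

context hypersurface
begin

abbreviation cylinder :: "('a \<times> real) set" where "cylinder \<equiv> S \<times> UNIV"

lemma hypersurface_cylinder: "hypersurface cylinder"
proof
  show "embedded_hypersurface cylinder" by (rule embedded_hypersurface_cylinder[OF embedded])
  fix p assume "p \<in> cylinder"
  then obtain \<nu> where "unit_normal_near S (fst p) \<nu>" using normal[of "fst p"] by auto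
  from unit_normal_near_cylinder[OF this, of "snd p"] show "\<exists>\<nu>. unit_normal_near cylinder p \<nu>"
    by auto
qed

text \<open>A normal of \<open>S\<close> extended off \<open>S\<close>, together with its lift to
  the cylinder that is constant along the axis, in the form in which the curvature lemmas take such
  data for both hypersurfaces.\<close>

lemma cylinder_normal_data:
  assumes x: "x \<in> S" and \<nu>: "unit_normal_near S x \<nu>"
  obtains U n where "open U" "x \<in> U" "smooth_on U n" "\<And>y. y \<in> S \<Longrightarrow> y \<in> U \<Longrightarrow> \<nu> y = n y"
    "\<And>y. y \<in> S \<Longrightarrow> y \<in> U \<Longrightarrow> norm (n y) = 1"
    "\<And>y. y \<in> S \<Longrightarrow> y \<in> U \<Longrightarrow> tangent_space S y = {v. n y \<bullet> v = 0}"
    "smooth_on (U \<times> UNIV) (\<lambda>z::'a \<times> real. (n (fst z), 0::real))"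
    "\<And>t v. frechet_derivative (\<lambda>z::'a \<times> real. (n (fst z), 0::real)) (at (x, t)) v
        = (frechet_derivative n (at x) (fst v), 0)"
    "\<And>z. z \<in> cylinder \<Longrightarrow> z \<in> U \<times> UNIV \<Longrightarrow> norm (n (fst z), 0::real) = 1"
    "\<And>z. z \<in> cylinder \<Longrightarrow> z \<in> U \<times> UNIV \<Longrightarrow> tangent_space cylinder z = {v. (n (fst z), 0) \<bullet> v = 0}"
proof -
  interpret cyl: hypersurface cylinder by (rule hypersurface_cylinder)
  obtain U n where U: "open U" "x \<in> U" "smooth_on U n" "\<And>y. y \<in> S \<Longrightarrow> y \<in> U \<Longrightarrow> \<nu> y = n y"
    "\<And>y. y \<in> S \<Longrightarrow> y \<in> U \<Longrightarrow> norm (n y) = 1"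
    "\<And>y. y \<in> S \<Longrightarrow> y \<in> U \<Longrightarrow> tangent_space S y = {v. n y \<bullet> v = 0}"
    by (rule normal_extension[OF x \<nu>]) (rule that; (assumption | simp))
  have sm: "smooth_on (U \<times> UNIV) (\<lambda>z::'a \<times> real. (n (fst z), 0::real))"
    using open_Times[OF U(1) open_UNIV]
    by (intro smooth_on_Pair smooth_on_cylinder U(3) smooth_on_const) auto
  have d: "frechet_derivative (\<lambda>z::'a \<times> real. (n (fst z), 0::real)) (at (x, t)) v
        = (frechet_derivative n (at x) (fst v), 0)" for t v
  proof -
    have "((\<lambda>z. n (fst z)) has_derivative (\<lambda>v. frechet_derivative n (at x) (fst v))) (at (x, t))"
      using smooth_on_has_derivative[OF U(3,2)]
      by (intro has_derivative_compose[of fst fst _ _ n] has_derivative_fst has_derivative_ident) simp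
    then have "((\<lambda>z::'a \<times> real. (n (fst z), 0::real)) has_derivative (\<lambda>v. (frechet_derivative n (at x) (fst v), 0))) (at (x, t))"
      by (intro has_derivative_Pair has_derivative_const)
    from frechet_derivative_eqI[OF this] show ?thesis by simp
  qed
  have T: "tangent_space cylinder z = {v. (n (fst z), 0) \<bullet> v = 0}" if z: "z \<in> cylinder" "z \<in> U \<times> UNIV" for z
  proof (rule tangent_space_unit_normal[OF cyl.embedded z(1)])
    show "norm (n (fst z), 0::real) = 1" using U(5)[of "fst z"] z by (auto simp: norm_Pair)
    fix v assume "v \<in> tangent_space cylinder z"
    from tangent_space_cylinder_fst[OF this] show "(n (fst z), 0) \<bullet> v = 0"
      using U(6)[of "fst z"] z by (auto simp: inner_prod_def)
  qed
  show thesis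
    by (rule that[OF U sm d _ T]) (use U(5) in \<open>auto simp: norm_Pair\<close>)
qed

lemma tangent_space_cylinder:
  assumes x: "x \<in> S"
  shows "tangent_space cylinder (x, t) = {v. fst v \<in> tangent_space S x}"
proof -
  obtain \<nu> where \<nu>: "unit_normal_near S x \<nu>" using normal[OF x] by blast
  obtain U n where U: "open U" "x \<in> U" "smooth_on U n" "\<And>y. y \<in> S \<Longrightarrow> y \<in> U \<Longrightarrow> \<nu> y = n y"
    "\<And>y. y \<in> S \<Longrightarrow> y \<in> U \<Longrightarrow> norm (n y) = 1"
    "\<And>y. y \<in> S \<Longrightarrow> y \<in> U \<Longrightarrow> tangent_space S y = {v. n y \<bullet> v = 0}"
    "smooth_on (U \<times> UNIV) (\<lambda>z::'a \<times> real. (n (fst z), 0::real))"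
    "\<And>t v. frechet_derivative (\<lambda>z::'a \<times> real. (n (fst z), 0::real)) (at (x, t)) v
        = (frechet_derivative n (at x) (fst v), 0)"
    "\<And>z. z \<in> cylinder \<Longrightarrow> z \<in> U \<times> UNIV \<Longrightarrow> norm (n (fst z), 0::real) = 1"
    "\<And>z. z \<in> cylinder \<Longrightarrow> z \<in> U \<times> UNIV \<Longrightarrow> tangent_space cylinder z = {v. (n (fst z), 0) \<bullet> v = 0}"
    by (rule cylinder_normal_data[OF x \<nu>]) (rule that; (assumption | simp))
  have "tangent_space cylinder (x, t) = {v. (n x, 0) \<bullet> v = 0}" using U(10)[of "(x, t)"] U(2) x by simp
  also have "\<dots> = {v. fst v \<in> tangent_space S x}" using U(6)[OF x U(2)] by (simp add: inner_prod_def)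
  finally show "tangent_space cylinder (x, t) = {v. fst v \<in> tangent_space S x}" .
qed

text \<open>A tangent basis adapted to the product. The lifted normal does not change in the axis
  direction \<open>(0, 1)\<close> and has no axis component, so this basis vector drops out of the
  sums for the mean curvature and for the squared norm.\<close>

lemma cylinder_onb:
  assumes x: "x \<in> S" and B: "orthonormal B" "span B = tangent_space S x"
  shows "orthonormal (insert (0, 1::real) ((\<lambda>b. (b, 0)) ` B))"
    "span (insert (0, 1) ((\<lambda>b. (b, 0)) ` B)) = tangent_space cylinder (x, t)"
proof -
  interpret cyl: hypersurface cylinder by (rule hypersurface_cylinder)
  let ?B = "insert (0, 1) ((\<lambda>b. (b, 0)) ` B) :: ('a \<times> real) set"
  show "orthonormal ?B" using B(1)
    by (auto simp: orthonormal_def pairwise_def orthogonal_def norm_Pair)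
  have lin: "linear (\<lambda>b::'a. (b, 0::real))" by (auto intro: linearI)
  show "span ?B = tangent_space cylinder (x, t)"
  proof (intro equalityI subsetI)
    fix v assume "v \<in> span ?B"
    moreover have "?B \<subseteq> tangent_space cylinder (x, t)"
      using B(2) span_base[of _ B] subspace_0[OF subspace_tangent_space[OF x]]
      unfolding tangent_space_cylinder[OF x] by auto
    ultimately show "v \<in> tangent_space cylinder (x, t)"
      using span_minimal cyl.subspace_tangent_space[of "(x, t)"] x by blast
  next
    fix v assume "v \<in> tangent_space cylinder (x, t)"
    then have "fst v \<in> span B" unfolding tangent_space_cylinder[OF x] B(2) by simp
    then have "(fst v, 0) \<in> span ((\<lambda>b. (b, 0::real)) ` B)"
      unfolding linear_span_image[OF lin] by (rule imageI)
    then have "(fst v, 0) \<in> span ?B" using span_mono[of "(\<lambda>b. (b, 0)) ` B" ?B] by auto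
    then have "(fst v, 0) + snd v *\<^sub>R (0, 1) \<in> span ?B"
      by (rule span_add[OF _ span_scale[OF span_base]]) simp
    then show "v \<in> span ?B" by simp
  qed
qed

lemma mean_curvature_cylinder:
  assumes x: "x \<in> S" and \<nu>: "unit_normal_near S x \<nu>"
  shows "mean_curvature cylinder (\<lambda>z. (\<nu> (fst z), 0)) (x, t) = mean_curvature S \<nu> x"
proof -
  interpret cyl: hypersurface cylinder by (rule hypersurface_cylinder)
  obtain U n where U: "open U" "x \<in> U" "smooth_on U n" "\<And>y. y \<in> S \<Longrightarrow> y \<in> U \<Longrightarrow> \<nu> y = n y"
    "\<And>y. y \<in> S \<Longrightarrow> y \<in> U \<Longrightarrow> norm (n y) = 1"
    "\<And>y. y \<in> S \<Longrightarrow> y \<in> U \<Longrightarrow> tangent_space S y = {v. n y \<bullet> v = 0}"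
    "smooth_on (U \<times> UNIV) (\<lambda>z::'a \<times> real. (n (fst z), 0::real))"
    "\<And>t v. frechet_derivative (\<lambda>z::'a \<times> real. (n (fst z), 0::real)) (at (x, t)) v
        = (frechet_derivative n (at x) (fst v), 0)"
    "\<And>z. z \<in> cylinder \<Longrightarrow> z \<in> U \<times> UNIV \<Longrightarrow> norm (n (fst z), 0::real) = 1"
    "\<And>z. z \<in> cylinder \<Longrightarrow> z \<in> U \<times> UNIV \<Longrightarrow> tangent_space cylinder z = {v. (n (fst z), 0) \<bullet> v = 0}"
    by (rule cylinder_normal_data[OF x \<nu>]) (rule that; (assumption | simp))
  define B where "B = tangent_onb S x"
  have B: "orthonormal B" "span B = tangent_space S x" using tangent_onb[OF x] by (auto simp: B_def)
  let ?B = "insert (0, 1) ((\<lambda>b. (b, 0)) ` B) :: ('a \<times> real) set"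
  have op: "open (U \<times> (UNIV::real set))" using U(1) by (intro open_Times) auto
  have "mean_curvature cylinder (\<lambda>z. (\<nu> (fst z), 0)) (x, t)
      = (\<Sum>b\<in>?B. frechet_derivative (\<lambda>z::'a \<times> real. (n (fst z), 0::real)) (at (x, t)) b \<bullet> b)"
    using x U(2,4) cylinder_onb[OF x B]
    by (intro cyl.mean_curvature_onb[OF _ op _ U(7)]) auto
  also have "\<dots> = (\<Sum>b\<in>?B. frechet_derivative n (at x) (fst b) \<bullet> fst b)"
    by (simp only: U(8)) (simp add: inner_prod_def)
  also have "\<dots> = (\<Sum>b\<in>(\<lambda>b. (b, 0::real)) ` B. frechet_derivative n (at x) (fst b) \<bullet> fst b)"
    using orthonormal_finite[OF B(1)] by (subst sum.insert) auto
  also have "\<dots> = (\<Sum>b\<in>B. frechet_derivative n (at x) b \<bullet> b)"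
    by (subst sum.reindex) (auto simp: inj_on_def)
  also have "\<dots> = mean_curvature S \<nu> x"
    by (rule mean_curvature_onb[OF x U(1-4) B, symmetric])
  finally show ?thesis .
qed

lemma norm_A_squared_cylinder:
  assumes x: "x \<in> S"
  shows "norm_A_squared cylinder (x, t) = norm_A_squared S x"
proof -
  interpret cyl: hypersurface cylinder by (rule hypersurface_cylinder)
  obtain \<nu> where \<nu>: "unit_normal_near S x \<nu>" using normal[OF x] by blast
  obtain U n where U: "open U" "x \<in> U" "smooth_on U n" "\<And>y. y \<in> S \<Longrightarrow> y \<in> U \<Longrightarrow> \<nu> y = n y"
    "\<And>y. y \<in> S \<Longrightarrow> y \<in> U \<Longrightarrow> norm (n y) = 1"
    "\<And>y. y \<in> S \<Longrightarrow> y \<in> U \<Longrightarrow> tangent_space S y = {v. n y \<bullet> v = 0}"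
    "smooth_on (U \<times> UNIV) (\<lambda>z::'a \<times> real. (n (fst z), 0::real))"
    "\<And>t v. frechet_derivative (\<lambda>z::'a \<times> real. (n (fst z), 0::real)) (at (x, t)) v
        = (frechet_derivative n (at x) (fst v), 0)"
    "\<And>z. z \<in> cylinder \<Longrightarrow> z \<in> U \<times> UNIV \<Longrightarrow> norm (n (fst z), 0::real) = 1"
    "\<And>z. z \<in> cylinder \<Longrightarrow> z \<in> U \<times> UNIV \<Longrightarrow> tangent_space cylinder z = {v. (n (fst z), 0) \<bullet> v = 0}"
    by (rule cylinder_normal_data[OF x \<nu>]) (rule that; (assumption | simp))
  define B where "B = tangent_onb S x"
  have B: "orthonormal B" "span B = tangent_space S x" using tangent_onb[OF x] by (auto simp: B_def)
  have finB: "finite B" by (rule orthonormal_finite[OF B(1)])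
  let ?D = "frechet_derivative n (at x)"
  let ?B = "insert (0, 1) ((\<lambda>b. (b, 0)) ` B) :: ('a \<times> real) set"
  have op: "open (U \<times> (UNIV::real set))" using U(1) by (intro open_Times) auto
  have lin: "?D 0 = 0" using smooth_on_has_derivative[OF U(3,2)] has_derivative_linear linear_0 by blast
  have red: "(\<Sum>b\<in>?B. h (fst b)) = (\<Sum>b\<in>B. h b)" if "h 0 = 0" for h :: "'a \<Rightarrow> real"
  proof -
    have "(\<Sum>b\<in>?B. h (fst b)) = (\<Sum>b\<in>(\<lambda>b. (b, 0::real)) ` B. h (fst b))"
      using finB that by (subst sum.insert) auto
    also have "\<dots> = (\<Sum>b\<in>B. h b)" by (subst sum.reindex) (auto simp: inj_on_def)
    finally show ?thesis .
  qed
  have "norm_A_squared cylinder (x, t)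
      = (\<Sum>b\<in>?B. \<Sum>c\<in>?B. (frechet_derivative (\<lambda>z::'a \<times> real. (n (fst z), 0::real)) (at (x, t)) b \<bullet> c)\<^sup>2)"
    using x U(2) U(9,10) cylinder_onb[OF x B]
    by (intro cyl.norm_A_squared_onb[OF _ op _ U(7)]) auto
  also have "\<dots> = (\<Sum>b\<in>?B. \<Sum>c\<in>?B. (?D (fst b) \<bullet> fst c)\<^sup>2)"
    by (simp only: U(8)) (simp add: inner_prod_def)
  also have "\<dots> = (\<Sum>b\<in>?B. \<Sum>c\<in>B. (?D (fst b) \<bullet> c)\<^sup>2)"
    by (intro sum.cong refl red) simp
  also have "\<dots> = (\<Sum>b\<in>B. \<Sum>c\<in>B. (?D b \<bullet> c)\<^sup>2)"
    by (rule red) (simp add: lin)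
  also have "\<dots> = norm_A_squared S x"
    by (rule norm_A_squared_onb[OF x U(1-3,5,6) B, symmetric])
  finally show ?thesis .
qed

text \<open>The second part records that the function is differentiable along the axis, which an
  equation about \<open>deriv\<close> does not imply; the one-dimensional inequality needs
  it.\<close>

lemma tangential_gradient_cylinder:
  assumes x: "x \<in> S" and F: "smooth_along cylinder F"
  shows "tangential_gradient cylinder F (x, t)
      = (tangential_gradient S (\<lambda>y. F (y, t)) x, deriv (\<lambda>s. F (x, s)) t)"
    and "((\<lambda>s. F (x, s)) has_real_derivative deriv (\<lambda>s. F (x, s)) t) (at t)"
proof -
  interpret cyl: hypersurface cylinder by (rule hypersurface_cylinder)
  obtain W g where W: "(x, t) \<in> W" "open W" "smooth_on W g" "\<And>z. z \<in> cylinder \<Longrightarrow> z \<in> W \<Longrightarrow> F z = g z"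
    using smooth_alongE[OF F, of "(x, t)"] x by blast
  let ?D = "frechet_derivative g (at (x, t))"
  have d: "(g has_derivative ?D) (at (x, t))" by (rule smooth_on_has_derivative[OF W(3,1)])
  have l: "linear ?D" using d has_derivative_linear by blast
  define W1 where "W1 = (\<lambda>y. (y, t)) -` W"
  have W1: "open W1" "x \<in> W1" unfolding W1_def using W
    by (auto intro!: open_vimage continuous_intros)
  define W2 where "W2 = (\<lambda>s. (x, s)) -` W"
  have W2: "open W2" "t \<in> W2" unfolding W2_def using W
    by (auto intro!: open_vimage continuous_intros)
  have d1: "((\<lambda>y. g (y, t)) has_derivative (\<lambda>v. ?D (v, 0))) (at x)"
    by (rule has_derivative_compose[OF has_derivative_Pair[OF has_derivative_ident has_derivative_const] d])
  have d2: "((\<lambda>s. g (x, s)) has_derivative (\<lambda>r. ?D (0, r))) (at t)"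
    by (rule has_derivative_compose[OF has_derivative_Pair[OF has_derivative_const has_derivative_ident] d])
  have D2: "?D (0, r) = ?D (0, 1) * r" for r
    using linear_scale[OF l, of r "(0, 1)"] by (simp add: mult.commute)
  have dF: "((\<lambda>s. F (x, s)) has_derivative (\<lambda>r. ?D (0, r))) (at t)"
    using W(4) x by (intro has_derivative_transform_within_open[OF d2 W2]) (auto simp: W2_def)
  have "(*) (?D (0, 1)) = (\<lambda>r. ?D (0, r))" by (rule ext) (rule D2[symmetric])
  then have F': "((\<lambda>s. F (x, s)) has_real_derivative ?D (0, 1)) (at t)"
    using dF by (simp only: has_field_derivative_def)
  then have deriv: "deriv (\<lambda>s. F (x, s)) t = ?D (0, 1)" by (rule DERIV_imp_deriv)
  show "((\<lambda>s. F (x, s)) has_real_derivative deriv (\<lambda>s. F (x, s)) t) (at t)"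
    using F' unfolding deriv .
  have slice: "smooth_along S (\<lambda>y. F (y, t))"
    by (rule smooth_along_compose_inner[OF F, of "\<lambda>y. (y, t)"])
      (auto intro!: smooth_on_Pair smooth_on_id smooth_on_const)
  define T where "T = tangential_gradient S (\<lambda>y. F (y, t)) x"
  have T: "T \<in> tangent_space S x" "\<And>v. v \<in> tangent_space S x \<Longrightarrow> T \<bullet> v = ?D (v, 0)"
  proof -
    show "T \<in> tangent_space S x" unfolding T_def by (rule tangential_gradient_tangent(1)[OF x slice])
    fix v assume v: "v \<in> tangent_space S x"
    have "T \<bullet> v = deriv_along S (\<lambda>y. F (y, t)) x v"
      unfolding T_def by (rule tangential_gradient_tangent(2)[OF x slice v])
    also have "\<dots> = ?D (v, 0)"
      using W(4) by (intro deriv_along_eq[OF d1 W1 x _ v]) (auto simp: W1_def)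
    finally show "T \<bullet> v = ?D (v, 0)" .
  qed
  show "tangential_gradient cylinder F (x, t) = (T, deriv (\<lambda>s. F (x, s)) t)"
  proof (rule cyl.tangential_gradient_unique)
    show "(x, t) \<in> cylinder" using x by simp
    show "(T, deriv (\<lambda>s. F (x, s)) t) \<in> tangent_space cylinder (x, t)"
      using T by (simp add: tangent_space_cylinder[OF x])
    fix v assume v: "v \<in> tangent_space cylinder (x, t)"
    then have fv: "fst v \<in> tangent_space S x" by (simp add: tangent_space_cylinder[OF x])
    have "deriv_along cylinder F (x, t) v = ?D v"
      using deriv_along_eq[OF d W(2,1) _ W(4) v] x by simp
    also have "v = (fst v, 0) + (0, snd v)" by simp
    also have "?D \<dots> = ?D (fst v, 0) + ?D (0, snd v)" by (rule linear_add[OF l])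
    finally show "(T, deriv (\<lambda>s. F (x, s)) t) \<bullet> v = deriv_along cylinder F (x, t) v"
      using T(2)[OF fv] D2[of "snd v"] by (simp add: inner_prod_def deriv)
  qed
qed

end

lemma self_shrinker_cylinder:
  fixes S :: "'a::euclidean_space set"
  assumes S: "self_shrinker S"
  shows "self_shrinker (S \<times> (UNIV :: real set))"
proof -
  interpret hypersurface S using S by (rule self_shrinker_hypersurface)
  interpret cyl: hypersurface cylinder by (rule hypersurface_cylinder)
  have "\<exists>\<nu>. unit_normal_near cylinder p \<nu> \<and> mean_curvature cylinder \<nu> p = p \<bullet> \<nu> p / 2" if pc: "p \<in> cylinder" for p
  proof -
    obtain x t where p: "p = (x, t)" "x \<in> S" using pc by (cases p) auto
    then obtain \<nu> where \<nu>: "unit_normal_near S x \<nu>" "mean_curvature S \<nu> x = x \<bullet> \<nu> x / 2"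
      using S unfolding self_shrinker_def by blast
    show ?thesis
      using unit_normal_near_cylinder[OF \<nu>(1), of t] mean_curvature_cylinder[OF p(2) \<nu>(1), of t] \<nu>(2)
      by (intro exI[of _ "\<lambda>z. (\<nu> (fst z), 0)"]) (simp add: p)
  qed
  then show ?thesis unfolding self_shrinker_def using cyl.embedded by blast
qed

section \<open>Surface measure of the cylinder\<close>

lemma hausdorff_outer_measure_expanding:
  fixes f :: "'a::metric_space \<Rightarrow> 'b::metric_space"
  assumes k: "k > 0" and f: "\<And>x y. x \<in> A \<Longrightarrow> y \<in> A \<Longrightarrow> k * dist x y \<le> dist (f x) (f y)"
  shows "hausdorff_outer_measure d A \<le> ennreal ((1 / k) ^ d) * hausdorff_outer_measure d (f ` A)"
proof -
  have inj: "inj_on f A"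
  proof (rule inj_onI)
    fix x y assume "x \<in> A" "y \<in> A" "f x = f y"
    then have "k * dist x y \<le> 0" using f[of x y] by simp
    then show "x = y" using k by (simp add: mult_le_0_iff)
  qed
  have "dist (inv_into A f u) (inv_into A f v) \<le> 1 / k * dist u v" if "u \<in> f ` A" "v \<in> f ` A" for u v
    using f[OF inv_into_into[OF that(1)] inv_into_into[OF that(2)]] k
    by (simp add: f_inv_into_f that field_simps)
  from hausdorff_outer_measure_lipschitz_image[OF _ this] k
  have "hausdorff_outer_measure d (inv_into A f ` f ` A) \<le> ennreal ((1 / k) ^ d) * hausdorff_outer_measure d (f ` A)"
    by simp
  then show ?thesis using inj by (simp add: inv_into_image_cancel)
qed

text \<open>The second factor is left fixed, so its distances are multiplied by exactly
  \<open>1\<close>; the condition \<open>1 \<le> k\<close> lets them obey the same constant.\<close>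

lemma dist_Pair_le:
  fixes a b :: "'a::metric_space" and a' b' :: "'b::metric_space"
  assumes "1 \<le> k" "dist a' b' \<le> k * dist a b"
  shows "dist (a', s::real) (b', t) \<le> k * dist (a, s) (b, t)"
proof -
  have "(dist a' b')\<^sup>2 + (dist s t)\<^sup>2 \<le> (k * dist a b)\<^sup>2 + (k * dist s t)\<^sup>2"
    using assms by (intro add_mono power_mono) (auto intro: mult_right_mono[of 1 k, simplified])
  also have "\<dots> = k\<^sup>2 * ((dist a b)\<^sup>2 + (dist s t)\<^sup>2)" by (simp add: power_mult_distrib algebra_simps)
  finally have "sqrt ((dist a' b')\<^sup>2 + (dist s t)\<^sup>2) \<le> sqrt (k\<^sup>2 * ((dist a b)\<^sup>2 + (dist s t)\<^sup>2))"
    by (rule real_sqrt_le_mono)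
  then show ?thesis using assms(1) by (simp add: dist_Pair_Pair real_sqrt_mult)
qed

lemma dist_Pair_ge:
  fixes a b :: "'a::metric_space" and a' b' :: "'b::metric_space"
  assumes "0 < k" "k \<le> 1" "k * dist a b \<le> dist a' b'"
  shows "k * dist (a, s::real) (b, t) \<le> dist (a', s) (b', t)"
proof -
  have "dist a b \<le> 1 / k * dist a' b'" using assms by (simp add: field_simps)
  then have "dist (a, s) (b, t) \<le> 1 / k * dist (a', s) (b', t)"
    using assms by (intro dist_Pair_le) auto
  then show ?thesis using assms by (simp add: field_simps)
qed

section \<open>Local structure of the hypersurface and of its product with the line\<close>

context hypersurface
begin

text \<open>A hypersurface is only locally closed. Every point has an open chart domain
  \<open>U\<close> with \<open>U - S\<close> open, and this presents \<open>S\<close> as a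
  difference of two open sets.\<close>

lemma borel: "S \<in> sets borel"
proof -
  define \<U> where "\<U> = {U. open U \<and> open (U - S)}"
  have "\<exists>U\<in>\<U>. p \<in> U" if p: "p \<in> S" for p
  proof -
    obtain U V \<Phi> \<Psi> and e :: 'a where ch: "e \<in> Basis" "p \<in> U" "smooth_on U \<Phi>" "smooth_on V \<Psi>"
      "\<And>x. x \<in> U \<Longrightarrow> \<Phi> x \<in> V" "\<And>y. y \<in> V \<Longrightarrow> \<Psi> y \<in> U"
      "\<And>x. x \<in> U \<Longrightarrow> \<Psi> (\<Phi> x) = x" "\<And>y. y \<in> V \<Longrightarrow> \<Phi> (\<Psi> y) = y"
      "\<And>x. x \<in> U \<Longrightarrow> x \<in> S \<longleftrightarrow> \<Phi> x \<bullet> e = 0"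
      by (rule embedded_hypersurface_chart[OF embedded p]) (rule that; (assumption | simp))
    have U: "open U" by (rule smooth_on_open[OF ch(3)])
    have "open (U \<inter> (\<lambda>x. \<Phi> x \<bullet> e) -` (- {0}))"
      using smooth_on_continuous[OF ch(3)] by (intro continuous_open_preimage continuous_intros U) auto
    moreover have "U \<inter> (\<lambda>x. \<Phi> x \<bullet> e) -` (- {0}) = U - S" using ch(9) by auto
    ultimately show ?thesis using U ch(2) by (auto simp: \<U>_def)
  qed
  then have "S = \<Union>\<U> - (\<Union>U\<in>\<U>. U - S)" by blast
  moreover have "open (\<Union>\<U>)" unfolding \<U>_def by auto
  moreover have "open (\<Union>U\<in>\<U>. U - S)" by (intro open_UN ballI) (simp add: \<U>_def)
  ultimately show ?thesis by (metis borel_open sets.Diff)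
qed

text \<open>\<open>S\<close> is closed relative to a chart domain, though possibly not in the
  ambient space. These compact pieces are where the local integral estimates take place.\<close>

lemma locally_compact_at:
  assumes p: "p \<in> S"
  shows "\<exists>r>0. \<forall>r'\<le>r. compact (S \<inter> cball p r')"
proof -
  obtain U V \<Phi> \<Psi> and e :: 'a where ch: "e \<in> Basis" "p \<in> U" "smooth_on U \<Phi>" "smooth_on V \<Psi>"
    "\<And>x. x \<in> U \<Longrightarrow> \<Phi> x \<in> V" "\<And>y. y \<in> V \<Longrightarrow> \<Psi> y \<in> U"
    "\<And>x. x \<in> U \<Longrightarrow> \<Psi> (\<Phi> x) = x" "\<And>y. y \<in> V \<Longrightarrow> \<Phi> (\<Psi> y) = y"
    "\<And>x. x \<in> U \<Longrightarrow> x \<in> S \<longleftrightarrow> \<Phi> x \<bullet> e = 0"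
    by (rule embedded_hypersurface_chart[OF embedded p]) (rule that; (assumption | simp))
  have U: "open U" by (rule smooth_on_open[OF ch(3)])
  obtain r where r: "r > 0" "cball p r \<subseteq> U" using U ch(2) open_contains_cball by blast
  have "compact (S \<inter> cball p r')" if "r' \<le> r" for r'
  proof -
    have sub: "cball p r' \<subseteq> U" using r(2) that by (meson order_trans subset_cball)
    have "closed (cball p r' \<inter> (\<lambda>x. \<Phi> x \<bullet> e) -` {0})"
      using smooth_on_continuous[OF ch(3)] sub
      by (intro continuous_closed_preimage continuous_intros) (auto intro: continuous_on_subset)
    moreover have "cball p r' \<inter> (\<lambda>x. \<Phi> x \<bullet> e) -` {0} = S \<inter> cball p r'" using ch(9) sub by auto
    ultimately show ?thesis by (simp add: compact_eq_bounded_closed bounded_Int)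
  qed
  then show ?thesis using r(1) by blast
qed

text \<open>The chart composed with the inverse of its derivative at \<open>p\<close> and an isometry of the tangent
  space is almost an isometry near \<open>p\<close>.\<close>

lemma almost_isometric_chart:
  assumes p: "p \<in> S" and eps: "0 < \<epsilon>" and e0: "e0 \<in> Basis"
  obtains r and T :: "'a \<Rightarrow> 'a" where "r > 0"
    "\<And>x y. x \<in> S \<inter> ball p r \<Longrightarrow> y \<in> S \<inter> ball p r \<Longrightarrow> (1 - \<epsilon>) * dist x y \<le> dist (T x) (T y)"
    "\<And>x y. x \<in> S \<inter> ball p r \<Longrightarrow> y \<in> S \<inter> ball p r \<Longrightarrow> dist (T x) (T y) \<le> (1 + \<epsilon>) * dist x y"
    "\<And>x. x \<in> S \<inter> ball p r \<Longrightarrow> T x \<bullet> e0 = 0"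
    "\<And>A. A \<in> sets borel \<Longrightarrow> A \<subseteq> S \<inter> ball p r \<Longrightarrow> T ` A \<in> sets borel"
proof -
  obtain U V \<Phi> \<Psi> and e :: 'a where ch: "e \<in> Basis" "p \<in> U" "smooth_on U \<Phi>" "smooth_on V \<Psi>"
    "\<And>x. x \<in> U \<Longrightarrow> \<Phi> x \<in> V" "\<And>y. y \<in> V \<Longrightarrow> \<Psi> y \<in> U"
    "\<And>x. x \<in> U \<Longrightarrow> \<Psi> (\<Phi> x) = x" "\<And>y. y \<in> V \<Longrightarrow> \<Phi> (\<Psi> y) = y"
    "\<And>x. x \<in> U \<Longrightarrow> x \<in> S \<longleftrightarrow> \<Phi> x \<bullet> e = 0"
    by (rule embedded_hypersurface_chart[OF embedded p]) (rule that; (assumption | simp))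
  define A where "A = frechet_derivative \<Phi> (at p)"
  define A' where "A' = frechet_derivative \<Psi> (at (\<Phi> p))"
  have blA: "bounded_linear A" "bounded_linear A'"
    unfolding A_def A'_def
    using smooth_on_has_derivative[OF ch(3,2)] smooth_on_has_derivative[OF ch(4) ch(5)[OF ch(2)]]
      has_derivative_bounded_linear by blast+
  then have linA: "linear A" "linear A'" by (auto simp: bounded_linear.linear)
  have A'A: "A' (A v) = v" for v
    unfolding A_def A'_def by (rule inverse_derivative[OF ch(3,4,2) ch(5)[OF ch(2)] ch(7)])
  have AA': "A (A' w) = w" for w
    using inverse_derivative[OF ch(4,3) ch(5)[OF ch(2)] _ ch(8)] ch(7)[OF ch(2)] ch(2)
    unfolding A_def A'_def by simp
  obtain n where n: "norm n = 1" "tangent_space S p = {v. n \<bullet> v = 0}"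
  proof -
    obtain \<nu> where \<nu>: "unit_normal_near S p \<nu>" using normal[OF p] by blast
    obtain U n where U: "open U" "p \<in> U" "smooth_on U n" "\<And>y. y \<in> S \<Longrightarrow> y \<in> U \<Longrightarrow> \<nu> y = n y"
      "\<And>y. y \<in> S \<Longrightarrow> y \<in> U \<Longrightarrow> norm (n y) = 1"
      "\<And>y. y \<in> S \<Longrightarrow> y \<in> U \<Longrightarrow> tangent_space S y = {v. n y \<bullet> v = 0}"
      by (rule normal_extension[OF p \<nu>]) (rule that; (assumption | simp))
    show thesis by (rule that[OF U(5,6)[OF p U(2)]])
  qed
  have Tp: "tangent_space S p = {v. A v \<bullet> e = 0}"
    unfolding A_def by (rule tangent_space_chart[OF ch(3-9) p ch(2)])
  let ?P = "{y::'a. y \<bullet> e0 = 0}"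
  have "dim (tangent_space S p) = DIM('a) - 1"
    using n by (simp add: dim_hyperplane) (metis dim_hyperplane norm_zero zero_neq_one One_nat_def)
  moreover have "?P = {y. e0 \<bullet> y = 0}" by (simp add: inner_commute)
  moreover have "dim {y. e0 \<bullet> y = 0} = DIM('a) - 1"
    using e0 nonzero_Basis by (intro dim_hyperplane) auto
  ultimately have dims: "dim (tangent_space S p) = dim ?P" by simp
  have sub: "subspace (tangent_space S p)" "subspace ?P"
    using subspace_tangent_space[OF p] subspace_hyperplane2[of e0] by (auto simp: inner_commute)
  \<comment> \<open>An isometry from the tangent space at \<open>p\<close> to the fixed hyperplane
    \<open>?P\<close>. As every tangent space is sent to the same hyperplane, one constant of the
    flat product formula serves at all points.\<close>
  obtain f g :: "'a \<Rightarrow> 'a" where fg: "linear f" "linear g" "f ` tangent_space S p = ?P" "g ` ?P = tangent_space S p"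
    "\<And>x. x \<in> tangent_space S p \<Longrightarrow> norm (f x) = norm x" "\<And>x. x \<in> ?P \<Longrightarrow> norm (g x) = norm x"
    "\<And>x. x \<in> tangent_space S p \<Longrightarrow> g (f x) = x" "\<And>x. x \<in> ?P \<Longrightarrow> f (g x) = x"
    by (rule isometries_subspaces[OF sub dims]) (rule that; (assumption | simp))
  obtain K where K: "K > 0" "\<And>w. norm (A' w) \<le> norm w * K"
    using bounded_linear.pos_bounded[OF blA(2)] by blast
  have "\<exists>r>0. ball p r \<subseteq> U \<and> (\<forall>x\<in>ball p r. \<forall>v. norm (frechet_derivative \<Phi> (at x) v - A v) \<le> \<epsilon> / K * norm v)"
    unfolding A_def by (rule smooth_on_deriv_close[OF ch(3,2)]) (use eps K(1) in simp)
  then obtain r where r: "r > 0" "ball p r \<subseteq> U"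
    "\<And>x v. x \<in> ball p r \<Longrightarrow> norm (frechet_derivative \<Phi> (at x) v - A v) \<le> \<epsilon> / K * norm v"
    by blast
  \<comment> \<open>The map \<open>A' \<circ> \<Phi>\<close> has the identity as its derivative at
    \<open>p\<close>, so by the mean value inequality it differs from the identity by an
    \<open>\<epsilon>\<close>-Lipschitz map near \<open>p\<close>.\<close>
  have close: "norm ((A' (\<Phi> x) - x) - (A' (\<Phi> y) - y)) \<le> \<epsilon> * norm (x - y)"
    if "x \<in> ball p r" "y \<in> ball p r" for x y
  proof (rule differentiable_bound[of "ball p r" "\<lambda>x. A' (\<Phi> x) - x" "\<lambda>x v. A' (frechet_derivative \<Phi> (at x) v) - v"])
    fix z assume z: "z \<in> ball p r"
    have dz: "(\<Phi> has_derivative frechet_derivative \<Phi> (at z)) (at z)"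
      using z r(2) by (intro smooth_on_has_derivative[OF ch(3)]) auto
    show "((\<lambda>x. A' (\<Phi> x) - x) has_derivative (\<lambda>v. A' (frechet_derivative \<Phi> (at z) v) - v)) (at z within ball p r)"
      by (rule has_derivative_at_withinI[OF has_derivative_diff[OF bounded_linear.has_derivative[OF blA(2) dz] has_derivative_ident]])
    show "onorm (\<lambda>v. A' (frechet_derivative \<Phi> (at z) v) - v) \<le> \<epsilon>"
    proof (rule onorm_bound)
      fix v
      have "A' (frechet_derivative \<Phi> (at z) v) - v = A' (frechet_derivative \<Phi> (at z) v - A v)"
        by (simp add: linear_diff[OF linA(2)] A'A)
      also have "norm \<dots> \<le> norm (frechet_derivative \<Phi> (at z) v - A v) * K" by (rule K)
      also have "\<dots> \<le> (\<epsilon> / K * norm v) * K" using r(3)[OF z, of v] K(1) by (intro mult_right_mono) auto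
      finally show "norm (A' (frechet_derivative \<Phi> (at z) v) - v) \<le> \<epsilon> * norm v" using K(1) by simp
    qed (use eps in simp)
  qed (use that in auto)
  define T where "T = (\<lambda>x. f (A' (\<Phi> x - \<Phi> p)))"
  have tan: "A' (\<Phi> x - \<Phi> y) \<in> tangent_space S p" if "x \<in> S \<inter> U" "y \<in> S \<inter> U" for x y
    unfolding Tp using that ch(9)[of x] ch(9)[of y] by (simp add: AA' inner_diff_left)
  have dT: "dist (T x) (T y) = norm (A' (\<Phi> x) - A' (\<Phi> y))" if xy: "x \<in> S \<inter> ball p r" "y \<in> S \<inter> ball p r" for x y
  proof -
    have "T x - T y = f (A' (\<Phi> x - \<Phi> y))"
      unfolding T_def by (simp add: linear_diff[OF fg(1), symmetric] linear_diff[OF linA(2), symmetric])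
    moreover have "norm (f (A' (\<Phi> x - \<Phi> y))) = norm (A' (\<Phi> x - \<Phi> y))"
      using xy r(2) by (intro fg(5) tan) auto
    ultimately show ?thesis by (simp add: dist_norm linear_diff[OF linA(2)])
  qed
  show thesis
  proof (rule that[of r T])
    fix x y assume xy: "x \<in> S \<inter> ball p r" "y \<in> S \<inter> ball p r"
    have c: "norm ((A' (\<Phi> x) - A' (\<Phi> y)) - (x - y)) \<le> \<epsilon> * norm (x - y)"
      using close[of x y] xy by (simp add: algebra_simps)
    show "(1 - \<epsilon>) * dist x y \<le> dist (T x) (T y)"
      using c norm_triangle_sub[of "x - y" "A' (\<Phi> x) - A' (\<Phi> y)"] unfolding dT[OF xy]
      by (simp add: dist_norm norm_minus_commute algebra_simps)
    show "dist (T x) (T y) \<le> (1 + \<epsilon>) * dist x y"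
      using c norm_triangle_sub[of "A' (\<Phi> x) - A' (\<Phi> y)" "x - y"] unfolding dT[OF xy]
      by (simp add: dist_norm algebra_simps)
  next
    fix x assume "x \<in> S \<inter> ball p r"
    then have "A' (\<Phi> x - \<Phi> p) \<in> tangent_space S p" using r(2) p ch(2) by (intro tan) auto
    then have "T x \<in> ?P" unfolding T_def fg(3)[symmetric] by (rule imageI)
    then show "T x \<bullet> e0 = 0" by simp
  next
    fix X assume X: "X \<in> sets borel" "X \<subseteq> S \<inter> ball p r"
    \<comment> \<open>On the image of \<open>T\<close> the map \<open>\<Psi> \<circ> h\<close>
      inverts \<open>T\<close> and is continuous. The image of a Borel set is thus a Borel preimage,
      cut down to the hyperplane.\<close>
    define h where "h = (\<lambda>y. A (g y) + \<Phi> p)"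
    have conth: "continuous_on UNIV h"
      unfolding h_def using blA(1) linear_conv_bounded_linear fg(2)
      by (intro continuous_intros bounded_linear.continuous_on[OF blA(1)] linear_continuous_on) auto
    have W: "open (h -` V)" using conth smooth_on_open[OF ch(4)] by (simp add: continuous_on_open_vimage)
    have "continuous_on (h -` V) (\<lambda>y. \<Psi> (h y))"
      by (rule continuous_on_compose2[OF smooth_on_continuous[OF ch(4)] continuous_on_subset[OF conth]]) auto
    then have "(\<lambda>y. \<Psi> (h y)) \<in> borel_measurable (restrict_space borel (h -` V))"
      by (rule borel_measurable_continuous_on_restrict)
    from measurable_sets[OF this X(1)]
    have "(\<lambda>y. \<Psi> (h y)) -` X \<inter> (h -` V) \<in> sets (restrict_space borel (h -` V))"
      by (simp add: space_restrict_space)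
    then have "(\<lambda>y. \<Psi> (h y)) -` X \<inter> (h -` V) \<in> sets borel"
      using W by (subst (asm) sets_restrict_space_iff) auto
    then have "((\<lambda>y. \<Psi> (h y)) -` X \<inter> (h -` V)) \<inter> ?P \<in> sets borel" by auto
    moreover have "T ` X = ((\<lambda>y. \<Psi> (h y)) -` X \<inter> (h -` V)) \<inter> ?P"
    proof (intro equalityI subsetI)
      fix y assume "y \<in> T ` X"
      then obtain x where x: "x \<in> X" "y = T x" by auto
      then have xS: "x \<in> S \<inter> U" using X(2) r(2) by auto
      have tx: "A' (\<Phi> x - \<Phi> p) \<in> tangent_space S p" using xS p ch(2) by (intro tan) auto
      have "h y = \<Phi> x" using fg(7)[OF tx] by (simp add: h_def x(2) T_def AA')
      moreover have "y \<in> ?P" using tx unfolding x(2) T_def fg(3)[symmetric] by (rule imageI)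
      ultimately show "y \<in> ((\<lambda>y. \<Psi> (h y)) -` X \<inter> (h -` V)) \<inter> ?P"
        using xS ch(5,7) x(1) by auto
    next
      fix y assume y: "y \<in> ((\<lambda>y. \<Psi> (h y)) -` X \<inter> (h -` V)) \<inter> ?P"
      then have "\<Phi> (\<Psi> (h y)) = h y" using ch(8) by auto
      then have "T (\<Psi> (h y)) = f (A' (A (g y)))" by (simp add: T_def h_def)
      also have "\<dots> = y" using y fg(8) by (simp add: A'A)
      finally show "y \<in> T ` X" using y by (auto intro!: image_eqI[of y T "\<Psi> (h y)"])
    qed
    ultimately show "T ` X \<in> sets borel" by simp
  qed (use r in simp)
qed

text \<open>A Lindelof subcover made disjoint. Since the radius may depend on the point, any
  estimate that holds for small Borel pieces near each point can be summed over the
  \<open>D i\<close>.\<close>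

lemma countable_partition:
  assumes "\<And>p. p \<in> S \<Longrightarrow> r p > 0"
  obtains D :: "nat \<Rightarrow> 'a set" where "\<And>i. D i \<in> sets borel" "disjoint_family D" "(\<Union>i. D i) = S"
    "\<And>i. D i \<noteq> {} \<Longrightarrow> \<exists>p\<in>S. D i \<subseteq> S \<inter> ball p (r p)"
proof (cases "S = {}")
  case True
  show thesis by (rule that[of "\<lambda>_. {}"]) (auto simp: True disjoint_family_on_def)
next
  case False
  obtain F where F: "F \<subseteq> (\<lambda>p. ball p (r p)) ` S" "countable F" "\<Union>F = (\<Union>p\<in>S. ball p (r p))"
    using Lindelof[of "(\<lambda>p. ball p (r p)) ` S"] by auto
  have cov: "S \<subseteq> \<Union>F" unfolding F(3) using assms by force
  then have "F \<noteq> {}" using False by auto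
  then have B': "range (from_nat_into F) = F" using F(2) by (rule range_from_nat_into)
  define B where "B = from_nat_into F"
  have B: "range B = F" using B' by (simp add: B_def)
  define D where "D = disjointed (\<lambda>i. S \<inter> B i)"
  have Bi: "\<exists>p\<in>S. B i = ball p (r p)" for i using B F(1) by auto
  have "S \<inter> B i \<in> sets borel" for i using Bi[of i] borel by auto
  then have "range D \<subseteq> sets borel" unfolding D_def by (intro sets.range_disjointed_sets) auto
  moreover have "(\<Union>i. D i) = S" unfolding D_def UN_disjointed_eq using cov B by auto
  moreover have "\<exists>p\<in>S. D i \<subseteq> S \<inter> ball p (r p)" for i
    using Bi[of i] disjointed_subset[of "\<lambda>i. S \<inter> B i" i] unfolding D_def by auto
  ultimately show thesis by (intro that[of D]) (auto simp: D_def disjoint_family_disjointed)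
qed

text \<open>The almost isometric chart with \<open>\<epsilon> = 1/2\<close> is bounded on the ball,
  so it maps the piece into a flat cube of finite measure; its inverse is Lipschitz.\<close>

lemma hausdorff_locally_finite:
  assumes p: "p \<in> S"
  shows "\<exists>r>0. hausdorff_outer_measure (DIM('a) - 1) (S \<inter> ball p r) < top"
proof -
  obtain e0 :: 'a where e0: "e0 \<in> Basis" using nonempty_Basis by blast
  obtain r and T :: "'a \<Rightarrow> 'a" where T: "r > 0"
    "\<And>x y. x \<in> S \<inter> ball p r \<Longrightarrow> y \<in> S \<inter> ball p r \<Longrightarrow> (1 - 1/2) * dist x y \<le> dist (T x) (T y)"
    "\<And>x y. x \<in> S \<inter> ball p r \<Longrightarrow> y \<in> S \<inter> ball p r \<Longrightarrow> dist (T x) (T y) \<le> (1 + 1/2) * dist x y"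
    "\<And>x. x \<in> S \<inter> ball p r \<Longrightarrow> T x \<bullet> e0 = 0"
    "\<And>A. A \<in> sets borel \<Longrightarrow> A \<subseteq> S \<inter> ball p r \<Longrightarrow> T ` A \<in> sets borel"
    by (rule almost_isometric_chart[OF p half_gt_zero[OF zero_less_one] e0]) (rule that; (assumption | simp))
  have pB: "p \<in> S \<inter> ball p r" using p T(1) by simp
  obtain k :: nat where k: "norm (T p) + 3/2 * r \<le> real k" using real_arch_simple by blast
  have "T ` (S \<inter> ball p r) \<subseteq> flat_cube (Basis - {e0}) (real k)"
  proof
    fix y assume "y \<in> T ` (S \<inter> ball p r)"
    then obtain x where x: "x \<in> S \<inter> ball p r" "y = T x" by auto
    have "norm (T x - T p) \<le> 3/2 * r"
      using T(3)[OF x(1) pB] x(1) by (simp add: dist_norm norm_minus_commute)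
    then have "norm y \<le> real k" using k norm_triangle_sub[of "T x" "T p"] unfolding x(2) by linarith
    then show "y \<in> flat_cube (Basis - {e0}) (real k)"
      using T(4)[OF x(1)] x(2) by (auto simp: flat_cube_def intro: order_trans[OF Basis_le_norm])
  qed
  then have fin: "hausdorff_outer_measure (DIM('a) - 1) (T ` (S \<inter> ball p r)) < top"
    using hausdorff_flat_cube_finite[of "Basis - {e0}" k] e0
    by (auto intro: le_less_trans[OF hausdorff_outer_measure_mono])
  have "hausdorff_outer_measure (DIM('a) - 1) (S \<inter> ball p r)
      \<le> ennreal ((1 / (1 - 1/2)) ^ (DIM('a) - 1)) * hausdorff_outer_measure (DIM('a) - 1) (T ` (S \<inter> ball p r))"
    using T(2) by (intro hausdorff_outer_measure_expanding) auto
  also have "\<dots> < top" using fin by (simp add: ennreal_mult_less_top)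
  finally show ?thesis using T(1) by blast
qed

text \<open>The almost isometric chart times the identity of the line carries
  \<open>A \<times> B\<close> to a flat product, where the formula is exact. Passing to the flat
  picture and back costs powers of \<open>1 + \<epsilon>\<close> and
  \<open>1 / (1 - \<epsilon>)\<close>, all absorbed in \<open>\<kappa>\<close>.\<close>

lemma cylinder_measure_local:
  fixes e0 :: 'a
  assumes p: "p \<in> S" and eps: "0 < \<epsilon>" "\<epsilon> < 1" and e0: "e0 \<in> Basis"
    and flat: "\<And>A (B::real set). A \<in> sets borel \<Longrightarrow> B \<in> sets borel \<Longrightarrow> A \<subseteq> {x::'a. x \<bullet> e0 = 0} \<Longrightarrow>
      hausdorff_outer_measure DIM('a) (A \<times> B) = ennreal c * hausdorff_outer_measure (DIM('a) - 1) A * emeasure lborel B"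
  defines "\<kappa> \<equiv> ennreal (((1 + \<epsilon>) / (1 - \<epsilon>)) ^ DIM('a))"
  shows "\<exists>r>0. \<forall>A\<in>sets borel. \<forall>B\<in>sets borel. A \<subseteq> S \<inter> ball p r \<longrightarrow>
    hausdorff_outer_measure DIM('a) (A \<times> (B::real set))
      \<le> \<kappa> * (ennreal c * hausdorff_outer_measure (DIM('a) - 1) A * emeasure lborel B) \<and>
    ennreal c * hausdorff_outer_measure (DIM('a) - 1) A * emeasure lborel B
      \<le> \<kappa> * hausdorff_outer_measure DIM('a) (A \<times> B)"
proof -
  obtain r and T :: "'a \<Rightarrow> 'a" where T: "r > 0"
    "\<And>x y. x \<in> S \<inter> ball p r \<Longrightarrow> y \<in> S \<inter> ball p r \<Longrightarrow> (1 - \<epsilon>) * dist x y \<le> dist (T x) (T y)"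
    "\<And>x y. x \<in> S \<inter> ball p r \<Longrightarrow> y \<in> S \<inter> ball p r \<Longrightarrow> dist (T x) (T y) \<le> (1 + \<epsilon>) * dist x y"
    "\<And>x. x \<in> S \<inter> ball p r \<Longrightarrow> T x \<bullet> e0 = 0"
    "\<And>A. A \<in> sets borel \<Longrightarrow> A \<subseteq> S \<inter> ball p r \<Longrightarrow> T ` A \<in> sets borel"
    by (rule almost_isometric_chart[OF p eps(1) e0]) (rule that; (assumption | simp))
  have main: "hausdorff_outer_measure DIM('a) (A \<times> (B::real set))
      \<le> \<kappa> * (ennreal c * hausdorff_outer_measure (DIM('a) - 1) A * emeasure lborel B) \<and>
    ennreal c * hausdorff_outer_measure (DIM('a) - 1) A * emeasure lborel B
      \<le> \<kappa> * hausdorff_outer_measure DIM('a) (A \<times> B)"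
    if A: "A \<in> sets borel" and B: "B \<in> sets borel" and AS: "A \<subseteq> S \<inter> ball p r" for A B
  proof -
    define n where "n = DIM('a) - 1"
    have DIM: "DIM('a) = Suc n" using DIM_positive[where 'a='a] by (simp add: n_def)
    define a where "a = 1 / (1 - \<epsilon>)"
    define b where "b = 1 + \<epsilon>"
    have ab: "1 \<le> a" "1 \<le> b" using eps by (auto simp: a_def b_def)
    have \<kappa>: "\<kappa> = ennreal (a ^ Suc n * b ^ Suc n)"
      unfolding \<kappa>_def DIM a_def b_def by (simp only: power_divide power_one times_divide_eq_left mult_1)
    define T' where "T' = (\<lambda>z. (T (fst z), snd z :: real))"
    have imT': "T' ` (A \<times> B) = (T ` A) \<times> B"
      by (auto simp: T'_def image_iff)
    have lo: "(1 - \<epsilon>) * dist x y \<le> dist (T x) (T y)" and hi: "dist (T x) (T y) \<le> (1 + \<epsilon>) * dist x y"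
      if "x \<in> A" "y \<in> A" for x y
      using T(2,3)[OF subsetD[OF AS that(1)] subsetD[OF AS that(2)]] by simp_all
    have lo': "(1 - \<epsilon>) * dist x y \<le> dist (T' x) (T' y)" and hi': "dist (T' x) (T' y) \<le> (1 + \<epsilon>) * dist x y"
      if "x \<in> A \<times> B" "y \<in> A \<times> B" for x y
      using that eps dist_Pair_ge[of "1 - \<epsilon>" "fst x" "fst y" "T (fst x)" "T (fst y)" "snd x" "snd y"]
        dist_Pair_le[of "1 + \<epsilon>" "T (fst x)" "T (fst y)" "fst x" "fst y" "snd x" "snd y"]
        lo[of "fst x" "fst y"] hi[of "fst x" "fst y"]
      by (auto simp: T'_def)
    let ?H = "hausdorff_outer_measure n" and ?H' = "hausdorff_outer_measure (Suc n)"
    have flat': "?H' (T ` A \<times> B) = ennreal c * ?H (T ` A) * emeasure lborel B"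
    proof -
      have "T ` A \<subseteq> {x. x \<bullet> e0 = 0}" using T(4)[OF subsetD[OF AS]] by auto
      from flat[OF T(5)[OF A AS] B this] show ?thesis by (simp add: DIM)
    qed
    have 1: "?H' (A \<times> B) \<le> ennreal (a ^ Suc n) * ?H' (T ` A \<times> B)"
      using hausdorff_outer_measure_expanding[of "1 - \<epsilon>" "A \<times> B" T' "Suc n"] lo' eps
      unfolding imT' a_def by simp
    have 2: "?H (T ` A) \<le> ennreal (b ^ n) * ?H A"
      unfolding b_def using hi eps by (intro hausdorff_outer_measure_lipschitz_image) auto
    have 3: "?H A \<le> ennreal (a ^ n) * ?H (T ` A)"
      unfolding a_def using lo eps by (intro hausdorff_outer_measure_expanding) auto
    have 4: "?H' (T ` A \<times> B) \<le> ennreal (b ^ Suc n) * ?H' (A \<times> B)"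
      using hausdorff_outer_measure_lipschitz_image[of "1 + \<epsilon>" "A \<times> B" T' "Suc n"] hi' eps
      unfolding imT' b_def by simp
    have "?H' (A \<times> B) \<le> ennreal (a ^ Suc n) * (ennreal c * (ennreal (b ^ n) * ?H A) * emeasure lborel B)"
      using 1 2 unfolding flat' by (meson mult_left_mono mult_right_mono order_trans zero_le)
    also have "\<dots> = ennreal (a ^ Suc n * b ^ n) * (ennreal c * ?H A * emeasure lborel B)"
      using ab by (simp add: ennreal_mult mult_ac)
    also have "\<dots> \<le> \<kappa> * (ennreal c * ?H A * emeasure lborel B)"
      unfolding \<kappa> using ab by (intro mult_right_mono ennreal_leI mult_left_mono power_increasing) auto
    finally have I: "?H' (A \<times> B) \<le> \<kappa> * (ennreal c * ?H A * emeasure lborel B)" .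
    have "ennreal c * ?H A * emeasure lborel B \<le> ennreal c * (ennreal (a ^ n) * ?H (T ` A)) * emeasure lborel B"
      using 3 by (intro mult_left_mono mult_right_mono) auto
    also have "\<dots> = ennreal (a ^ n) * ?H' (T ` A \<times> B)" unfolding flat' by (simp add: mult_ac)
    also have "\<dots> \<le> ennreal (a ^ n) * (ennreal (b ^ Suc n) * ?H' (A \<times> B))"
      using 4 by (intro mult_left_mono) auto
    also have "\<dots> = ennreal (a ^ n * b ^ Suc n) * ?H' (A \<times> B)" using ab by (simp add: ennreal_mult mult_ac)
    also have "\<dots> \<le> \<kappa> * ?H' (A \<times> B)"
      unfolding \<kappa> using ab by (intro mult_right_mono ennreal_leI power_increasing) auto
    finally have II: "ennreal c * ?H A * emeasure lborel B \<le> \<kappa> * ?H' (A \<times> B)" .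
    show ?thesis using I II by (simp add: DIM)
  qed
  show ?thesis using T(1) main by blast
qed

end

text \<open>On the ambient type but carried by \<open>S\<close>. For a hypersurface it is
  \<sigma>-finite, as Fubini's theorem demands, whereas the Hausdorff measure of this dimension on
  the whole ambient space is not.\<close>

definition surface_measure :: "'a::euclidean_space set \<Rightarrow> 'a measure" where
  "surface_measure S = density (hausdorff_measure (DIM('a) - 1)) (indicator S)"

lemma sets_surface_measure [simp, measurable_cong]: "sets (surface_measure S) = sets borel"
  and space_surface_measure [simp]: "space (surface_measure S) = UNIV"
  by (simp_all add: surface_measure_def)

context hypersurface
begin

lemma emeasure_surface_measure:
  assumes "A \<in> sets borel"
  shows "emeasure (surface_measure S) A = hausdorff_outer_measure (DIM('a) - 1) (S \<inter> A)"
  unfolding surface_measure_def using assms borel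
  by (subst emeasure_restricted) (auto simp: emeasure_hausdorff_measure)

lemma surface_measure_partition:
  obtains D :: "nat \<Rightarrow> 'a set" where "\<And>i. D i \<in> sets borel" "disjoint_family D" "(\<Union>i. D i) = S"
    "\<And>i. emeasure (surface_measure S) (D i) < top"
proof -
  have "\<exists>r. \<forall>p\<in>S. r p > 0 \<and> hausdorff_outer_measure (DIM('a) - 1) (S \<inter> ball p (r p)) < top"
    using hausdorff_locally_finite by (intro bchoice) blast
  then obtain r where r: "\<And>p. p \<in> S \<Longrightarrow> r p > 0"
    "\<And>p. p \<in> S \<Longrightarrow> hausdorff_outer_measure (DIM('a) - 1) (S \<inter> ball p (r p)) < top" by blast
  obtain D :: "nat \<Rightarrow> 'a set" where D: "\<And>i. D i \<in> sets borel" "disjoint_family D" "(\<Union>i. D i) = S"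
    "\<And>i. D i \<noteq> {} \<Longrightarrow> \<exists>p\<in>S. D i \<subseteq> S \<inter> ball p (r p)"
    by (rule countable_partition[of r]) (rule r(1), assumption, (rule that; (assumption | simp)))
  show thesis
  proof (rule that[OF D(1-3)])
    fix i
    show "emeasure (surface_measure S) (D i) < top"
    proof (cases "D i = {}")
      case False
      then obtain p where p: "p \<in> S" "D i \<subseteq> S \<inter> ball p (r p)" using D(4) by blast
      have "emeasure (surface_measure S) (D i) \<le> hausdorff_outer_measure (DIM('a) - 1) (S \<inter> ball p (r p))"
        unfolding emeasure_surface_measure[OF D(1)] using p(2) by (intro hausdorff_outer_measure_mono) auto
      then show ?thesis using r(2)[OF p(1)] by (rule le_less_trans)
    qed simp
  qed
qed

lemma sigma_finite_surface_measure: "sigma_finite_measure (surface_measure S)"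
proof -
  obtain D :: "nat \<Rightarrow> 'a set" where D: "\<And>i. D i \<in> sets borel" "disjoint_family D" "(\<Union>i. D i) = S"
    "\<And>i. emeasure (surface_measure S) (D i) < top"
    by (rule surface_measure_partition) (rule that; (assumption | simp))
  have "emeasure (surface_measure S) (- S) = 0" using borel by (simp add: emeasure_surface_measure)
  moreover have "emeasure (surface_measure S) (D i) \<noteq> top" for i using D(4)[of i] by simp
  moreover have "\<Union> (insert (- S) (range D)) = UNIV" using D(3) by auto
  ultimately show ?thesis using D(1) borel
    by (intro sigma_finite_measure.intro exI[of _ "insert (- S) (range D)"]) auto
qed

lemma surface_measure_compact_finite:
  assumes K: "compact K" "K \<subseteq> S"
  shows "emeasure (surface_measure S) K < top"
proof -
  have "\<exists>r. \<forall>p\<in>S. r p > 0 \<and> hausdorff_outer_measure (DIM('a) - 1) (S \<inter> ball p (r p)) < top"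
    using hausdorff_locally_finite by (intro bchoice) blast
  then obtain r where r: "\<And>p. p \<in> S \<Longrightarrow> r p > 0"
    "\<And>p. p \<in> S \<Longrightarrow> hausdorff_outer_measure (DIM('a) - 1) (S \<inter> ball p (r p)) < top" by blast
  have "K \<subseteq> (\<Union>p\<in>K. ball p (r p))" using r(1) K(2) by force
  from compactE_image[OF K(1) _ this] obtain F where F: "F \<subseteq> K" "finite F" "K \<subseteq> (\<Union>p\<in>F. ball p (r p))"
    by (metis open_ball)
  have "emeasure (surface_measure S) K \<le> emeasure (surface_measure S) (\<Union>p\<in>F. ball p (r p))"
    using F by (intro emeasure_mono) auto
  also have "\<dots> \<le> (\<Sum>p\<in>F. emeasure (surface_measure S) (ball p (r p)))"
    using F(2) by (intro emeasure_subadditive_finite) auto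
  also have "\<dots> < top"
    using F(1,2) K(2) r(2) by (auto simp: ennreal_sum_less_top emeasure_surface_measure subset_eq)
  finally show ?thesis .
qed

text \<open>The local comparison up to the factor \<open>\<kappa>\<close> adds up over a countable
  partition of \<open>A\<close>, and then \<open>\<epsilon>\<close> tends to \<open>0\<close>. The
  partition depends on \<open>\<epsilon>\<close>, but the two sides compared do not.\<close>

lemma cylinder_measure_times:
  fixes e0 :: 'a
  assumes e0: "e0 \<in> Basis" and c: "c \<ge> 0"
    and flat: "\<And>A (B::real set). A \<in> sets borel \<Longrightarrow> B \<in> sets borel \<Longrightarrow> A \<subseteq> {x::'a. x \<bullet> e0 = 0} \<Longrightarrow>
      hausdorff_outer_measure DIM('a) (A \<times> B) = ennreal c * hausdorff_outer_measure (DIM('a) - 1) A * emeasure lborel B"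
    and A: "A \<in> sets borel" "A \<subseteq> S" and B: "B \<in> sets borel"
  shows "hausdorff_outer_measure DIM('a) (A \<times> (B::real set))
    = ennreal c * hausdorff_outer_measure (DIM('a) - 1) A * emeasure lborel B"
proof -
  let ?L = "hausdorff_outer_measure DIM('a) (A \<times> B)"
  let ?R = "ennreal c * hausdorff_outer_measure (DIM('a) - 1) A * emeasure lborel B"
  have bound: "?L \<le> \<kappa> * ?R \<and> ?R \<le> \<kappa> * ?L"
    if eps: "0 < \<epsilon>" "\<epsilon> < 1" and \<kappa>: "\<kappa> = ennreal (((1 + \<epsilon>) / (1 - \<epsilon>)) ^ DIM('a))" for \<epsilon> \<kappa>
  proof -
    let ?P = "\<lambda>A. hausdorff_outer_measure DIM('a) (A \<times> B)
      \<le> \<kappa> * (ennreal c * hausdorff_outer_measure (DIM('a) - 1) A * emeasure lborel B) \<and>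
      ennreal c * hausdorff_outer_measure (DIM('a) - 1) A * emeasure lborel B
      \<le> \<kappa> * hausdorff_outer_measure DIM('a) (A \<times> B)"
    have "\<exists>r>0. \<forall>A\<in>sets borel. A \<subseteq> S \<inter> ball p r \<longrightarrow> ?P A" if pS: "p \<in> S" for p
    proof -
      obtain r where "r > 0" and r: "\<forall>A\<in>sets borel. \<forall>B\<in>sets borel. A \<subseteq> S \<inter> ball p r \<longrightarrow>
        hausdorff_outer_measure DIM('a) (A \<times> (B::real set))
          \<le> \<kappa> * (ennreal c * hausdorff_outer_measure (DIM('a) - 1) A * emeasure lborel B) \<and>
        ennreal c * hausdorff_outer_measure (DIM('a) - 1) A * emeasure lborel B
          \<le> \<kappa> * hausdorff_outer_measure DIM('a) (A \<times> B)"
        using cylinder_measure_local[OF pS eps e0 flat] unfolding \<kappa> by blast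
      have "?P A" if "A \<in> sets borel" "A \<subseteq> S \<inter> ball p r" for A
        using r[rule_format, OF that(1) B that(2)] .
      then show ?thesis using \<open>r > 0\<close> by blast
    qed
    then have "\<exists>r. \<forall>p\<in>S. r p > 0 \<and> (\<forall>A\<in>sets borel. A \<subseteq> S \<inter> ball p (r p) \<longrightarrow> ?P A)"
      by (intro bchoice) blast
    then obtain r where r: "\<And>p. p \<in> S \<Longrightarrow> r p > 0"
      "\<And>p A. p \<in> S \<Longrightarrow> A \<in> sets borel \<Longrightarrow> A \<subseteq> S \<inter> ball p (r p) \<Longrightarrow> ?P A" by blast
    obtain D :: "nat \<Rightarrow> 'a set" where D: "\<And>i. D i \<in> sets borel" "disjoint_family D" "(\<Union>i. D i) = S"
      "\<And>i. D i \<noteq> {} \<Longrightarrow> \<exists>p\<in>S. D i \<subseteq> S \<inter> ball p (r p)"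
      by (rule countable_partition[of r]) (rule r(1), assumption, (rule that; (assumption | simp)))
    define E where "E = (\<lambda>i. A \<inter> D i)"
    have E: "\<And>i. E i \<in> sets borel" "disjoint_family E" "(\<Union>i. E i) = A"
      subgoal using A(1) D(1) by (simp add: E_def)
      subgoal using D(2) unfolding disjoint_family_on_def E_def by blast
      subgoal using A(2) D(3) unfolding E_def by blast
      done
    have EP: "?P (E i)" for i
    proof (cases "E i = {}")
      case False
      then obtain p where "p \<in> S" "D i \<subseteq> S \<inter> ball p (r p)" using D(4)[of i] by (auto simp: E_def)
      then show ?thesis using r(2)[of p "E i"] E(1)[of i] by (auto simp: E_def)
    qed simp
    have EB: "E i \<times> B \<in> sets borel" for i
      unfolding borel_prod[symmetric] using E(1) B by (intro pair_measureI) auto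
    have sumL: "?L = (\<Sum>i. hausdorff_outer_measure DIM('a) (E i \<times> B))"
    proof -
      have "(\<Sum>i. emeasure (hausdorff_measure DIM('a)) (E i \<times> B))
          = emeasure (hausdorff_measure DIM('a)) (\<Union>i. E i \<times> B)"
        using EB E(2) by (intro suminf_emeasure) (auto simp: disjoint_family_on_def)
      moreover have "(\<Union>i. E i \<times> B) = A \<times> B" using E(3) by auto
      moreover have "A \<times> B \<in> sets borel"
        unfolding borel_prod[symmetric] using A B by (intro pair_measureI) auto
      ultimately show ?thesis using EB by (simp add: emeasure_hausdorff_measure)
    qed
    have sumR: "?R = (\<Sum>i. ennreal c * hausdorff_outer_measure (DIM('a) - 1) (E i) * emeasure lborel B)"
    proof -
      have "(\<Sum>i. emeasure (hausdorff_measure (DIM('a) - 1)) (E i))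
          = emeasure (hausdorff_measure (DIM('a) - 1)) (\<Union>i. E i)"
        using E by (intro suminf_emeasure) auto
      then have "hausdorff_outer_measure (DIM('a) - 1) A = (\<Sum>i. hausdorff_outer_measure (DIM('a) - 1) (E i))"
        using E A by (simp add: emeasure_hausdorff_measure)
      then show ?thesis by (simp add: ennreal_suminf_multc ennreal_suminf_cmult)
    qed
    have "?L \<le> (\<Sum>i. \<kappa> * (ennreal c * hausdorff_outer_measure (DIM('a) - 1) (E i) * emeasure lborel B))"
      unfolding sumL using EP by (intro suminf_le) auto
    moreover have "?R \<le> (\<Sum>i. \<kappa> * hausdorff_outer_measure DIM('a) (E i \<times> B))"
      unfolding sumR using EP by (intro suminf_le) auto
    ultimately show ?thesis by (simp only: ennreal_suminf_cmult sumL[symmetric] sumR[symmetric])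
  qed
  \<comment> \<open>Here \<open>\<epsilon> = 1 / (i + 2)\<close>, shifted by \<open>2\<close> so
    that \<open>\<epsilon> < 1\<close> for every \<open>i\<close>.\<close>
  define \<kappa> where "\<kappa> = (\<lambda>i::nat. ennreal (((1 + 1 / real (i + 2)) / (1 - 1 / real (i + 2))) ^ DIM('a)))"
  have \<kappa>: "\<kappa> \<longlonglongrightarrow> 1"
  proof -
    have "(\<lambda>i::nat. 1 / real (i + 2)) \<longlonglongrightarrow> 0"
      using LIMSEQ_ignore_initial_segment[OF lim_1_over_n, of 2] by simp
    then have "(\<lambda>i::nat. ((1 + 1 / real (i + 2)) / (1 - 1 / real (i + 2))) ^ DIM('a)) \<longlonglongrightarrow> ((1 + 0) / (1 - 0)) ^ DIM('a)"
      by (intro tendsto_intros) auto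
    from tendsto_ennrealI[OF this] show ?thesis by (simp add: \<kappa>_def)
  qed
  have b: "?L \<le> \<kappa> i * ?R \<and> ?R \<le> \<kappa> i * ?L" for i
    by (rule bound[of "1 / real (i + 2)"]) (auto simp: \<kappa>_def)
  have lim: "(\<lambda>i. \<kappa> i * x) \<longlonglongrightarrow> x" for x
    using tendsto_mult_ennreal[OF \<kappa> tendsto_const[of x]] by simp
  show ?thesis
  proof (rule antisym)
    show "?L \<le> ?R" by (rule LIMSEQ_le_const[OF lim]) (use b in auto)
    show "?R \<le> ?L" by (rule LIMSEQ_le_const[OF lim]) (use b in auto)
  qed
qed

proposition surface_measure_cylinder:
  obtains c :: real where "c \<ge> 0"
    "surface_measure cylinder = density (surface_measure S) (\<lambda>_. ennreal c) \<Otimes>\<^sub>M lborel"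
proof -
  interpret cyl: hypersurface cylinder by (rule hypersurface_cylinder)
  obtain e0 :: 'a where e0: "e0 \<in> Basis" using nonempty_Basis by blast
  obtain c :: real where c: "c \<ge> 0"
    "\<And>A (B::real set). A \<in> sets borel \<Longrightarrow> B \<in> sets borel \<Longrightarrow> A \<subseteq> {x::'a. x \<bullet> e0 = 0} \<Longrightarrow>
      hausdorff_outer_measure DIM('a) (A \<times> B) = ennreal c * hausdorff_outer_measure (DIM('a) - 1) A * emeasure lborel B"
    by (rule hausdorff_flat_product[OF e0]) (rule that; (assumption | simp))
  let ?M = "density (surface_measure S) (\<lambda>_. ennreal c)"
  interpret sm: sigma_finite_measure "surface_measure S" by (rule sigma_finite_surface_measure)
  have emM: "emeasure ?M A = ennreal c * emeasure (surface_measure S) A" if "A \<in> sets borel" for A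
    using that by (subst emeasure_density) (auto simp: nn_integral_cmult)
  have sf: "sigma_finite_measure ?M"
    by (rule sm.sigma_finite_iff_density_finite[THEN iffD2]) auto
  have "?M \<Otimes>\<^sub>M lborel = surface_measure cylinder"
  proof (rule pair_measure_eqI[OF sf sigma_finite_lborel])
    show "sets (?M \<Otimes>\<^sub>M lborel) = sets (surface_measure cylinder)"
      unfolding sets_surface_measure borel_prod[symmetric] by (intro sets_pair_measure_cong) auto
    fix A :: "'a set" and B :: "real set" assume "A \<in> sets ?M" "B \<in> sets lborel"
    then have AB: "A \<in> sets borel" "B \<in> sets borel" by auto
    then have "A \<times> B \<in> sets borel" unfolding borel_prod[symmetric] by (intro pair_measureI)
    then have "emeasure (surface_measure cylinder) (A \<times> B)
        = hausdorff_outer_measure DIM('a) ((S \<inter> A) \<times> B)"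
      by (subst cyl.emeasure_surface_measure) (auto simp: Times_Int_Times)
    also have "\<dots> = ennreal c * hausdorff_outer_measure (DIM('a) - 1) (S \<inter> A) * emeasure lborel B"
      using AB borel by (intro cylinder_measure_times[OF e0 c]) auto
    also have "\<dots> = emeasure ?M A * emeasure lborel B"
      using AB by (simp add: emM emeasure_surface_measure)
    finally show "emeasure ?M A * emeasure lborel B = emeasure (surface_measure cylinder) (A \<times> B)" ..
  qed
  then show thesis using c(1) that by metis
qed

end

section \<open>A Poincare inequality with Gaussian weight\<close>

text \<open>Integrating \<open>\<psi>'\<close> for a suitable \<open>\<psi>\<close> that vanishes at \<open>a\<close> and is nonnegative at \<open>b\<close> turns a
  pointwise estimate into an integral one.\<close>

lemma poincare_from_primitive:
  fixes h h' :: "real \<Rightarrow> real"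
  assumes ab: "a \<le> b" and h: "\<And>t. (h has_real_derivative h' t) (at t)" and h': "continuous_on UNIV h'"
    and \<psi>: "\<And>t. (\<psi> has_real_derivative \<psi>' t) (at t)" "\<psi> a = 0" "\<psi> b \<ge> 0"
    and le: "\<And>t. a \<le> t \<Longrightarrow> t \<le> b \<Longrightarrow>
      \<psi>' t \<le> \<beta> * ((h' t)\<^sup>2 * exp (- t\<^sup>2 / 4)) - \<alpha> * ((h t - h a)\<^sup>2 * exp (- t\<^sup>2 / 4))"
  shows "\<alpha> * integral {a..b} (\<lambda>t. (h t - h a)\<^sup>2 * exp (- t\<^sup>2 / 4))
    \<le> \<beta> * integral {a..b} (\<lambda>t. (h' t)\<^sup>2 * exp (- t\<^sup>2 / 4))"
proof -
  have ch: "continuous_on UNIV h" using h DERIV_isCont continuous_at_imp_continuous_on by blast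
  have i1: "(\<lambda>t. (h t - h a)\<^sup>2 * exp (- t\<^sup>2 / 4)) integrable_on {a..b}"
    by (intro integrable_continuous_real continuous_intros continuous_on_subset[OF ch]) auto
  have i2: "(\<lambda>t. (h' t)\<^sup>2 * exp (- t\<^sup>2 / 4)) integrable_on {a..b}"
    by (intro integrable_continuous_real continuous_intros continuous_on_subset[OF h']) auto
  have "(\<psi>' has_integral \<psi> b - \<psi> a) {a..b}"
    using ab \<psi>(1) by (intro fundamental_theorem_of_calculus)
      (auto simp: has_real_derivative_iff_has_vector_derivative[symmetric] intro: has_field_derivative_at_within)
  moreover have "((\<lambda>t. \<beta> * ((h' t)\<^sup>2 * exp (- t\<^sup>2 / 4)) - \<alpha> * ((h t - h a)\<^sup>2 * exp (- t\<^sup>2 / 4))) has_integral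
      \<beta> * integral {a..b} (\<lambda>t. (h' t)\<^sup>2 * exp (- t\<^sup>2 / 4)) - \<alpha> * integral {a..b} (\<lambda>t. (h t - h a)\<^sup>2 * exp (- t\<^sup>2 / 4))) {a..b}"
    using i1 i2 by (intro has_integral_diff has_integral_mult_right integrable_integral)
  ultimately have "\<psi> b - \<psi> a \<le> \<beta> * integral {a..b} (\<lambda>t. (h' t)\<^sup>2 * exp (- t\<^sup>2 / 4)) - \<alpha> * integral {a..b} (\<lambda>t. (h t - h a)\<^sup>2 * exp (- t\<^sup>2 / 4))"
    by (rule has_integral_le) (use le in auto)
  then show ?thesis using \<psi> by simp
qed

text \<open>The factor \<open>b - t\<close> makes \<open>\<psi>\<close> vanish at \<open>b\<close>
  too. For \<open>0 \<le> a\<close> the derivative of the Gaussian contributes a term of favourable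
  sign, which is dropped, so the constant depends on the length of the interval only.\<close>

lemma poincare_interval:
  fixes h h' :: "real \<Rightarrow> real"
  assumes ab: "0 \<le> a" "a \<le> b" and h: "\<And>t. (h has_real_derivative h' t) (at t)" and h': "continuous_on UNIV h'"
  shows "integral {a..b} (\<lambda>t. (h t - h a)\<^sup>2 * exp (- t\<^sup>2 / 4))
    \<le> 4 * (b - a)\<^sup>2 * integral {a..b} (\<lambda>t. (h' t)\<^sup>2 * exp (- t\<^sup>2 / 4))"
proof -
  let ?\<gamma> = "\<lambda>t::real. exp (- t\<^sup>2 / 4)"
  have "1/2 * integral {a..b} (\<lambda>t. (h t - h a)\<^sup>2 * ?\<gamma> t) \<le> 2 * (b - a)\<^sup>2 * integral {a..b} (\<lambda>t. (h' t)\<^sup>2 * ?\<gamma> t)"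
  proof (rule poincare_from_primitive[OF ab(2) h h', where \<psi>="\<lambda>t. (b - t) * ((h t - h a)\<^sup>2 * ?\<gamma> t)" and
        \<psi>'="\<lambda>t. - ((h t - h a)\<^sup>2 * ?\<gamma> t) + (b - t) * (2 * (h t - h a) * h' t * ?\<gamma> t - t / 2 * (h t - h a)\<^sup>2 * ?\<gamma> t)"])
    fix t
    show "((\<lambda>t. (b - t) * ((h t - h a)\<^sup>2 * ?\<gamma> t)) has_real_derivative
        - ((h t - h a)\<^sup>2 * ?\<gamma> t) + (b - t) * (2 * (h t - h a) * h' t * ?\<gamma> t - t / 2 * (h t - h a)\<^sup>2 * ?\<gamma> t)) (at t)"
      by (auto intro!: derivative_eq_intros h simp: field_simps power2_eq_square)
  next
    fix t assume t: "a \<le> t" "t \<le> b"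
    define x where "x = h t - h a"
    define y where "y = (b - t) * h' t"
    define K where "K = (b - a)\<^sup>2 * (h' t)\<^sup>2"
    have "(b - t) * (t / 2 * x\<^sup>2) \<ge> 0" using t ab by simp
    moreover have "(b - t) * (2 * x * h' t - t / 2 * x\<^sup>2) = 2 * x * y - (b - t) * (t / 2 * x\<^sup>2)"
      by (simp add: y_def algebra_simps)
    moreover have "0 \<le> (x - 2 * y)\<^sup>2" by simp
    then have "2 * x * y \<le> x\<^sup>2 / 2 + 2 * y\<^sup>2" by (simp add: power2_eq_square algebra_simps)
    moreover have "y\<^sup>2 \<le> K"
      unfolding K_def y_def power_mult_distrib using t ab by (intro mult_right_mono power_mono) auto
    ultimately have "- x\<^sup>2 + (b - t) * (2 * x * h' t - t / 2 * x\<^sup>2) \<le> 2 * (b - a)\<^sup>2 * (h' t)\<^sup>2 - 1/2 * x\<^sup>2"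
      unfolding mult.assoc[of 2 "(b - a)\<^sup>2"] K_def[symmetric] by linarith
    then have "(- x\<^sup>2 + (b - t) * (2 * x * h' t - t / 2 * x\<^sup>2)) * ?\<gamma> t \<le> (2 * (b - a)\<^sup>2 * (h' t)\<^sup>2 - 1/2 * x\<^sup>2) * ?\<gamma> t"
      by (rule mult_right_mono) simp
    then show "- ((h t - h a)\<^sup>2 * ?\<gamma> t) + (b - t) * (2 * (h t - h a) * h' t * ?\<gamma> t - t / 2 * (h t - h a)\<^sup>2 * ?\<gamma> t)
        \<le> 2 * (b - a)\<^sup>2 * ((h' t)\<^sup>2 * ?\<gamma> t) - 1/2 * ((h t - h a)\<^sup>2 * ?\<gamma> t)"
      unfolding x_def by (simp add: algebra_simps)
  qed auto
  then show ?thesis by simp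
qed

text \<open>Now the derivative of the Gaussian does the work: it contributes at most
  \<open>- a / 2\<close> times the square, and half of that absorbs the mixed term. The constant
  does not grow with \<open>b\<close> and becomes small for large \<open>a\<close>.\<close>

lemma poincare_tail:
  fixes h h' :: "real \<Rightarrow> real"
  assumes ab: "0 < a" "a \<le> b" and h: "\<And>t. (h has_real_derivative h' t) (at t)" and h': "continuous_on UNIV h'"
  shows "integral {a..b} (\<lambda>t. (h t - h a)\<^sup>2 * exp (- t\<^sup>2 / 4))
    \<le> 16 / a\<^sup>2 * integral {a..b} (\<lambda>t. (h' t)\<^sup>2 * exp (- t\<^sup>2 / 4))"
proof -
  let ?\<gamma> = "\<lambda>t::real. exp (- t\<^sup>2 / 4)"
  have "a / 4 * integral {a..b} (\<lambda>t. (h t - h a)\<^sup>2 * ?\<gamma> t) \<le> 4 / a * integral {a..b} (\<lambda>t. (h' t)\<^sup>2 * ?\<gamma> t)"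
  proof (rule poincare_from_primitive[OF ab(2) h h', where \<psi>="\<lambda>t. (h t - h a)\<^sup>2 * ?\<gamma> t" and
        \<psi>'="\<lambda>t. 2 * (h t - h a) * h' t * ?\<gamma> t - t / 2 * (h t - h a)\<^sup>2 * ?\<gamma> t"])
    fix t
    show "((\<lambda>t. (h t - h a)\<^sup>2 * ?\<gamma> t) has_real_derivative
        2 * (h t - h a) * h' t * ?\<gamma> t - t / 2 * (h t - h a)\<^sup>2 * ?\<gamma> t) (at t)"
      by (auto intro!: derivative_eq_intros h simp: algebra_simps power2_eq_square)
  next
    fix t assume t: "a \<le> t" "t \<le> b"
    define x where "x = h t - h a"
    have "0 \<le> (a * x / 4 - h' t)\<^sup>2 * (4 / a)" using ab by simp
    also have "\<dots> = a / 4 * x\<^sup>2 - 2 * x * h' t + 4 / a * (h' t)\<^sup>2"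
      using ab by (simp add: power2_eq_square field_simps)
    finally have "2 * x * h' t \<le> a / 4 * x\<^sup>2 + 4 / a * (h' t)\<^sup>2" by simp
    moreover have "a / 2 * x\<^sup>2 \<le> t / 2 * x\<^sup>2" using t by (intro mult_right_mono) auto
    ultimately have "2 * x * h' t - t / 2 * x\<^sup>2 \<le> 4 / a * (h' t)\<^sup>2 - a / 4 * x\<^sup>2" by simp
    then have "(2 * x * h' t - t / 2 * x\<^sup>2) * ?\<gamma> t \<le> (4 / a * (h' t)\<^sup>2 - a / 4 * x\<^sup>2) * ?\<gamma> t"
      by (rule mult_right_mono) simp
    then show "2 * (h t - h a) * h' t * ?\<gamma> t - t / 2 * (h t - h a)\<^sup>2 * ?\<gamma> t
        \<le> 4 / a * ((h' t)\<^sup>2 * ?\<gamma> t) - a / 4 * ((h t - h a)\<^sup>2 * ?\<gamma> t)"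
      unfolding x_def by (simp add: algebra_simps)
  qed auto
  then have "a / 4 * integral {a..b} (\<lambda>t. (h t - h a)\<^sup>2 * ?\<gamma> t) * (4 / a)
      \<le> 4 / a * integral {a..b} (\<lambda>t. (h' t)\<^sup>2 * ?\<gamma> t) * (4 / a)"
    using ab by (intro mult_right_mono) auto
  then show ?thesis using ab by (simp add: power2_eq_square mult.commute)
qed

section \<open>Gluing the intervals along a finite grid\<close>

lemma nn_integral_Ico_continuous:
  fixes f :: "real \<Rightarrow> real"
  assumes "continuous_on UNIV f" "\<And>t. f t \<ge> 0"
  shows "(\<integral>\<^sup>+t. ennreal (f t) * indicator {a..<b} t \<partial>lborel) = ennreal (integral {a..b} f)"
proof -
  have si: "set_integrable lborel {a..b} f"
    by (rule borel_integrable_atLeastAtMost') (rule continuous_on_subset[OF assms(1) subset_UNIV])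
  have "(\<integral>\<^sup>+t. ennreal (f t) * indicator {a..<b} t \<partial>lborel) = (\<integral>\<^sup>+t. ennreal (indicator {a..b} t *\<^sub>R f t) \<partial>lborel)"
    by (rule nn_integral_cong_AE, rule AE_mp[OF AE_lborel_singleton[of b]]) (auto split: split_indicator)
  also have "\<dots> = ennreal (LINT t:{a..b}|lborel. f t)"
    using si assms(2) unfolding set_integrable_def set_lebesgue_integral_def
    by (intro nn_integral_eq_integral) auto
  also have "\<dots> = ennreal (integral {a..b} f)" using si by (simp add: set_borel_integral_eq_integral)
  finally show ?thesis .
qed

text \<open>For \<open>t \<ge> 0\<close>, the left end of the cell of \<open>t\<close> in the grid
  with mesh \<open>\<rho>\<close>, where everything from \<open>N * \<rho>\<close> on forms one last
  unbounded cell.\<close>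

definition grid_index :: "real \<Rightarrow> nat \<Rightarrow> real \<Rightarrow> real" where
  "grid_index \<rho> N t = min (real N * \<rho>) (\<rho> * real_of_int \<lfloor>t / \<rho>\<rfloor>)"

text \<open>On each of the \<open>N\<close> short cells the constant of the interval inequality
  gives \<open>4 * \<rho>\<^sup>2 * C \<le> 1\<close>, and on the last cell that of the tail
  inequality gives \<open>16 * C / (N * \<rho>)\<^sup>2 \<le> 1\<close>. Half-open cells are
  disjoint and \<open>grid_index\<close> is constant on each of them, equal to its left end.\<close>

lemma poincare_half_line:
  fixes h h' :: "real \<Rightarrow> real"
  assumes \<rho>: "\<rho> > 0" "4 * \<rho>\<^sup>2 * C \<le> 1" and N: "16 * C \<le> (real N * \<rho>)\<^sup>2" "N > 0" and C: "C \<ge> 0"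
    and h: "\<And>t. (h has_real_derivative h' t) (at t)" and h': "continuous_on UNIV h'"
    and R: "real N * \<rho> \<le> R"
  shows "(\<integral>\<^sup>+t. ennreal (C * (h t - h (grid_index \<rho> N t))\<^sup>2 * exp (- t\<^sup>2 / 4)) * indicator {0..<R} t \<partial>lborel)
    \<le> (\<integral>\<^sup>+t. ennreal ((h' t)\<^sup>2 * exp (- t\<^sup>2 / 4)) * indicator {0..<R} t \<partial>lborel)"
proof -
  let ?\<gamma> = "\<lambda>t::real. exp (- t\<^sup>2 / 4)"
  let ?j = "grid_index \<rho> N"
  have ch: "continuous_on UNIV h" using h DERIV_isCont continuous_at_imp_continuous_on by blast
  have [measurable]: "h \<in> borel_measurable borel" "h' \<in> borel_measurable borel"
    using ch h' by (auto intro: borel_measurable_continuous_onI)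
  have [measurable]: "?j \<in> borel_measurable borel" unfolding grid_index_def by measurable
  define L where "L = (\<lambda>A. \<integral>\<^sup>+t. ennreal (C * (h t - h (?j t))\<^sup>2 * ?\<gamma> t) * indicator A t \<partial>lborel)"
  define M where "M = (\<lambda>A. \<integral>\<^sup>+t. ennreal ((h' t)\<^sup>2 * ?\<gamma> t) * indicator A t \<partial>lborel)"
  have piece: "L {a..<b} \<le> M {a..<b}"
    if j: "\<And>t. a \<le> t \<Longrightarrow> t < b \<Longrightarrow> ?j t = a" and
      le: "C * integral {a..b} (\<lambda>t. (h t - h a)\<^sup>2 * ?\<gamma> t) \<le> integral {a..b} (\<lambda>t. (h' t)\<^sup>2 * ?\<gamma> t)" for a b
  proof -
    have "L {a..<b} = (\<integral>\<^sup>+t. ennreal (C * ((h t - h a)\<^sup>2 * ?\<gamma> t)) * indicator {a..<b} t \<partial>lborel)"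
      unfolding L_def by (intro nn_integral_cong) (auto split: split_indicator simp: j mult.assoc)
    also have "\<dots> = ennreal (integral {a..b} (\<lambda>t. C * ((h t - h a)\<^sup>2 * ?\<gamma> t)))"
      using C by (intro nn_integral_Ico_continuous continuous_intros ch) auto
    also have "\<dots> \<le> ennreal (integral {a..b} (\<lambda>t. (h' t)\<^sup>2 * ?\<gamma> t))"
      using le by (intro ennreal_leI) simp
    also have "\<dots> = M {a..<b}"
      unfolding M_def by (intro nn_integral_Ico_continuous[symmetric] continuous_intros h') auto
    finally show ?thesis .
  qed
  have union: "L {0..<b} \<le> M {0..<b}" if "0 \<le> a" "a \<le> b" "L {0..<a} \<le> M {0..<a}" "L {a..<b} \<le> M {a..<b}" for a b
  proof -
    have ind: "indicator {0..<b} t = (indicator {0..<a} t + indicator {a..<b} t :: ennreal)" for t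
      using that(1,2) by (auto split: split_indicator)
    have "L {0..<b} = L {0..<a} + L {a..<b}" "M {0..<b} = M {0..<a} + M {a..<b}"
      unfolding L_def M_def ind distrib_left by (subst nn_integral_add; simp)+
    then show ?thesis using that(3,4) by (simp add: add_mono)
  qed
  have grid: "L {0..<real i * \<rho>} \<le> M {0..<real i * \<rho>}" if "i \<le> N" for i
    using that
  proof (induction i)
    case 0
    then show ?case by (simp add: L_def)
  next
    case (Suc i)
    have new: "L {real i * \<rho>..<real (Suc i) * \<rho>} \<le> M {real i * \<rho>..<real (Suc i) * \<rho>}"
    proof (rule piece)
      fix t assume t: "real i * \<rho> \<le> t" "t < real (Suc i) * \<rho>"
      then have "\<lfloor>t / \<rho>\<rfloor> = int i" using \<rho>(1) by (simp add: floor_eq_iff field_simps)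
      moreover have "real i * \<rho> \<le> real N * \<rho>" using Suc.prems \<rho>(1) by (intro mult_right_mono) auto
      ultimately show "?j t = real i * \<rho>" by (simp add: grid_index_def mult.commute)
    next
      have "integral {real i * \<rho>..real (Suc i) * \<rho>} (\<lambda>t. (h t - h (real i * \<rho>))\<^sup>2 * ?\<gamma> t)
          \<le> 4 * (real (Suc i) * \<rho> - real i * \<rho>)\<^sup>2 * integral {real i * \<rho>..real (Suc i) * \<rho>} (\<lambda>t. (h' t)\<^sup>2 * ?\<gamma> t)"
        using \<rho>(1) by (intro poincare_interval h h') auto
      also have "real (Suc i) * \<rho> - real i * \<rho> = \<rho>" by (simp add: algebra_simps)
      finally have "C * integral {real i * \<rho>..real (Suc i) * \<rho>} (\<lambda>t. (h t - h (real i * \<rho>))\<^sup>2 * ?\<gamma> t)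
          \<le> C * (4 * \<rho>\<^sup>2 * integral {real i * \<rho>..real (Suc i) * \<rho>} (\<lambda>t. (h' t)\<^sup>2 * ?\<gamma> t))"
        using C by (intro mult_left_mono)
      also have "\<dots> = (4 * \<rho>\<^sup>2 * C) * integral {real i * \<rho>..real (Suc i) * \<rho>} (\<lambda>t. (h' t)\<^sup>2 * ?\<gamma> t)" by simp
      also have "\<dots> \<le> 1 * integral {real i * \<rho>..real (Suc i) * \<rho>} (\<lambda>t. (h' t)\<^sup>2 * ?\<gamma> t)"
        using \<rho>(2) by (intro mult_right_mono Henstock_Kurzweil_Integration.integral_nonneg
            integrable_continuous_real continuous_intros continuous_on_subset[OF h']) auto
      finally show "C * integral {real i * \<rho>..real (Suc i) * \<rho>} (\<lambda>t. (h t - h (real i * \<rho>))\<^sup>2 * ?\<gamma> t)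
          \<le> integral {real i * \<rho>..real (Suc i) * \<rho>} (\<lambda>t. (h' t)\<^sup>2 * ?\<gamma> t)" by simp
    qed
    have "0 \<le> real i * \<rho>" "real i * \<rho> \<le> real (Suc i) * \<rho>" using \<rho>(1) by simp_all
    moreover have "L {0..<real i * \<rho>} \<le> M {0..<real i * \<rho>}" using Suc by simp
    ultimately show ?case using new by (rule union)
  qed
  define T where "T = real N * \<rho>"
  have T: "T > 0" using N \<rho> by (simp add: T_def)
  have tail: "L {T..<R} \<le> M {T..<R}"
  proof (rule piece)
    fix t assume t: "T \<le> t" "t < R"
    then have "real N \<le> t / \<rho>" using \<rho>(1) by (simp add: T_def field_simps)
    then have "int N \<le> \<lfloor>t / \<rho>\<rfloor>" by (simp add: le_floor_iff)
    then have "real N \<le> real_of_int \<lfloor>t / \<rho>\<rfloor>" by linarith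
    then have "T \<le> \<rho> * real_of_int \<lfloor>t / \<rho>\<rfloor>"
      unfolding T_def using \<rho>(1) by (simp add: mult.commute mult_left_mono)
    then show "?j t = T" by (simp add: grid_index_def T_def)
  next
    have "C * integral {T..R} (\<lambda>t. (h t - h T)\<^sup>2 * ?\<gamma> t) \<le> C * (16 / T\<^sup>2 * integral {T..R} (\<lambda>t. (h' t)\<^sup>2 * ?\<gamma> t))"
      using C T R by (intro mult_left_mono poincare_tail h h') (auto simp: T_def)
    also have "\<dots> = (16 * C / T\<^sup>2) * integral {T..R} (\<lambda>t. (h' t)\<^sup>2 * ?\<gamma> t)" by simp
    also have "\<dots> \<le> 1 * integral {T..R} (\<lambda>t. (h' t)\<^sup>2 * ?\<gamma> t)"
    proof (rule mult_right_mono)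
      show "16 * C / T\<^sup>2 \<le> 1" using N(1) T unfolding T_def by (simp only: divide_le_eq_1_pos zero_less_power)
    qed (intro Henstock_Kurzweil_Integration.integral_nonneg
          integrable_continuous_real continuous_intros continuous_on_subset[OF h']; simp)
    finally show "C * integral {T..R} (\<lambda>t. (h t - h T)\<^sup>2 * ?\<gamma> t) \<le> integral {T..R} (\<lambda>t. (h' t)\<^sup>2 * ?\<gamma> t)" by simp
  qed
  have "L {0..<R} \<le> M {0..<R}"
    using union[of T R] tail grid[of N] T R by (simp add: T_def)
  then show ?thesis by (simp add: L_def M_def)
qed

text \<open>The estimate is made on every large window \<open>{-R<..<R}\<close> and with nonnegative
  integrals, so neither side has to be known finite. For a function of compact support any window
  containing the support will do.\<close>

proposition gaussian_poincare_grid: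
  assumes C: "C \<ge> (0::real)"
  obtains T :: real and G and j :: "real \<Rightarrow> real" where "finite G" "range j \<subseteq> G" "j \<in> borel_measurable borel"
    "\<And>R h h'. T \<le> R \<Longrightarrow> (\<And>t. (h has_real_derivative h' t) (at t)) \<Longrightarrow> continuous_on UNIV h' \<Longrightarrow>
      (\<integral>\<^sup>+t. ennreal (C * (h t - h (j t))\<^sup>2 * exp (- t\<^sup>2 / 4)) * indicator {-R<..<R} t \<partial>lborel)
      \<le> (\<integral>\<^sup>+t. ennreal ((h' t)\<^sup>2 * exp (- t\<^sup>2 / 4)) * indicator {-R<..<R} t \<partial>lborel)"
proof -
  \<comment> \<open>Chosen so that \<open>4 * \<rho>\<^sup>2 * C = C / (C + 1)\<^sup>2\<close>,
    which is at most \<open>1\<close>; the \<open>+ 1\<close> also covers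
    \<open>C = 0\<close>.\<close>
  define \<rho> where "\<rho> = 1 / (2 * (C + 1))"
  have \<rho>: "\<rho> > 0" "4 * \<rho>\<^sup>2 * C \<le> 1"
  proof -
    show "\<rho> > 0" using C by (simp add: \<rho>_def)
    have "(2 * (C + 1))\<^sup>2 = 4 * (C + 1)\<^sup>2" by (simp only: power_mult_distrib) simp
    then have "4 * \<rho>\<^sup>2 * C = C / (C + 1)\<^sup>2" unfolding \<rho>_def power_divide by simp
    also have "\<dots> \<le> 1"
    proof -
      have "C \<le> (C + 1)\<^sup>2" using C by (simp add: power2_eq_square algebra_simps)
      then show ?thesis using C by (intro divide_le_eq_1_pos[THEN iffD2]) auto
    qed
    finally show "4 * \<rho>\<^sup>2 * C \<le> 1" .
  qed
  obtain N0 :: nat where N0: "(16 * C + 1) / \<rho> \<le> real N0" using real_arch_simple by blast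
  define N where "N = Suc N0"
  have N: "16 * C \<le> (real N * \<rho>)\<^sup>2" "N > 0"
  proof -
    have "16 * C + 1 \<le> real N0 * \<rho>" using N0 \<rho>(1) by (simp add: pos_divide_le_eq)
    also have "\<dots> \<le> real N * \<rho>" using \<rho>(1) by (simp add: N_def)
    finally have 1: "16 * C + 1 \<le> real N * \<rho>" .
    then have "(16 * C + 1) * 1 \<le> (real N * \<rho>) * (real N * \<rho>)" using C by (intro mult_mono) auto
    then show "16 * C \<le> (real N * \<rho>)\<^sup>2" by (simp add: power2_eq_square)
  qed (simp add: N_def)
  let ?g = "grid_index \<rho> N"
  \<comment> \<open>The half-line estimates use that the Gaussian decreases, so negative times are
    treated by applying them to \<open>h (- t)\<close>; the grid map is reflected
    accordingly.\<close>
  define j where "j = (\<lambda>t. if t \<ge> 0 then ?g t else - ?g (- t))"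
  define G where "G = (\<lambda>i. real_of_int i * \<rho>) ` {- int N..int N}"
  have g_grid: "?g t \<in> (\<lambda>i. real_of_int i * \<rho>) ` {0..int N}" if "t \<ge> 0" for t
  proof (cases "\<lfloor>t / \<rho>\<rfloor> \<le> int N")
    case True
    then have "\<rho> * real_of_int \<lfloor>t / \<rho>\<rfloor> \<le> real N * \<rho>"
      using \<rho>(1) by (simp add: mult.commute mult_left_mono)
    then have "?g t = real_of_int \<lfloor>t / \<rho>\<rfloor> * \<rho>" by (simp add: grid_index_def mult.commute)
    then show ?thesis using True that \<rho>(1) by (intro image_eqI[of _ _ "\<lfloor>t / \<rho>\<rfloor>"]) auto
  next
    case False
    then have "real N \<le> real_of_int \<lfloor>t / \<rho>\<rfloor>" by linarith
    then have "real N * \<rho> \<le> \<rho> * real_of_int \<lfloor>t / \<rho>\<rfloor>"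
      using \<rho>(1) by (simp add: mult.commute mult_left_mono)
    then have "?g t = real_of_int (int N) * \<rho>" by (simp add: grid_index_def)
    then show ?thesis by (intro image_eqI[of _ _ "int N"]) auto
  qed
  have "j t \<in> G" for t
  proof (cases "t \<ge> 0")
    case True
    then show ?thesis using g_grid[of t] by (auto simp: j_def G_def)
  next
    case False
    then obtain i where "i \<in> {0..int N}" "?g (- t) = real_of_int i * \<rho>" using g_grid[of "- t"] by auto
    then show ?thesis using False by (auto simp: j_def G_def intro!: image_eqI[of _ _ "- i"])
  qed
  then have jG: "range j \<subseteq> G" by auto
  have [measurable]: "?g \<in> borel_measurable borel" unfolding grid_index_def by measurable
  have jm [measurable]: "j \<in> borel_measurable borel" unfolding j_def by measurable
  have main: "(\<integral>\<^sup>+t. ennreal (C * (h t - h (j t))\<^sup>2 * exp (- t\<^sup>2 / 4)) * indicator {-R<..<R} t \<partial>lborel)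
      \<le> (\<integral>\<^sup>+t. ennreal ((h' t)\<^sup>2 * exp (- t\<^sup>2 / 4)) * indicator {-R<..<R} t \<partial>lborel)"
    if R: "real N * \<rho> \<le> R" and h: "\<And>t. (h has_real_derivative h' t) (at t)" and h': "continuous_on UNIV h'" for R h h'
  proof -
    have ch: "continuous_on UNIV h" using h DERIV_isCont continuous_at_imp_continuous_on by blast
    have [measurable]: "h \<in> borel_measurable borel" "h' \<in> borel_measurable borel"
      using ch h' by (auto intro: borel_measurable_continuous_onI)
    have split: "(\<integral>\<^sup>+t. f t * indicator {-R<..<R} t \<partial>lborel)
        = (\<integral>\<^sup>+t. f t * indicator {0..<R} t \<partial>lborel) + (\<integral>\<^sup>+t. f (- t) * indicator {0..<R} t \<partial>lborel)"
      if [measurable]: "f \<in> borel_measurable borel" for f :: "real \<Rightarrow> ennreal"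
    proof -
      have "(\<integral>\<^sup>+t. f t * indicator {-R<..<R} t \<partial>lborel)
          = (\<integral>\<^sup>+t. f t * indicator {0..<R} t + f t * indicator {0..<R} (- t) \<partial>lborel)"
        by (rule nn_integral_cong_AE, rule AE_mp[OF AE_lborel_singleton[of 0]]) (auto split: split_indicator)
      also have "\<dots> = (\<integral>\<^sup>+t. f t * indicator {0..<R} t \<partial>lborel) + (\<integral>\<^sup>+t. f t * indicator {0..<R} (- t) \<partial>lborel)"
        by (rule nn_integral_add) auto
      also have "(\<integral>\<^sup>+t. f t * indicator {0..<R} (- t) \<partial>lborel)
          = (\<integral>\<^sup>+t. f t * indicator {0..<R} (- t) \<partial>distr lborel borel uminus)"
        by (simp add: lborel_distr_uminus)
      also have "\<dots> = (\<integral>\<^sup>+t. f (- t) * indicator {0..<R} t \<partial>lborel)"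
        by (subst nn_integral_distr) auto
      finally show ?thesis .
    qed
    have hm: "((\<lambda>t. h (- t)) has_real_derivative - h' (- t)) (at t)" for t
      using DERIV_chain2[OF h[of "- t"] DERIV_minus[OF DERIV_ident]] by simp
    have chm: "continuous_on UNIV (\<lambda>t. - h' (- t))"
      by (intro continuous_intros continuous_on_compose2[OF h']) auto
    have 1: "(\<integral>\<^sup>+t. ennreal (C * (h t - h (j t))\<^sup>2 * exp (- t\<^sup>2 / 4)) * indicator {0..<R} t \<partial>lborel)
        \<le> (\<integral>\<^sup>+t. ennreal ((h' t)\<^sup>2 * exp (- t\<^sup>2 / 4)) * indicator {0..<R} t \<partial>lborel)"
    proof -
      have "(\<integral>\<^sup>+t. ennreal (C * (h t - h (j t))\<^sup>2 * exp (- t\<^sup>2 / 4)) * indicator {0..<R} t \<partial>lborel)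
          = (\<integral>\<^sup>+t. ennreal (C * (h t - h (?g t))\<^sup>2 * exp (- t\<^sup>2 / 4)) * indicator {0..<R} t \<partial>lborel)"
        by (intro nn_integral_cong) (auto simp: j_def split: split_indicator)
      then show ?thesis using poincare_half_line[OF \<rho> N C h h' R] by simp
    qed
    have 2: "(\<integral>\<^sup>+t. ennreal (C * (h (- t) - h (j (- t)))\<^sup>2 * exp (- (- t)\<^sup>2 / 4)) * indicator {0..<R} t \<partial>lborel)
        \<le> (\<integral>\<^sup>+t. ennreal ((h' (- t))\<^sup>2 * exp (- (- t)\<^sup>2 / 4)) * indicator {0..<R} t \<partial>lborel)"
    proof -
      have "(\<integral>\<^sup>+t. ennreal (C * (h (- t) - h (j (- t)))\<^sup>2 * exp (- (- t)\<^sup>2 / 4)) * indicator {0..<R} t \<partial>lborel)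
          = (\<integral>\<^sup>+t. ennreal (C * (h (- t) - h (- ?g t))\<^sup>2 * exp (- t\<^sup>2 / 4)) * indicator {0..<R} t \<partial>lborel)"
        by (rule nn_integral_cong_AE, rule AE_mp[OF AE_lborel_singleton[of 0]])
          (auto simp: j_def split: split_indicator)
      then show ?thesis using poincare_half_line[OF \<rho> N C hm chm R] by simp
    qed
    show ?thesis
      using add_mono[OF 1 2]
      by (subst split, measurable, subst split, measurable)
  qed
  show thesis by (rule that[of G j "real N * \<rho>"]) (use jG jm main in \<open>auto simp: G_def\<close>)
qed

section \<open>The index form as a bilinear form\<close>

definition gauss_weight :: "'a::euclidean_space \<Rightarrow> real" where
  "gauss_weight x = exp (- (norm x)\<^sup>2 / 4)"

lemma gauss_weight_pos [simp]: "gauss_weight x > 0"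
  by (simp add: gauss_weight_def)

lemma smooth_along_gauss_weight: "smooth_along S (gauss_weight :: 'a::euclidean_space \<Rightarrow> real)"
proof -
  have "smooth_on UNIV (\<lambda>x::'a. exp ((x \<bullet> x) * (- 1 / 4)))"
    by (intro smooth_on_compose[OF smooth_on_linear[OF bounded_linear_mult_left[of "- 1 / 4"]] smooth_on_exp]
        smooth_on_bilinear[OF bounded_bilinear_inner] smooth_on_id) auto
  moreover have "(\<lambda>x::'a. exp ((x \<bullet> x) * (- 1 / 4))) = gauss_weight"
    by (simp add: gauss_weight_def fun_eq_iff power2_norm_eq_inner)
  ultimately show ?thesis using smooth_along_smooth_on by metis
qed

context hypersurface
begin

text \<open>The integrand is cut off to \<open>S\<close> although the measure already lives there:
  gradients and curvature have meaning on \<open>S\<close> only, and a function continuous on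
  \<open>S\<close> becomes Borel on the whole type after this cut-off.\<close>

definition surf_int :: "('a \<Rightarrow> real) \<Rightarrow> real" where
  "surf_int h = (\<integral>x. indicator S x * h x \<partial>surface_measure S)"

definition surf_integrable :: "('a \<Rightarrow> real) \<Rightarrow> bool" where
  "surf_integrable h \<longleftrightarrow> integrable (surface_measure S) (\<lambda>x. indicator S x * h x)"

lemma surf_measurable:
  fixes h :: "'a \<Rightarrow> real"
  assumes "continuous_on S h"
  shows "(\<lambda>x. indicator S x * h x) \<in> borel_measurable borel"
  using borel_measurable_continuous_on_indicator[OF borel assms] by simp

lemma surf_integrable_compact:
  assumes h: "continuous_on S h" and K: "compact K" "K \<subseteq> S" and z: "\<And>x. x \<in> S \<Longrightarrow> x \<notin> K \<Longrightarrow> h x = 0"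
  shows "surf_integrable h"
proof -
  have "compact (h ` K)" using compact_continuous_image[OF continuous_on_subset[OF h K(2)] K(1)] .
  then obtain B where B: "\<And>x. x \<in> K \<Longrightarrow> \<bar>h x\<bar> \<le> B"
    using compact_imp_bounded bounded_iff by (metis imageI real_norm_def)
  show ?thesis
    unfolding surf_integrable_def
  proof (rule integrableI_bounded_set[where A=K and B=B])
    show "K \<in> sets (surface_measure S)" using K by (simp add: borel_compact)
    show "(\<lambda>x. indicator S x * h x) \<in> borel_measurable (surface_measure S)"
      using surf_measurable[OF h] by simp
    show "emeasure (surface_measure S) K < \<infinity>" using surface_measure_compact_finite[OF K] by simp
  qed (use B z K(2) in \<open>auto split: split_indicator\<close>)
qed

lemma surf_int_cong: "(\<And>x. x \<in> S \<Longrightarrow> f x = g x) \<Longrightarrow> surf_int f = surf_int g"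
  unfolding surf_int_def by (intro Bochner_Integration.integral_cong) (auto split: split_indicator)

lemma surf_int_add: "surf_integrable f \<Longrightarrow> surf_integrable g \<Longrightarrow> surf_int (\<lambda>x. f x + g x) = surf_int f + surf_int g"
  and surf_int_diff: "surf_integrable f \<Longrightarrow> surf_integrable g \<Longrightarrow> surf_int (\<lambda>x. f x - g x) = surf_int f - surf_int g"
  and surf_int_cmult: "surf_int (\<lambda>x. c * f x) = c * surf_int f"
  and surf_integrable_add: "surf_integrable f \<Longrightarrow> surf_integrable g \<Longrightarrow> surf_integrable (\<lambda>x. f x + g x)"
  and surf_integrable_diff: "surf_integrable f \<Longrightarrow> surf_integrable g \<Longrightarrow> surf_integrable (\<lambda>x. f x - g x)"
  and surf_integrable_cmult: "surf_integrable f \<Longrightarrow> surf_integrable (\<lambda>x. c * f x)"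
  unfolding surf_int_def surf_integrable_def by (simp_all add: algebra_simps)

lemma surf_int_mono:
  "surf_integrable f \<Longrightarrow> surf_integrable g \<Longrightarrow> (\<And>x. x \<in> S \<Longrightarrow> f x \<le> g x) \<Longrightarrow> surf_int f \<le> surf_int g"
  unfolding surf_int_def surf_integrable_def by (rule integral_mono) (auto split: split_indicator)

lemma surf_int_nonneg: "(\<And>x. x \<in> S \<Longrightarrow> 0 \<le> f x) \<Longrightarrow> 0 \<le> surf_int f"
  unfolding surf_int_def by (rule Bochner_Integration.integral_nonneg) (auto split: split_indicator)

abbreviation grad :: "('a \<Rightarrow> real) \<Rightarrow> 'a \<Rightarrow> 'a" where "grad \<equiv> tangential_gradient S"

text \<open>One chain rule for \<open>\<phi> (f y) (f' y)\<close>, required to agree with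
  \<open>g\<close> only on \<open>S\<close> near \<open>x\<close>. Gradients of sums, multiples and
  squares, and their vanishing off a support, are all instances.\<close>

lemma grad_eqI:
  assumes x: "x \<in> S" and U: "open U" "x \<in> U"
    and F: "smooth_along S f" "smooth_along S f'" and g: "\<And>y. y \<in> S \<Longrightarrow> y \<in> U \<Longrightarrow> g y = \<phi> (f y) (f' y)"
    and \<phi>: "\<And>u v. ((\<lambda>z. \<phi> (fst z) (snd z)) has_derivative (\<lambda>z. a u v * fst z + b u v * snd z)) (at (u, v))"
  shows "grad g x = a (f x) (f' x) *\<^sub>R grad f x + b (f x) (f' x) *\<^sub>R grad f' x"
proof (rule tangential_gradient_unique[OF x])
  note sT = subspace_tangent_space[OF x]
  show "a (f x) (f' x) *\<^sub>R grad f x + b (f x) (f' x) *\<^sub>R grad f' x \<in> tangent_space S x"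
    using tangential_gradient_tangent(1)[OF x] F sT by (intro subspace_add subspace_scale) auto
  fix v assume v: "v \<in> tangent_space S x"
  obtain V F1 where V: "x \<in> V" "open V" "smooth_on V F1" "\<And>y. y \<in> S \<Longrightarrow> y \<in> V \<Longrightarrow> f y = F1 y"
    using smooth_alongE[OF F(1) x] by blast
  obtain W F2 where W: "x \<in> W" "open W" "smooth_on W F2" "\<And>y. y \<in> S \<Longrightarrow> y \<in> W \<Longrightarrow> f' y = F2 y"
    using smooth_alongE[OF F(2) x] by blast
  note d1 = smooth_on_has_derivative[OF V(3,1)] and d2 = smooth_on_has_derivative[OF W(3,1)]
  have e1: "deriv_along S f x v = frechet_derivative F1 (at x) v"
    by (rule deriv_along_eq[OF d1 V(2,1) x V(4) v])
  have e2: "deriv_along S f' x v = frechet_derivative F2 (at x) v"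
    by (rule deriv_along_eq[OF d2 W(2,1) x W(4) v])
  have "((\<lambda>y. \<phi> (fst (F1 y, F2 y)) (snd (F1 y, F2 y))) has_derivative
      (\<lambda>v. a (F1 x) (F2 x) * fst (frechet_derivative F1 (at x) v, frechet_derivative F2 (at x) v)
        + b (F1 x) (F2 x) * snd (frechet_derivative F1 (at x) v, frechet_derivative F2 (at x) v))) (at x)"
    by (rule has_derivative_compose[OF has_derivative_Pair[OF d1 d2] \<phi>])
  then have "((\<lambda>y. \<phi> (F1 y) (F2 y)) has_derivative
      (\<lambda>v. a (F1 x) (F2 x) * frechet_derivative F1 (at x) v + b (F1 x) (F2 x) * frechet_derivative F2 (at x) v)) (at x)"
    by simp
  then have "deriv_along S g x v = a (F1 x) (F2 x) * frechet_derivative F1 (at x) v + b (F1 x) (F2 x) * frechet_derivative F2 (at x) v"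
    using U V W g by (intro deriv_along_eq[where U="U \<inter> V \<inter> W", OF _ _ _ x _ v]) auto
  then show "(a (f x) (f' x) *\<^sub>R grad f x + b (f x) (f' x) *\<^sub>R grad f' x) \<bullet> v = deriv_along S g x v"
    using tangential_gradient_tangent(2)[OF x F(1) v] tangential_gradient_tangent(2)[OF x F(2) v] e1 e2
      V(4)[OF x V(1)] W(4)[OF x W(1)]
    by (simp add: inner_add_left)
qed

lemma grad_add:
  assumes "x \<in> S" "smooth_along S f" "smooth_along S g"
  shows "grad (\<lambda>x. f x + g x) x = grad f x + grad g x"
proof -
  have "grad (\<lambda>x. f x + g x) x = 1 *\<^sub>R grad f x + 1 *\<^sub>R grad g x"
    by (rule grad_eqI[OF assms(1) open_UNIV UNIV_I assms(2,3), where \<phi>="\<lambda>u v. u + v"])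
      (auto intro!: derivative_eq_intros)
  then show ?thesis by simp
qed

lemma grad_affine_cmult:
  assumes "x \<in> S" "smooth_along S f"
  shows "grad (\<lambda>x. c * f x) x = c *\<^sub>R grad f x"
proof -
  have "grad (\<lambda>x. c * f x) x = c *\<^sub>R grad f x + 0 *\<^sub>R grad f x"
    by (rule grad_eqI[OF assms(1) open_UNIV UNIV_I assms(2,2), where \<phi>="\<lambda>u v. c * u"])
      (auto intro!: derivative_eq_intros)
  then show ?thesis by simp
qed

lemma grad_square:
  assumes "x \<in> S" "smooth_along S f"
  shows "grad (\<lambda>x. k * (f x + c)\<^sup>2) x = (2 * k * (f x + c)) *\<^sub>R grad f x"
proof -
  have "grad (\<lambda>x. k * (f x + c)\<^sup>2) x = (2 * k * (f x + c)) *\<^sub>R grad f x + 0 *\<^sub>R grad f x"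
    by (rule grad_eqI[OF assms(1) open_UNIV UNIV_I assms(2,2), where \<phi>="\<lambda>u v. k * (u + c)\<^sup>2"
          and a="\<lambda>u v. 2 * k * (u + c)"])
      (auto intro!: derivative_eq_intros simp: power2_eq_square)
  then show ?thesis by simp
qed

lemma grad_zero:
  assumes "x \<in> S" "open U" "x \<in> U" "\<And>y. y \<in> S \<Longrightarrow> y \<in> U \<Longrightarrow> f y = 0"
  shows "grad f x = 0"
proof -
  have "grad f x = 0 *\<^sub>R grad (\<lambda>_. 0) x + 0 *\<^sub>R grad (\<lambda>_. 0) x"
    by (rule grad_eqI[OF assms(1-3) smooth_along_const[of S 0] smooth_along_const[of S 0], where \<phi>="\<lambda>u v. 0"])
      (auto simp: assms(4))
  then show ?thesis by simp
qed

section \<open>Test functions\<close>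

definition test :: "('a \<Rightarrow> real) set" where
  "test = {f \<in> smooth_functions S. compactly_supported_in S f}"

text \<open>The compact set inside \<open>S\<close> is the form in which compact support is used
  later. A field that is continuous on \<open>S\<close> is bounded on it, so its products with
  \<open>f\<close> or \<open>grad f\<close> are integrable however \<open>S\<close> behaves near its
  ends.\<close>

lemma testD:
  assumes "f \<in> test"
  shows "smooth_along S f" "\<And>x. x \<notin> S \<Longrightarrow> f x = 0"
    "\<exists>K. compact K \<and> K \<subseteq> S \<and> (\<forall>x. x \<notin> K \<longrightarrow> f x = 0)"
proof -
  show "smooth_along S f" and z: "\<And>x. x \<notin> S \<Longrightarrow> f x = 0"
    using assms by (auto simp: test_def smooth_functions_def)
  have "f x = 0" if "x \<notin> S \<inter> closure {x \<in> S. f x \<noteq> 0}" for x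
    using that z[of x] closure_subset[of "{x \<in> S. f x \<noteq> 0}"] by auto
  moreover have "compact (S \<inter> closure {x \<in> S. f x \<noteq> 0})"
    using assms unfolding test_def compactly_supported_in_def by blast
  ultimately show "\<exists>K. compact K \<and> K \<subseteq> S \<and> (\<forall>x. x \<notin> K \<longrightarrow> f x = 0)"
    by (meson Int_lower1)
qed

lemma testI:
  assumes "smooth_along S f" "compact K" "K \<subseteq> S" "\<And>x. x \<notin> K \<Longrightarrow> f x = 0"
  shows "f \<in> test"
proof -
  have "closure {x \<in> S. f x \<noteq> 0} \<subseteq> K"
    using assms(4) by (intro closure_minimal compact_imp_closed assms(2)) auto
  then have "S \<inter> closure {x \<in> S. f x \<noteq> 0} = K \<inter> closure {x \<in> S. f x \<noteq> 0}" using assms(3) by auto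
  then have "compact (S \<inter> closure {x \<in> S. f x \<noteq> 0})" using assms(2) by (simp add: compact_Int_closed)
  then show ?thesis using assms by (auto simp: test_def smooth_functions_def compactly_supported_in_def)
qed

lemma test_add: assumes "f \<in> test" "g \<in> test" shows "f + g \<in> test"
proof -
  obtain K L where "compact K" "K \<subseteq> S" "\<forall>x. x \<notin> K \<longrightarrow> f x = 0" "compact L" "L \<subseteq> S" "\<forall>x. x \<notin> L \<longrightarrow> g x = 0"
    using testD(3)[OF assms(1)] testD(3)[OF assms(2)] by blast
  moreover have "smooth_along S (\<lambda>x. f x + g x)" using assms testD(1) by (intro smooth_along_add) auto
  ultimately show ?thesis
    by (intro testI[of _ "K \<union> L"]) (auto simp: plus_fun_def)
qed

lemma test_scaleR: assumes "f \<in> test" shows "c *\<^sub>R f \<in> test"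
proof -
  obtain K where "compact K" "K \<subseteq> S" "\<forall>x. x \<notin> K \<longrightarrow> f x = 0"
    using testD(3)[OF assms] by blast
  moreover have "smooth_along S (\<lambda>x. c *\<^sub>R f x)"
    using assms testD(1) by (intro smooth_along_linear[OF bounded_linear_scaleR_right]) auto
  ultimately show ?thesis
    by (intro testI[of _ K]) (auto simp: scaleR_fun_def)
qed

lemma test_zero: "0 \<in> test"
  by (rule testI[of _ "{}"]) (auto simp: zero_fun_def smooth_along_const)

lemma test_grad_zero:
  assumes "x \<in> S" "compact K" "\<forall>x. x \<notin> K \<longrightarrow> f x = 0" "x \<notin> K"
  shows "grad f x = 0"
  using assms compact_imp_closed by (intro grad_zero[of x "- K"]) (auto simp: open_Compl)

lemma grad_test_add: "f \<in> test \<Longrightarrow> g \<in> test \<Longrightarrow> x \<in> S \<Longrightarrow> grad (f + g) x = grad f x + grad g x"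
  using grad_add[of x f g] testD(1) by (simp add: plus_fun_def)

lemma grad_test_scaleR: "f \<in> test \<Longrightarrow> x \<in> S \<Longrightarrow> grad (c *\<^sub>R f) x = c *\<^sub>R grad f x"
  using grad_affine_cmult[of x f c] testD(1) by (simp add: scaleR_fun_def)

section \<open>Polarisation of the index form\<close>

definition bform_density :: "('a \<Rightarrow> real) \<Rightarrow> ('a \<Rightarrow> real) \<Rightarrow> 'a \<Rightarrow> real" where
  "bform_density f g x = (grad f x \<bullet> grad g x - norm_A_squared S x * (f x * g x) - 1/2 * (f x * g x)) * gauss_weight x"

definition bform :: "('a \<Rightarrow> real) \<Rightarrow> ('a \<Rightarrow> real) \<Rightarrow> real" where
  "bform f g = surf_int (bform_density f g)"

lemma continuous_on_bform_density:
  assumes "smooth_along S f" "smooth_along S g"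
  shows "continuous_on S (bform_density f g)"
  unfolding bform_density_def
  by (intro continuous_intros smooth_along_continuous smooth_along_tangential_gradient
      smooth_along_norm_A_squared smooth_along_gauss_weight assms)

lemma bform_integrable:
  assumes f: "f \<in> test" and g: "g \<in> test"
  shows "surf_integrable (bform_density f g)"
proof -
  obtain K where K: "compact K" "K \<subseteq> S" "\<forall>x. x \<notin> K \<longrightarrow> f x = 0" using testD(3)[OF f] by blast
  show ?thesis
    using test_grad_zero[OF _ K(1,3)] K
    by (intro surf_integrable_compact[OF _ K(1,2)] continuous_on_bform_density testD(1) f g)
      (simp add: bform_density_def)
qed

lemma bform_commute: "bform f g = bform g f"
  by (simp add: bform_def bform_density_def[abs_def] inner_commute mult.commute)

lemma bform_add_left:
  assumes "f \<in> test" "g \<in> test" "h \<in> test"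
  shows "bform (f + g) h = bform f h + bform g h"
proof -
  have "bform (f + g) h = surf_int (\<lambda>x. bform_density f h x + bform_density g h x)"
    unfolding bform_def
    by (rule surf_int_cong) (simp add: bform_density_def grad_test_add[OF assms(1,2)] inner_add_left algebra_simps)
  then show ?thesis using bform_integrable assms by (simp add: surf_int_add bform_def)
qed

lemma bform_scaleR_left:
  assumes "f \<in> test" "h \<in> test"
  shows "bform (c *\<^sub>R f) h = c * bform f h"
proof -
  have "bform (c *\<^sub>R f) h = surf_int (\<lambda>x. c * bform_density f h x)"
    unfolding bform_def
  proof (rule surf_int_cong)
    fix x assume "x \<in> S"
    then show "bform_density (c *\<^sub>R f) h x = c * bform_density f h x"
      unfolding bform_density_def grad_test_scaleR[OF assms(1) \<open>x \<in> S\<close>]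
      by (simp add: scaleR_fun_def algebra_simps)
  qed
  then show ?thesis by (simp add: surf_int_cmult bform_def)
qed

lemma bform_sum_left:
  assumes "finite I" "\<And>i. i \<in> I \<Longrightarrow> f i \<in> test" "h \<in> test"
  shows "bform (\<Sum>i\<in>I. c i *\<^sub>R f i) h = (\<Sum>i\<in>I. c i * bform (f i) h)"
    and "(\<Sum>i\<in>I. c i *\<^sub>R f i) \<in> test"
proof -
  have "(\<Sum>i\<in>I. c i *\<^sub>R f i) \<in> test \<and> bform (\<Sum>i\<in>I. c i *\<^sub>R f i) h = (\<Sum>i\<in>I. c i * bform (f i) h)"
    using assms(1,2)
  proof (induction I rule: finite_induct)
    case empty
    have "bform 0 h = 0" using bform_scaleR_left[OF test_zero assms(3), of 0] by simp
    then show ?case using test_zero by (simp add: zero_fun_def)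
  next
    case (insert i I)
    then have fi: "f i \<in> test" and IH: "(\<Sum>i\<in>I. c i *\<^sub>R f i) \<in> test"
      "bform (\<Sum>i\<in>I. c i *\<^sub>R f i) h = (\<Sum>i\<in>I. c i * bform (f i) h)" by auto
    note cf = test_scaleR[OF fi, of "c i"]
    show ?case
      unfolding sum.insert[OF insert(1,2)]
      by (intro conjI test_add[OF cf IH(1)]) (simp only: bform_add_left[OF cf IH(1) assms(3)] bform_scaleR_left[OF fi assms(3)] IH(2))
  qed
  then show "bform (\<Sum>i\<in>I. c i *\<^sub>R f i) h = (\<Sum>i\<in>I. c i * bform (f i) h)"
    and "(\<Sum>i\<in>I. c i *\<^sub>R f i) \<in> test" by auto
qed

lemma set_integral_surface:
  fixes h :: "'a \<Rightarrow> real"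
  assumes "continuous_on S h"
  shows "(LINT x:S|hausdorff_measure (DIM('a) - 1). h x) = surf_int h"
proof -
  have m: "(\<lambda>x. indicator S x * h x) \<in> borel_measurable (hausdorff_measure (DIM('a) - 1))"
    using surf_measurable[OF assms] by simp
  have "surf_int h = (\<integral>x. indicator S x * h x \<partial>density (hausdorff_measure (DIM('a) - 1)) (\<lambda>x. ennreal (indicator S x)))"
    unfolding surf_int_def surface_measure_def by (simp add: ennreal_indicator)
  also have "\<dots> = (\<integral>x. indicator S x *\<^sub>R (indicator S x * h x) \<partial>hausdorff_measure (DIM('a) - 1))"
    using m borel by (intro integral_density) auto
  also have "\<dots> = (LINT x:S|hausdorff_measure (DIM('a) - 1). h x)"
    unfolding set_lebesgue_integral_def by (intro Bochner_Integration.integral_cong) (auto split: split_indicator)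
  finally show ?thesis ..
qed

lemma index_form_bform: "smooth_along S f \<Longrightarrow> index_form S f = bform f f"
proof -
  assume f: "smooth_along S f"
  have "index_form S f = (LINT x:S|hausdorff_measure (DIM('a) - 1). bform_density f f x)"
    unfolding index_form_def bform_density_def gauss_weight_def power2_norm_eq_inner
    by (simp add: power2_eq_square)
  then show ?thesis
    using set_integral_surface[OF continuous_on_bform_density[OF f f]] by (simp add: bform_def)
qed

end

section \<open>Integration by parts via Lipschitz deformations\<close>

lemma smooth_along_lipschitz_on_compact:
  fixes f :: "'a::euclidean_space \<Rightarrow> 'b::real_normed_vector"
  assumes f: "smooth_along S f" and N: "compact N" "N \<subseteq> S"
  shows "\<exists>L\<ge>0. \<forall>x\<in>N. \<forall>y\<in>N. norm (f x - f y) \<le> L * norm (x - y)"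
proof -
  \<comment> \<open>\<open>local_lipschitz\<close> concerns time-dependent maps; the set of times is
    a dummy singleton. It passes from local constants to one constant on a compact set that need not
    be convex.\<close>
  have "local_lipschitz {0::real} N (\<lambda>_. f)"
    unfolding local_lipschitz_def
  proof (intro ballI)
    fix x assume x: "x \<in> N"
    then obtain U g where U: "x \<in> U" "smooth_on U g" "\<And>y. y \<in> S \<Longrightarrow> y \<in> U \<Longrightarrow> f y = g y"
      using smooth_alongE[OF f, of x] N(2) by (metis subsetD)
    obtain r L where r: "r > 0" "L \<ge> 0" "ball x r \<subseteq> U"
      "\<And>y z. y \<in> ball x r \<Longrightarrow> z \<in> ball x r \<Longrightarrow> norm (g y - g z) \<le> L * norm (y - z)"
      using smooth_on_local_lipschitz[OF U(2,1)] by meson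
    have "L-lipschitz_on (cball x (r/2) \<inter> N) f"
    proof (rule lipschitz_onI)
      fix y z assume yz: "y \<in> cball x (r/2) \<inter> N" "z \<in> cball x (r/2) \<inter> N"
      then have b: "y \<in> ball x r" "z \<in> ball x r" using r(1) by auto
      then have "f y = g y" "f z = g z" using U(3) yz N(2) r(3) by blast+
      then show "dist (f y) (f z) \<le> L * dist y z" using r(4)[OF b] by (simp add: dist_norm)
    qed (rule r(2))
    then show "\<exists>u>0. \<exists>L. \<forall>t\<in>cball t u \<inter> {0}. L-lipschitz_on (cball x u \<inter> N) f" for t :: real
      using r(1) by (intro exI[of _ "r/2"] conjI exI[of _ L]) auto
  qed
  then obtain L where "\<And>t. t \<in> {0::real} \<Longrightarrow> L-lipschitz_on N f"
    using local_lipschitz_compact_implies_lipschitz[OF _ N(1), of "{0::real}" "\<lambda>_. f"] by (metis compact_sing continuous_on_const)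
  then have L: "L-lipschitz_on N f" by simp
  show ?thesis
    using lipschitz_on_nonneg[OF L] lipschitz_onD[OF L]
    by (intro exI[of _ L]) (auto simp: dist_norm)
qed

context hypersurface
begin

text \<open>In the chart the point is moved along the straight segment with velocity
  \<open>Y\<close>, the image of \<open>X\<close>; it stays on \<open>S\<close> because
  \<open>X\<close> is tangent. The field is only Lipschitz, since cut-offs by distance functions
  will be applied to it, and \<open>C * \<delta> \<le> 1/2\<close> keeps the deformations injective.
  The radius precedes the field in the quantifiers, so that one cover of a compact set can serve for
  all cut-offs of a field.\<close>

lemma deformation_exists:
  assumes p: "p \<in> S"
  shows "\<exists>r>0. compact (S \<inter> cball p r) \<and>
    (\<forall>X L. (\<forall>x\<in>S. X x \<in> tangent_space S x) \<longrightarrow>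
       (\<forall>x\<in>S \<inter> cball p r. \<forall>y\<in>S \<inter> cball p r. norm (X x - X y) \<le> L * norm (x - y)) \<longrightarrow>
       (\<forall>x\<in>S. r / 2 \<le> dist p x \<longrightarrow> X x = 0) \<longrightarrow>
       (\<exists>\<phi> C \<delta>. 0 \<le> C \<and> 0 < \<delta> \<and> C * \<delta> \<le> 1/2 \<and>
         (\<forall>s x. \<bar>s\<bar> \<le> \<delta> \<longrightarrow> x \<in> S \<inter> cball p r \<longrightarrow> \<phi> s x \<in> S \<inter> cball p r \<and> norm (\<phi> s x - x) \<le> C * \<bar>s\<bar>) \<and>
         (\<forall>s x y. \<bar>s\<bar> \<le> \<delta> \<longrightarrow> x \<in> S \<inter> cball p r \<longrightarrow> y \<in> S \<inter> cball p r \<longrightarrow>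
            norm ((\<phi> s x - x) - (\<phi> s y - y)) \<le> C * \<bar>s\<bar> * norm (x - y)) \<and>
         (\<forall>x\<in>S \<inter> cball p r. ((\<lambda>s. \<phi> s x) has_vector_derivative X x) (at (0::real)))))"
proof -
  obtain U V \<Phi> \<Psi> and e :: 'a where ch: "e \<in> Basis" "p \<in> U" "smooth_on U \<Phi>" "smooth_on V \<Psi>"
    "\<And>x. x \<in> U \<Longrightarrow> \<Phi> x \<in> V" "\<And>y. y \<in> V \<Longrightarrow> \<Psi> y \<in> U"
    "\<And>x. x \<in> U \<Longrightarrow> \<Psi> (\<Phi> x) = x" "\<And>y. y \<in> V \<Longrightarrow> \<Phi> (\<Psi> y) = y"
    "\<And>x. x \<in> U \<Longrightarrow> x \<in> S \<longleftrightarrow> \<Phi> x \<bullet> e = 0"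
    by (rule embedded_hypersurface_chart[OF embedded p]) (rule that; (assumption | simp))
  let ?D = "\<lambda>x. frechet_derivative \<Phi> (at x)" and ?E = "\<lambda>z. frechet_derivative \<Psi> (at z)"
  define q where "q = \<Phi> p"
  have q: "q \<in> V" using ch by (simp add: q_def)
  obtain r1 L1 where r1: "r1 > 0" "L1 \<ge> 0" "ball p r1 \<subseteq> U"
    "\<And>x v. x \<in> ball p r1 \<Longrightarrow> norm (?D x v) \<le> L1 * norm v"
    "\<And>x y. x \<in> ball p r1 \<Longrightarrow> y \<in> ball p r1 \<Longrightarrow> norm (\<Phi> x - \<Phi> y) \<le> L1 * norm (x - y)"
    using smooth_on_local_lipschitz[OF ch(3,2)] by meson
  obtain r2 L2 where r2: "r2 > 0" "L2 \<ge> 0"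
    "\<And>x y v. x \<in> ball p r2 \<Longrightarrow> y \<in> ball p r2 \<Longrightarrow> norm (?D x v - ?D y v) \<le> L2 * norm (x - y) * norm v"
    using smooth_on_deriv_local_lipschitz[OF ch(3,2)] by meson
  obtain r3 L3 where r3: "r3 > 0" "L3 \<ge> 0" "ball q r3 \<subseteq> V"
    "\<And>x y. x \<in> ball q r3 \<Longrightarrow> y \<in> ball q r3 \<Longrightarrow> norm (\<Psi> x - \<Psi> y) \<le> L3 * norm (x - y)"
    using smooth_on_local_lipschitz[OF ch(4) q] by meson
  obtain r4 L4 where r4: "r4 > 0" "L4 \<ge> 0"
    "\<And>x y v. x \<in> ball q r4 \<Longrightarrow> y \<in> ball q r4 \<Longrightarrow> norm (?E x v - ?E y v) \<le> L4 * norm (x - y) * norm v"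
    using smooth_on_deriv_local_lipschitz[OF ch(4) q] by meson
  obtain rc where rc: "rc > 0" "\<And>r'. r' \<le> rc \<Longrightarrow> compact (S \<inter> cball p r')"
    using locally_compact_at[OF p] by blast
  define \<rho> where "\<rho> = min r3 r4"
  have \<rho>: "\<rho> > 0" "\<rho> \<le> r3" "\<rho> \<le> r4" using r3(1) r4(1) by (auto simp: \<rho>_def)
  \<comment> \<open>Small enough that \<open>\<Phi>\<close> sends \<open>cball p r\<close> into
    \<open>ball q (\<rho> / 2)\<close>; the other half of \<open>\<rho>\<close> is left for the
    displacement inside the chart.\<close>
  define r where "r = Min {r1/2, r2/2, rc, \<rho> / (4 * (L1 + 1))}"
  have r_le: "r \<le> r1/2" "r \<le> r2/2" "r \<le> rc" "r \<le> \<rho> / (4 * (L1 + 1))"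
    unfolding r_def by (rule Min_le; simp)+
  have r: "r > 0" unfolding r_def using r1(1,2) r2(1) rc(1) \<rho>(1) by (subst Min_gr_iff) auto
  have in1: "x \<in> ball p r1" and in2: "x \<in> ball p r2" if "x \<in> cball p r" for x
    using that r_le r1(1) r2(1) by auto
  have pr: "p \<in> S \<inter> cball p r" using p r by simp
  have \<Phi>_close: "\<Phi> x \<in> ball q (\<rho> / 2)" if x: "x \<in> cball p r" for x
  proof -
    have "norm (\<Phi> p - \<Phi> x) \<le> L1 * norm (p - x)" using r1(5)[of p x] in1[OF x] r1(1) by simp
    also have "\<dots> \<le> L1 * r" using x r1(2) by (intro mult_left_mono) (auto simp: dist_norm)
    also have "\<dots> \<le> (L1 + 1) * r" using r by (intro mult_right_mono) auto
    also have "\<dots> \<le> \<rho> / 4"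
    proof -
      have "r * (4 * (L1 + 1)) \<le> \<rho>" using r_le(4) r1(2) by (subst (asm) pos_le_divide_eq) auto
      then show ?thesis by (simp add: algebra_simps)
    qed
    also have "\<dots> < \<rho> / 2" using \<rho>(1) by simp
    finally show ?thesis by (simp add: q_def dist_norm)
  qed
  have main: "\<exists>\<phi> C \<delta>. 0 \<le> C \<and> 0 < \<delta> \<and> C * \<delta> \<le> 1/2 \<and>
         (\<forall>s x. \<bar>s\<bar> \<le> \<delta> \<longrightarrow> x \<in> S \<inter> cball p r \<longrightarrow> \<phi> s x \<in> S \<inter> cball p r \<and> norm (\<phi> s x - x) \<le> C * \<bar>s\<bar>) \<and>
         (\<forall>s x y. \<bar>s\<bar> \<le> \<delta> \<longrightarrow> x \<in> S \<inter> cball p r \<longrightarrow> y \<in> S \<inter> cball p r \<longrightarrow>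
            norm ((\<phi> s x - x) - (\<phi> s y - y)) \<le> C * \<bar>s\<bar> * norm (x - y)) \<and>
         (\<forall>x\<in>S \<inter> cball p r. ((\<lambda>s. \<phi> s x) has_vector_derivative X x) (at (0::real)))"
    if X: "\<And>x. x \<in> S \<Longrightarrow> X x \<in> tangent_space S x"
      and lip: "\<And>x y. x \<in> S \<inter> cball p r \<Longrightarrow> y \<in> S \<inter> cball p r \<Longrightarrow> norm (X x - X y) \<le> L * norm (x - y)"
      and van: "\<And>x. x \<in> S \<Longrightarrow> r / 2 \<le> dist p x \<Longrightarrow> X x = 0" for X L
  proof -
    define BX where "BX = norm (X p) + \<bar>L\<bar> * r"
    have BX0: "BX \<ge> 0" using r by (simp add: BX_def)
    have BX: "norm (X x) \<le> BX" if x: "x \<in> S \<inter> cball p r" for x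
    proof -
      have "norm (X x - X p) \<le> L * norm (x - p)" by (rule lip[OF x pr])
      also have "\<dots> \<le> \<bar>L\<bar> * r" using x by (intro mult_mono) (auto simp: dist_norm norm_minus_commute)
      finally show ?thesis unfolding BX_def using norm_triangle_sub[of "X x" "X p"] by linarith
    qed
    define Y where "Y = (\<lambda>x. ?D x (X x))"
    define BY where "BY = L1 * BX"
    define LY where "LY = L1 * \<bar>L\<bar> + L2 * BX"
    have BY0: "BY \<ge> 0" and LY0: "LY \<ge> 0" using BX0 r1(2) r2(2) by (auto simp: BY_def LY_def)
    have linD: "linear (?D x)" if "x \<in> cball p r" for x
      using smooth_on_has_derivative[OF ch(3)] in1[OF that] r1(3) has_derivative_linear by blast
    have BY: "norm (Y x) \<le> BY" if x: "x \<in> S \<inter> cball p r" for x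
    proof -
      have "norm (Y x) \<le> L1 * norm (X x)" unfolding Y_def using x by (intro r1(4) in1) auto
      also have "\<dots> \<le> BY" unfolding BY_def using BX[OF x] r1(2) by (rule mult_left_mono)
      finally show ?thesis .
    qed
    have LY: "norm (Y x - Y y) \<le> LY * norm (x - y)" if x: "x \<in> S \<inter> cball p r" and y: "y \<in> S \<inter> cball p r" for x y
    proof -
      have "Y x - Y y = ?D x (X x - X y) + (?D x (X y) - ?D y (X y))"
        unfolding Y_def using linD[of x] x by (simp add: linear_diff)
      also have "norm \<dots> \<le> norm (?D x (X x - X y)) + norm (?D x (X y) - ?D y (X y))" by (rule norm_triangle_ineq)
      also have "\<dots> \<le> L1 * norm (X x - X y) + L2 * norm (x - y) * norm (X y)"
        using x y by (intro add_mono r1(4) r2(3) in1 in2) auto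
      also have "\<dots> \<le> L1 * (\<bar>L\<bar> * norm (x - y)) + L2 * norm (x - y) * BX"
      proof (intro add_mono mult_left_mono BX[OF y])
        show "norm (X x - X y) \<le> \<bar>L\<bar> * norm (x - y)"
          using lip[OF x y] by (rule order_trans) (intro mult_right_mono, auto)
      qed (use r1(2) r2(2) in auto)
      also have "\<dots> = LY * norm (x - y)" by (simp add: LY_def algebra_simps)
      finally show ?thesis .
    qed
    define C where "C = L3 * BY + (L4 * BY * L1 + L3 * LY)"
    have C0: "C \<ge> 0" using BY0 LY0 r1(2) r3(2) r4(2) by (simp add: C_def)
    \<comment> \<open>The three bounds keep the displacement \<open>s *\<^sub>R Y x\<close> below
      \<open>\<rho> / 2\<close>, the resulting motion on \<open>S\<close> at most
      \<open>r / 2\<close>, and \<open>C * \<delta>\<close> at most \<open>1 / 2\<close>.\<close>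
    define \<delta> where "\<delta> = Min {\<rho> / (2 * (BY + 1)), r / (2 * (L3 * BY + 1)), 1 / (2 * (C + 1))}"
    have \<delta>_le: "\<delta> \<le> \<rho> / (2 * (BY + 1))" "\<delta> \<le> r / (2 * (L3 * BY + 1))" "\<delta> \<le> 1 / (2 * (C + 1))"
      unfolding \<delta>_def by (rule Min_le; simp)+
    have LB0: "L3 * BY \<ge> 0" using r3(2) BY0 by simp
    have \<delta>: "\<delta> > 0" unfolding \<delta>_def using \<rho>(1) r BY0 LB0 C0 by (subst Min_gr_iff) (auto simp: add_nonneg_pos)
    have \<delta>1: "\<delta> * BY < \<rho> / 2"
    proof -
      have "\<delta> * (2 * (BY + 1)) \<le> \<rho>" using \<delta>_le(1) BY0 by (subst (asm) pos_le_divide_eq) auto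
      then show ?thesis using \<delta> by (simp add: algebra_simps)
    qed
    have \<delta>2: "L3 * BY * \<delta> \<le> r / 2"
    proof -
      have "\<delta> * (2 * (L3 * BY + 1)) \<le> r" using \<delta>_le(2) LB0 by (subst (asm) pos_le_divide_eq) auto
      then show ?thesis using \<delta> by (simp add: algebra_simps)
    qed
    have \<delta>3: "C * \<delta> \<le> 1/2"
    proof -
      have "\<delta> * (2 * (C + 1)) \<le> 1" using \<delta>_le(3) C0 by (subst (asm) pos_le_divide_eq) auto
      then show ?thesis using \<delta> by (simp add: algebra_simps)
    qed
    define \<phi> where "\<phi> = (\<lambda>s x. \<Psi> (\<Phi> x + s *\<^sub>R Y x))"
    have sY: "norm (s *\<^sub>R Y x) \<le> BY * \<bar>s\<bar>" "norm (s *\<^sub>R Y x) < \<rho> / 2" if s: "\<bar>s\<bar> \<le> \<delta>" and x: "x \<in> S \<inter> cball p r" for s x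
    proof -
      show 1: "norm (s *\<^sub>R Y x) \<le> BY * \<bar>s\<bar>" using mult_left_mono[OF BY[OF x], of "\<bar>s\<bar>"] by (simp add: mult.commute)
      also have "\<dots> \<le> BY * \<delta>" using s BY0 by (rule mult_left_mono)
      finally show "norm (s *\<^sub>R Y x) < \<rho> / 2" using \<delta>1 by (simp add: mult.commute)
    qed
    have inball: "z + w \<in> ball q \<rho>" if "z \<in> ball q (\<rho>/2)" "norm w < \<rho> / 2" for z w
      using that norm_triangle_ineq4[of "q - z" w] by (simp add: dist_norm diff_diff_eq)
    have sub: "ball q (\<rho>/2) \<subseteq> ball q \<rho>" using \<rho>(1) by auto
    have sub3: "ball q \<rho> \<subseteq> ball q r3" and sub4: "ball q \<rho> \<subseteq> ball q r4" using \<rho> by auto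
    have move: "norm (\<phi> s x - x) \<le> L3 * BY * \<bar>s\<bar>" if s: "\<bar>s\<bar> \<le> \<delta>" and x: "x \<in> S \<inter> cball p r" for s x
    proof -
      have z: "\<Phi> x \<in> ball q (\<rho>/2)" using x by (intro \<Phi>_close) auto
      have xU: "x \<in> U" using x in1[of x] r1(3) by auto
      have "\<phi> s x - x = \<Psi> (\<Phi> x + s *\<^sub>R Y x) - \<Psi> (\<Phi> x)" using ch(7)[OF xU] by (simp add: \<phi>_def)
      also have "norm \<dots> \<le> L3 * norm (\<Phi> x + s *\<^sub>R Y x - \<Phi> x)"
        using inball[OF z sY(2)[OF s x]] z sub sub3 by (intro r3(4)) blast+
      also have "\<dots> \<le> L3 * (BY * \<bar>s\<bar>)" using sY(1)[OF s x] r3(2) by (intro mult_left_mono) auto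
      finally show ?thesis by (simp add: mult.assoc)
    qed
    have stay: "\<phi> s x \<in> S \<inter> cball p r" if s: "\<bar>s\<bar> \<le> \<delta>" and x: "x \<in> S \<inter> cball p r" for s x
    proof
      have xU: "x \<in> U" using x in1[of x] r1(3) by auto
      have z: "\<Phi> x \<in> ball q (\<rho>/2)" using x by (intro \<Phi>_close) auto
      have V: "\<Phi> x + s *\<^sub>R Y x \<in> V" using inball[OF z sY(2)[OF s x]] sub3 r3(3) by blast
      have "tangent_space S x = {v. ?D x v \<bullet> e = 0}"
        using x xU by (intro tangent_space_chart[OF ch(3-9)]) auto
      then have "Y x \<bullet> e = 0" using X[of x] x by (auto simp: Y_def)
      then have "\<Phi> (\<phi> s x) \<bullet> e = 0" using ch(8)[OF V] ch(9)[OF xU] x by (simp add: \<phi>_def inner_add_left)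
      then show "\<phi> s x \<in> S" using ch(6)[OF V] ch(9)[of "\<phi> s x"] by (simp add: \<phi>_def)
      \<comment> \<open>Points in the outer half of the ball are fixed because \<open>X\<close>
        vanishes there; the others move by at most \<open>r / 2\<close> and cannot leave the
        ball.\<close>
      show "\<phi> s x \<in> cball p r"
      proof (cases "r / 2 \<le> dist p x")
        case True
        then have "X x = 0" using van x by simp
        then have "Y x = 0" unfolding Y_def using linD[of x] x by (simp add: linear_0)
        then have "\<phi> s x = x" using ch(7)[OF xU] by (simp add: \<phi>_def)
        then show ?thesis using x by simp
      next
        case False
        have "dist x (\<phi> s x) \<le> L3 * BY * \<bar>s\<bar>" using move[OF s x] by (simp add: dist_norm norm_minus_commute)
        also have "\<dots> \<le> L3 * BY * \<delta>" using s LB0 by (rule mult_left_mono)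
        also have "\<dots> \<le> r / 2" by (rule \<delta>2)
        finally have "dist p (\<phi> s x) \<le> r" using False dist_triangle[of p "\<phi> s x" x] by linarith
        then show ?thesis by simp
      qed
    qed
    have lipG: "norm ((\<phi> s x - x) - (\<phi> s y - y)) \<le> C * \<bar>s\<bar> * norm (x - y)"
      if s: "\<bar>s\<bar> \<le> \<delta>" and x: "x \<in> S \<inter> cball p r" and y: "y \<in> S \<inter> cball p r" for s x y
    proof -
      have zx: "\<Phi> x \<in> ball q (\<rho>/2)" using x by (intro \<Phi>_close) simp
      have zy: "\<Phi> y \<in> ball q (\<rho>/2)" using y by (intro \<Phi>_close) simp
      have xU: "x \<in> U" "y \<in> U" using x y in1 r1(3) by auto
      \<comment> \<open>The point \<open>y\<close> is first given the displacement \<open>w\<close>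
        of \<open>x\<close>. This leaves a second difference of \<open>\<Psi>\<close>, of order
        \<open>norm w * norm (x - y)\<close>, and a correction for the difference of
        \<open>Y x\<close> and \<open>Y y\<close>; both carry a factor
        \<open>\<bar>s\<bar>\<close>.\<close>
      define w where "w = s *\<^sub>R Y x"
      have w: "norm w \<le> BY * \<bar>s\<bar>" "norm w < \<rho> / 2" unfolding w_def using sY[OF s x] by auto
      have 1: "norm ((\<Psi> (\<Phi> x + w) - \<Psi> (\<Phi> x)) - (\<Psi> (\<Phi> y + w) - \<Psi> (\<Phi> y))) \<le> (L4 * norm w) * norm (\<Phi> x - \<Phi> y)"
      proof (rule differentiable_bound[of "ball q (\<rho>/2)" "\<lambda>z. \<Psi> (z + w) - \<Psi> z" "\<lambda>z v. ?E (z + w) v - ?E z v"])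
        fix z assume z: "z \<in> ball q (\<rho>/2)"
        have zw: "z + w \<in> ball q \<rho>" by (rule inball[OF z w(2)])
        then have VV: "z + w \<in> V" "z \<in> V" using z sub sub3 r3(3) by blast+
        have "((\<lambda>z. \<Psi> (z + w)) has_derivative ?E (z + w)) (at z)"
        proof -
          have "((\<lambda>z. z + w) has_derivative (\<lambda>v. v)) (at z)" by (auto intro!: derivative_eq_intros)
          from has_derivative_compose[OF this smooth_on_has_derivative[OF ch(4) VV(1)]] show ?thesis .
        qed
        then show "((\<lambda>z. \<Psi> (z + w) - \<Psi> z) has_derivative (\<lambda>v. ?E (z + w) v - ?E z v)) (at z within ball q (\<rho>/2))"
          by (rule has_derivative_at_withinI[OF has_derivative_diff[OF _ smooth_on_has_derivative[OF ch(4) VV(2)]]])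
        show "onorm (\<lambda>v. ?E (z + w) v - ?E z v) \<le> L4 * norm w"
        proof (rule onorm_bound)
          fix v
          have "z \<in> ball q r4" "z + w \<in> ball q r4" using z zw sub sub4 by blast+
          from r4(3)[OF this(2,1), of v] show "norm (?E (z + w) v - ?E z v) \<le> L4 * norm w * norm v" by simp
        qed (use r4(2) in simp)
      qed (use zx zy in auto)
      have "norm (\<Phi> x - \<Phi> y) \<le> L1 * norm (x - y)" using x y by (intro r1(5) in1) auto
      then have "(L4 * norm w) * norm (\<Phi> x - \<Phi> y) \<le> (L4 * (BY * \<bar>s\<bar>)) * (L1 * norm (x - y))"
        using w(1) r4(2) BY0 by (intro mult_mono) auto
      with 1 have 1: "norm ((\<Psi> (\<Phi> x + w) - \<Psi> (\<Phi> x)) - (\<Psi> (\<Phi> y + w) - \<Psi> (\<Phi> y))) \<le> (L4 * (BY * \<bar>s\<bar>)) * (L1 * norm (x - y))"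
        by linarith
      have "norm (\<Psi> (\<Phi> y + w) - \<Psi> (\<Phi> y + s *\<^sub>R Y y)) \<le> L3 * norm ((\<Phi> y + w) - (\<Phi> y + s *\<^sub>R Y y))"
        using inball[OF zy w(2)] inball[OF zy sY(2)[OF s y]] sub3 by (intro r3(4)) blast+
      also have "(\<Phi> y + w) - (\<Phi> y + s *\<^sub>R Y y) = s *\<^sub>R (Y x - Y y)" by (simp add: w_def algebra_simps)
      also have "L3 * norm (s *\<^sub>R (Y x - Y y)) \<le> L3 * (\<bar>s\<bar> * (LY * norm (x - y)))"
        using LY[OF x y] r3(2) by (auto intro!: mult_left_mono)
      finally have 2: "norm (\<Psi> (\<Phi> y + w) - \<Psi> (\<Phi> y + s *\<^sub>R Y y)) \<le> L3 * (\<bar>s\<bar> * (LY * norm (x - y)))" .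
      have "(\<phi> s x - x) - (\<phi> s y - y)
          = ((\<Psi> (\<Phi> x + w) - \<Psi> (\<Phi> x)) - (\<Psi> (\<Phi> y + w) - \<Psi> (\<Phi> y))) + (\<Psi> (\<Phi> y + w) - \<Psi> (\<Phi> y + s *\<^sub>R Y y))"
        using ch(7)[OF xU(1)] ch(7)[OF xU(2)] by (simp add: \<phi>_def w_def)
      also have "norm \<dots> \<le> (L4 * (BY * \<bar>s\<bar>)) * (L1 * norm (x - y)) + L3 * (\<bar>s\<bar> * (LY * norm (x - y)))"
        by (rule norm_triangle_mono[OF 1 2])
      also have "\<dots> = (L4 * BY * L1 + L3 * LY) * \<bar>s\<bar> * norm (x - y)" by (simp add: algebra_simps)
      also have "\<dots> \<le> C * \<bar>s\<bar> * norm (x - y)"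
        unfolding C_def using LB0 by (intro mult_right_mono) auto
      finally show ?thesis .
    qed
    have deriv: "((\<lambda>s. \<phi> s x) has_vector_derivative X x) (at 0)" if x: "x \<in> S \<inter> cball p r" for x
    proof -
      have xU: "x \<in> U" using x in1[of x] r1(3) by auto
      note d\<Psi> = smooth_on_has_derivative[OF ch(4) ch(5)[OF xU]]
      have "((\<lambda>s. \<Phi> x + s *\<^sub>R Y x) has_derivative (\<lambda>s. s *\<^sub>R Y x)) (at 0)"
        by (auto intro!: derivative_eq_intros)
      moreover have "(\<Psi> has_derivative ?E (\<Phi> x)) (at (\<Phi> x + 0 *\<^sub>R Y x))" using d\<Psi> by simp
      ultimately have "((\<lambda>s. \<phi> s x) has_derivative (\<lambda>s. ?E (\<Phi> x) (s *\<^sub>R Y x))) (at 0)"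
        unfolding \<phi>_def by (rule has_derivative_compose)
      moreover have "?E (\<Phi> x) (s *\<^sub>R Y x) = s *\<^sub>R X x" for s
        using inverse_derivative[OF ch(3,4) xU ch(5)[OF xU] ch(7), of "X x"] has_derivative_linear[OF d\<Psi>]
        by (simp add: Y_def linear_scale)
      ultimately show ?thesis by (simp add: has_vector_derivative_def)
    qed
    have move': "norm (\<phi> s x - x) \<le> C * \<bar>s\<bar>" if "\<bar>s\<bar> \<le> \<delta>" "x \<in> S \<inter> cball p r" for s x
    proof -
      have "L3 * BY * \<bar>s\<bar> \<le> C * \<bar>s\<bar>"
        unfolding C_def using BY0 LY0 r1(2) r3(2) r4(2) by (intro mult_right_mono) auto
      with move[OF that] show ?thesis by linarith
    qed
    show ?thesis
      using C0 \<delta> \<delta>3 stay move' lipG deriv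
      by (intro exI[of _ \<phi>] exI[of _ C] exI[of _ \<delta>]) blast
  qed
  show ?thesis
  proof (intro exI[of _ r] conjI allI impI)
    show "r > 0" by (rule r)
    show "compact (S \<inter> cball p r)" by (rule rc(2)[OF r_le(3)])
  qed (rule main; blast)
qed

end

section \<open>First-order change of integrals under deformation\<close>

context hypersurface
begin

lemma surf_integrable_on_compact:
  fixes h :: "'a \<Rightarrow> real"
  assumes h: "continuous_on N h" and N: "compact N" "N \<subseteq> S"
  shows "surf_integrable (\<lambda>x. indicator N x * h x)"
proof -
  have "compact (h ` N)" using compact_continuous_image[OF h N(1)] .
  then obtain B where B: "\<And>x. x \<in> N \<Longrightarrow> \<bar>h x\<bar> \<le> B"
    using compact_imp_bounded bounded_iff by (metis imageI real_norm_def)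
  have NB: "N \<in> sets borel" using N by (simp add: borel_compact)
  have eq: "indicator S x * (indicator N x * h x) = indicator N x * h x" for x
    using N(2) by (auto split: split_indicator)
  show ?thesis
    unfolding surf_integrable_def eq
  proof (rule integrableI_bounded_set[where A=N and B=B])
    show "N \<in> sets (surface_measure S)" using NB by simp
    show "(\<lambda>x. indicator N x * h x) \<in> borel_measurable (surface_measure S)"
      using borel_measurable_continuous_on_indicator[OF NB h] by simp
    show "emeasure (surface_measure S) N < \<infinity>" using surface_measure_compact_finite[OF N] by simp
  qed (use B in \<open>auto split: split_indicator\<close>)
qed

text \<open>The inverse of \<open>\<phi>\<close> on its image is Lipschitz with constant
  \<open>1 / k\<close>, so the part of \<open>N\<close> that \<open>\<phi>\<close> sends into
  \<open>A\<close> has at most \<open>(1 / k) ^ (DIM('a) - 1)\<close> times the measure of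
  \<open>N \<inter> A\<close>. This compares the push-forward of the measure on \<open>N\<close>
  with that measure itself.\<close>

lemma surf_int_expanding_map:
  assumes N: "compact N" "N \<subseteq> S" and \<phi>: "continuous_on N \<phi>" "\<phi> ` N \<subseteq> N"
    and k: "k > 0" "\<And>x y. x \<in> N \<Longrightarrow> y \<in> N \<Longrightarrow> k * dist x y \<le> dist (\<phi> x) (\<phi> y)"
    and f: "continuous_on N f" "\<And>x. x \<in> N \<Longrightarrow> 0 \<le> f x"
  shows "surf_int (\<lambda>x. indicator N x * f (\<phi> x)) \<le> (1 / k) ^ (DIM('a) - 1) * surf_int (\<lambda>x. indicator N x * f x)"
proof -
  let ?n = "DIM('a) - 1"
  have NB: "N \<in> sets borel" using N by (simp add: borel_compact)
  define M where "M = density (surface_measure S) (indicator N)"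
  have sM: "sets M = sets borel" "space M = UNIV" by (simp_all add: M_def)
  have emM: "emeasure M A = hausdorff_outer_measure ?n (N \<inter> A)" if A: "A \<in> sets borel" for A
  proof -
    have "emeasure M A = emeasure (surface_measure S) (N \<inter> A)"
      unfolding M_def using NB A by (intro emeasure_restricted) auto
    also have "\<dots> = hausdorff_outer_measure ?n (S \<inter> (N \<inter> A))" using NB A by (intro emeasure_surface_measure) auto
    also have "S \<inter> (N \<inter> A) = N \<inter> A" using N(2) by auto
    finally show ?thesis .
  qed
  \<comment> \<open>\<open>\<phi>\<close> is controlled on \<open>N\<close> only. Continuing it by
    the identity gives a Borel map on the whole type and changes nothing for \<open>M\<close>, which
    is carried by \<open>N\<close>.\<close>
  define \<phi>' where "\<phi>' = (\<lambda>x. indicator N x *\<^sub>R \<phi> x + indicator (- N) x *\<^sub>R x)"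
  have \<phi>'m: "\<phi>' \<in> borel_measurable borel"
    unfolding \<phi>'_def using borel_measurable_continuous_on_indicator[OF NB \<phi>(1)] NB by measurable
  have \<phi>'N: "\<phi>' x = \<phi> x" if "x \<in> N" for x using that by (simp add: \<phi>'_def)
  define g where "g = (\<lambda>x. indicator N x * f x)"
  have gm: "g \<in> borel_measurable borel"
    using borel_measurable_continuous_on_indicator[OF NB f(1)] by (simp add: g_def)
  have g0: "g x \<ge> 0" for x using f(2) by (auto simp: g_def split: split_indicator)
  define \<kappa> where "\<kappa> = ennreal ((1 / k) ^ ?n)"
  have le: "distr M borel \<phi>' \<le> scale_measure \<kappa> M"
  proof (subst le_measure)
    show "sets (distr M borel \<phi>') = sets (scale_measure \<kappa> M)" by (simp add: sM)
    show "\<forall>A\<in>sets (distr M borel \<phi>'). emeasure (distr M borel \<phi>') A \<le> emeasure (scale_measure \<kappa> M) A"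
    proof
      fix A assume "A \<in> sets (distr M borel \<phi>')"
      then have A: "A \<in> sets borel" by simp
      define B where "B = N \<inter> \<phi>' -` A"
      have "emeasure (distr M borel \<phi>') A = emeasure M (\<phi>' -` A)"
        using A \<phi>'m by (subst emeasure_distr) (auto simp: sM measurable_cong_sets[OF sM(1) refl])
      also have "\<dots> = hausdorff_outer_measure ?n B"
        unfolding B_def by (rule emM[OF measurable_sets_borel[OF \<phi>'m A]])
      also have "\<dots> \<le> \<kappa> * hausdorff_outer_measure ?n (\<phi> ` B)"
        unfolding \<kappa>_def using k by (intro hausdorff_outer_measure_expanding) (auto simp: B_def)
      also have "\<dots> \<le> \<kappa> * hausdorff_outer_measure ?n (N \<inter> A)"
        using \<phi>(2) \<phi>'N by (intro mult_left_mono hausdorff_outer_measure_mono) (auto simp: B_def)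
      finally show "emeasure (distr M borel \<phi>') A \<le> emeasure (scale_measure \<kappa> M) A" by (simp add: emM[OF A])
    qed
  qed
  have nnM: "(\<integral>\<^sup>+x. ennreal (h x) \<partial>M) = (\<integral>\<^sup>+x. ennreal (indicator S x * (indicator N x * h x)) \<partial>surface_measure S)"
    if h: "h \<in> borel_measurable borel" for h
  proof -
    have "(\<integral>\<^sup>+x. ennreal (h x) \<partial>M) = (\<integral>\<^sup>+x. indicator N x * ennreal (h x) \<partial>surface_measure S)"
      unfolding M_def using NB h by (intro nn_integral_density) auto
    also have "\<dots> = (\<integral>\<^sup>+x. ennreal (indicator S x * (indicator N x * h x)) \<partial>surface_measure S)"
      using N(2) by (intro nn_integral_cong) (auto split: split_indicator)
    finally show ?thesis .
  qed
  have int_nn: "ennreal (surf_int (\<lambda>x. indicator N x * h x)) = (\<integral>\<^sup>+x. ennreal (indicator S x * (indicator N x * h x)) \<partial>surface_measure S)"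
    if h: "continuous_on N h" "\<And>x. x \<in> N \<Longrightarrow> 0 \<le> h x" for h
    unfolding surf_int_def
    using surf_integrable_on_compact[OF h(1) N] h(2)
    by (intro nn_integral_eq_integral[symmetric]) (auto simp: surf_integrable_def split: split_indicator)
  have gi: "indicator N x * g x = indicator N x * f x" for x by (auto simp: g_def split: split_indicator)
  have gi': "indicator N x * g (\<phi>' x) = indicator N x * f (\<phi> x)" for x
    using \<phi>(2) \<phi>'N by (auto simp: g_def split: split_indicator)
  have cont_comp: "continuous_on N (\<lambda>x. f (\<phi> x))"
    by (rule continuous_on_compose2[OF f(1) \<phi>(1) \<phi>(2)])
  have "ennreal (surf_int (\<lambda>x. indicator N x * f (\<phi> x))) = (\<integral>\<^sup>+x. ennreal (g (\<phi>' x)) \<partial>M)"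
    using \<phi>(2) f(2) gm \<phi>'m by (subst int_nn[OF cont_comp], force, subst nnM) (auto simp: gi')
  also have "\<dots> = (\<integral>\<^sup>+x. ennreal (g x) \<partial>distr M borel \<phi>')"
    using gm \<phi>'m by (subst nn_integral_distr) (auto simp: measurable_cong_sets[OF sM(1) refl])
  also have "\<dots> \<le> (\<integral>\<^sup>+x. ennreal (g x) \<partial>scale_measure \<kappa> M)"
    by (rule nn_integral_mono_measure[OF _ le]) (simp add: sM)
  also have "\<dots> = \<kappa> * (\<integral>\<^sup>+x. ennreal (g x) \<partial>M)"
    using gm by (subst nn_integral_scale_measure) (auto simp: measurable_cong_sets[OF sM(1) refl])
  also have "(\<integral>\<^sup>+x. ennreal (g x) \<partial>M) = ennreal (surf_int (\<lambda>x. indicator N x * f x))"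
    using f gm by (subst int_nn[OF f(1)], force, subst nnM) (auto simp: gi)
  also have "\<kappa> * ennreal (surf_int (\<lambda>x. indicator N x * f x)) = ennreal ((1 / k) ^ ?n * surf_int (\<lambda>x. indicator N x * f x))"
    unfolding \<kappa>_def using k by (subst ennreal_mult') auto
  finally have "ennreal (surf_int (\<lambda>x. indicator N x * f (\<phi> x)))
      \<le> ennreal ((1 / k) ^ ?n * surf_int (\<lambda>x. indicator N x * f x))" .
  moreover have "0 \<le> surf_int (\<lambda>x. indicator N x * f x)"
    by (rule surf_int_nonneg) (use f(2) in \<open>simp add: indicator_def\<close>)
  then have "0 \<le> (1 / k) ^ ?n * surf_int (\<lambda>x. indicator N x * f x)" using k(1) by simp
  ultimately show ?thesis by (simp only: ennreal_le_iff)
qed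

text \<open>The curve is only known to be differentiable at \<open>0\<close>, unlike the smooth
  curves that define tangent vectors, so the chain rule is applied to a local extension of
  \<open>f\<close>.\<close>

lemma grad_inner_deriv:
  assumes x: "x \<in> S" and f: "smooth_along S f" and v: "v \<in> tangent_space S x"
    and c: "(c has_vector_derivative v) (at (0::real))" "c 0 = x" "\<delta> > 0" "\<And>s. \<bar>s\<bar> \<le> \<delta> \<Longrightarrow> c s \<in> S"
  shows "((\<lambda>s. f (c s)) has_real_derivative grad f x \<bullet> v) (at 0)"
proof -
  obtain U g where U: "x \<in> U" "open U" "smooth_on U g" "\<And>y. y \<in> S \<Longrightarrow> y \<in> U \<Longrightarrow> f y = g y"
    using smooth_alongE[OF f x] by blast
  note d = smooth_on_has_derivative[OF U(3,1)]
  have gv: "grad f x \<bullet> v = frechet_derivative g (at x) v"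
    using tangential_gradient_tangent(2)[OF x f v] deriv_along_eq[OF d U(2,1) x U(4) v] by simp
  have cd: "(c has_derivative (\<lambda>s. s *\<^sub>R v)) (at 0)" using c(1) by (simp add: has_vector_derivative_def)
  have "((\<lambda>s. g (c s)) has_derivative (\<lambda>s. frechet_derivative g (at x) (s *\<^sub>R v))) (at 0)"
    by (rule has_derivative_compose[OF cd]) (use d c(2) in simp)
  moreover have "(\<lambda>s. frechet_derivative g (at x) (s *\<^sub>R v)) = (*) (frechet_derivative g (at x) v)"
    using has_derivative_linear[OF d] by (auto simp: linear_scale fun_eq_iff)
  ultimately have dg: "((\<lambda>s. g (c s)) has_real_derivative grad f x \<bullet> v) (at 0)"
    by (simp add: has_field_derivative_def gv)
  have "isCont c 0" using has_derivative_continuous[OF cd] .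
  then have "\<forall>\<^sub>F s in nhds 0. c s \<in> U"
  proof -
    from \<open>isCont c 0\<close> have "\<forall>\<^sub>F s in at 0. c s \<in> U"
      unfolding isCont_def by (rule topological_tendstoD) (use U c(2) in auto)
    then show ?thesis using U(1) c(2) by (simp add: eventually_nhds_conv_at)
  qed
  moreover have "\<forall>\<^sub>F s::real in nhds 0. \<bar>s\<bar> \<le> \<delta>"
    unfolding eventually_nhds_metric using c(3) by (intro exI[of _ \<delta>]) (auto simp: dist_real_def)
  ultimately have "\<forall>\<^sub>F s in nhds 0. g (c s) = f (c s)"
    by eventually_elim (use U(4) c(4) in auto)
  then show ?thesis using dg by (subst (asm) DERIV_cong_ev[OF refl _ refl]) auto
qed

text \<open>For \<open>f \<ge> 0\<close> the integral of \<open>f \<circ> \<phi>\<^sub>s\<close> is at most \<open>(1 + O(s))\<close> times that of \<open>f\<close>, because the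
  inverse of \<open>\<phi>\<^sub>s\<close> is Lipschitz with constant \<open>1 + O(s)\<close>; differentiate at \<open>s = 0\<close>.\<close>

lemma deformation_bound:
  fixes \<phi> :: "real \<Rightarrow> 'a \<Rightarrow> 'a"
  assumes N: "compact N" "N \<subseteq> S"
    and C: "0 \<le> C" "0 < \<delta>" "C * \<delta> \<le> 1/2"
    and \<phi>: "\<And>s x. \<bar>s\<bar> \<le> \<delta> \<Longrightarrow> x \<in> N \<Longrightarrow> \<phi> s x \<in> N \<and> norm (\<phi> s x - x) \<le> C * \<bar>s\<bar>"
      "\<And>s x y. \<bar>s\<bar> \<le> \<delta> \<Longrightarrow> x \<in> N \<Longrightarrow> y \<in> N \<Longrightarrow> norm ((\<phi> s x - x) - (\<phi> s y - y)) \<le> C * \<bar>s\<bar> * norm (x - y)"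
      "\<And>x. x \<in> N \<Longrightarrow> ((\<lambda>s. \<phi> s x) has_vector_derivative X x) (at (0::real))"
    and X: "\<And>x. x \<in> N \<Longrightarrow> X x \<in> tangent_space S x" "continuous_on N X"
  shows "\<exists>D\<ge>0. \<forall>f. smooth_along S f \<longrightarrow> (\<forall>x\<in>S. 0 \<le> f x) \<longrightarrow>
    surf_int (\<lambda>x. indicator N x * (grad f x \<bullet> X x)) \<le> D * surf_int (\<lambda>x. indicator N x * f x)"
proof -
  let ?n = "DIM('a) - 1"
  have NB: "N \<in> sets borel" using N by (simp add: borel_compact)
  \<comment> \<open>\<open>1 - C * s\<close> is an expansion constant for \<open>\<phi> s\<close> on
    \<open>N\<close>. The derivative of \<open>\<kappa>\<close> at \<open>0\<close> will be the
    constant in the bound.\<close>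
  define \<kappa> where "\<kappa> = (\<lambda>s. (1 / (1 - C * s)) ^ ?n)"
  have "\<exists>D. (\<kappa> has_real_derivative D) (at 0)"
    unfolding \<kappa>_def by (rule exI) (auto intro!: derivative_eq_intros)
  then obtain D where D: "(\<kappa> has_real_derivative D) (at 0)" by blast
  \<comment> \<open>The times tend to \<open>0\<close> from the right, so dividing the comparison of
    integrals by them keeps its direction.\<close>
  define s where "s = (\<lambda>k::nat. \<delta> / real (Suc k))"
  have s: "0 < s k" "s k \<le> \<delta>" for k using C(2) by (auto simp: s_def field_simps)
  have s_at: "filterlim s (at 0) sequentially"
    unfolding filterlim_at
  proof
    show "s \<longlonglongrightarrow> 0" using tendsto_mult[OF tendsto_const[of \<delta>] LIMSEQ_inverse_real_of_nat]
      by (simp add: s_def field_simps)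
    show "\<forall>\<^sub>F k in sequentially. s k \<in> UNIV \<and> s k \<noteq> 0" using s by (simp add: less_imp_neq[symmetric])
  qed
  have \<kappa>_lim: "(\<lambda>k. (\<kappa> (s k) - 1) / s k) \<longlonglongrightarrow> D"
    using filterlim_compose[OF D[unfolded DERIV_def] s_at] by (simp add: \<kappa>_def)
  have sk: "\<bar>s k\<bar> \<le> \<delta>" for k using s[of k] by simp
  have main: "surf_int (\<lambda>x. indicator N x * (grad f x \<bullet> X x)) \<le> D * surf_int (\<lambda>x. indicator N x * f x)"
    if f: "smooth_along S f" "\<And>x. x \<in> S \<Longrightarrow> 0 \<le> f x" for f
  proof -
    have cf: "continuous_on N f" using continuous_on_subset[OF smooth_along_continuous[OF f(1)] N(2)] .
    obtain Lf where Lf: "Lf \<ge> 0" "\<And>x y. x \<in> N \<Longrightarrow> y \<in> N \<Longrightarrow> norm (f x - f y) \<le> Lf * norm (x - y)"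
      using smooth_along_lipschitz_on_compact[OF f(1) N] by blast
    have c\<phi>: "continuous_on N (\<phi> t)" if t: "\<bar>t\<bar> \<le> \<delta>" for t
    proof -
      have "(C * \<bar>t\<bar>)-lipschitz_on N (\<lambda>x. \<phi> t x - x)"
        using \<phi>(2)[OF t] C(1) by (intro lipschitz_onI) (auto simp: dist_norm)
      then have "continuous_on N (\<lambda>x. \<phi> t x - x)" by (rule lipschitz_on_continuous_on)
      from continuous_on_add[OF this continuous_on_id] show ?thesis by simp
    qed
    have step: "surf_int (\<lambda>x. indicator N x * f (\<phi> (s k) x)) \<le> \<kappa> (s k) * surf_int (\<lambda>x. indicator N x * f x)" for k
      unfolding \<kappa>_def
    proof (rule surf_int_expanding_map[OF N c\<phi>[OF sk]])
      have Cs: "C * s k \<le> C * \<delta>" using s(2)[of k] C(1) by (rule mult_left_mono)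
      then show "1 - C * s k > 0" using C(3) by simp
      show "\<phi> (s k) ` N \<subseteq> N" using \<phi>(1)[OF sk] by auto
      fix x y assume xy: "x \<in> N" "y \<in> N"
      have "norm ((\<phi> (s k) x - x) - (\<phi> (s k) y - y)) \<le> C * s k * norm (x - y)"
        using \<phi>(2)[OF sk[of k] xy] s(1)[of k] by simp
      moreover have "norm (x - y) - norm (\<phi> (s k) x - \<phi> (s k) y) \<le> norm ((\<phi> (s k) x - x) - (\<phi> (s k) y - y))"
        using norm_triangle_ineq2[of "x - y" "\<phi> (s k) x - \<phi> (s k) y"]
        by (simp add: norm_minus_commute algebra_simps)
      ultimately show "(1 - C * s k) * dist x y \<le> dist (\<phi> (s k) x) (\<phi> (s k) y)"
        by (simp add: dist_norm algebra_simps)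
    qed (use cf f(2) N(2) in auto)
    define F where "F = (\<lambda>k x. indicator N x * ((f (\<phi> (s k) x) - f x) / s k))"
    have comp: "continuous_on N (\<lambda>x. f (\<phi> (s k) x))" for k
      using \<phi>(1)[OF sk] by (intro continuous_on_compose2[OF cf c\<phi>[OF sk]]) auto
    have F_int: "surf_int (F k) \<le> (\<kappa> (s k) - 1) / s k * surf_int (\<lambda>x. indicator N x * f x)" for k
    proof -
      have "surf_int (F k) = surf_int (\<lambda>x. (1 / s k) * (indicator N x * f (\<phi> (s k) x) - indicator N x * f x))"
        unfolding F_def by (rule surf_int_cong) (simp add: diff_divide_distrib right_diff_distrib)
      also have "\<dots> = (1 / s k) * (surf_int (\<lambda>x. indicator N x * f (\<phi> (s k) x)) - surf_int (\<lambda>x. indicator N x * f x))"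
        unfolding surf_int_cmult
        by (subst surf_int_diff) (auto intro: surf_integrable_on_compact[OF _ N] comp cf)
      also have "\<dots> \<le> (1 / s k) * (\<kappa> (s k) * surf_int (\<lambda>x. indicator N x * f x) - surf_int (\<lambda>x. indicator N x * f x))"
        using step[of k] s(1)[of k] by (intro mult_left_mono) auto
      also have "\<dots> = (\<kappa> (s k) - 1) / s k * surf_int (\<lambda>x. indicator N x * f x)" by (simp add: algebra_simps diff_divide_distrib)
      finally show ?thesis .
    qed
    \<comment> \<open>The difference quotients are dominated on \<open>N\<close> by the Lipschitz
      constant of \<open>f\<close> times the bound \<open>C\<close> on the speed of the
      deformation.\<close>
    have F_lim: "(\<lambda>k. surf_int (F k)) \<longlonglongrightarrow> surf_int (\<lambda>x. indicator N x * (grad f x \<bullet> X x))"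
      unfolding surf_int_def
    proof (rule integral_dominated_convergence[where w="\<lambda>x. indicator S x * (indicator N x * (Lf * C))"])
      show "integrable (surface_measure S) (\<lambda>x. indicator S x * (indicator N x * (Lf * C)))"
        using surf_integrable_on_compact[OF continuous_on_const N] by (simp add: surf_integrable_def)
      have cg: "continuous_on N (\<lambda>x. grad f x \<bullet> X x)"
        using continuous_on_subset[OF smooth_along_continuous[OF smooth_along_tangential_gradient[OF f(1)]] N(2)] X(2)
        by (intro continuous_intros)
      from surf_integrable_on_compact[OF cg N]
      show "(\<lambda>x. indicator S x * (indicator N x * (grad f x \<bullet> X x))) \<in> borel_measurable (surface_measure S)"
        by (auto simp: surf_integrable_def)
      fix k
      have "continuous_on N (\<lambda>x. (f (\<phi> (s k) x) - f x) / s k)"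
        using s(1)[of k] by (intro continuous_intros comp cf) auto
      from surf_integrable_on_compact[OF this N]
      show "(\<lambda>x. indicator S x * F k x) \<in> borel_measurable (surface_measure S)"
        by (auto simp: surf_integrable_def F_def)
      have "norm (F k x) \<le> indicator N x * (Lf * C)" for x
      proof (cases "x \<in> N")
        case True
        have "norm (f (\<phi> (s k) x) - f x) \<le> Lf * norm (\<phi> (s k) x - x)" using Lf(2) \<phi>(1)[OF sk[of k] True] True by auto
        also have "\<dots> \<le> Lf * (C * s k)" using \<phi>(1)[OF sk[of k] True] s(1)[of k] Lf(1) by (intro mult_left_mono) auto
        finally show ?thesis using True s(1)[of k] by (simp add: F_def field_simps)
      qed (simp add: F_def)
      then show "AE x in surface_measure S. norm (indicator S x * F k x) \<le> indicator S x * (indicator N x * (Lf * C))"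
        by (intro AE_I2) (auto split: split_indicator simp del: real_norm_def simp: norm_mult)
    next
      have "(\<lambda>k. F k x) \<longlonglongrightarrow> indicator N x * (grad f x \<bullet> X x)" for x
      proof (cases "x \<in> N")
        case True
        have "\<phi> 0 x = x" using \<phi>(1)[of 0 x] C(2) True by simp
        moreover have "((\<lambda>s. f (\<phi> s x)) has_real_derivative grad f x \<bullet> X x) (at 0)"
          using True N(2) \<phi>(1) \<phi>(3)[OF True] X(1) C(2) f(1) calculation
          by (intro grad_inner_deriv[where \<delta>=\<delta>]) auto
        ultimately show ?thesis
          using filterlim_compose[OF _ s_at, of "\<lambda>h. (f (\<phi> h x) - f x) / h"] True
          by (simp add: F_def DERIV_def)
      qed (simp add: F_def)
      then show "AE x in surface_measure S. (\<lambda>k. indicator S x * F k x) \<longlonglongrightarrow> indicator S x * (indicator N x * (grad f x \<bullet> X x))"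
        by (intro AE_I2 tendsto_mult_left)
    qed
    show ?thesis
      by (rule LIMSEQ_le[OF F_lim tendsto_mult_right[OF \<kappa>_lim]]) (use F_int in auto)
  qed
  have nonneg: "0 \<le> surf_int (\<lambda>x. indicator N x * f x)" if "\<forall>x\<in>S. 0 \<le> f x" for f
    using that by (intro surf_int_nonneg) (auto split: split_indicator)
  show ?thesis
  proof (intro exI[of _ "max D 0"] conjI allI impI)
    fix f :: "'a \<Rightarrow> real" assume f: "smooth_along S f" "\<forall>x\<in>S. 0 \<le> f x"
    have "surf_int (\<lambda>x. indicator N x * (grad f x \<bullet> X x)) \<le> D * surf_int (\<lambda>x. indicator N x * f x)"
      using f by (intro main) auto
    also have "\<dots> \<le> max D 0 * surf_int (\<lambda>x. indicator N x * f x)"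
      using nonneg[OF f(2)] by (intro mult_right_mono) auto
    finally show "surf_int (\<lambda>x. indicator N x * (grad f x \<bullet> X x)) \<le> max D 0 * surf_int (\<lambda>x. indicator N x * f x)" .
  qed simp
qed

end

text \<open>Optimising over \<open>a\<close> turns a family of scaled bounds into one of
  Cauchy-Schwarz type. The choice \<open>a = \<bar>y\<bar> / (2 * Q)\<close> makes the second term
  half of \<open>\<bar>y\<bar>\<close>; for \<open>Q = 0\<close> a large \<open>a\<close> forces
  \<open>y = 0\<close>.\<close>

lemma square_le_of_scaled_bounds:
  fixes y P Q :: real
  assumes "P \<ge> 0" "Q \<ge> 0" and le: "\<And>a. a > 0 \<Longrightarrow> \<bar>y\<bar> \<le> P / a + Q * a"
  shows "y\<^sup>2 \<le> 4 * P * Q"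
proof (cases "y = 0")
  case False
  then have y: "\<bar>y\<bar> > 0" by simp
  have "Q > 0"
  proof (rule ccontr)
    assume "\<not> Q > 0"
    then have "Q = 0" using assms(2) by simp
    then have "\<bar>y\<bar> \<le> P / ((P + 1) / \<bar>y\<bar>)" using le[of "(P + 1) / \<bar>y\<bar>"] y assms(1) by simp
    then have "\<bar>y\<bar> * (P + 1) \<le> P * \<bar>y\<bar>" using assms(1) y by (simp add: pos_le_divide_eq)
    then show False using y by (simp add: algebra_simps)
  qed
  then have "\<bar>y\<bar> \<le> P / (\<bar>y\<bar> / (2 * Q)) + Q * (\<bar>y\<bar> / (2 * Q))" using y by (intro le) simp
  then have "\<bar>y\<bar> \<le> 2 * P * Q / \<bar>y\<bar> + \<bar>y\<bar> / 2" using \<open>Q > 0\<close> by (simp add: mult_ac)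
  then have "\<bar>y\<bar> * \<bar>y\<bar> \<le> (2 * P * Q / \<bar>y\<bar> + \<bar>y\<bar> / 2) * \<bar>y\<bar>" using y by (intro mult_right_mono) auto
  then show ?thesis using y by (simp add: power2_eq_square distrib_right)
qed (use assms in simp)

section \<open>From bounds on nonnegative functions to weighted square-integral bounds\<close>

context hypersurface
begin

lemma surf_integrable_cong: "(\<And>x. x \<in> S \<Longrightarrow> f x = g x) \<Longrightarrow> surf_integrable f \<longleftrightarrow> surf_integrable g"
  unfolding surf_integrable_def
  by (intro Bochner_Integration.integrable_cong) (auto split: split_indicator)

text \<open>A bound by \<open>\<integral> f\<close> for all nonnegative \<open>f\<close> self-improves to an \<open>L\<^sup>2\<close> bound for all \<open>f\<close>, since
  \<open>f = (f + a)\<^sup>2 / (2 a) - f\<^sup>2 / (2 a) - a / 2\<close>.\<close>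

lemma l2_bound_of_nonneg_bound:
  assumes N: "compact N" "N \<subseteq> S" and X: "continuous_on N X" and D: "D \<ge> 0"
    and le: "\<And>f. smooth_along S f \<Longrightarrow> (\<And>x. x \<in> S \<Longrightarrow> 0 \<le> f x) \<Longrightarrow>
      \<bar>surf_int (\<lambda>x. indicator N x * (grad f x \<bullet> X x))\<bar> \<le> D * surf_int (\<lambda>x. indicator N x * f x)"
    and f: "smooth_along S f"
  shows "(surf_int (\<lambda>x. indicator N x * (grad f x \<bullet> X x)))\<^sup>2
    \<le> 8 * D\<^sup>2 * surf_int (indicator N) * surf_int (\<lambda>x. indicator N x * (f x)\<^sup>2)"
proof -
  define I where "I = (\<lambda>g. surf_int (\<lambda>x. indicator N x * (grad g x \<bullet> X x)))"
  define J where "J = (\<lambda>g. surf_int (\<lambda>x. indicator N x * (g x :: real)))"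
  have cf: "continuous_on N f" using continuous_on_subset[OF smooth_along_continuous[OF f] N(2)] .
  have cg: "continuous_on N (grad f)"
    using continuous_on_subset[OF smooth_along_continuous[OF smooth_along_tangential_gradient[OF f]] N(2)] .
  note int = surf_integrable_on_compact[OF _ N]
  have J1: "J (\<lambda>_. 1) = surf_int (indicator N)" by (simp add: J_def)
  have Jnn: "J g \<ge> 0" if "\<And>x. x \<in> N \<Longrightarrow> 0 \<le> g x" for g
    unfolding J_def by (rule surf_int_nonneg) (use that in \<open>simp add: indicator_def\<close>)
  have "(I f)\<^sup>2 \<le> 4 * (2 * D * J (\<lambda>x. (f x)\<^sup>2)) * (D * J (\<lambda>_. 1))"
  proof (rule square_le_of_scaled_bounds)
    fix a :: real assume a: "a > 0"
    \<comment> \<open>The gradient of \<open>h b\<close> is \<open>(f + b) / a\<close> times that of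
      \<open>f\<close>, so \<open>I (h a) - I (h 0) = I f\<close>. Both functions are nonnegative,
      and estimating their integrals leaves exactly terms in \<open>1 / a\<close> and in
      \<open>a\<close>.\<close>
    define h where "h = (\<lambda>b x. 1 / (2 * a) * (f x + b)\<^sup>2)"
    have sh: "smooth_along S (h b)" for b
      unfolding h_def power2_eq_square
      by (intro smooth_along_bilinear[OF bounded_bilinear_mult] smooth_along_add smooth_along_const f)
    have gh: "grad (h b) x = (1 / a * (f x + b)) *\<^sub>R grad f x" if "x \<in> S" for b x
      unfolding h_def grad_square[OF that f] by simp
    have hn: "h b x \<ge> 0" for b x using a by (simp add: h_def)
    have "I f = surf_int (\<lambda>x. indicator N x * ((1 / a * (f x + a)) * (grad f x \<bullet> X x)) - indicator N x * ((1 / a * (f x + 0)) * (grad f x \<bullet> X x)))"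
      unfolding I_def
    proof (rule surf_int_cong)
      fix x
      show "indicator N x * (grad f x \<bullet> X x) = indicator N x * ((1 / a * (f x + a)) * (grad f x \<bullet> X x)) - indicator N x * ((1 / a * (f x + 0)) * (grad f x \<bullet> X x))"
        using a by (simp add: field_simps)
    qed
    also have "\<dots> = surf_int (\<lambda>x. indicator N x * ((1 / a * (f x + a)) * (grad f x \<bullet> X x))) - surf_int (\<lambda>x. indicator N x * ((1 / a * (f x + 0)) * (grad f x \<bullet> X x)))"
      by (intro surf_int_diff int continuous_intros cf cg X)
    also have "\<dots> = I (h a) - I (h 0)"
      unfolding I_def by (intro arg_cong2[where f="(-)"] surf_int_cong) (simp_all add: gh)
    finally have "\<bar>I f\<bar> \<le> \<bar>I (h a)\<bar> + \<bar>I (h 0)\<bar>" by linarith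
    also have "\<dots> \<le> D * J (h a) + D * J (h 0)"
      unfolding I_def J_def by (intro add_mono le sh hn)
    also have "J (h a) \<le> surf_int (\<lambda>x. 1 / a * (indicator N x * (f x)\<^sup>2) + a * (indicator N x * 1))"
      unfolding J_def
    proof (rule surf_int_mono)
      show "surf_integrable (\<lambda>x. indicator N x * h a x)" unfolding h_def by (intro int continuous_intros cf)
      show "surf_integrable (\<lambda>x. 1 / a * (indicator N x * (f x)\<^sup>2) + a * (indicator N x * 1))"
        by (intro surf_integrable_add surf_integrable_cmult int continuous_intros cf)
      fix x
      have "(f x + a)\<^sup>2 \<le> 2 * (f x)\<^sup>2 + 2 * a\<^sup>2" using sum_squares_bound[of "f x" a] by (simp add: power2_sum)
      then have "1 / (2 * a) * (f x + a)\<^sup>2 \<le> 1 / (2 * a) * (2 * (f x)\<^sup>2 + 2 * a\<^sup>2)" using a by (intro mult_left_mono) auto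
      also have "\<dots> = 1 / a * (f x)\<^sup>2 + a" using a by (simp add: field_simps power2_eq_square)
      finally show "indicator N x * h a x \<le> 1 / a * (indicator N x * (f x)\<^sup>2) + a * (indicator N x * 1)"
        by (simp add: h_def split: split_indicator)
    qed
    also have "\<dots> = 1 / a * J (\<lambda>x. (f x)\<^sup>2) + a * J (\<lambda>_. 1)"
      unfolding J_def surf_int_cmult[symmetric]
      by (intro surf_int_add surf_integrable_cmult int continuous_intros cf)
    also have "J (h 0) \<le> 1 / a * J (\<lambda>x. (f x)\<^sup>2)"
      unfolding J_def surf_int_cmult[symmetric]
    proof (rule surf_int_mono)
      show "surf_integrable (\<lambda>x. indicator N x * h 0 x)" unfolding h_def by (intro int continuous_intros cf)
      show "surf_integrable (\<lambda>x. 1 / a * (indicator N x * (f x)\<^sup>2))"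
        by (intro surf_integrable_cmult int continuous_intros cf)
      show "indicator N x * h 0 x \<le> 1 / a * (indicator N x * (f x)\<^sup>2)" for x
        using a by (simp add: h_def field_simps split: split_indicator)
    qed
    finally have "\<bar>I f\<bar> \<le> D * (1 / a * J (\<lambda>x. (f x)\<^sup>2) + a * J (\<lambda>_. 1)) + D * (1 / a * J (\<lambda>x. (f x)\<^sup>2))"
      using D by (simp add: mult_left_mono)
    then show "\<bar>I f\<bar> \<le> (2 * D * J (\<lambda>x. (f x)\<^sup>2)) / a + D * J (\<lambda>_. 1) * a"
      by (simp add: algebra_simps)
  qed (use D Jnn in auto)
  then show ?thesis unfolding I_def J1 by (simp add: J_def power2_eq_square mult_ac)
qed

text \<open>Applied to \<open>X\<close> and to \<open>- X\<close>, the one-sided bound becomes a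
  bound on the absolute value, as the passage to squares requires. The radius is again fixed before
  the field.\<close>

lemma local_l2_bound:
  assumes p: "p \<in> S"
  shows "\<exists>r>0. compact (S \<inter> cball p r) \<and>
    (\<forall>X L. (\<forall>x\<in>S. X x \<in> tangent_space S x) \<longrightarrow>
       (\<forall>x\<in>S \<inter> cball p r. \<forall>y\<in>S \<inter> cball p r. norm (X x - X y) \<le> L * norm (x - y)) \<longrightarrow>
       (\<forall>x\<in>S. r / 2 \<le> dist p x \<longrightarrow> X x = 0) \<longrightarrow>
       (\<exists>C\<ge>0. \<forall>f. smooth_along S f \<longrightarrow> (surf_int (\<lambda>x. indicator (S \<inter> cball p r) x * (grad f x \<bullet> X x)))\<^sup>2
          \<le> C * surf_int (\<lambda>x. indicator (S \<inter> cball p r) x * (f x)\<^sup>2)))"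
proof -
  obtain r where r: "r > 0" "compact (S \<inter> cball p r)" and def:
    "\<And>X L. (\<forall>x\<in>S. X x \<in> tangent_space S x) \<Longrightarrow>
       (\<forall>x\<in>S \<inter> cball p r. \<forall>y\<in>S \<inter> cball p r. norm (X x - X y) \<le> L * norm (x - y)) \<Longrightarrow>
       (\<forall>x\<in>S. r / 2 \<le> dist p x \<longrightarrow> X x = 0) \<Longrightarrow>
       (\<exists>\<phi> C \<delta>. 0 \<le> C \<and> 0 < \<delta> \<and> C * \<delta> \<le> 1/2 \<and>
         (\<forall>s x. \<bar>s\<bar> \<le> \<delta> \<longrightarrow> x \<in> S \<inter> cball p r \<longrightarrow> \<phi> s x \<in> S \<inter> cball p r \<and> norm (\<phi> s x - x) \<le> C * \<bar>s\<bar>) \<and>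
         (\<forall>s x y. \<bar>s\<bar> \<le> \<delta> \<longrightarrow> x \<in> S \<inter> cball p r \<longrightarrow> y \<in> S \<inter> cball p r \<longrightarrow>
            norm ((\<phi> s x - x) - (\<phi> s y - y)) \<le> C * \<bar>s\<bar> * norm (x - y)) \<and>
         (\<forall>x\<in>S \<inter> cball p r. ((\<lambda>s. \<phi> s x) has_vector_derivative X x) (at (0::real))))"
    using deformation_exists[OF p] by (elim exE conjE) blast
  define N where "N = S \<inter> cball p r"
  have N: "compact N" "N \<subseteq> S" using r(2) by (auto simp: N_def)
  have one_sided: "\<exists>D\<ge>0. \<forall>f. smooth_along S f \<longrightarrow> (\<forall>x\<in>S. 0 \<le> f x) \<longrightarrow>
      surf_int (\<lambda>x. indicator N x * (grad f x \<bullet> X x)) \<le> D * surf_int (\<lambda>x. indicator N x * f x)"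
    if X: "\<forall>x\<in>S. X x \<in> tangent_space S x"
      "\<forall>x\<in>N. \<forall>y\<in>N. norm (X x - X y) \<le> L * norm (x - y)"
      "\<forall>x\<in>S. r / 2 \<le> dist p x \<longrightarrow> X x = 0" "continuous_on N X" for X L
  proof -
    obtain \<phi> C \<delta> where \<phi>: "0 \<le> C" "0 < \<delta>" "C * \<delta> \<le> 1/2"
      "\<And>s x. \<bar>s\<bar> \<le> \<delta> \<Longrightarrow> x \<in> N \<Longrightarrow> \<phi> s x \<in> N \<and> norm (\<phi> s x - x) \<le> C * \<bar>s\<bar>"
      "\<And>s x y. \<bar>s\<bar> \<le> \<delta> \<Longrightarrow> x \<in> N \<Longrightarrow> y \<in> N \<Longrightarrow> norm ((\<phi> s x - x) - (\<phi> s y - y)) \<le> C * \<bar>s\<bar> * norm (x - y)"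
      "\<And>x. x \<in> N \<Longrightarrow> ((\<lambda>s. \<phi> s x) has_vector_derivative X x) (at (0::real))"
      using def[OF X(1) X(2)[unfolded N_def] X(3)] unfolding N_def by (elim exE conjE) blast
    show ?thesis
      by (rule deformation_bound[OF N \<phi>]) (use X N(2) in auto)
  qed
  have main: "\<exists>C\<ge>0. \<forall>f. smooth_along S f \<longrightarrow> (surf_int (\<lambda>x. indicator N x * (grad f x \<bullet> X x)))\<^sup>2
          \<le> C * surf_int (\<lambda>x. indicator N x * (f x)\<^sup>2)"
    if X: "\<forall>x\<in>S. X x \<in> tangent_space S x"
      "\<forall>x\<in>N. \<forall>y\<in>N. norm (X x - X y) \<le> L * norm (x - y)"
      "\<forall>x\<in>S. r / 2 \<le> dist p x \<longrightarrow> X x = 0" for X L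
  proof -
    have "\<bar>L\<bar>-lipschitz_on N X"
    proof (rule lipschitz_onI)
      fix x y assume "x \<in> N" "y \<in> N"
      then have "norm (X x - X y) \<le> L * norm (x - y)" using X(2) by blast
      also have "\<dots> \<le> \<bar>L\<bar> * norm (x - y)" by (intro mult_right_mono) auto
      finally show "dist (X x) (X y) \<le> \<bar>L\<bar> * dist x y" by (simp add: dist_norm)
    qed simp
    then have cX: "continuous_on N X" by (rule lipschitz_on_continuous_on)
    obtain D1 where D1: "D1 \<ge> 0" "\<And>f. smooth_along S f \<Longrightarrow> (\<forall>x\<in>S. 0 \<le> f x) \<Longrightarrow>
      surf_int (\<lambda>x. indicator N x * (grad f x \<bullet> X x)) \<le> D1 * surf_int (\<lambda>x. indicator N x * f x)"
      using one_sided[OF X cX] by blast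
    have "\<exists>D\<ge>0. \<forall>f. smooth_along S f \<longrightarrow> (\<forall>x\<in>S. 0 \<le> f x) \<longrightarrow>
      surf_int (\<lambda>x. indicator N x * (grad f x \<bullet> - X x)) \<le> D * surf_int (\<lambda>x. indicator N x * f x)"
    proof (rule one_sided[where L=L])
      show "\<forall>x\<in>S. - X x \<in> tangent_space S x" using X(1) subspace_tangent_space by (auto intro: subspace_neg)
      show "\<forall>x\<in>N. \<forall>y\<in>N. norm (- X x - - X y) \<le> L * norm (x - y)"
        using X(2) by (auto simp: norm_minus_commute)
      show "\<forall>x\<in>S. r / 2 \<le> dist p x \<longrightarrow> - X x = 0" using X(3) by simp
      show "continuous_on N (\<lambda>x. - X x)" using cX by (rule continuous_on_minus)
    qed
    then obtain D2 where D2: "D2 \<ge> 0" "\<And>f. smooth_along S f \<Longrightarrow> (\<forall>x\<in>S. 0 \<le> f x) \<Longrightarrow>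
      surf_int (\<lambda>x. indicator N x * (grad f x \<bullet> - X x)) \<le> D2 * surf_int (\<lambda>x. indicator N x * f x)"
      by blast
    define D where "D = max D1 D2"
    have D0: "D \<ge> 0" using D1(1) by (simp add: D_def)
    have abs: "\<bar>surf_int (\<lambda>x. indicator N x * (grad f x \<bullet> X x))\<bar> \<le> D * surf_int (\<lambda>x. indicator N x * f x)"
      if f: "smooth_along S f" "\<And>x. x \<in> S \<Longrightarrow> 0 \<le> f x" for f
    proof -
      have nn: "0 \<le> surf_int (\<lambda>x. indicator N x * f x)"
        by (rule surf_int_nonneg) (use f(2) in \<open>simp add: indicator_def\<close>)
      have "surf_int (\<lambda>x. indicator N x * (grad f x \<bullet> - X x)) = surf_int (\<lambda>x. (-1) * (indicator N x * (grad f x \<bullet> X x)))"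
        by (rule surf_int_cong) simp
      then have "- surf_int (\<lambda>x. indicator N x * (grad f x \<bullet> X x)) \<le> D2 * surf_int (\<lambda>x. indicator N x * f x)"
        using D2(2)[OF f(1)] f(2) unfolding surf_int_cmult by simp
      moreover have "surf_int (\<lambda>x. indicator N x * (grad f x \<bullet> X x)) \<le> D1 * surf_int (\<lambda>x. indicator N x * f x)"
        using D1(2)[OF f(1)] f(2) by simp
      moreover have "D1 * surf_int (\<lambda>x. indicator N x * f x) \<le> D * surf_int (\<lambda>x. indicator N x * f x)"
        "D2 * surf_int (\<lambda>x. indicator N x * f x) \<le> D * surf_int (\<lambda>x. indicator N x * f x)"
        using nn by (auto simp: D_def intro: mult_right_mono)
      ultimately show ?thesis by linarith
    qed
    have "surf_int (indicator N) \<ge> 0" by (rule surf_int_nonneg) simp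
    then show ?thesis
      using l2_bound_of_nonneg_bound[OF N cX D0 abs]
      by (intro exI[of _ "8 * D\<^sup>2 * surf_int (indicator N)"]) auto
  qed
  show ?thesis
  proof (rule exI[of _ r], intro conjI allI impI)
    fix X :: "'a \<Rightarrow> 'a" and L :: real
    assume X: "\<forall>x\<in>S. X x \<in> tangent_space S x"
      "\<forall>x\<in>S \<inter> cball p r. \<forall>y\<in>S \<inter> cball p r. norm (X x - X y) \<le> L * norm (x - y)"
      "\<forall>x\<in>S. r / 2 \<le> dist p x \<longrightarrow> X x = 0"
    from main[OF X(1) X(2)[folded N_def] X(3)]
    show "\<exists>C\<ge>0. \<forall>f. smooth_along S f \<longrightarrow> (surf_int (\<lambda>x. indicator (S \<inter> cball p r) x * (grad f x \<bullet> X x)))\<^sup>2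
          \<le> C * surf_int (\<lambda>x. indicator (S \<inter> cball p r) x * (f x)\<^sup>2)"
      unfolding N_def .
  qed (use r in auto)
qed

text \<open>Weaker than smoothness along \<open>S\<close>, because the fields are multiplied by
  cut-offs built from \<open>dist\<close>, which are Lipschitz but not smooth.\<close>

definition compactly_lipschitz :: "('a \<Rightarrow> 'b::real_normed_vector) \<Rightarrow> bool" where
  "compactly_lipschitz X \<longleftrightarrow>
    (\<forall>N. compact N \<longrightarrow> N \<subseteq> S \<longrightarrow> (\<exists>L\<ge>0. \<forall>x\<in>N. \<forall>y\<in>N. norm (X x - X y) \<le> L * norm (x - y)))"

lemma compactly_lipschitz_continuous:
  assumes "compactly_lipschitz X" "compact N" "N \<subseteq> S"
  shows "continuous_on N X"
proof -
  obtain L where "L \<ge> 0" "\<forall>x\<in>N. \<forall>y\<in>N. norm (X x - X y) \<le> L * norm (x - y)"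
    using assms(1)[unfolded compactly_lipschitz_def, rule_format, OF assms(2,3)] by blast
  then have "L-lipschitz_on N X" by (intro lipschitz_onI) (auto simp: dist_norm)
  then show ?thesis by (rule lipschitz_on_continuous_on)
qed

lemma compactly_lipschitz_scaleR:
  fixes X :: "'a \<Rightarrow> 'b::real_normed_vector"
  assumes \<eta>: "\<And>x y. \<bar>\<eta> x - \<eta> y\<bar> \<le> K * norm (x - y)" "\<And>x. \<bar>\<eta> x\<bar> \<le> 1" "K \<ge> 0"
    and X: "compactly_lipschitz X"
  shows "compactly_lipschitz (\<lambda>x. \<eta> x *\<^sub>R X x)"
  unfolding compactly_lipschitz_def
proof (intro allI impI)
  fix N assume N: "compact N" "N \<subseteq> S"
  obtain L where L: "L \<ge> 0" "\<forall>x\<in>N. \<forall>y\<in>N. norm (X x - X y) \<le> L * norm (x - y)"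
    using X[unfolded compactly_lipschitz_def, rule_format, OF N] by blast
  have "compact (X ` N)" using compact_continuous_image[OF compactly_lipschitz_continuous[OF X N] N(1)] .
  then obtain B where B: "B > 0" "\<And>x. x \<in> N \<Longrightarrow> norm (X x) \<le> B"
    using compact_imp_bounded bounded_pos by (metis imageI)
  have "norm (\<eta> x *\<^sub>R X x - \<eta> y *\<^sub>R X y) \<le> (L + K * B) * norm (x - y)" if xy: "x \<in> N" "y \<in> N" for x y
  proof -
    have "\<eta> x *\<^sub>R X x - \<eta> y *\<^sub>R X y = \<eta> x *\<^sub>R (X x - X y) + (\<eta> x - \<eta> y) *\<^sub>R X y" by (simp add: algebra_simps)
    also have "norm \<dots> \<le> \<bar>\<eta> x\<bar> * norm (X x - X y) + \<bar>\<eta> x - \<eta> y\<bar> * norm (X y)"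
      by (rule order_trans[OF norm_triangle_ineq]) simp
    also have "\<dots> \<le> 1 * (L * norm (x - y)) + (K * norm (x - y)) * B"
      using \<eta>(1)[of x y] \<eta>(2)[of x] \<eta>(3) L(2)[rule_format, OF xy] B(2)[OF xy(2)]
      by (intro add_mono mult_mono) auto
    finally show ?thesis by (simp add: algebra_simps)
  qed
  then show "\<exists>L\<ge>0. \<forall>x\<in>N. \<forall>y\<in>N. norm (\<eta> x *\<^sub>R X x - \<eta> y *\<^sub>R X y) \<le> L * norm (x - y)"
    using L(1) B(1) \<eta>(3) by (intro exI[of _ "L + K * B"]) auto
qed

definition l2_bounded :: "('a \<Rightarrow> 'a) \<Rightarrow> bool" where
  "l2_bounded X \<longleftrightarrow> (\<exists>C\<ge>0. \<forall>f\<in>test. (surf_int (\<lambda>x. grad f x \<bullet> X x))\<^sup>2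
     \<le> C * surf_int (\<lambda>x. (f x)\<^sup>2 * gauss_weight x))"

lemma test_l2_integrable:
  assumes f: "f \<in> test" and h: "continuous_on S h"
  shows "surf_integrable (\<lambda>x. (f x)\<^sup>2 * h x)" "surf_integrable (\<lambda>x. f x * h x)"
proof -
  obtain K where K: "compact K" "K \<subseteq> S" "\<forall>x. x \<notin> K \<longrightarrow> f x = 0" using testD(3)[OF f] by blast
  have cf: "continuous_on S f" by (rule smooth_along_continuous[OF testD(1)[OF f]])
  show "surf_integrable (\<lambda>x. (f x)\<^sup>2 * h x)" "surf_integrable (\<lambda>x. f x * h x)"
    using K(3) by (auto intro!: surf_integrable_compact[OF _ K(1,2)] continuous_intros cf h)
qed

lemma continuous_on_gauss_weight: "continuous_on A gauss_weight"
  unfolding gauss_weight_def[abs_def] by (intro continuous_intros) simp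

lemma l2_bounded_add:
  assumes X: "l2_bounded X" "compactly_lipschitz X" and Y: "l2_bounded Y" "compactly_lipschitz Y"
  shows "l2_bounded (\<lambda>x. X x + Y x)"
proof -
  obtain C D where C: "C \<ge> 0" "\<And>f. f \<in> test \<Longrightarrow> (surf_int (\<lambda>x. grad f x \<bullet> X x))\<^sup>2 \<le> C * surf_int (\<lambda>x. (f x)\<^sup>2 * gauss_weight x)"
    and D: "D \<ge> 0" "\<And>f. f \<in> test \<Longrightarrow> (surf_int (\<lambda>x. grad f x \<bullet> Y x))\<^sup>2 \<le> D * surf_int (\<lambda>x. (f x)\<^sup>2 * gauss_weight x)"
    using X(1) Y(1) unfolding l2_bounded_def by blast
  have "(surf_int (\<lambda>x. grad f x \<bullet> (X x + Y x)))\<^sup>2 \<le> (2 * C + 2 * D) * surf_int (\<lambda>x. (f x)\<^sup>2 * gauss_weight x)"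
    if f: "f \<in> test" for f
  proof -
    obtain K where K: "compact K" "K \<subseteq> S" "\<forall>x. x \<notin> K \<longrightarrow> f x = 0" using testD(3)[OF f] by blast
    have cg: "continuous_on K (grad f)"
      using continuous_on_subset[OF smooth_along_continuous[OF smooth_along_tangential_gradient[OF testD(1)[OF f]]] K(2)] .
    have int: "surf_integrable (\<lambda>x. grad f x \<bullet> Z x)" if Z: "compactly_lipschitz Z" for Z
    proof -
      have "surf_integrable (\<lambda>x. indicator K x * (grad f x \<bullet> Z x))"
        by (intro surf_integrable_on_compact[OF _ K(1,2)] continuous_intros cg compactly_lipschitz_continuous[OF Z K(1,2)])
      then show ?thesis
        using test_grad_zero[OF _ K(1,3)]
        by (subst surf_integrable_cong[of _ "\<lambda>x. indicator K x * (grad f x \<bullet> Z x)"]) (auto split: split_indicator)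
    qed
    have eq: "surf_int (\<lambda>x. grad f x \<bullet> (X x + Y x)) = surf_int (\<lambda>x. grad f x \<bullet> X x) + surf_int (\<lambda>x. grad f x \<bullet> Y x)"
      unfolding inner_add_right by (rule surf_int_add[OF int[OF X(2)] int[OF Y(2)]])
    have "(u + v)\<^sup>2 \<le> 2 * u\<^sup>2 + 2 * v\<^sup>2" for u v :: real
      using sum_squares_bound[of u v] by (simp add: power2_sum)
    then have "(surf_int (\<lambda>x. grad f x \<bullet> (X x + Y x)))\<^sup>2 \<le> 2 * (surf_int (\<lambda>x. grad f x \<bullet> X x))\<^sup>2 + 2 * (surf_int (\<lambda>x. grad f x \<bullet> Y x))\<^sup>2"
      unfolding eq .
    then show ?thesis using C(2)[OF f] D(2)[OF f] by (simp add: algebra_simps)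
  qed
  then show ?thesis unfolding l2_bounded_def using C(1) D(1) by (intro exI[of _ "2 * C + 2 * D"]) auto
qed

text \<open>The support is covered by finitely many balls of a quarter of the local radii. Cutting
  the field off around one centre leaves a piece to which the local bound applies, and a remainder
  supported in the other balls.\<close>

proposition l2_bounded_compact_support:
  assumes X: "\<And>x. x \<in> S \<Longrightarrow> X x \<in> tangent_space S x" "compactly_lipschitz X"
    and K: "compact K" "K \<subseteq> S" "\<And>x. x \<in> S \<Longrightarrow> x \<notin> K \<Longrightarrow> X x = 0"
  shows "l2_bounded X"
proof -
  define good where "good = (\<lambda>p r. r > 0 \<and> compact (S \<inter> cball p r) \<and>
    (\<forall>X L. (\<forall>x\<in>S. X x \<in> tangent_space S x) \<longrightarrow>
       (\<forall>x\<in>S \<inter> cball p r. \<forall>y\<in>S \<inter> cball p r. norm (X x - X y) \<le> L * norm (x - y)) \<longrightarrow>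
       (\<forall>x\<in>S. r / 2 \<le> dist p x \<longrightarrow> X x = 0) \<longrightarrow>
       (\<exists>C\<ge>0. \<forall>f. smooth_along S f \<longrightarrow> (surf_int (\<lambda>x. indicator (S \<inter> cball p r) x * (grad f x \<bullet> X x)))\<^sup>2
          \<le> C * surf_int (\<lambda>x. indicator (S \<inter> cball p r) x * (f x)\<^sup>2))))"
  have "\<forall>p\<in>S. \<exists>r. good p r" using local_l2_bound unfolding good_def by blast
  then obtain r where r: "\<And>p. p \<in> S \<Longrightarrow> good p (r p)" by metis
  have r0: "r p > 0" and rc: "compact (S \<inter> cball p (r p))" if "p \<in> S" for p
    using r[OF that] by (auto simp: good_def)
  have local: "l2_bounded Y"
    if p: "p \<in> S" and Y: "\<And>x. x \<in> S \<Longrightarrow> Y x \<in> tangent_space S x" "compactly_lipschitz Y"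
      "\<And>x. x \<in> S \<Longrightarrow> r p / 2 \<le> dist p x \<Longrightarrow> Y x = 0" for p Y
  proof -
    define N where "N = S \<inter> cball p (r p)"
    have N: "compact N" "N \<subseteq> S" using rc[OF p] by (auto simp: N_def)
    obtain L where L: "\<forall>x\<in>N. \<forall>y\<in>N. norm (Y x - Y y) \<le> L * norm (x - y)"
      using Y(2)[unfolded compactly_lipschitz_def, rule_format, OF N] by blast
    have "\<exists>C\<ge>0. \<forall>f. smooth_along S f \<longrightarrow> (surf_int (\<lambda>x. indicator N x * (grad f x \<bullet> Y x)))\<^sup>2
          \<le> C * surf_int (\<lambda>x. indicator N x * (f x)\<^sup>2)"
      using r[OF p, unfolded good_def, THEN conjunct2, THEN conjunct2, rule_format, of Y L] Y L
      unfolding N_def by blast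
    then obtain C where C: "C \<ge> 0" "\<And>f. smooth_along S f \<Longrightarrow> (surf_int (\<lambda>x. indicator N x * (grad f x \<bullet> Y x)))\<^sup>2
          \<le> C * surf_int (\<lambda>x. indicator N x * (f x)\<^sup>2)" by blast
    \<comment> \<open>The Gaussian weight is bounded below on the bounded set \<open>N\<close>, and
      \<open>W\<close> is the reciprocal of such a bound. This converts the local unweighted
      estimate into a weighted one.\<close>
    define W where "W = exp ((norm p + r p)\<^sup>2 / 4)"
    have W: "1 \<le> W * gauss_weight x" if x: "x \<in> N" for x
    proof -
      have "norm x \<le> norm p + r p"
        using x norm_triangle_sub[of x p] by (auto simp: N_def dist_norm norm_minus_commute)
      then have "(norm x)\<^sup>2 \<le> (norm p + r p)\<^sup>2" by (intro power_mono) auto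
      then show ?thesis unfolding W_def gauss_weight_def exp_add[symmetric] by simp
    qed
    have "(surf_int (\<lambda>x. grad f x \<bullet> Y x))\<^sup>2 \<le> (C * W) * surf_int (\<lambda>x. (f x)\<^sup>2 * gauss_weight x)" if f: "f \<in> test" for f
    proof -
      have sf: "smooth_along S f" by (rule testD(1)[OF f])
      have cf: "continuous_on N f" using continuous_on_subset[OF smooth_along_continuous[OF sf] N(2)] .
      have "surf_int (\<lambda>x. grad f x \<bullet> Y x) = surf_int (\<lambda>x. indicator N x * (grad f x \<bullet> Y x))"
      proof (rule surf_int_cong)
        fix x assume x: "x \<in> S"
        show "grad f x \<bullet> Y x = indicator N x * (grad f x \<bullet> Y x)"
        proof (cases "x \<in> N")
          case False
          then have "r p / 2 \<le> dist p x" using x r0[OF p] by (auto simp: N_def)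
          then show ?thesis using Y(3)[OF x] by simp
        qed simp
      qed
      then have "(surf_int (\<lambda>x. grad f x \<bullet> Y x))\<^sup>2 \<le> C * surf_int (\<lambda>x. indicator N x * (f x)\<^sup>2)"
        using C(2)[OF sf] by simp
      also have "\<dots> \<le> C * surf_int (\<lambda>x. W * ((f x)\<^sup>2 * gauss_weight x))"
      proof (rule mult_left_mono[OF surf_int_mono C(1)])
        show "surf_integrable (\<lambda>x. indicator N x * (f x)\<^sup>2)"
          by (intro surf_integrable_on_compact[OF _ N] continuous_intros cf)
        show "surf_integrable (\<lambda>x. W * ((f x)\<^sup>2 * gauss_weight x))"
          by (intro surf_integrable_cmult test_l2_integrable[OF f] continuous_on_gauss_weight)
        fix x
        show "indicator N x * (f x)\<^sup>2 \<le> W * ((f x)\<^sup>2 * gauss_weight x)"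
        proof (cases "x \<in> N")
          case True
          have "1 * (f x)\<^sup>2 \<le> (W * gauss_weight x) * (f x)\<^sup>2" using W[OF True] by (intro mult_right_mono) auto
          then show ?thesis using True by (simp add: mult_ac)
        next
          case False
          then show ?thesis by (simp add: W_def less_imp_le)
        qed
      qed
      finally show ?thesis by (simp add: surf_int_cmult)
    qed
    then show ?thesis unfolding l2_bounded_def using C(1) by (intro exI[of _ "C * W"]) (auto simp: W_def)
  qed
  \<comment> \<open>The induction is over the centres with the field left general, since the
    remainder \<open>(1 - \<eta>) Y\<close> is again a compactly Lipschitz tangent field.\<close>
  have cover: "l2_bounded Y"
    if "finite F" "F \<subseteq> S" "\<And>x. x \<in> S \<Longrightarrow> Y x \<in> tangent_space S x" "compactly_lipschitz Y"
      "\<And>x. x \<in> S \<Longrightarrow> x \<notin> (\<Union>p\<in>F. ball p (r p / 4)) \<Longrightarrow> Y x = 0" for F Y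
    using that
  proof (induction F arbitrary: Y rule: finite_induct)
    case empty
    have "surf_int (\<lambda>x. grad f x \<bullet> Y x) = 0" for f
      using surf_int_cong[of "\<lambda>x. grad f x \<bullet> Y x" "\<lambda>x. 0 * 0"] empty(4) surf_int_cmult[of 0 "\<lambda>_. 0"] by simp
    then show ?case unfolding l2_bounded_def by (intro exI[of _ 0]) simp
  next
    case (insert p F)
    have p: "p \<in> S" using insert.prems by auto
    \<comment> \<open>Equal to \<open>1\<close> on the ball of radius \<open>r p / 4\<close>, to
      \<open>0\<close> beyond \<open>r p / 2\<close> as the local bound demands, and linear in the
      distance in between, with slope \<open>4 / r p\<close>.\<close>
    define \<eta> where "\<eta> = (\<lambda>x. max 0 (min 1 (2 - 4 / r p * dist p x)))"
    have \<eta>1: "\<bar>\<eta> x\<bar> \<le> 1" "\<bar>1 - \<eta> x\<bar> \<le> 1" for x by (auto simp: \<eta>_def)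
    have \<eta>L: "\<bar>\<eta> x - \<eta> y\<bar> \<le> 4 / r p * norm (x - y)" for x y
    proof -
      have mm: "\<bar>max 0 (min 1 u) - max 0 (min 1 v)\<bar> \<le> \<bar>u - v\<bar>" for u v :: real by (auto simp: max_def min_def)
      have "\<bar>\<eta> x - \<eta> y\<bar> \<le> \<bar>4 / r p * dist p y - 4 / r p * dist p x\<bar>"
        unfolding \<eta>_def using mm[of "2 - 4 / r p * dist p x" "2 - 4 / r p * dist p y"] by simp
      also have "\<dots> = 4 / r p * \<bar>dist p y - dist p x\<bar>"
        using r0[OF p] unfolding right_diff_distrib[symmetric] abs_mult by simp
      also have "\<dots> \<le> 4 / r p * dist x y"
        using abs_dist_diff_le[of y p x] r0[OF p] by (intro mult_left_mono) (auto simp: dist_commute)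
      finally show ?thesis by (simp add: dist_norm)
    qed
    have \<eta>L': "\<bar>(1 - \<eta> x) - (1 - \<eta> y)\<bar> \<le> 4 / r p * norm (x - y)" for x y
      using \<eta>L[of y x] by (simp add: norm_minus_commute)
    have K0: "4 / r p \<ge> 0" using r0[OF p] by simp
    have \<eta>in: "\<eta> x = 1" if "x \<in> ball p (r p / 4)" for x
      using that r0[OF p] by (simp add: \<eta>_def field_simps)
    have \<eta>out: "\<eta> x = 0" if "r p / 2 \<le> dist p x" for x
      using that r0[OF p] by (simp add: \<eta>_def field_simps)
    have cl1: "compactly_lipschitz (\<lambda>x. \<eta> x *\<^sub>R Y x)"
      by (rule compactly_lipschitz_scaleR[OF \<eta>L \<eta>1(1) K0 insert.prems(3)])
    have cl2: "compactly_lipschitz (\<lambda>x. (1 - \<eta> x) *\<^sub>R Y x)"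
      by (rule compactly_lipschitz_scaleR[OF \<eta>L' \<eta>1(2) K0 insert.prems(3)])
    have tan: "c *\<^sub>R Y x \<in> tangent_space S x" if "x \<in> S" for c x
      using insert.prems(2)[OF that] subspace_tangent_space[OF that] by (rule subspace_scale[rotated])
    have 1: "l2_bounded (\<lambda>x. \<eta> x *\<^sub>R Y x)"
      by (rule local[OF p tan cl1]) (simp_all add: \<eta>out)
    have 2: "l2_bounded (\<lambda>x. (1 - \<eta> x) *\<^sub>R Y x)"
    proof (rule insert.IH[OF _ tan cl2])
      fix x assume x: "x \<in> S" "x \<notin> (\<Union>p\<in>F. ball p (r p / 4))"
      show "(1 - \<eta> x) *\<^sub>R Y x = 0"
        using insert.prems(4)[OF x(1)] x(2) \<eta>in[of x] by (cases "x \<in> ball p (r p / 4)") auto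
    qed (use insert.prems(1) in auto)
    have "l2_bounded (\<lambda>x. \<eta> x *\<^sub>R Y x + (1 - \<eta> x) *\<^sub>R Y x)"
      by (rule l2_bounded_add[OF 1 cl1 2 cl2])
    then show ?case by (simp add: scaleR_add_left[symmetric])
  qed
  have "K \<subseteq> (\<Union>p\<in>K. ball p (r p / 4))" using r0 K(2) by force
  then obtain F where F: "F \<subseteq> K" "finite F" "K \<subseteq> (\<Union>p\<in>F. ball p (r p / 4))"
    using compactE_image[OF K(1), of K "\<lambda>p. ball p (r p / 4)"] by (metis open_ball)
  show ?thesis
  proof (rule cover[OF F(2) _ X])
    show "F \<subseteq> S" using F(1) K(2) by blast
    show "X x = 0" if "x \<in> S" "x \<notin> (\<Union>p\<in>F. ball p (r p / 4))" for x
      using K(3)[OF that(1)] F(3) that(2) by blast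
  qed
qed

text \<open>The first-order part pairs \<open>grad f\<close> with the compactly supported tangent
  field \<open>gauss_weight x *\<^sub>R grad w x\<close>, to which the preceding bound applies; the
  zero-order part is a Cauchy-Schwarz estimate. No derivative of \<open>f\<close> survives on the
  right.\<close>

proposition bform_l2_bound:
  assumes w: "w \<in> test"
  shows "\<exists>C\<ge>0. \<forall>f\<in>test. (bform f w)\<^sup>2 \<le> C * surf_int (\<lambda>x. (f x)\<^sup>2 * gauss_weight x)"
proof -
  let ?e = gauss_weight
  obtain K where K: "compact K" "K \<subseteq> S" "\<forall>x. x \<notin> K \<longrightarrow> w x = 0" using testD(3)[OF w] by blast
  define X where "X = (\<lambda>x. ?e x *\<^sub>R grad w x)"
  have sX: "smooth_along S X" unfolding X_def
    by (intro smooth_along_bilinear[OF bounded_bilinear_scaleR] smooth_along_gauss_weight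
        smooth_along_tangential_gradient testD(1)[OF w])
  have "l2_bounded X"
  proof (rule l2_bounded_compact_support[OF _ _ K(1,2)])
    show "X x \<in> tangent_space S x" if "x \<in> S" for x
      unfolding X_def using subspace_tangent_space[OF that] tangential_gradient_tangent(1)[OF that testD(1)[OF w]]
      by (rule subspace_scale)
    show "compactly_lipschitz X"
      unfolding compactly_lipschitz_def using smooth_along_lipschitz_on_compact[OF sX] by blast
    show "X x = 0" if "x \<in> S" "x \<notin> K" for x
      using test_grad_zero[OF that(1) K(1,3) that(2)] by (simp add: X_def)
  qed
  then obtain C where C: "C \<ge> 0" "\<And>f. f \<in> test \<Longrightarrow> (surf_int (\<lambda>x. grad f x \<bullet> X x))\<^sup>2 \<le> C * surf_int (\<lambda>x. (f x)\<^sup>2 * ?e x)"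
    unfolding l2_bounded_def by blast
  define v where "v = (\<lambda>x. (norm_A_squared S x + 1/2) * w x)"
  have cont: "continuous_on S v" "continuous_on S (?e :: 'a \<Rightarrow> real)" "continuous_on S X" "continuous_on S w"
    unfolding v_def
    by (intro continuous_intros smooth_along_continuous smooth_along_norm_A_squared testD(1)[OF w]
        smooth_along_gauss_weight sX)+
  define Q where "Q = surf_int (\<lambda>x. (v x)\<^sup>2 * ?e x)"
  have Q0: "Q \<ge> 0" unfolding Q_def by (rule surf_int_nonneg) (simp add: less_imp_le)
  have intv: "surf_integrable (\<lambda>x. (v x)\<^sup>2 * ?e x)"
    using K(3) by (intro surf_integrable_compact[OF _ K(1,2)] continuous_intros cont) (simp add: v_def)
  have "(bform f w)\<^sup>2 \<le> (2 * C + 2 * Q) * surf_int (\<lambda>x. (f x)\<^sup>2 * ?e x)" if f: "f \<in> test" for f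
  proof -
    let ?A = "surf_int (\<lambda>x. (f x)\<^sup>2 * ?e x)"
    have A0: "?A \<ge> 0" by (rule surf_int_nonneg) (simp add: less_imp_le)
    have cf: "continuous_on S f" "continuous_on S (grad f)"
      by (intro smooth_along_continuous smooth_along_tangential_gradient testD(1)[OF f])+
    have i1: "surf_integrable (\<lambda>x. grad f x \<bullet> X x)"
      using test_grad_zero[OF _ K(1,3)]
      by (intro surf_integrable_compact[OF _ K(1,2)] continuous_intros cont cf) (simp add: X_def)
    have i2: "surf_integrable (\<lambda>x. f x * (v x * ?e x))"
      by (intro test_l2_integrable[OF f] continuous_intros cont)
    have "bform f w = surf_int (\<lambda>x. grad f x \<bullet> X x - f x * (v x * ?e x))"
      unfolding bform_def by (rule surf_int_cong) (simp add: bform_density_def X_def v_def algebra_simps)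
    then have eq: "bform f w = surf_int (\<lambda>x. grad f x \<bullet> X x) - surf_int (\<lambda>x. f x * (v x * ?e x))"
      using surf_int_diff[OF i1 i2] by simp
    \<comment> \<open>Cauchy-Schwarz in scaled form; the two halves come from
      \<open>2 * f * v \<le> f\<^sup>2 / a + a * v\<^sup>2\<close>.\<close>
    have "(surf_int (\<lambda>x. f x * (v x * ?e x)))\<^sup>2 \<le> 4 * (?A / 2) * (Q / 2)"
    proof (rule square_le_of_scaled_bounds)
      fix a :: real assume a: "a > 0"
      have pt: "\<sigma> * (f x * (v x * ?e x)) \<le> (1 / (2 * a)) * ((f x)\<^sup>2 * ?e x) + (a / 2) * ((v x)\<^sup>2 * ?e x)"
        if \<sigma>: "\<sigma> = 1 \<or> \<sigma> = - 1" for x \<sigma>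
      proof -
        have "0 \<le> (f x - \<sigma> * a * v x)\<^sup>2 / (2 * a)" using a by simp
        also have "\<dots> = (1 / (2 * a)) * (f x)\<^sup>2 + (a / 2) * (v x)\<^sup>2 - \<sigma> * (f x * v x)"
          using a \<sigma> by (auto simp: power2_eq_square field_simps)
        finally have "\<sigma> * (f x * v x) * ?e x \<le> ((1 / (2 * a)) * (f x)\<^sup>2 + (a / 2) * (v x)\<^sup>2) * ?e x"
          by (intro mult_right_mono) (auto intro: less_imp_le)
        then show ?thesis by (simp add: algebra_simps)
      qed
      have bd: "\<sigma> * surf_int (\<lambda>x. f x * (v x * ?e x)) \<le> ?A / 2 / a + Q / 2 * a" if \<sigma>: "\<sigma> = 1 \<or> \<sigma> = - 1" for \<sigma>
      proof -
        have "\<sigma> * surf_int (\<lambda>x. f x * (v x * ?e x)) = surf_int (\<lambda>x. \<sigma> * (f x * (v x * ?e x)))"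
          by (simp add: surf_int_cmult)
        also have "\<dots> \<le> surf_int (\<lambda>x. (1 / (2 * a)) * ((f x)\<^sup>2 * ?e x) + (a / 2) * ((v x)\<^sup>2 * ?e x))"
          by (intro surf_int_mono pt[OF \<sigma>] surf_integrable_add surf_integrable_cmult i2 intv test_l2_integrable[OF f] cont)
        also have "\<dots> = (1 / (2 * a)) * ?A + (a / 2) * Q"
          unfolding Q_def surf_int_cmult[symmetric]
          by (intro surf_int_add surf_integrable_cmult intv test_l2_integrable[OF f] cont)
        finally show ?thesis by (simp add: mult.commute)
      qed
      show "\<bar>surf_int (\<lambda>x. f x * (v x * ?e x))\<bar> \<le> ?A / 2 / a + Q / 2 * a"
        using bd[of 1] bd[of "- 1"] by simp
    qed (use A0 Q0 in auto)
    then have "(surf_int (\<lambda>x. f x * (v x * ?e x)))\<^sup>2 \<le> Q * ?A" by (simp add: mult.commute)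
    moreover have "(u - u')\<^sup>2 \<le> 2 * u\<^sup>2 + 2 * u'\<^sup>2" for u u' :: real
      using sum_squares_bound[of u "- u'"] by (simp add: power2_diff)
    then have "(bform f w)\<^sup>2 \<le> 2 * (surf_int (\<lambda>x. grad f x \<bullet> X x))\<^sup>2 + 2 * (surf_int (\<lambda>x. f x * (v x * ?e x)))\<^sup>2"
      unfolding eq .
    ultimately show ?thesis using C(2)[OF f] by (simp add: algebra_simps)
  qed
  then show ?thesis using C(1) Q0 by (intro exI[of _ "2 * C + 2 * Q"]) auto
qed

end

section \<open>Semiboundedness from finite index\<close>

text \<open>Fewer functionals than dimensions. The values of all functionals form a vector in a
  space spanned by \<open>card I\<close> elements, so the images of the basis either coincide
  somewhere or are dependent. Linearity is asked for on \<open>span B\<close> only, because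
  \<open>bform\<close> is linear on test functions and not on all functions.\<close>

lemma common_kernel_vector:
  fixes B :: "'v::real_vector set" and L :: "'i \<Rightarrow> 'v \<Rightarrow> real"
  assumes B: "independent B" "finite B" and I: "finite I" "card I < card B"
    and add: "\<And>i f g. i \<in> I \<Longrightarrow> f \<in> span B \<Longrightarrow> g \<in> span B \<Longrightarrow> L i (f + g) = L i f + L i g"
    and scale: "\<And>i c f. i \<in> I \<Longrightarrow> f \<in> span B \<Longrightarrow> L i (c *\<^sub>R f) = c * L i f"
  shows "\<exists>f\<in>span B. f \<noteq> 0 \<and> (\<forall>i\<in>I. L i f = 0)"
proof -
  define \<Lambda> where "\<Lambda> = (\<lambda>f i. if i \<in> I then L i f else 0)"
  define e :: "'i \<Rightarrow> 'i \<Rightarrow> real" where "e = (\<lambda>i k. if k = i then 1 else 0)"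
  have zero: "L i 0 = 0" if "i \<in> I" for i using scale[OF that span_zero, of 0] by simp
  have L_sum: "L i (\<Sum>b\<in>A. u b *\<^sub>R b) = (\<Sum>b\<in>A. u b * L i b)" if i: "i \<in> I" and A: "finite A" "A \<subseteq> B" for i u A
    using A
  proof (induction A rule: finite_induct)
    case (insert a A)
    then have "a \<in> span B" "(\<Sum>b\<in>A. u b *\<^sub>R b) \<in> span B"
      by (auto intro!: span_base span_sum span_scale)
    then show ?case using insert by (simp add: add[OF i] scale[OF i] span_scale)
  qed (simp add: zero[OF i])
  have \<Lambda>_span: "\<Lambda> f \<in> span (e ` I)" for f
  proof -
    have "\<Lambda> f = (\<Sum>i\<in>I. L i f *\<^sub>R e i)"
    proof
      fix k
      have "(\<Sum>i\<in>J. L i f *\<^sub>R e i) k = (\<Sum>i\<in>J. L i f * e i k)" if "finite J" for J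
        using that by (induction J rule: finite_induct) (simp_all add: scaleR_fun_def)
      then have "(\<Sum>i\<in>I. L i f *\<^sub>R e i) k = (\<Sum>i\<in>I. L i f * e i k)" using I(1) .
      also have "\<dots> = (\<Sum>i\<in>I. if i = k then L i f else 0)" by (intro sum.cong) (auto simp: e_def)
      also have "\<dots> = \<Lambda> f k" using I(1) by (simp add: \<Lambda>_def)
      finally show "\<Lambda> f k = (\<Sum>i\<in>I. L i f *\<^sub>R e i) k" ..
    qed
    moreover have "(\<Sum>i\<in>I. L i f *\<^sub>R e i) \<in> span (e ` I)"
      by (rule span_sum, rule span_scale, rule span_base, rule imageI)
    ultimately show ?thesis by simp
  qed
  show ?thesis
  proof (cases "inj_on \<Lambda> B")
    case False
    then obtain b b' where b: "b \<in> B" "b' \<in> B" "b \<noteq> b'" "\<Lambda> b = \<Lambda> b'" by (auto simp: inj_on_def)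
    have sp: "b \<in> span B" "b' \<in> span B" using b span_base by auto
    have "L i (b - b') = 0" if i: "i \<in> I" for i
    proof -
      have "L i (b + (-1) *\<^sub>R b') = L i b + L i ((-1) *\<^sub>R b')" by (intro add i sp span_scale)
      then have "L i (b - b') = L i b - L i b'" using scale[OF i sp(2), of "-1"] by simp
      then show ?thesis using fun_cong[OF b(4), of i] i by (simp add: \<Lambda>_def)
    qed
    then show ?thesis using b sp by (intro bexI[of _ "b - b'"] conjI) (auto intro: span_diff)
  next
    case True
    have "\<not> independent (\<Lambda> ` B)"
    proof
      assume "independent (\<Lambda> ` B)"
      then have "card (\<Lambda> ` B) \<le> card (e ` I)"
        using independent_span_bound[of "e ` I" "\<Lambda> ` B"] I(1) \<Lambda>_span by auto
      also have "\<dots> \<le> card I" using I(1) by (rule card_image_le)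
      finally show False using I(2) card_image[OF True] by simp
    qed
    then obtain u b where u: "b \<in> B" "u (\<Lambda> b) \<noteq> 0" "(\<Sum>v\<in>\<Lambda> ` B. u v *\<^sub>R v) = 0"
      using B(2) by (auto simp: dependent_finite)
    define f where "f = (\<Sum>b\<in>B. u (\<Lambda> b) *\<^sub>R b)"
    have "f \<in> span B" unfolding f_def by (intro span_sum span_scale span_base)
    moreover have "f \<noteq> 0"
    proof
      assume "f = 0"
      then have "dependent B" unfolding dependent_finite[OF B(2)] f_def using u(1,2) by (intro exI[of _ "\<lambda>b. u (\<Lambda> b)"]) auto
      then show False using B(1) by simp
    qed
    moreover have "L i f = 0" if i: "i \<in> I" for i
    proof -
      have ev: "(\<Sum>b\<in>A. u (\<Lambda> b) *\<^sub>R \<Lambda> b) i = (\<Sum>b\<in>A. u (\<Lambda> b) * L i b)" if "finite A" for A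
        using that i by (induction A rule: finite_induct) (simp_all add: scaleR_fun_def \<Lambda>_def)
      have "(\<Sum>b\<in>B. u (\<Lambda> b) *\<^sub>R \<Lambda> b) = 0" using u(3) unfolding sum.reindex[OF True] by (simp add: comp_def)
      from fun_cong[OF this, of i] show ?thesis unfolding f_def L_sum[OF i B(2) subset_refl] ev[OF B(2)] by simp
    qed
    ultimately show ?thesis by blast
  qed
qed

section \<open>Maximal negative orthonormal families\<close>

context hypersurface
begin

text \<open>Orthonormal for the negative of the form; the span is then a negative definite space of
  dimension \<open>m\<close>.\<close>

definition bform_orthonormal :: "nat \<Rightarrow> (nat \<Rightarrow> 'a \<Rightarrow> real) \<Rightarrow> bool" where
  "bform_orthonormal m w \<longleftrightarrow> (\<forall>i<m. w i \<in> test) \<and>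
     (\<forall>i<m. \<forall>j<m. bform (w i) (w j) = (if i = j then - 1 else 0))"

lemma bform_orthonormal_expansion:
  assumes w: "bform_orthonormal m w"
  shows "(\<Sum>i<m. c i *\<^sub>R w i) \<in> test"
    and "j < m \<Longrightarrow> bform (\<Sum>i<m. c i *\<^sub>R w i) (w j) = - c j"
    and "bform (\<Sum>i<m. c i *\<^sub>R w i) (\<Sum>i<m. c i *\<^sub>R w i) = - (\<Sum>i<m. (c i)\<^sup>2)"
proof -
  let ?f = "\<Sum>i<m. c i *\<^sub>R w i"
  have wt: "w i \<in> test" if "i \<in> {..<m}" for i using w that by (simp add: bform_orthonormal_def)
  show ft: "?f \<in> test" by (rule bform_sum_left(2)[OF _ wt test_zero]) auto
  have fw: "bform ?f (w j) = - c j" if j: "j < m" for j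
  proof -
    have "bform ?f (w j) = (\<Sum>i<m. c i * bform (w i) (w j))"
      using j by (intro bform_sum_left(1) wt) auto
    also have "\<dots> = (\<Sum>i<m. if i = j then - c j else 0)"
      using w j by (intro sum.cong) (auto simp: bform_orthonormal_def)
    finally show ?thesis using j by simp
  qed
  then show "j < m \<Longrightarrow> bform ?f (w j) = - c j" .
  have "bform ?f ?f = (\<Sum>i<m. c i * bform (w i) ?f)"
    by (intro bform_sum_left(1) wt ft) auto
  also have "\<dots> = (\<Sum>i<m. - (c i)\<^sup>2)"
    using fw by (intro sum.cong) (auto simp: bform_commute[of _ ?f] power2_eq_square)
  finally show "bform ?f ?f = - (\<Sum>i<m. (c i)\<^sup>2)" by (simp add: sum_negf)
qed

lemma index_ge_of_bform_orthonormal: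
  assumes w: "bform_orthonormal m w"
  shows "index_ge S m"
proof -
  have inj: "inj_on w {..<m}"
  proof (rule inj_onI, rule ccontr)
    fix i j assume ij: "i \<in> {..<m}" "j \<in> {..<m}" "w i = w j" "i \<noteq> j"
    have "bform (w i) (w j) = 0" "bform (w i) (w i) = - 1"
      using w ij(1,2,4) by (simp_all add: bform_orthonormal_def)
    then show False using ij(3) by simp
  qed
  define B where "B = w ` {..<m}"
  have B: "finite B" "card B = m" using inj by (auto simp: B_def card_image)
  have reindex: "(\<Sum>v\<in>B. u v *\<^sub>R v) = (\<Sum>i<m. u (w i) *\<^sub>R w i)" for u
    unfolding B_def sum.reindex[OF inj] by (simp add: comp_def)
  have indep: "independent B"
  proof
    assume "dependent B"
    then obtain u v where u: "v \<in> B" "u v \<noteq> 0" "(\<Sum>v\<in>B. u v *\<^sub>R v) = 0"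
      using B(1) by (auto simp: dependent_finite)
    then obtain j where j: "j < m" "v = w j" by (auto simp: B_def)
    have "bform 0 (w j) = - u (w j)"
      using bform_orthonormal_expansion(2)[OF w j(1), of "\<lambda>i. u (w i)"] u(3) unfolding reindex by metis
    moreover have "bform 0 (w j) = 0"
      using bform_scaleR_left[OF test_zero, of "w j" 0] w j(1) by (simp add: bform_orthonormal_def zero_fun_def)
    ultimately show False using u(2) j(2) by simp
  qed
  have neg: "f \<in> test \<and> (f \<noteq> 0 \<longrightarrow> index_form S f < 0)" if f: "f \<in> span B" for f
  proof -
    obtain u where u: "f = (\<Sum>i<m. u (w i) *\<^sub>R w i)"
      using f unfolding span_finite[OF B(1)] by (auto simp: reindex)
    have ft: "f \<in> test" unfolding u by (rule bform_orthonormal_expansion(1)[OF w])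
    have "index_form S f = - (\<Sum>i<m. (u (w i))\<^sup>2)"
      unfolding index_form_bform[OF testD(1)[OF ft]] unfolding u by (rule bform_orthonormal_expansion(3)[OF w])
    moreover have "(\<Sum>i<m. (u (w i))\<^sup>2) > 0" if "f \<noteq> 0"
    proof (rule ccontr)
      assume "\<not> ?thesis"
      then have "(\<Sum>i<m. (u (w i))\<^sup>2) = 0" using sum_nonneg[of "{..<m}" "\<lambda>i. (u (w i))\<^sup>2"] by simp
      then have z: "u (w i) = 0" if "i < m" for i using that by (simp add: sum_nonneg_eq_0_iff)
      have "f = (\<Sum>i<m. 0)" unfolding u by (intro sum.cong) (auto simp: z)
      then show False using that by simp
    qed
    ultimately show ?thesis using ft by simp
  qed
  show ?thesis
    unfolding index_ge_def
  proof (rule exI[of _ "span B"], intro conjI exI[of _ B] ballI impI)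
    show "span B \<subseteq> smooth_functions S" using neg by (auto simp: test_def)
    fix f assume f: "f \<in> span B" "f \<noteq> 0"
    show "compactly_supported_in S f" using neg[OF f(1)] by (simp add: test_def)
    show "index_form S f < 0" using neg[OF f(1)] f(2) by simp
  qed (use B indep in auto)
qed

text \<open>A longest family exists because one of length \<open>m\<close> forces
  \<open>index_ge S m\<close>. A test function orthogonal to it on which the form is negative could
  be normalised and appended, so the form is nonnegative on the orthogonal complement.\<close>

lemma semibounded_of_finite_index:
  assumes "finite_index S"
  obtains m :: nat and w where "\<And>i. i < m \<Longrightarrow> w i \<in> test"
    "\<And>f. f \<in> test \<Longrightarrow> - (\<Sum>i<m. (bform f (w i))\<^sup>2) \<le> bform f f"
proof -
  obtain k where k: "\<not> index_ge S (k + 1)" using assms by (auto simp: finite_index_def has_index_def)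
  have "\<exists>m w. bform_orthonormal m w \<and> \<not> (\<exists>w'. bform_orthonormal (Suc m) w')"
  proof (rule ccontr)
    assume no: "\<not> ?thesis"
    have "\<exists>w. bform_orthonormal m w" for m
    proof (induction m)
      case 0
      show ?case by (simp add: bform_orthonormal_def)
    next
      case (Suc m)
      then show ?case using no by blast
    qed
    then show False using k index_ge_of_bform_orthonormal by blast
  qed
  then obtain m w where w: "bform_orthonormal m w" and max: "\<And>w'. \<not> bform_orthonormal (Suc m) w'" by blast
  have wt: "w i \<in> test" if "i < m" for i using w that by (simp add: bform_orthonormal_def)
  have nonneg: "bform g g \<ge> 0" if g: "g \<in> test" "\<And>i. i < m \<Longrightarrow> bform g (w i) = 0" for g
  proof (rule ccontr)
    assume "\<not> bform g g \<ge> 0"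
    then have q: "- bform g g > 0" by simp
    define s where "s = 1 / sqrt (- bform g g)"
    define w' where "w' = w(m := s *\<^sub>R g)"
    have gt: "s *\<^sub>R g \<in> test" by (rule test_scaleR[OF g(1)])
    have s1: "bform (s *\<^sub>R g) (s *\<^sub>R g) = - 1"
    proof -
      have "bform (s *\<^sub>R g) (s *\<^sub>R g) = s * (s * bform g g)"
        unfolding bform_scaleR_left[OF g(1) gt] bform_commute[of g "s *\<^sub>R g"] bform_scaleR_left[OF g(1) g(1)] ..
      also have "\<dots> = - (s\<^sup>2 * (- bform g g))" by (simp add: power2_eq_square)
      also have "s\<^sup>2 * (- bform g g) = 1" using q by (simp add: s_def power_divide del: neg_0_less_iff_less)
      finally show ?thesis .
    qed
    have s0: "bform (s *\<^sub>R g) (w i) = 0" if "i < m" for i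
      using bform_scaleR_left[OF g(1) wt[OF that], of s] g(2)[OF that] by simp
    have "bform_orthonormal (Suc m) w'"
      unfolding bform_orthonormal_def
    proof (intro conjI allI impI)
      fix i assume i: "i < Suc m"
      show "w' i \<in> test" using i gt wt by (cases "i = m") (simp_all add: w'_def)
      fix j assume j: "j < Suc m"
      consider "i = m" "j = m" | "i = m" "j < m" | "i < m" "j = m" | "i < m" "j < m"
        using i j by linarith
      then show "bform (w' i) (w' j) = (if i = j then - 1 else 0)"
      proof cases
        case 1 then show ?thesis using s1 by (simp only: 1 w'_def fun_upd_same refl if_True)
      next
        case 2 then show ?thesis using s0[of j] by (simp add: w'_def)
      next
        case 3
        then have "bform (w i) (s *\<^sub>R g) = 0" using s0[of i] bform_commute[of "w i"] by metis
        then show ?thesis using 3 by (simp add: w'_def)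
      next
        case 4 then show ?thesis using w by (simp add: w'_def bform_orthonormal_def)
      qed
    qed
    then show False using max by blast
  qed
  have main: "- (\<Sum>i<m. (bform f (w i))\<^sup>2) \<le> bform f f" if f: "f \<in> test" for f
  proof -
    define l where "l = (\<lambda>i. bform f (w i))"
    \<comment> \<open>As the members of the family have square \<open>- 1\<close>, the component of
      \<open>f\<close> along them is \<open>- v\<close>, and \<open>f + v\<close> is orthogonal to
      the family.\<close>
    define v where "v = (\<Sum>i<m. l i *\<^sub>R w i)"
    note v = bform_orthonormal_expansion[OF w, where c=l, folded v_def]
    have gt: "f + v \<in> test" by (rule test_add[OF f v(1)])
    have gw: "bform (f + v) (w i) = 0" if "i < m" for i
      using bform_add_left[OF f v(1) wt[OF that]] v(2)[OF that] by (simp add: l_def)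
    have vf: "bform v f = (\<Sum>i<m. (l i)\<^sup>2)"
    proof -
      have "bform v f = (\<Sum>i<m. l i * bform (w i) f)"
        unfolding v_def by (intro bform_sum_left(1) wt f) auto
      then show ?thesis by (simp add: l_def bform_commute[of _ f] power2_eq_square)
    qed
    have "0 \<le> bform (f + v) (f + v)" by (rule nonneg[OF gt gw])
    also have "bform (f + v) (f + v) = bform f (f + v) + bform v (f + v)" by (rule bform_add_left[OF f v(1) gt])
    also have "bform f (f + v) = bform f f + bform v f"
      unfolding bform_commute[of f "f + v"] by (rule bform_add_left[OF f v(1) f])
    also have "bform v (f + v) = bform v f + bform v v"
      unfolding bform_commute[of v "f + v"] bform_add_left[OF f v(1) v(1)] bform_commute[of f v] ..
    finally show ?thesis using vf v(3) by (simp add: l_def)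
  qed
  show thesis by (rule that[of m w]) (rule wt main; assumption)+
qed

end

section \<open>The index form of the cylinder\<close>

lemma gauss_weight_Pair: "gauss_weight (x, t) = gauss_weight x * gauss_weight (t::real)"
  by (simp add: gauss_weight_def norm_Pair exp_add[symmetric] add_divide_distrib)

lemma gauss_weight_real: "gauss_weight (t::real) = exp (- t\<^sup>2 / 4)"
  by (simp add: gauss_weight_def)

context hypersurface
begin

definition time_deriv :: "('a \<times> real \<Rightarrow> real) \<Rightarrow> 'a \<Rightarrow> real \<Rightarrow> real" where
  "time_deriv F x t = deriv (\<lambda>s. F (x, s)) t"

abbreviation cylinder_test :: "('a \<times> real \<Rightarrow> real) set" where
  "cylinder_test \<equiv> hypersurface.test cylinder"

lemma slice_test:
  assumes F: "F \<in> cylinder_test"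
  shows "(\<lambda>x. F (x, t)) \<in> test"
proof -
  interpret cyl: hypersurface cylinder by (rule hypersurface_cylinder)
  obtain K where K: "compact K" "K \<subseteq> cylinder" "\<forall>z. z \<notin> K \<longrightarrow> F z = 0" using cyl.testD(3)[OF F] by blast
  have "smooth_along S (\<lambda>x. F (x, t))"
    by (rule smooth_along_compose_inner[OF cyl.testD(1)[OF F], of "\<lambda>y. (y, t)"])
      (auto intro!: smooth_on_Pair smooth_on_id smooth_on_const)
  moreover have "compact (fst ` K)" by (intro compact_continuous_image K continuous_intros)
  ultimately show ?thesis
    using K(2,3) by (intro testI[of _ "fst ` K"]) (force simp: image_iff)+
qed

lemma bform_density_cylinder:
  assumes x: "x \<in> S" and F: "smooth_along cylinder F"
  shows "hypersurface.bform_density cylinder F F (x, t)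
    = (bform_density (\<lambda>y. F (y, t)) (\<lambda>y. F (y, t)) x + (time_deriv F x t)\<^sup>2 * gauss_weight x) * gauss_weight t"
proof -
  interpret cyl: hypersurface cylinder by (rule hypersurface_cylinder)
  show ?thesis
    unfolding cyl.bform_density_def bform_density_def tangential_gradient_cylinder(1)[OF x F]
      norm_A_squared_cylinder[OF x] gauss_weight_Pair time_deriv_def
    by (simp add: power2_eq_square algebra_simps)
qed

text \<open>Joint continuity in point and time is read off from the last component of the tangential
  gradient, which is smooth along the cylinder.\<close>

lemma continuous_time_deriv:
  assumes F: "smooth_along cylinder F"
  shows "continuous_on cylinder (\<lambda>z. time_deriv F (fst z) (snd z))"
proof -
  interpret cyl: hypersurface cylinder by (rule hypersurface_cylinder)
  have "continuous_on cylinder (\<lambda>z. snd (cyl.grad F z))"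
    by (intro continuous_intros smooth_along_continuous cyl.smooth_along_tangential_gradient F)
  moreover have "snd (cyl.grad F z) = time_deriv F (fst z) (snd z)" if "z \<in> cylinder" for z
    using tangential_gradient_cylinder(1)[OF _ F, of "fst z" "snd z"] that by (auto simp: time_deriv_def)
  ultimately show ?thesis by (metis (no_types, lifting) continuous_on_cong)
qed

lemma sets_surface_pair: "sets (surface_measure S \<Otimes>\<^sub>M (lborel :: real measure)) = sets borel"
  unfolding borel_prod[symmetric] by (intro sets_pair_measure_cong) auto

text \<open>Integrability in time is claimed for \<open>c > 0\<close> only: if \<open>c = 0\<close>,
  integrability for the product measure says nothing about the slices.\<close>

lemma bform_cylinder_fubini:
  assumes F: "F \<in> cylinder_test"
  obtains c where "c \<ge> 0"
    "hypersurface.bform cylinder F F = c * (\<integral>t. surf_int (\<lambda>x. hypersurface.bform_density cylinder F F (x, t)) \<partial>lborel)"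
    "c > 0 \<Longrightarrow> integrable lborel (\<lambda>t. surf_int (\<lambda>x. hypersurface.bform_density cylinder F F (x, t)))"
proof -
  interpret cyl: hypersurface cylinder by (rule hypersurface_cylinder)
  interpret sm: sigma_finite_measure "surface_measure S" by (rule sigma_finite_surface_measure)
  obtain c where c: "c \<ge> 0" "surface_measure cylinder = density (surface_measure S) (\<lambda>_. ennreal c) \<Otimes>\<^sub>M lborel"
    by (rule surface_measure_cylinder) (rule that; (assumption | simp))
  let ?M = "density (surface_measure S) (\<lambda>_. ennreal c)"
  have sf: "sigma_finite_measure ?M" by (rule sm.sigma_finite_iff_density_finite[THEN iffD2]) auto
  interpret pair_sigma_finite ?M "lborel :: real measure"
    by (intro pair_sigma_finite.intro sf sigma_finite_lborel)
  define G where "G = (\<lambda>z. indicator cylinder z * cyl.bform_density F F z)"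
  have ind: "indicator cylinder (x, t) = (indicator S x :: real)" for x t by (auto split: split_indicator)
  have Geq: "(\<lambda>(x, t). G (x, t)) = G" by (simp add: fun_eq_iff)
  have int: "integrable (?M \<Otimes>\<^sub>M lborel) (\<lambda>(x, t). G (x, t))"
    using cyl.bform_integrable[OF F F] unfolding Geq cyl.surf_integrable_def c(2) by (simp add: G_def)
  have inner: "(\<integral>x. G (x, t) \<partial>?M) = c * surf_int (\<lambda>x. cyl.bform_density F F (x, t))" for t
  proof -
    have Gm: "G \<in> borel_measurable borel"
      unfolding G_def by (intro cyl.surf_measurable cyl.continuous_on_bform_density cyl.testD(1) F)
    have "(\<lambda>x. G (x, t)) \<in> borel_measurable borel"
      by (rule measurable_compose[OF _ Gm]) (simp add: borel_measurable_continuous_onI continuous_intros)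
    then have "(\<integral>x. G (x, t) \<partial>?M) = (\<integral>x. c *\<^sub>R G (x, t) \<partial>surface_measure S)"
      using c(1) by (intro integral_density) auto
    then show ?thesis by (simp add: surf_int_def G_def ind)
  qed
  have "cyl.bform F F = integral\<^sup>L (?M \<Otimes>\<^sub>M lborel) (\<lambda>(x, t). G (x, t))"
    unfolding Geq cyl.bform_def cyl.surf_int_def c(2) by (simp add: G_def)
  also have "\<dots> = (\<integral>t. (\<integral>x. G (x, t) \<partial>?M) \<partial>lborel)" by (rule integral_snd[OF int, symmetric])
  finally have eq: "cyl.bform F F = c * (\<integral>t. surf_int (\<lambda>x. cyl.bform_density F F (x, t)) \<partial>lborel)"
    by (simp add: inner)
  have "integrable lborel (\<lambda>t. surf_int (\<lambda>x. cyl.bform_density F F (x, t)))" if "c > 0"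
    using integrable_snd[OF int] that by (simp add: inner)
  then show thesis using that[OF c(1) eq] by blast
qed

lemma slice_bform_split:
  assumes F: "F \<in> cylinder_test"
  shows "surf_int (\<lambda>x. hypersurface.bform_density cylinder F F (x, t))
    = (bform (\<lambda>y. F (y, t)) (\<lambda>y. F (y, t)) + surf_int (\<lambda>x. (time_deriv F x t)\<^sup>2 * gauss_weight x)) * gauss_weight t"
    and "surf_integrable (\<lambda>x. (time_deriv F x t)\<^sup>2 * gauss_weight x)"
proof -
  interpret cyl: hypersurface cylinder by (rule hypersurface_cylinder)
  have sF: "smooth_along cylinder F" by (rule cyl.testD(1)[OF F])
  obtain K where K: "compact K" "K \<subseteq> cylinder" "\<forall>z. z \<notin> K \<longrightarrow> F z = 0" using cyl.testD(3)[OF F] by blast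
  have ct: "continuous_on S (\<lambda>x. time_deriv F x t)"
  proof -
    have "continuous_on S (\<lambda>x. time_deriv F (fst (x, t)) (snd (x, t)))"
      by (rule continuous_on_compose2[OF continuous_time_deriv[OF sF]]) (auto intro!: continuous_intros)
    then show ?thesis by simp
  qed
  have Kx: "compact (fst ` K)" "fst ` K \<subseteq> S" using K(2) by (auto intro!: compact_continuous_image K continuous_intros)
  have z: "time_deriv F x t = 0" if "x \<notin> fst ` K" for x
  proof -
    have "(\<lambda>s. F (x, s)) = (\<lambda>_. 0)" using K(3) that by (force simp: image_iff)
    then show ?thesis by (simp add: time_deriv_def)
  qed
  show i2: "surf_integrable (\<lambda>x. (time_deriv F x t)\<^sup>2 * gauss_weight x)"
    using z by (intro surf_integrable_compact[OF _ Kx] continuous_intros ct continuous_on_gauss_weight) auto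
  have i1: "surf_integrable (bform_density (\<lambda>y. F (y, t)) (\<lambda>y. F (y, t)))"
    by (intro bform_integrable slice_test F)
  have "surf_int (\<lambda>x. cyl.bform_density F F (x, t))
      = surf_int (\<lambda>x. gauss_weight t * (bform_density (\<lambda>y. F (y, t)) (\<lambda>y. F (y, t)) x + (time_deriv F x t)\<^sup>2 * gauss_weight x))"
    by (rule surf_int_cong) (simp add: bform_density_cylinder[OF _ sF])
  also have "\<dots> = gauss_weight t * (bform (\<lambda>y. F (y, t)) (\<lambda>y. F (y, t)) + surf_int (\<lambda>x. (time_deriv F x t)\<^sup>2 * gauss_weight x))"
    unfolding surf_int_cmult bform_def by (subst surf_int_add[OF i1 i2]) (rule refl)
  finally show "surf_int (\<lambda>x. cyl.bform_density F F (x, t))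
    = (bform (\<lambda>y. F (y, t)) (\<lambda>y. F (y, t)) + surf_int (\<lambda>x. (time_deriv F x t)\<^sup>2 * gauss_weight x)) * gauss_weight t"
    by (simp add: mult.commute)
qed

text \<open>The one-dimensional inequality on each line over a point of \<open>S\<close>, integrated
  over \<open>S\<close> with the order of integration exchanged. \<open>F (x, j t)\<close> need not
  vanish for large \<open>t\<close>; on the window the integrand is bounded and lives over a compact
  part of \<open>S\<close>, hence on a set of finite measure.\<close>

lemma cylinder_poincare:
  assumes F: "F \<in> cylinder_test" and C: "C \<ge> 0" and j: "j \<in> borel_measurable borel"
    and poincare: "\<And>h h'. (\<And>t. (h has_real_derivative h' t) (at t)) \<Longrightarrow> continuous_on UNIV h' \<Longrightarrow>
      (\<integral>\<^sup>+t. ennreal (C * (h t - h (j t))\<^sup>2 * exp (- t\<^sup>2 / 4)) * indicator {-R<..<R} t \<partial>lborel)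
      \<le> (\<integral>\<^sup>+t. ennreal ((h' t)\<^sup>2 * exp (- t\<^sup>2 / 4)) * indicator {-R<..<R} t \<partial>lborel)"
  defines "g \<equiv> \<lambda>t. indicator {-R<..<R} t * gauss_weight t *
    (surf_int (\<lambda>x. (time_deriv F x t)\<^sup>2 * gauss_weight x) - C * surf_int (\<lambda>x. (F (x, t) - F (x, j t))\<^sup>2 * gauss_weight x))"
  shows "integrable lborel g" "(\<integral>t. g t \<partial>lborel) \<ge> 0"
proof -
  interpret cyl: hypersurface cylinder by (rule hypersurface_cylinder)
  interpret sm: sigma_finite_measure "surface_measure S" by (rule sigma_finite_surface_measure)
  interpret pair_sigma_finite "surface_measure S" "lborel :: real measure" ..
  let ?M = "surface_measure S" and ?J = "{-R<..<R}"
  have sF: "smooth_along cylinder F" by (rule cyl.testD(1)[OF F])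
  have cF: "continuous_on cylinder F" by (rule smooth_along_continuous[OF sF])
  obtain K where K: "compact K" "K \<subseteq> cylinder" "\<forall>z. z \<notin> K \<longrightarrow> F z = 0" using cyl.testD(3)[OF F] by blast
  define K1 where "K1 = fst ` K"
  have K1: "compact K1" "K1 \<subseteq> S" unfolding K1_def using K(2) by (auto intro!: compact_continuous_image K continuous_intros)
  have K1B: "K1 \<in> sets borel" using K1 by (simp add: borel_compact)
  have F0: "F (x, t) = 0" if "x \<notin> K1" for x t using K(3) that by (force simp: K1_def image_iff)
  have T0: "time_deriv F x t = 0" if "x \<notin> K1" for x t
    using F0[OF that] by (simp add: time_deriv_def)
  \<comment> \<open>Vanishing off \<open>K\<close> itself, and not only off its projection, bounds
    the time derivative on the whole cylinder by its maximum over a compact set.\<close>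
  have Tz: "time_deriv F x t = 0" if "x \<in> S" "(x, t) \<notin> K" for x t
  proof -
    have "cyl.grad F (x, t) = 0" using that by (intro cyl.test_grad_zero[OF _ K(1,3)]) auto
    then show ?thesis using tangential_gradient_cylinder(1)[OF that(1) sF, of t] by (simp add: time_deriv_def zero_prod_def)
  qed
  obtain BF where BF: "BF \<ge> 0" "\<And>z. \<bar>F z\<bar> \<le> BF"
  proof -
    have "compact (F ` K)" by (rule compact_continuous_image[OF continuous_on_subset[OF cF K(2)] K(1)])
    then obtain b where b: "b > 0" "\<forall>y\<in>F ` K. norm y \<le> b" using compact_imp_bounded bounded_pos by metis
    show thesis
    proof (rule that[of b])
      show "\<bar>F z\<bar> \<le> b" for z using b K(3)[rule_format, of z] by (cases "z \<in> K") auto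
    qed (use b in simp)
  qed
  obtain BT where BT: "BT \<ge> 0" "\<And>x t. x \<in> S \<Longrightarrow> \<bar>time_deriv F x t\<bar> \<le> BT"
  proof -
    have "compact ((\<lambda>z. time_deriv F (fst z) (snd z)) ` K)"
      by (rule compact_continuous_image[OF continuous_on_subset[OF continuous_time_deriv[OF sF] K(2)] K(1)])
    then obtain b where b: "b > 0" "\<forall>y\<in>(\<lambda>z. time_deriv F (fst z) (snd z)) ` K. norm y \<le> b"
      using compact_imp_bounded bounded_pos by metis
    show thesis
    proof (rule that[of b])
      fix x t assume "x \<in> S"
      then show "\<bar>time_deriv F x t\<bar> \<le> b" using b Tz[of x t] by (cases "(x, t) \<in> K") force+
    qed (use b in simp)
  qed
  define H where "H = (\<lambda>x t. indicator S x * (indicator ?J t * gauss_weight t * gauss_weight x *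
     ((time_deriv F x t)\<^sup>2 - C * (F (x, t) - F (x, j t))\<^sup>2)))"
  have Fm [measurable]: "F \<in> borel_measurable borel"
  proof -
    have "(\<lambda>z. indicator cylinder z * F z) = F" using cyl.testD(2)[OF F] by (auto split: split_indicator)
    with cyl.surf_measurable[OF cF] show ?thesis by simp
  qed
  have Tm: "(\<lambda>z. indicator cylinder z * time_deriv F (fst z) (snd z)) \<in> borel_measurable borel"
    by (rule cyl.surf_measurable[OF continuous_time_deriv[OF sF]])
  note [measurable] = j borel
  have gm [measurable]: "(gauss_weight :: 'c::euclidean_space \<Rightarrow> real) \<in> borel_measurable borel"
    by (intro borel_measurable_continuous_onI continuous_on_gauss_weight)
  have jm: "(\<lambda>z::'a \<times> real. F (fst z, j (snd z))) \<in> borel_measurable borel"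
    by (rule measurable_compose[OF _ Fm]) (simp add: borel_prod[symmetric])
  have Hm: "(\<lambda>(x, t). H x t) \<in> borel_measurable (?M \<Otimes>\<^sub>M lborel)"
  proof -
    have eq: "(\<lambda>(x, t). H x t) = (\<lambda>z. indicator S (fst z) * (indicator ?J (snd z) * gauss_weight (snd z) * gauss_weight (fst z) *
       ((indicator cylinder z * time_deriv F (fst z) (snd z))\<^sup>2 - C * (F z - F (fst z, j (snd z)))\<^sup>2)))"
      by (auto simp: H_def fun_eq_iff split: split_indicator)
    have f1: "fst \<in> borel_measurable (borel :: ('a \<times> real) measure)" and f2: "snd \<in> borel_measurable (borel :: ('a \<times> real) measure)"
      by (auto intro!: borel_measurable_continuous_onI continuous_intros)
    have m1: "(\<lambda>z::'a \<times> real. indicator S (fst z) :: real) \<in> borel_measurable borel"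
      by (rule measurable_compose[OF f1]) simp
    have m2: "(\<lambda>z::'a \<times> real. indicator ?J (snd z) :: real) \<in> borel_measurable borel"
      by (rule measurable_compose[OF f2]) simp
    have m3: "(\<lambda>z::'a \<times> real. gauss_weight (snd z) :: real) \<in> borel_measurable borel"
      by (rule measurable_compose[OF f2 gm])
    have m4: "(\<lambda>z::'a \<times> real. gauss_weight (fst z) :: real) \<in> borel_measurable borel"
      by (rule measurable_compose[OF f1 gm])
    have "(\<lambda>(x, t). H x t) \<in> borel_measurable borel"
      unfolding eq
      by (intro borel_measurable_times borel_measurable_diff borel_measurable_power borel_measurable_const m1 m2 m3 m4 Tm Fm jm)
    then show ?thesis by (simp add: measurable_cong_sets[OF sets_surface_pair refl])
  qed
  have ew1: "gauss_weight z \<le> 1" for z :: "'c::euclidean_space" by (simp add: gauss_weight_def)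
  define B where "B = BT\<^sup>2 + C * (2 * BF)\<^sup>2"
  have Hb: "norm (H x t) \<le> B" for x t
  proof (cases "x \<in> S")
    case True
    have 1: "(time_deriv F x t)\<^sup>2 \<le> BT\<^sup>2" using BT(2)[OF True, of t] by (simp add: abs_le_square_iff[symmetric] BT(1))
    have "\<bar>F (x, t) - F (x, j t)\<bar> \<le> 2 * BF" using BF(2)[of "(x, t)"] BF(2)[of "(x, j t)"] by linarith
    from power_mono[OF this abs_ge_zero, of 2]
    have "(F (x, t) - F (x, j t))\<^sup>2 \<le> (2 * BF)\<^sup>2" by simp
    then have 2: "C * (F (x, t) - F (x, j t))\<^sup>2 \<le> C * (2 * BF)\<^sup>2" using C by (rule mult_left_mono)
    have 3: "0 \<le> C * (F (x, t) - F (x, j t))\<^sup>2" using C by simp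
    have "\<bar>(time_deriv F x t)\<^sup>2 - C * (F (x, t) - F (x, j t))\<^sup>2\<bar> \<le> B"
      unfolding B_def using 1 2 3 zero_le_power2[of "time_deriv F x t"] by linarith
    moreover have "\<bar>indicator ?J t * gauss_weight t * gauss_weight x\<bar> \<le> 1"
      using ew1[of t] ew1[of x] by (auto simp: abs_mult less_imp_le intro!: mult_le_one split: split_indicator)
    ultimately have "\<bar>indicator ?J t * gauss_weight t * gauss_weight x\<bar> * \<bar>(time_deriv F x t)\<^sup>2 - C * (F (x, t) - F (x, j t))\<^sup>2\<bar> \<le> 1 * B"
      by (intro mult_mono) auto
    then show ?thesis using True by (simp add: H_def abs_mult)
  next
    case False
    then show ?thesis using C by (simp add: H_def B_def)
  qed
  have Hz: "H x t = 0" if "(x, t) \<notin> K1 \<times> ?J" for x t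
  proof (cases "x \<in> K1")
    case True
    then have "t \<notin> ?J" using that by simp
    then show ?thesis by (simp add: H_def)
  next
    case False
    then show ?thesis by (simp add: H_def F0 T0)
  qed
  have int: "integrable (?M \<Otimes>\<^sub>M lborel) (\<lambda>(x, t). H x t)"
  proof (rule integrableI_bounded_set[where A="K1 \<times> ?J" and B=B])
    show "K1 \<times> ?J \<in> sets (?M \<Otimes>\<^sub>M lborel)" using K1B by (intro pair_measureI) auto
    have "emeasure (?M \<Otimes>\<^sub>M lborel) (K1 \<times> ?J) = emeasure ?M K1 * emeasure lborel ?J"
      using K1B by (intro lborel.emeasure_pair_measure_Times) auto
    also have "\<dots> < \<infinity>" using surface_measure_compact_finite[OF K1] by (simp add: ennreal_mult_less_top emeasure_bounded_finite[of ?J, simplified])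
    finally show "emeasure (?M \<Otimes>\<^sub>M lborel) (K1 \<times> ?J) < \<infinity>" .
    show "AE z in ?M \<Otimes>\<^sub>M lborel. z \<in> K1 \<times> ?J \<longrightarrow> norm (case z of (x, t) \<Rightarrow> H x t) \<le> B" using Hb by auto
    show "AE z in ?M \<Otimes>\<^sub>M lborel. z \<notin> K1 \<times> ?J \<longrightarrow> (case z of (x, t) \<Rightarrow> H x t) = 0"
    proof (rule AE_I2, rule impI)
      show "(case z of (x, t) \<Rightarrow> H x t) = 0" if "z \<notin> K1 \<times> ?J" for z using Hz[of "fst z" "snd z"] that by (cases z) simp
    qed
  qed (rule Hm)
  have inner_t: "(\<integral>x. H x t \<partial>?M) = g t" for t
  proof -
    have i1: "surf_integrable (\<lambda>x. (time_deriv F x t)\<^sup>2 * gauss_weight x)" by (rule slice_bform_split(2)[OF F])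
    have cs: "continuous_on S (\<lambda>x. F (x, s))" for s
      by (rule smooth_along_continuous[OF testD(1)[OF slice_test[OF F]]])
    have i2: "surf_integrable (\<lambda>x. (F (x, t) - F (x, j t))\<^sup>2 * gauss_weight x)"
      using F0 by (intro surf_integrable_compact[OF _ K1] continuous_intros cs continuous_on_gauss_weight) auto
    have "(\<integral>x. H x t \<partial>?M) = surf_int (\<lambda>x. (indicator ?J t * gauss_weight t) *
        ((time_deriv F x t)\<^sup>2 * gauss_weight x - C * ((F (x, t) - F (x, j t))\<^sup>2 * gauss_weight x)))"
      unfolding surf_int_def H_def by (intro Bochner_Integration.integral_cong) (auto simp: algebra_simps)
    also have "\<dots> = g t"
      unfolding surf_int_cmult g_def by (subst surf_int_diff[OF i1 surf_integrable_cmult[OF i2]]) (simp add: surf_int_cmult)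
    finally show ?thesis .
  qed
  have inner_x: "(\<integral>t. H x t \<partial>lborel) \<ge> 0" for x
  proof (cases "x \<in> S")
    case True
    define h where "h = (\<lambda>t. F (x, t))"
    define h' where "h' = time_deriv F x"
    have dh: "(h has_real_derivative h' t) (at t)" for t
      unfolding h_def h'_def time_deriv_def by (rule tangential_gradient_cylinder(2)[OF True sF])
    have ch': "continuous_on UNIV h'"
    proof -
      have "continuous_on UNIV (\<lambda>t. time_deriv F (fst (x, t)) (snd (x, t)))"
        by (rule continuous_on_compose2[OF continuous_time_deriv[OF sF]]) (use True in \<open>auto intro!: continuous_intros\<close>)
      then show ?thesis by (simp add: h'_def)
    qed
    have ch: "continuous_on UNIV h" using dh DERIV_isCont continuous_at_imp_continuous_on by blast
    have [measurable]: "h \<in> borel_measurable borel" "h' \<in> borel_measurable borel"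
      using ch ch' by (auto intro: borel_measurable_continuous_onI)
    define a where "a = (\<lambda>t. (h' t)\<^sup>2 * exp (- t\<^sup>2 / 4) * indicator ?J t)"
    define b where "b = (\<lambda>t. C * (h t - h (j t))\<^sup>2 * exp (- t\<^sup>2 / 4) * indicator ?J t)"
    have ab0: "a t \<ge> 0" "b t \<ge> 0" for t using C by (auto simp: a_def b_def)
    have [measurable]: "a \<in> borel_measurable borel" "b \<in> borel_measurable borel" unfolding a_def b_def by measurable
    have nab: "(\<integral>\<^sup>+t. ennreal (b t) \<partial>lborel) \<le> (\<integral>\<^sup>+t. ennreal (a t) \<partial>lborel)"
      using poincare[OF dh ch'] C unfolding a_def b_def by (simp add: ennreal_mult'' ennreal_indicator)
    have h'b: "\<bar>h' t\<bar> \<le> BT" for t using BT(2)[OF True] by (simp add: h'_def)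
    have ia: "integrable lborel a"
    proof (rule integrableI_bounded_set[where A="?J" and B="BT\<^sup>2"])
      show "AE t in lborel. t \<in> ?J \<longrightarrow> norm (a t) \<le> BT\<^sup>2"
      proof (rule AE_I2, rule impI)
        fix t assume "t \<in> ?J"
        have "(h' t)\<^sup>2 \<le> BT\<^sup>2" using h'b[of t] BT(1) by (simp add: abs_le_square_iff[symmetric])
        then have "(h' t)\<^sup>2 * exp (- t\<^sup>2 / 4) \<le> BT\<^sup>2 * 1" by (intro mult_mono) auto
        then show "norm (a t) \<le> BT\<^sup>2" using \<open>t \<in> ?J\<close> by (simp add: a_def)
      qed
    qed (auto simp: a_def emeasure_bounded_finite[of ?J, simplified])
    have na: "(\<integral>\<^sup>+t. ennreal (a t) \<partial>lborel) = ennreal (\<integral>t. a t \<partial>lborel)"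
      using ia ab0 by (intro nn_integral_eq_integral) auto
    \<comment> \<open>Integrability of \<open>b\<close> is itself a consequence of the inequality,
      whose right-hand side is finite.\<close>
    have ib: "integrable lborel b"
      using nab na ab0 by (intro integrableI_nonneg) (auto intro: le_less_trans)
    have nb: "(\<integral>\<^sup>+t. ennreal (b t) \<partial>lborel) = ennreal (\<integral>t. b t \<partial>lborel)"
      using ib ab0 by (intro nn_integral_eq_integral) auto
    have le: "(\<integral>t. b t \<partial>lborel) \<le> (\<integral>t. a t \<partial>lborel)"
      using nab unfolding na nb by (subst (asm) ennreal_le_iff) (auto intro!: Bochner_Integration.integral_nonneg ab0)
    have "(\<integral>t. H x t \<partial>lborel) = (\<integral>t. gauss_weight x * (a t - b t) \<partial>lborel)"
      using True by (intro Bochner_Integration.integral_cong)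
        (auto simp: H_def a_def b_def h_def h'_def gauss_weight_real algebra_simps)
    also have "\<dots> = gauss_weight x * ((\<integral>t. a t \<partial>lborel) - (\<integral>t. b t \<partial>lborel))"
      using ia ib by simp
    finally show ?thesis using le by (simp add: less_imp_le)
  qed (simp add: H_def)
  show "integrable lborel g" using integrable_snd[OF int] by (simp add: inner_t)
  have "(\<integral>t. g t \<partial>lborel) = (\<integral>t. (\<integral>x. H x t \<partial>?M) \<partial>lborel)" by (simp add: inner_t)
  also have "\<dots> = (\<integral>x. (\<integral>t. H x t \<partial>lborel) \<partial>?M)" by (rule Fubini_integral[OF int])
  also have "\<dots> \<ge> 0" by (rule Bochner_Integration.integral_nonneg) (rule inner_x)
  finally show "(\<integral>t. g t \<partial>lborel) \<ge> 0" .
qed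

end

section \<open>Counting negative directions on the cylinder\<close>

context hypersurface
begin

theorem finite_index_cylinder:
  assumes fin: "finite_index S"
  shows "finite_index cylinder"
proof -
  interpret cyl: hypersurface cylinder by (rule hypersurface_cylinder)
  obtain m :: nat and w where w: "\<And>i. i < m \<Longrightarrow> w i \<in> test"
    and semi: "\<And>f. f \<in> test \<Longrightarrow> - (\<Sum>i<m. (bform f (w i))\<^sup>2) \<le> bform f f"
    by (rule semibounded_of_finite_index[OF fin]) (rule that; (assumption | simp))
  have "\<forall>i. \<exists>C\<ge>0. i < m \<longrightarrow> (\<forall>f\<in>test. (bform f (w i))\<^sup>2 \<le> C * surf_int (\<lambda>x. (f x)\<^sup>2 * gauss_weight x))"
    using bform_l2_bound[OF w] by (metis order_refl)
  then obtain c where c: "\<And>i. c i \<ge> 0"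
    "\<And>i f. i < m \<Longrightarrow> f \<in> test \<Longrightarrow> (bform f (w i))\<^sup>2 \<le> c i * surf_int (\<lambda>x. (f x)\<^sup>2 * gauss_weight x)"
    by metis
  define C where "C = (\<Sum>i<m. c i)"
  have C0: "C \<ge> 0" unfolding C_def by (intro sum_nonneg c(1))
  \<comment> \<open>To be used with \<open>f\<close> the slice of \<open>F\<close> at time
    \<open>t\<close> and \<open>f'\<close> the slice at the grid time \<open>j t\<close>: the
    orthogonality is imposed on the latter, and the former pays with a weighted square integral of
    the difference.\<close>
  have semiC: "- (C * surf_int (\<lambda>x. (f x - f' x)\<^sup>2 * gauss_weight x)) \<le> bform f f"
    if f: "f \<in> test" "f' \<in> test" and z: "\<And>i. i < m \<Longrightarrow> bform f' (w i) = 0" for f f'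
  proof -
    have d: "f + (-1) *\<^sub>R f' \<in> test" by (intro test_add test_scaleR f)
    have "(bform f (w i))\<^sup>2 \<le> c i * surf_int (\<lambda>x. (f x - f' x)\<^sup>2 * gauss_weight x)" if i: "i < m" for i
    proof -
      have "bform (f + (-1) *\<^sub>R f') (w i) = bform f (w i)"
        unfolding bform_add_left[OF f(1) test_scaleR[OF f(2)] w[OF i]] bform_scaleR_left[OF f(2) w[OF i]] z[OF i]
        by simp
      then show ?thesis using c(2)[OF i d] by (simp add: scaleR_fun_def)
    qed
    then have "(\<Sum>i<m. (bform f (w i))\<^sup>2) \<le> (\<Sum>i<m. c i * surf_int (\<lambda>x. (f x - f' x)\<^sup>2 * gauss_weight x))"
      by (intro sum_mono) auto
    then show ?thesis using semi[OF f(1)] by (simp add: C_def sum_distrib_right)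
  qed
  obtain T :: real and G and j :: "real \<Rightarrow> real" where grid: "finite G" "range j \<subseteq> G" "j \<in> borel_measurable borel"
    and poincare: "\<And>R h h'. T \<le> R \<Longrightarrow> (\<And>t. (h has_real_derivative h' t) (at t)) \<Longrightarrow> continuous_on UNIV h' \<Longrightarrow>
      (\<integral>\<^sup>+t. ennreal (C * (h t - h (j t))\<^sup>2 * exp (- t\<^sup>2 / 4)) * indicator {-R<..<R} t \<partial>lborel)
      \<le> (\<integral>\<^sup>+t. ennreal ((h' t)\<^sup>2 * exp (- t\<^sup>2 / 4)) * indicator {-R<..<R} t \<partial>lborel)"
  proof (rule gaussian_poincare_grid[OF C0], goal_cases)
    case (1 T' G' j')
    show ?case by (rule that[of G' j' T']; fact 1)
  qed
  have nonneg: "cyl.bform F F \<ge> 0"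
    if F: "F \<in> cylinder_test" and z: "\<And>i s. i < m \<Longrightarrow> s \<in> G \<Longrightarrow> bform (\<lambda>x. F (x, s)) (w i) = 0" for F
  proof -
    obtain K where K: "compact K" "K \<subseteq> cylinder" "\<forall>z. z \<notin> K \<longrightarrow> F z = 0" using cyl.testD(3)[OF F] by blast
    have "bounded (snd ` K)"
      by (intro compact_imp_bounded compact_continuous_image K(1) continuous_intros)
    then obtain R0 where R0: "\<And>t. t \<in> snd ` K \<Longrightarrow> \<bar>t\<bar> \<le> R0" unfolding bounded_real by blast
    \<comment> \<open>Large enough for the grid inequality and beyond the times where
      \<open>F\<close> lives, so that outside the window the slices vanish.\<close>
    define R where "R = max T (R0 + 1)"
    have R: "T \<le> R" by (simp add: R_def)
    have Fz: "F (x, t) = 0" if "R0 < \<bar>t\<bar>" for x t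
      using K(3) R0[of t] that by (force simp: image_iff)
    obtain k where k: "k \<ge> 0"
      "cyl.bform F F = k * (\<integral>t. surf_int (\<lambda>x. cyl.bform_density F F (x, t)) \<partial>lborel)"
      "k > 0 \<Longrightarrow> integrable lborel (\<lambda>t. surf_int (\<lambda>x. cyl.bform_density F F (x, t)))"
      by (rule bform_cylinder_fubini[OF F]) (rule that; (assumption | simp))
    \<comment> \<open>If \<open>k = 0\<close>, the form of \<open>F\<close> is zero by the Fubini
      formula. Otherwise the slice integrals are integrable in time and can be compared with
      \<open>g\<close> pointwise.\<close>
    show ?thesis
    proof (cases "k = 0")
      case False
      then have kpos: "k > 0" using k(1) by simp
      define g where "g = (\<lambda>t. indicator {-R<..<R} t * gauss_weight t *
        (surf_int (\<lambda>x. (time_deriv F x t)\<^sup>2 * gauss_weight x) - C * surf_int (\<lambda>x. (F (x, t) - F (x, j t))\<^sup>2 * gauss_weight x)))"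
      have g: "integrable lborel g" "(\<integral>t. g t \<partial>lborel) \<ge> 0"
        unfolding g_def by (rule cylinder_poincare[OF F C0 grid(3) poincare[OF R]]; assumption)+
      have "g t \<le> surf_int (\<lambda>x. cyl.bform_density F F (x, t))" for t
      proof (cases "t \<in> {-R<..<R}")
        case True
        have "j t \<in> G" using grid(2) by auto
        then have "- (C * surf_int (\<lambda>x. (F (x, t) - F (x, j t))\<^sup>2 * gauss_weight x)) \<le> bform (\<lambda>x. F (x, t)) (\<lambda>x. F (x, t))"
          by (intro semiC slice_test F z)
        then have "(surf_int (\<lambda>x. (time_deriv F x t)\<^sup>2 * gauss_weight x) - C * surf_int (\<lambda>x. (F (x, t) - F (x, j t))\<^sup>2 * gauss_weight x)) * gauss_weight t
          \<le> (bform (\<lambda>x. F (x, t)) (\<lambda>x. F (x, t)) + surf_int (\<lambda>x. (time_deriv F x t)\<^sup>2 * gauss_weight x)) * gauss_weight t"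
          by (intro mult_right_mono) (auto intro: less_imp_le)
        then show ?thesis unfolding slice_bform_split(1)[OF F] g_def using True by (simp add: mult.commute)
      next
        case False
        then have t: "R0 < \<bar>t\<bar>" by (auto simp: R_def)
        have "bform (\<lambda>x. F (x, t)) (\<lambda>x. F (x, t)) = 0"
        proof -
          have "(\<lambda>x. F (x, t)) = 0 *\<^sub>R (\<lambda>x. F (x, t))" using Fz[OF t] by (simp add: fun_eq_iff scaleR_fun_def)
          then show ?thesis using bform_scaleR_left[OF slice_test[OF F] slice_test[OF F], of 0 t t] by simp
        qed
        moreover have "surf_int (\<lambda>x. (time_deriv F x t)\<^sup>2 * gauss_weight x) \<ge> 0"
          by (intro surf_int_nonneg) (simp add: less_imp_le)
        ultimately show ?thesis unfolding slice_bform_split(1)[OF F] g_def using False by (simp add: less_imp_le)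
      qed
      then have "(\<integral>t. g t \<partial>lborel) \<le> (\<integral>t. surf_int (\<lambda>x. cyl.bform_density F F (x, t)) \<partial>lborel)"
        by (intro integral_mono g(1) k(3) kpos)
      then show ?thesis unfolding k(2) using g(2) k(1) by simp
    qed (simp add: k(2))
  qed
  \<comment> \<open>One more than the number of linear conditions, which are indexed by pairs of a
    \<open>w i\<close> and a grid time.\<close>
  define N where "N = card ({..<m} \<times> G) + 1"
  have "\<not> index_ge cylinder N"
  proof
    assume "index_ge cylinder N"
    then obtain W B where W: "W \<subseteq> smooth_functions cylinder" "independent B" "finite B" "card B = N" "span B = W"
      "\<forall>f\<in>W. f \<noteq> 0 \<longrightarrow> compactly_supported_in cylinder f \<and> index_form cylinder f < 0"
      unfolding index_ge_def by blast
    have Wt: "F \<in> cylinder_test" if "F \<in> span B" for F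
    proof (cases "F = 0")
      case False
      then show ?thesis using W that unfolding cyl.test_def by blast
    qed (simp add: cyl.test_zero)
    define L where "L = (\<lambda>(i, s :: real) (F :: 'a \<times> real \<Rightarrow> real). bform (\<lambda>x. F (x, s)) (w i))"
    have "\<exists>F\<in>span B. F \<noteq> 0 \<and> (\<forall>q\<in>{..<m} \<times> G. L q F = 0)"
    proof (rule common_kernel_vector[OF W(2,3)])
      show "finite ({..<m} \<times> G)" using grid(1) by simp
      show "card ({..<m} \<times> G) < card B" using W(4) by (simp add: N_def)
      fix q F F' assume q: "q \<in> {..<m} \<times> G" and FF: "F \<in> span B" "F' \<in> span B"
      obtain i s where qis: "q = (i, s)" "i < m" using q by auto
      show "L q (F + F') = L q F + L q F'"
        using bform_add_left[OF slice_test[OF Wt[OF FF(1)]] slice_test[OF Wt[OF FF(2)]] w[OF qis(2)], of s s]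
        by (simp add: L_def qis(1) plus_fun_def)
    next
      fix q r F assume q: "q \<in> {..<m} \<times> G" and F: "F \<in> span B"
      obtain i s where qis: "q = (i, s)" "i < m" using q by auto
      show "L q (r *\<^sub>R F) = r * L q F"
        using bform_scaleR_left[OF slice_test[OF Wt[OF F]] w[OF qis(2)], of r s]
        by (simp add: L_def qis(1) scaleR_fun_def)
    qed
    then obtain F where F: "F \<in> span B" "F \<noteq> 0" "\<forall>q\<in>{..<m} \<times> G. L q F = 0" by blast
    have Ft: "F \<in> cylinder_test" by (rule Wt[OF F(1)])
    have "cyl.bform F F \<ge> 0" using F(3) by (intro nonneg Ft) (force simp: L_def)
    moreover have "index_form cylinder F < 0" using W(5,6) F(1,2) by blast
    ultimately show False using cyl.index_form_bform[OF cyl.testD(1)[OF Ft]] by simp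
  qed
  moreover have "index_ge cylinder 0"
    using cyl.index_ge_of_bform_orthonormal[of 0 "\<lambda>_. 0"] by (simp add: cyl.bform_orthonormal_def)
  \<comment> \<open>\<open>index_ge\<close> holds at \<open>0\<close> and fails at \<open>N\<close>,
    so it must fail for the first time at some successor; this is all that \<open>has_index\<close>
    asks of \<open>k\<close>.\<close>
  ultimately obtain k where "index_ge cylinder k" "\<not> index_ge cylinder (Suc k)"
    by (metis (full_types) nat_induct)
  then show ?thesis by (auto simp: finite_index_def has_index_def)
qed

end

theorem theorem5p3:
  fixes \<Sigma> :: "'a::euclidean_space set"
  assumes "self_shrinker \<Sigma>"
    and "finite_index \<Sigma>"
  shows "self_shrinker (\<Sigma> \<times> (UNIV :: real set)) \<and> finite_index (\<Sigma> \<times> (UNIV :: real set))"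
  using self_shrinker_cylinder[OF assms(1)]
    hypersurface.finite_index_cylinder[OF self_shrinker_hypersurface[OF assms(1)] assms(2)]
  by simp

end
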